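(* Let $1\le p<\infty$, $1/p+1/q=1$, $w\in\mathcal{W}^\alpha$ for some $\alpha>0$, $n\in\mathbb{N}$, and let $M$ be a $d\times d$ dilation matrix. Suppose that 1) $\varphi\in\mathcal{L}_{p,w^*}\cap L_2$ and $\widetilde\varphi\in\mathcal{L}_{q,w^*}$; 2) $\widehat\varphi,\widehat{\widetilde\varphi}\in C^\gamma(B_\varepsilon)$ for some integer $\gamma>n+d+p\alpha$ and some $\varepsilon>0$; 3) $\widetilde\varphi$ and $\varphi$ are weakly compatible of order $n$, i.e. $D^\beta\big(1-\widehat\varphi\,\overline{\widehat{\widetilde\varphi}}\big)(\mathbf{0})=0$ for all $\beta\in\mathbb{Z}_+^d$ with $[\beta]<n$; 4) $\operatorname{supp}\widehat\varphi\subset(-1,1)^d$. Then for any $f\in L_{p,1/w}$ and any integer $j\ge0$ $$\bigg\|f-\sum_{k\in\mathbb{Z}^d}\langle f,\widetilde\varphi_{jk}\rangle\varphi_{jk}\bigg\|_{p,1/w}\le C\,\Omega_n(f,M^{-j})_{p,1/w}\le C\,\omega_n(f,\|M^{-j}\|)_{p,1/w},$$ where $C$ does not depend on $f$ and $j$.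
   Context: All functions are defined on $\mathbb{R}^d$. $\widehat f(\xi)=\int_{\mathbb{R}^d}f(x)e^{-2\pi i(x,\xi)}dx$, $\langle f,g\rangle=\int_{\mathbb{R}^d}f\overline g$, $[\beta]=\beta_1+\dots+\beta_d$ for $\beta\in\mathbb{Z}^d_+$, $B_\varepsilon=\{|x|\le\varepsilon\}$. A dilation matrix is a real $d\times d$ matrix all of whose eigenvalues exceed $1$ in modulus; $\mathfrak{M}$ is the set of all of these, $m=|\det M|$. For a function $\varphi$ set $\varphi_{jk}(x)=m^{j/2}\varphi(M^jx+k)$. Weights: $w:\mathbb{R}^d\to[1,\infty)$ belongs to $\mathcal{W}^\alpha$ ($\alpha>0$) if: (1) $w$ is continuous and even; (2) there are an even function $w^*:\mathbb{R}^d\to\mathbb{R}_+$ and a constant $c_w>0$ with $w(x+y)\le w^*(x)w(y)$ and $w^*(x)\le c_w(1+|x|^2)^{\alpha/2}$ for all $x,y$; (3) for every $M\in\mathfrak{M}$ there is $C'>0$ with $w^*(M^{-j}x)\le C'w^*(x)$ for all $x$ and integers $j\ge0$. Here $w^*$ denotes a fixed function as in (2)–(3). $\|f\|_{p,w}=\|fw\|_{L_p(\mathbb{R}^d)}$ is the norm of $L_{p,w}$ (so $\|f\|_{p,1/w}=\|f/w\|_{L_p}$), $L_p=L_p(\mathbb{R}^d)$. $\mathcal{L}_p$ is the set of $\varphi\in L_p$ with $\|\varphi\|_{\mathcal{L}_p}=\big\|\sum_{k\in\mathbb{Z}^d}|\varphi(\cdot+k)|\big\|_{L_p([-1/2,1/2]^d)}<\infty$;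 $\mathcal{L}_{p,w^*}$ is defined by the norm $\|\varphi\|_{\mathcal{L}_{p,w^*}}=\|\varphi w^*\|_{\mathcal{L}_p}$. Moduli of smoothness: $\Delta_h^nf(x)=\sum_{\nu=0}^n(-1)^\nu\binom n\nu f(x+h\nu)$; $\omega_n(f,t)_{p,1/w}=\sup_{|h|<t}\|\Delta_h^nf\|_{p,1/w}$; for an invertible real matrix $A$, $\Omega_n(f,A^{-1})_{p,1/w}=\sup_{|Ah|<1}\|\Delta_h^nf\|_{p,1/w}$ (suprema over $h\in\mathbb{R}^d$). The series is understood as an (absolutely convergent) pointwise a.e. sum. *)

theory Defs
  imports "HOL-Analysis.Analysis" "HOL-Probability.Essential_Supremum"
begin

subsection \<open>Dilation matrices\<close>

text \<open>The operator \<open>^\<close> is not available for the matrix product: \<open>*\<close> on vectors and matrices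
  is componentwise.\<close>

definition mat_pow :: "real^'d^'d \<Rightarrow> nat \<Rightarrow> real^'d^'d" where
  "mat_pow M j = (((**) M) ^^ j) (mat 1)"

definition dilation_matrix :: "real^'d^'d \<Rightarrow> bool" where
  "dilation_matrix M \<longleftrightarrow>
     (\<forall>\<mu>::complex. \<forall>v::complex^'d.
        v \<noteq> 0 \<and> map_matrix complex_of_real M *v v = \<mu> *s v \<longrightarrow> 1 < cmod \<mu>)"

definition int_vec :: "int^'d \<Rightarrow> real^'d" where
  "int_vec k = (\<chi> i. real_of_int (k $ i))"

definition dil_shift ::
    "real^'d^'d \<Rightarrow> (real^'d \<Rightarrow> complex) \<Rightarrow> nat \<Rightarrow> int^'d \<Rightarrow> real^'d \<Rightarrow> complex" where
  "dil_shift M \<phi> j k x =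
     complex_of_real (\<bar>det M\<bar> powr (real j / 2)) * \<phi> (mat_pow M j *v x + int_vec k)"

subsection \<open>Lebesgue spaces\<close>

definition ennreal_powr :: "ennreal \<Rightarrow> real \<Rightarrow> ennreal" where
  "ennreal_powr a r = (if a = \<infinity> then \<infinity> else ennreal (enn2real a powr r))"

text \<open>The exponent \<open>p\<close> ranges over \<open>[1, \<infinity>]\<close>.\<close>

definition eLp :: "ennreal \<Rightarrow> 'a measure \<Rightarrow> ('a \<Rightarrow> ennreal) \<Rightarrow> ennreal" where
  "eLp p N g =
     (if p = \<infinity> then esssup N g
      else ennreal_powr (\<integral>\<^sup>+x. ennreal_powr (g x) (enn2real p) \<partial>N) (1 / enn2real p))"

definition Lp_norm :: "ennreal \<Rightarrow> (real^'d \<Rightarrow> complex) \<Rightarrow> ennreal" where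
  "Lp_norm p f = eLp p lebesgue (\<lambda>x. ennreal (cmod (f x)))"

definition Lp_space :: "ennreal \<Rightarrow> (real^'d \<Rightarrow> complex) set" where
  "Lp_space p = {f. f \<in> borel_measurable lebesgue \<and> Lp_norm p f < \<infinity>}"

text \<open>The weighted norm is \<open>\<parallel>f u\<parallel>\<^sub>p\<close>; the norm with index \<open>p, 1/w\<close> is obtained with
  \<open>u = (\<lambda>x. 1 / w x)\<close>.\<close>

definition weighted :: "(real^'d \<Rightarrow> real) \<Rightarrow> (real^'d \<Rightarrow> complex) \<Rightarrow> real^'d \<Rightarrow> complex" where
  "weighted u f x = f x * complex_of_real (u x)"

definition Lpw_norm :: "ennreal \<Rightarrow> (real^'d \<Rightarrow> real) \<Rightarrow> (real^'d \<Rightarrow> complex) \<Rightarrow> ennreal" where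
  "Lpw_norm p u f = Lp_norm p (weighted u f)"

definition Lpw_space :: "ennreal \<Rightarrow> (real^'d \<Rightarrow> real) \<Rightarrow> (real^'d \<Rightarrow> complex) set" where
  "Lpw_space p u = {f. f \<in> borel_measurable lebesgue \<and> weighted u f \<in> Lp_space p}"

definition calL_norm :: "ennreal \<Rightarrow> (real^'d \<Rightarrow> complex) \<Rightarrow> ennreal" where
  "calL_norm p \<phi> =
     eLp p (lebesgue_on (cbox (\<chi> i. - 1 / 2) (\<chi> i. 1 / 2)))
       (\<lambda>x. \<Sum>\<^sub>\<infinity>k\<in>(UNIV :: (int^'d) set). ennreal (cmod (\<phi> (x + int_vec k))))"

definition calL_space :: "ennreal \<Rightarrow> (real^'d \<Rightarrow> complex) set" where
  "calL_space p = {\<phi> \<in> Lp_space p. calL_norm p \<phi> < \<infinity>}"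

text \<open>The multiplier \<open>u\<close> is not assumed measurable, so measurability of \<open>\<phi>\<close> is required
  in addition to that of \<open>\<phi> u\<close>.\<close>

definition calLw_space :: "ennreal \<Rightarrow> (real^'d \<Rightarrow> real) \<Rightarrow> (real^'d \<Rightarrow> complex) set" where
  "calLw_space p u = {\<phi>. \<phi> \<in> borel_measurable lebesgue \<and> weighted u \<phi> \<in> calL_space p}"

definition pairing :: "(real^'d \<Rightarrow> complex) \<Rightarrow> (real^'d \<Rightarrow> complex) \<Rightarrow> complex" where
  "pairing f g = (\<integral>x. f x * cnj (g x) \<partial>lebesgue)"

text \<open>Pointwise Fourier transform of an integrable function. Every function in
  \<open>calL_space p\<close> with \<open>p \<ge> 1\<close> is integrable.\<close>

definition fourier :: "(real^'d \<Rightarrow> complex) \<Rightarrow> real^'d \<Rightarrow> complex" where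
  "fourier f \<xi> = (\<integral>x. f x * exp (- 2 * of_real pi * \<i> * of_real (x \<bullet> \<xi>)) \<partial>lebesgue)"

subsection \<open>Weights\<close>

definition weight_companion :: "real \<Rightarrow> (real^'d \<Rightarrow> real) \<Rightarrow> (real^'d \<Rightarrow> real) \<Rightarrow> bool" where
  "weight_companion \<alpha> w ws \<longleftrightarrow>
     (\<forall>x. 0 \<le> ws x) \<and> (\<forall>x. ws (- x) = ws x) \<and>
     (\<forall>x y. w (x + y) \<le> ws x * w y) \<and>
     (\<exists>c>0. \<forall>x. ws x \<le> c * (1 + (norm x)\<^sup>2) powr (\<alpha> / 2)) \<and>
     (\<forall>M. dilation_matrix M \<longrightarrow>
        (\<exists>C'>0. \<forall>x. \<forall>j::nat. ws (matrix_inv (mat_pow M j) *v x) \<le> C' * ws x))"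

definition weight_class :: "real \<Rightarrow> (real^'d \<Rightarrow> real) set" where
  "weight_class \<alpha> =
     {w. (\<forall>x. 1 \<le> w x) \<and> continuous_on UNIV w \<and> (\<forall>x. w (- x) = w x) \<and>
         (\<exists>ws. weight_companion \<alpha> w ws)}"

subsection \<open>Partial derivatives and smoothness classes\<close>

definition partial_deriv :: "'d \<Rightarrow> (real^'d \<Rightarrow> complex) \<Rightarrow> real^'d \<Rightarrow> complex" where
  "partial_deriv i f x = vector_derivative (\<lambda>t. f (x + t *\<^sub>R axis i 1)) (at 0)"

text \<open>The coordinates are differentiated in some fixed order; for a function that is
  \<open>[\<beta>]\<close> times continuously differentiable near the point in question the order is immaterial.\<close>

definition multi_deriv :: "nat^'d \<Rightarrow> (real^'d \<Rightarrow> complex) \<Rightarrow> real^'d \<Rightarrow> complex" where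
  "multi_deriv \<beta> =
     foldr (\<lambda>i. partial_deriv i ^^ (\<beta> $ i)) (SOME xs. distinct xs \<and> set xs = (UNIV :: 'd set))"

definition multi_order :: "nat^'d \<Rightarrow> nat" where
  "multi_order \<beta> = (\<Sum>i\<in>UNIV. \<beta> $ i)"

text \<open>For the closure \<open>S\<close> of an open set: all partial derivatives up to order \<open>k\<close> exist in
  the interior of \<open>S\<close> and, together with the function, extend continuously to \<open>S\<close>.\<close>

primrec Ck_on :: "nat \<Rightarrow> (real^'d) set \<Rightarrow> (real^'d \<Rightarrow> complex) \<Rightarrow> bool" where
  "Ck_on 0 S f \<longleftrightarrow> continuous_on S f"
| "Ck_on (Suc k) S f \<longleftrightarrow>
     continuous_on S f \<and>
     (\<forall>i. \<exists>g. Ck_on k S g \<and>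
        (\<forall>x\<in>interior S. ((\<lambda>t. f (x + t *\<^sub>R axis i 1)) has_vector_derivative g x) (at 0)))"

definition weakly_compatible ::
    "nat \<Rightarrow> (real^'d \<Rightarrow> complex) \<Rightarrow> (real^'d \<Rightarrow> complex) \<Rightarrow> bool" where
  "weakly_compatible n \<phi>t \<phi> \<longleftrightarrow>
     (\<forall>\<beta>. multi_order \<beta> < n \<longrightarrow>
        multi_deriv \<beta> (\<lambda>\<xi>. 1 - fourier \<phi> \<xi> * cnj (fourier \<phi>t \<xi>)) 0 = 0)"

subsection \<open>Moduli of smoothness\<close>

definition fin_diff :: "nat \<Rightarrow> real^'d \<Rightarrow> (real^'d \<Rightarrow> complex) \<Rightarrow> real^'d \<Rightarrow> complex" where
  "fin_diff n h f x = (\<Sum>\<nu>\<le>n. (-1) ^ \<nu> * of_nat (n choose \<nu>) * f (x + real \<nu> *\<^sub>R h))"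

definition modulus ::
    "nat \<Rightarrow> ennreal \<Rightarrow> (real^'d \<Rightarrow> real) \<Rightarrow> (real^'d \<Rightarrow> complex) \<Rightarrow> real \<Rightarrow> ennreal" where
  "modulus n p u f t = (SUP h\<in>{h. norm h < t}. Lpw_norm p u (fin_diff n h f))"

text \<open>Anisotropic modulus \<open>\<Omega>\<^sub>n(f, B)\<close>, to be used with invertible \<open>B = A\<^sup>-\<^sup>1\<close>.\<close>

definition aniso_modulus ::
    "nat \<Rightarrow> ennreal \<Rightarrow> (real^'d \<Rightarrow> real) \<Rightarrow> (real^'d \<Rightarrow> complex) \<Rightarrow> real^'d^'d \<Rightarrow> ennreal" where
  "aniso_modulus n p u f B =
     (SUP h\<in>{h. norm (matrix_inv B *v h) < 1}. Lpw_norm p u (fin_diff n h f))"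

subsection \<open>The quasi-projection operator\<close>

definition quasi_proj_term ::
    "real^'d^'d \<Rightarrow> (real^'d \<Rightarrow> complex) \<Rightarrow> (real^'d \<Rightarrow> complex) \<Rightarrow> nat \<Rightarrow> (real^'d \<Rightarrow> complex) \<Rightarrow>
     real^'d \<Rightarrow> int^'d \<Rightarrow> complex" where
  "quasi_proj_term M \<phi> \<phi>t j f x k = pairing f (dil_shift M \<phi>t j k) * dil_shift M \<phi> j k x"

definition quasi_proj ::
    "real^'d^'d \<Rightarrow> (real^'d \<Rightarrow> complex) \<Rightarrow> (real^'d \<Rightarrow> complex) \<Rightarrow> nat \<Rightarrow> (real^'d \<Rightarrow> complex) \<Rightarrow>
     real^'d \<Rightarrow> complex" where
  "quasi_proj M \<phi> \<phi>t j f x = (\<Sum>\<^sub>\<infinity>k\<in>UNIV. quasi_proj_term M \<phi> \<phi>t j f x k)"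

end

theory Submission
  imports Defs
begin

text \<open>
  By the substitution \<open>y = M\<^sup>j x\<close> the operator becomes the unit-scale operator
  \<open>Q F = (\<Sum>k. \<langle>F, \<psi>(\<sqdot> + k)\<rangle> \<phi>(\<sqdot> + k))\<close>, applied to \<open>F = f \<circ> M\<^sup>-\<^sup>j\<close> in the space
  with weight \<open>1 / v\<close>, \<open>v = w \<circ> M\<^sup>-\<^sup>j\<close>, and the anisotropic modulus becomes
  \<open>\<Omega> = sup {\<parallel>\<Delta>\<^sub>h\<^sup>n F\<parallel> | \<bar>h\<bar> < 1}\<close>. The third condition on the weight says that
  \<open>v (x + y) \<le> u x * v y\<close> with one function \<open>u\<close> of polynomial growth for all \<open>j\<close>. The whole
  problem is thus \<open>\<parallel>F - Q F\<parallel> \<le> C \<Omega>\<close> with \<open>C\<close> depending on \<open>v\<close> only through \<open>u\<close>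
  (quasi_projection_error_unit_scale).

  \<^item> \<open>Q\<close> is bounded (J_qop). The coefficients are controlled by Jensen's inequality with the
    weights \<open>s\<^sup>q\<^sup>-\<^sup>1\<close>, \<open>s\<close> the periodization of \<open>\<bar>\<psi>\<bar> u\<close> (analysis_bound_Lp), the sum over \<open>k\<close> by
    Jensen's inequality on the unit cube (synthesis_bound).

  \<^item> A smoothing kernel with Fourier transform \<open>k\<close> supported near the origin is built from
    differences, so that \<open>E = F - F * k\<^sup>\<or>\<close> is an average of differences \<open>\<Delta>\<^sub>-\<^sub>s\<^sup>n F\<close>. For
    \<open>g = F * k\<^sup>\<or> * k\<^sup>\<or>\<close> the error \<open>F - g = E + E * k\<^sup>\<or>\<close> is therefore at most \<open>C \<Omega>\<close> (smoothing_kernel_exists,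
    convol_diff_symbol, J_difference_average). Differences with large steps are sums of differences
    with small ones (J_fin_diff_large).

  \<^item> On \<open>g\<close> the operator is explicit (qop_convol): since \<open>\<phi>\<close> has no frequencies near the nonzero
    integer points, Poisson summation removes the sum over \<open>k\<close>, and \<open>g - Q g\<close> is the convolution of
    \<open>F * k\<^sup>\<or>\<close> with the kernel \<open>b\<^sup>\<or>\<close>, where \<open>b\<close> is \<open>k\<close> times one minus the product of the
    transform of \<open>\<phi>\<close> with the conjugate of that of \<open>\<psi>\<close>. Smoothness near the origin makes
    \<open>b\<^sup>\<or>\<close> decay with order \<open>\<gamma>\<close>, weak compatibility makes its moments of order less than \<open>n\<close>
    vanish.

  \<^item> Vanishing moments remove the Taylor polynomial of \<open>F * k\<^sup>\<or>\<close>. By a second representation of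
    \<open>k\<close> the derivatives of order \<open>n\<close> in the remainder are again averages of differences of
    \<open>F\<close>, so \<open>\<parallel>g - Q g\<parallel> \<le> C \<Omega>\<close> (J_taylor_convol).

  The decomposition \<open>F - Q F = (F - g) + (g - Q g) - Q (F - g)\<close> concludes. As
  \<open>F\<close> may grow polynomially, Fourier transforms are taken of kernels only. All norms occur as their
  \<open>p\<close>-th powers \<open>J F = \<integral> (\<bar>F\<bar> / v)\<^sup>p\<close> with values in the
  extended nonnegative reals.
\<close>

section \<open>Powers of extended nonnegative reals and Jensen's inequality\<close>

lemma ennreal_powr_ennreal [simp]:
  "0 \<le> x \<Longrightarrow> ennreal_powr (ennreal x) r = ennreal (x powr r)"
  by (simp add: ennreal_powr_def)

lemma ennreal_powr_top [simp]: "ennreal_powr \<infinity> r = \<infinity>" "ennreal_powr top r = top"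
  by (simp_all add: ennreal_powr_def)

lemma ennreal_powr_0 [simp]: "ennreal_powr 0 r = 0"
  by (simp add: ennreal_powr_def)

lemma ennreal_powr_1 [simp]: "ennreal_powr 1 r = 1"
  by (simp add: ennreal_powr_def)

lemma ennreal_powr_one [simp]: "ennreal_powr x 1 = x"
  by (cases x) (simp_all add: ennreal_powr_def)

lemma ennreal_powr_measurable [measurable]:
  "(\<lambda>x. ennreal_powr x r) \<in> borel_measurable borel"
  unfolding ennreal_powr_def by measurable

lemma ennreal_powr_mono: "a \<le> b \<Longrightarrow> 0 \<le> r \<Longrightarrow> ennreal_powr a r \<le> ennreal_powr b r"
  by (cases a; cases b) (auto intro!: ennreal_leI powr_mono2 simp: top_unique)

lemma ennreal_powr_mult:
  "0 < r \<Longrightarrow> ennreal_powr (a * b) r = ennreal_powr a r * ennreal_powr b r"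
proof (cases a; cases b)
  fix x y :: real assume "0 \<le> x" "0 \<le> y" "a = ennreal x" "b = ennreal y"
  then show ?thesis by (simp add: ennreal_mult[symmetric] powr_mult)
next
  fix x :: real assume *: "0 < r" "0 \<le> x" "a = ennreal x" "b = top"
  show ?thesis by (cases "x = 0") (use * in \<open>auto simp: ennreal_mult_top\<close>)
next
  fix x :: real assume *: "0 < r" "0 \<le> x" "b = ennreal x" "a = top"
  show ?thesis by (cases "x = 0") (use * in \<open>auto simp: ennreal_top_mult\<close>)
qed (auto)

lemma ennreal_powr_powr: "ennreal_powr (ennreal_powr a r) s = ennreal_powr a (r * s)"
  by (cases a) (simp_all add: powr_powr)

lemma ennreal_powr_eq_0_iff [simp]: "ennreal_powr a r = 0 \<longleftrightarrow> a = 0"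
  by (cases a) auto

lemma ennreal_powr_eq_top_iff [simp]: "ennreal_powr a r = top \<longleftrightarrow> a = top"
  by (cases a) auto

lemma ennreal_powr_less_top_iff [simp]: "ennreal_powr a r < top \<longleftrightarrow> a < top"
  by (cases a) auto

lemma ennreal_powr_add_exponent:
  "a \<noteq> 0 \<or> 0 < r \<and> 0 < s \<Longrightarrow> ennreal_powr a (r + s) = ennreal_powr a r * ennreal_powr a s"
  by (cases a) (auto simp: powr_add ennreal_mult ennreal_top_mult)

lemma ennreal_powr_pred: "1 \<le> p \<Longrightarrow> ennreal_powr a (p - 1) * a = ennreal_powr a p"
  by (cases "a = 0") (use ennreal_powr_add_exponent[of a "p - 1" 1] in auto)

lemma ennreal_powr_add_le:
  assumes "1 \<le> p"
  shows "ennreal_powr (a + b) p \<le> ennreal (2 powr p) * (ennreal_powr a p + ennreal_powr b p)"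
proof -
  have "ennreal_powr (a + b) p \<le> ennreal_powr (2 * max a b) p"
    using assms by (intro ennreal_powr_mono) (simp_all add: mult_2 add_mono)
  also have "\<dots> = ennreal (2 powr p) * ennreal_powr (max a b) p"
    using assms ennreal_powr_ennreal[of 2 p] by (subst ennreal_powr_mult) auto
  also have "\<dots> \<le> ennreal (2 powr p) * (ennreal_powr a p + ennreal_powr b p)"
    by (intro mult_left_mono) (auto simp: max_def add_increasing add_increasing2)
  finally show ?thesis .
qed

text \<open>The convex function \<open>x\<^sup>p\<close> lies above its tangent at \<open>A\<close>.\<close>

lemma tangent_powr:
  fixes A x p :: real
  assumes "1 \<le> p" "0 \<le> A" "0 \<le> x"
  shows "p * A powr (p - 1) * x \<le> x powr p + (p - 1) * A powr p"
proof (cases "p = 1 \<or> A = 0")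
  case True then show ?thesis using assms by (auto simp: powr_one)
next
  case False
  then have p: "1 < p" and A: "0 < A" using assms by auto
  have "x * A powr (p - 1) \<le> x powr p / p + (A powr (p - 1)) powr (p / (p - 1)) / (p / (p - 1))"
    using assms p by (intro Youngs_inequality) (auto simp: field_simps)
  also have "(A powr (p - 1)) powr (p / (p - 1)) = A powr p"
    using p by (simp add: powr_powr)
  finally show ?thesis using p by (simp add: field_simps)
qed

text \<open>The tangent inequality at the mean value of \<open>g\<close>, integrated against \<open>k\<close>; the powers of the
  mass of \<open>k\<close> account for the missing normalization.\<close>

lemma nn_integral_jensen_powr:
  fixes g k :: "'a \<Rightarrow> ennreal"
  assumes p: "1 \<le> p" and [measurable]: "g \<in> borel_measurable N" "k \<in> borel_measurable N"
  shows "ennreal_powr (\<integral>\<^sup>+x. g x * k x \<partial>N) p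
    \<le> ennreal_powr (\<integral>\<^sup>+x. k x \<partial>N) (p - 1) * (\<integral>\<^sup>+x. ennreal_powr (g x) p * k x \<partial>N)"
proof -
  define m where "m = (\<integral>\<^sup>+x. k x \<partial>N)"
  define X where "X = (\<integral>\<^sup>+x. ennreal_powr (g x) p * k x \<partial>N)"
  have zero: "(\<integral>\<^sup>+x. g x * k x \<partial>N) = 0" if "m = 0 \<or> X = 0"
  proof -
    have "AE x in N. g x = 0 \<or> k x = 0"
      using that unfolding m_def X_def by (auto simp: nn_integral_0_iff_AE)
    then show ?thesis by (simp add: nn_integral_0_iff_AE)
  qed
  consider "m = 0 \<or> X = 0" | "m = \<infinity>" "X \<noteq> 0" | "m \<noteq> 0" "X = \<infinity>" 
    | "m \<noteq> 0" "m < \<infinity>" "X < \<infinity>"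
    by (metis infinity_ennreal_def less_top)
  then show ?thesis
  proof cases
    case 1 then show ?thesis using zero by simp
  next
    case 2 then show ?thesis
      unfolding m_def[symmetric] X_def[symmetric] by (simp add: ennreal_top_mult)
  next
    case 3 then show ?thesis
      unfolding m_def[symmetric] X_def[symmetric] by (simp add: ennreal_mult_top)
  next
    case 4
    define I where "I = (\<integral>\<^sup>+x. g x * k x \<partial>N)"
    have tan: "ennreal (p * A powr (p - 1)) * I \<le> X + ennreal ((p - 1) * A powr p) * m"
      if A: "0 \<le> A" for A
    proof -
      have pt: "ennreal (p * A powr (p - 1)) * y \<le> ennreal_powr y p + ennreal ((p - 1) * A powr p)"
        for y
      proof (cases y)
        case (real r)
        then show ?thesis using tangent_powr[OF p A, of r] A p
          by (simp add: ennreal_mult[symmetric] ennreal_plus[symmetric] del: ennreal_plus)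
      qed (auto)
      have "ennreal (p * A powr (p - 1)) * I = (\<integral>\<^sup>+x. ennreal (p * A powr (p - 1)) * g x * k x \<partial>N)"
        unfolding I_def by (subst nn_integral_cmult[symmetric]) (auto simp: mult.assoc)
      also have "\<dots> \<le> (\<integral>\<^sup>+x. ennreal_powr (g x) p * k x + ennreal ((p - 1) * A powr p) * k x \<partial>N)"
        by (intro nn_integral_mono) (auto simp: distrib_right[symmetric] intro!: mult_right_mono pt)
      also have "\<dots> = X + ennreal ((p - 1) * A powr p) * m"
        unfolding X_def m_def by (subst nn_integral_add) (auto simp: nn_integral_cmult)
      finally show ?thesis .
    qed
    obtain m' where m': "m = ennreal m'" "0 < m'"
      using 4 by (cases m) (auto simp: order.order_iff_strict)
    obtain X' where X': "X = ennreal X'" "0 \<le> X'" using 4 by (cases X) auto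
    have "ennreal p * I < \<infinity>"
      using tan[of 1] p m' X'
      by (simp add: ennreal_mult[symmetric] ennreal_plus[symmetric] del: ennreal_plus)
         (metis ennreal_less_top order_le_less_trans)
    then have "I < \<infinity>" using p by (auto simp: ennreal_mult_less_top)
    then obtain I' where I': "I = ennreal I'" "0 \<le> I'" by (cases I) auto
    define A where "A = I' / m'"
    have A: "0 \<le> A" "I' = A * m'" using I' m' by (auto simp: A_def)
    have "p * A powr (p - 1) * I' \<le> X' + (p - 1) * A powr p * m'"
      using tan[OF A(1)] I' m' X' A p
      by (simp add: ennreal_mult[symmetric] ennreal_plus[symmetric] del: ennreal_plus)
    moreover have "A powr (p - 1) * A = A powr p"
      using A p by (cases "A = 0") (auto simp: powr_diff)
    ultimately have *: "A powr p * m' \<le> X'" unfolding A(2) 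
      by (simp add: algebra_simps) (smt (verit) mult.commute mult.left_commute)
    have "I' powr p = m' powr (p - 1) * (A powr p * m')"
      using m' A by (simp add: powr_mult powr_diff)
    also have "\<dots> \<le> m' powr (p - 1) * X'" using * by (intro mult_left_mono) auto
    finally show ?thesis
      unfolding m_def[symmetric] X_def[symmetric] I_def[symmetric] 
      using I' m' X' by (simp add: ennreal_mult[symmetric])
  qed
qed

text \<open>Minkowski's inequality in the form in which it follows from Jensen's inequality and Fubini's theorem:
  all \<open>y\<close>-slices of \<open>H\<close> have a common bound.\<close>

lemma nn_integral_minkowski_powr:
  fixes H :: "'a \<Rightarrow> 'b \<Rightarrow> ennreal" and k :: "'b \<Rightarrow> ennreal"
  assumes p: "1 \<le> p" and "sigma_finite_measure L" "sigma_finite_measure N"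
    and [measurable]: "case_prod H \<in> borel_measurable (L \<Otimes>\<^sub>M N)" "k \<in> borel_measurable N"
    and le: "\<And>y. y \<in> space N \<Longrightarrow> (\<integral>\<^sup>+x. ennreal_powr (H x y) p \<partial>L) \<le> c"
  shows "(\<integral>\<^sup>+x. ennreal_powr (\<integral>\<^sup>+y. H x y * k y \<partial>N) p \<partial>L)
    \<le> ennreal_powr (\<integral>\<^sup>+y. k y \<partial>N) p * c"
proof -
  interpret L: sigma_finite_measure L by fact
  interpret N: sigma_finite_measure N by fact
  interpret P: pair_sigma_finite L N ..
  let ?m = "\<integral>\<^sup>+y. k y \<partial>N"
  have [measurable]: "H x \<in> borel_measurable N" if "x \<in> space L" for x
    using measurable_Pair2[OF assms(4) that] by simp
  have [measurable]: "(\<lambda>x. \<integral>\<^sup>+y. ennreal_powr (H x y) p * k y \<partial>N) \<in> borel_measurable L"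
    by measurable
  have "(\<integral>\<^sup>+x. ennreal_powr (\<integral>\<^sup>+y. H x y * k y \<partial>N) p \<partial>L)
     \<le> (\<integral>\<^sup>+x. ennreal_powr ?m (p - 1) * (\<integral>\<^sup>+y. ennreal_powr (H x y) p * k y \<partial>N) \<partial>L)"
    by (intro nn_integral_mono nn_integral_jensen_powr p) auto
  also have "\<dots> = ennreal_powr ?m (p - 1) * (\<integral>\<^sup>+x. (\<integral>\<^sup>+y. ennreal_powr (H x y) p * k y \<partial>N) \<partial>L)"
    by (rule nn_integral_cmult) measurable
  also have "(\<integral>\<^sup>+x. (\<integral>\<^sup>+y. ennreal_powr (H x y) p * k y \<partial>N) \<partial>L)
      = (\<integral>\<^sup>+y. (\<integral>\<^sup>+x. ennreal_powr (H x y) p * k y \<partial>L) \<partial>N)"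
    by (rule P.Fubini'[symmetric]) measurable
  also have "\<dots> \<le> (\<integral>\<^sup>+y. c * k y \<partial>N)"
  proof (intro nn_integral_mono)
    fix y assume y: "y \<in> space N"
    have [measurable]: "(\<lambda>x. H x y) \<in> borel_measurable L"
      using measurable_Pair1[OF assms(4) y] by simp
    show "(\<integral>\<^sup>+x. ennreal_powr (H x y) p * k y \<partial>L) \<le> c * k y"
      using le[OF y] by (simp add: nn_integral_multc mult_right_mono)
  qed
  also have "\<dots> = c * ?m" by (simp add: nn_integral_cmult)
  also have "ennreal_powr ?m (p - 1) * (c * ?m) = ennreal_powr ?m p * c"
    using ennreal_powr_pred[OF p, of ?m] by (metis mult.assoc mult.commute)
  finally show ?thesis by (simp add: mult_left_mono)
qed

section \<open>Tiling by integer translates of the unit cube\<close>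

definition unit_cube :: "(real^'d) set" where
  "unit_cube = {x. \<forall>i. - 1 / 2 \<le> x $ i \<and> x $ i < 1 / 2}"

abbreviation lcube :: "(real^'d) measure" where
  "lcube \<equiv> density lborel (indicator unit_cube)"

abbreviation counting :: "(int^'d) measure" where
  "counting \<equiv> count_space UNIV"

lemma borel_measurable_vec_nth [measurable]:
  "(\<lambda>x::real^'d. x $ i) \<in> borel_measurable borel"
  by (intro borel_measurable_continuous_onI continuous_intros)

lemma unit_cube_measurable [measurable]: "unit_cube \<in> sets (borel :: (real^'d) measure)"
  unfolding unit_cube_def by measurable

lemma borel_measurable_int_vec [measurable]: "int_vec \<in> borel_measurable (count_space UNIV)"
  by simp

lemma int_vec_add: "int_vec (k + l) = int_vec k + int_vec l"
  by (simp add: int_vec_def vec_eq_iff)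

lemma int_vec_uminus: "int_vec (- k) = - int_vec k"
  by (simp add: int_vec_def vec_eq_iff)

lemma int_vec_0 [simp]: "int_vec 0 = 0"
  by (simp add: int_vec_def vec_eq_iff)

lemma emeasure_unit_cube: "emeasure lborel (unit_cube :: (real^'d) set) = 1"
proof -
  let ?l = "(\<chi> i. - 1 / 2) :: real^'d" and ?u = "(\<chi> i. 1 / 2) :: real^'d"
  have B: "(?u - ?l) \<bullet> b = 1 \<and> ?l \<bullet> b \<le> ?u \<bullet> b" if "b \<in> Basis" for b
    using that by (auto simp: Basis_vec_def inner_axis)
  have "box ?l ?u \<subseteq> unit_cube" "unit_cube \<subseteq> cbox ?l ?u"
    by (auto simp: unit_cube_def mem_box_cart less_imp_le)
  moreover have "emeasure lborel (box ?l ?u) = 1" "emeasure lborel (cbox ?l ?u) = 1"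
    using B by (simp_all add: emeasure_lborel_box_eq emeasure_lborel_cbox_eq)
  ultimately show ?thesis
    using emeasure_mono[of "box ?l ?u" unit_cube lborel] emeasure_mono[of unit_cube "cbox ?l ?u" lborel]
    by (intro order_antisym) auto
qed

lemma emeasure_lcube [simp]: "emeasure lcube (UNIV :: (real^'d) set) = 1"
  by (subst emeasure_density) (auto simp: emeasure_unit_cube)

lemma finite_measure_lcube: "finite_measure (lcube :: (real^'d) measure)"
  by standard (simp add: emeasure_lcube)

interpretation lcube: finite_measure "lcube :: (real^'d) measure"
  by (rule finite_measure_lcube)

interpretation counting: sigma_finite_measure "counting :: (int^'d) measure"
  by (rule sigma_finite_measure_count_space_countable) simp

interpretation lcube_counting: pair_sigma_finite "lcube :: (real^'d) measure" "counting :: (int^'d) measure" ..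
interpretation counting_lborel: pair_sigma_finite "counting :: (int^'d) measure" "lborel :: (real^'d) measure" ..
interpretation lborel_counting: pair_sigma_finite "lborel :: (real^'d) measure" "counting :: (int^'d) measure" ..
interpretation counting2: pair_sigma_finite "counting :: (int^'d) measure" "counting :: (int^'d) measure" ..
interpretation lborel2: pair_sigma_finite "lborel :: (real^'d) measure" "lborel :: (real^'d) measure" ..
interpretation lborel_lcube: pair_sigma_finite "lborel :: (real^'d) measure" "lcube :: (real^'d) measure" ..

lemma unit_cube_unique_translate: "\<exists>!k. y - int_vec k \<in> unit_cube"
proof (rule ex1I[of _ "\<chi> i. \<lfloor>y $ i + 1 / 2\<rfloor>"])
  show "y - int_vec (\<chi> i. \<lfloor>y $ i + 1 / 2\<rfloor>) \<in> unit_cube"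
    by (auto simp: unit_cube_def int_vec_def) linarith+
  fix k assume k: "y - int_vec k \<in> unit_cube"
  have "k $ i = \<lfloor>y $ i + 1 / 2\<rfloor>" for i
    using k[unfolded unit_cube_def int_vec_def, simplified, rule_format, of i]
    by (intro floor_unique[symmetric]) auto
  then show "k = (\<chi> i. \<lfloor>y $ i + 1 / 2\<rfloor>)" by (simp add: vec_eq_iff)
qed

lemma nn_integral_translate:
  fixes g :: "real^'d \<Rightarrow> ennreal"
  assumes [measurable]: "g \<in> borel_measurable borel"
  shows "(\<integral>\<^sup>+x. g (x + c) \<partial>lborel) = (\<integral>\<^sup>+x. g x \<partial>lborel)"
  by (subst (2) lborel_distr_plus[of c, symmetric])
     (simp add: nn_integral_distr add.commute)

text \<open>Every point is \<open>x + k\<close> for exactly one \<open>x\<close> in the cube and one integer vector \<open>k\<close>.\<close>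

lemma distr_cube_tiling:
  "distr (lcube \<Otimes>\<^sub>M counting) borel (\<lambda>(x, k). x + int_vec k) = (lborel :: (real^'d) measure)"
    (is "?D = _")
proof (rule measure_eqI)
  fix A :: "(real^'d) set" assume "A \<in> sets ?D"
  then have [measurable]: "A \<in> sets borel" by simp
  have one: "(\<integral>\<^sup>+k. indicator unit_cube (y - int_vec k) \<partial>counting) = 1" for y :: "real^'d"
  proof -
    obtain k0 where k0: "{k. y - int_vec k \<in> unit_cube} = {k0}"
      using unit_cube_unique_translate[of y] by (elim ex1E) blast
    have "(\<integral>\<^sup>+k. indicator unit_cube (y - int_vec k) \<partial>counting)
        = (\<integral>\<^sup>+k. indicator {k. y - int_vec k \<in> unit_cube} k \<partial>counting)"
      by (intro nn_integral_cong) (auto simp: indicator_def)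
    then show ?thesis by (simp add: k0)
  qed
  have "emeasure ?D A = (\<integral>\<^sup>+z. indicator A z \<partial>?D)" by simp
  also have "\<dots> = (\<integral>\<^sup>+z. indicator A ((\<lambda>(x, k). x + int_vec k) z) \<partial>(lcube \<Otimes>\<^sub>M counting))"
    by (rule nn_integral_distr) auto
  also have "\<dots> = (\<integral>\<^sup>+k. (\<integral>\<^sup>+x. indicator A (x + int_vec k) \<partial>lcube) \<partial>counting)"
    by (subst lcube_counting.nn_integral_snd[symmetric]) auto
  also have "\<dots> = (\<integral>\<^sup>+k. (\<integral>\<^sup>+x. indicator unit_cube x * indicator A (x + int_vec k) \<partial>lborel) \<partial>counting)"
    by (intro nn_integral_cong nn_integral_density) auto
  also have "\<dots> = (\<integral>\<^sup>+k. (\<integral>\<^sup>+y. indicator unit_cube (y - int_vec k) * indicator A y \<partial>lborel) \<partial>counting)"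
  proof (rule nn_integral_cong)
    fix k :: "int^'d"
    show "(\<integral>\<^sup>+x. indicator unit_cube x * indicator A (x + int_vec k) \<partial>lborel)
      = (\<integral>\<^sup>+y. indicator unit_cube (y - int_vec k) * indicator A y \<partial>lborel)"
      using nn_integral_translate[of "\<lambda>y. indicator unit_cube (y - int_vec k) * indicator A y" "int_vec k"]
      by simp
  qed
  also have "\<dots> = (\<integral>\<^sup>+y. (\<integral>\<^sup>+k. indicator unit_cube (y - int_vec k) * indicator A y \<partial>counting) \<partial>lborel)"
    by (rule lborel_counting.Fubini') measurable
  also have "\<dots> = emeasure lborel A"
    by (simp add: nn_integral_multc one)
  finally show "emeasure ?D A = emeasure lborel A" .
qed simp

lemma nn_integral_tiling:
  fixes g :: "real^'d \<Rightarrow> ennreal"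
  assumes [measurable]: "g \<in> borel_measurable borel"
  shows "(\<integral>\<^sup>+x. g x \<partial>lborel) = (\<integral>\<^sup>+x. (\<integral>\<^sup>+k. g (x + int_vec k) \<partial>counting) \<partial>lcube)"
proof -
  have "(\<integral>\<^sup>+x. g x \<partial>lborel) = (\<integral>\<^sup>+z. g ((\<lambda>(x, k). x + int_vec k) z) \<partial>(lcube \<Otimes>\<^sub>M counting))"
    by (subst distr_cube_tiling[symmetric], subst nn_integral_distr) auto
  also have "\<dots> = (\<integral>\<^sup>+x. (\<integral>\<^sup>+k. g (x + int_vec k) \<partial>counting) \<partial>lcube)"
    by (subst counting.nn_integral_fst[symmetric]) auto
  finally show ?thesis .
qed

lemma
  fixes g :: "real^'d \<Rightarrow> complex"
  assumes g: "integrable lborel g"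
  shows AE_integrable_tiling: "AE x in lcube. integrable counting (\<lambda>k. g (x + int_vec k))"
    and integrable_tiling: "integrable lcube (\<lambda>x. \<integral>k. g (x + int_vec k) \<partial>counting)"
    and integral_tiling: "(\<integral>x. g x \<partial>lborel) = (\<integral>x. (\<integral>k. g (x + int_vec k) \<partial>counting) \<partial>lcube)"
proof -
  have [measurable]: "g \<in> borel_measurable borel" using g by auto
  have i: "integrable (lcube \<Otimes>\<^sub>M counting) (\<lambda>(x, k). g (x + int_vec k))"
    using g by (subst (asm) distr_cube_tiling[symmetric], subst (asm) integrable_distr_eq)
       (auto simp: case_prod_unfold)
  show "AE x in lcube. integrable counting (\<lambda>k. g (x + int_vec k))"
    using lcube_counting.AE_integrable_fst[OF i] .
  show "integrable lcube (\<lambda>x. \<integral>k. g (x + int_vec k) \<partial>counting)"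
    using lcube_counting.integrable_fst[OF i] .
  have "(\<integral>x. g x \<partial>lborel) = (\<integral>z. (case z of (x, k) \<Rightarrow> g (x + int_vec k)) \<partial>(lcube \<Otimes>\<^sub>M counting))"
    by (subst distr_cube_tiling[symmetric], subst integral_distr) (auto simp: case_prod_unfold)
  then show "(\<integral>x. g x \<partial>lborel) = (\<integral>x. (\<integral>k. g (x + int_vec k) \<partial>counting) \<partial>lcube)"
    using lcube_counting.integral_fst[OF i] by simp
qed

lemma nn_integral_count_shift:
  "(\<integral>\<^sup>+k. g (l + k) \<partial>counting) = (\<integral>\<^sup>+k. g k \<partial>(counting :: (int^'d) measure))"
proof -
  have "bij_betw (\<lambda>k::int^'d. l + k) UNIV UNIV"
    by (rule bij_betwI[of _ _ _ "\<lambda>k. k - l"]) auto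
  from nn_integral_bij_count_space[OF this, of g] show ?thesis .
qed

lemma AE_periodic:
  fixes P :: "real^'d \<Rightarrow> bool"
  assumes AE: "AE x in lcube. P x" and [measurable]: "Measurable.pred borel P"
    and per: "\<And>x k. P x \<Longrightarrow> P (x + int_vec k)"
  shows "AE x in lborel. P x"
proof -
  have "emeasure lborel {x. \<not> P x} = (\<integral>\<^sup>+x. indicator {x. \<not> P x} x \<partial>lborel)"
    by (subst nn_integral_indicator) auto
  also have "\<dots> = (\<integral>\<^sup>+x. (\<integral>\<^sup>+k. indicator {x. \<not> P x} (x + int_vec k) \<partial>counting) \<partial>lcube)"
    by (rule nn_integral_tiling) measurable
  also have "\<dots> = (\<integral>\<^sup>+x. 0 \<partial>(lcube :: (real^'d) measure))"
  proof (rule nn_integral_cong_AE)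
    show "AE x in lcube. (\<integral>\<^sup>+k. indicator {x. \<not> P x} (x + int_vec k) \<partial>counting) = 0"
      using AE
    proof eventually_elim
      case (elim x)
      then have "indicator {x. \<not> P x} (x + int_vec k) = (0 :: ennreal)" for k
        using per[OF elim] by (simp add: indicator_def)
      then show ?case by simp
    qed
  qed
  finally show ?thesis by (intro AE_I[where N="{x. \<not> P x}"]) auto
qed

section \<open>Periodization estimates\<close>

lemma ennreal_powr_pred': "1 \<le> p \<Longrightarrow> ennreal_powr s (p - 1) * (c * s) = c * ennreal_powr s p"
  using ennreal_powr_pred[of p s] by (metis mult.left_commute)

lemma ennreal_inverse_mult_self: "a \<noteq> 0 \<Longrightarrow> a \<noteq> \<infinity> \<Longrightarrow> inverse a * a = (1 :: ennreal)"
  using ennreal_divide_self[of a] by (simp add: divide_ennreal_def mult.commute less_top)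

abbreviation periodization :: "(real^'d \<Rightarrow> ennreal) \<Rightarrow> real^'d \<Rightarrow> ennreal" where
  "periodization b x \<equiv> (\<integral>\<^sup>+k. b (x + int_vec k) \<partial>counting)"

lemma periodization_translate: "periodization b (x + int_vec l) = periodization b x"
  using nn_integral_count_shift[of "\<lambda>k. b (x + int_vec k)" l] by (simp add: int_vec_add add.assoc)

text \<open>The \<open>\<L>\<^sub>p\<close> spaces are contained in \<open>L\<^sub>1\<close>.\<close>

lemma nn_integral_le_periodization:
  fixes b :: "real^'d \<Rightarrow> ennreal"
  assumes p: "1 \<le> p" and [measurable]: "b \<in> borel_measurable borel"
  shows "ennreal_powr (\<integral>\<^sup>+x. b x \<partial>lborel) p \<le> (\<integral>\<^sup>+x. ennreal_powr (periodization b x) p \<partial>lcube)"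
  using nn_integral_jensen_powr[OF p, of "periodization b" lcube "\<lambda>_. 1"]
  by (simp add: nn_integral_tiling)

text \<open>Jensen's inequality in the sum over \<open>k\<close>, with the masses \<open>a (x + k)\<close> of total weight
  \<open>periodization a x\<close>; the outer integral is then tiled by unit cubes.\<close>

lemma synthesis_bound:
  fixes a :: "real^'d \<Rightarrow> ennreal" and \<beta> :: "int^'d \<Rightarrow> ennreal"
  assumes p: "1 \<le> p" and [measurable]: "a \<in> borel_measurable borel"
  shows "(\<integral>\<^sup>+x. ennreal_powr (\<integral>\<^sup>+k. \<beta> k * a (x + int_vec k) \<partial>counting) p \<partial>lborel)
    \<le> (\<integral>\<^sup>+k. ennreal_powr (\<beta> k) p \<partial>counting) * (\<integral>\<^sup>+x. ennreal_powr (periodization a x) p \<partial>lcube)"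
proof -
  have shift: "(\<integral>\<^sup>+l. a (x + int_vec l + int_vec k) \<partial>counting) = periodization a x" for x k
    using nn_integral_count_shift[of "\<lambda>l. a (x + int_vec l)" k]
    by (simp add: int_vec_add algebra_simps)
  have "(\<integral>\<^sup>+x. ennreal_powr (\<integral>\<^sup>+k. \<beta> k * a (x + int_vec k) \<partial>counting) p \<partial>lborel)
    = (\<integral>\<^sup>+x. (\<integral>\<^sup>+l. ennreal_powr (\<integral>\<^sup>+k. \<beta> k * a (x + int_vec l + int_vec k) \<partial>counting) p \<partial>counting) \<partial>lcube)"
    by (subst nn_integral_tiling) measurable
  also have "\<dots> \<le> (\<integral>\<^sup>+x. (\<integral>\<^sup>+k. ennreal_powr (\<beta> k) p \<partial>counting) * ennreal_powr (periodization a x) p \<partial>lcube)"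
  proof (rule nn_integral_mono)
    fix x :: "real^'d"
    let ?s = "periodization a x"
    have "(\<integral>\<^sup>+l. ennreal_powr (\<integral>\<^sup>+k. \<beta> k * a (x + int_vec l + int_vec k) \<partial>counting) p \<partial>counting)
      \<le> (\<integral>\<^sup>+l. ennreal_powr ?s (p - 1) * (\<integral>\<^sup>+k. ennreal_powr (\<beta> k) p * a (x + int_vec l + int_vec k) \<partial>counting) \<partial>counting)"
      using nn_integral_jensen_powr[OF p, of \<beta> counting "\<lambda>k. a (x + int_vec _ + int_vec k)"]
      by (intro nn_integral_mono) (simp add: periodization_translate)
    also have "\<dots> = ennreal_powr ?s (p - 1) * (\<integral>\<^sup>+l. (\<integral>\<^sup>+k. ennreal_powr (\<beta> k) p * a (x + int_vec l + int_vec k) \<partial>counting) \<partial>counting)"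
      by (rule nn_integral_cmult) simp
    also have "(\<integral>\<^sup>+l. (\<integral>\<^sup>+k. ennreal_powr (\<beta> k) p * a (x + int_vec l + int_vec k) \<partial>counting) \<partial>counting)
      = (\<integral>\<^sup>+k. (\<integral>\<^sup>+l. ennreal_powr (\<beta> k) p * a (x + int_vec l + int_vec k) \<partial>counting) \<partial>counting)"
      by (rule counting2.Fubini') (simp add: pair_measure_countable)
    also have "\<dots> = (\<integral>\<^sup>+k. ennreal_powr (\<beta> k) p \<partial>counting) * ?s"
      by (simp add: nn_integral_cmult nn_integral_multc shift)
    also have "ennreal_powr ?s (p - 1) * ((\<integral>\<^sup>+k. ennreal_powr (\<beta> k) p \<partial>counting) * ?s)
      = (\<integral>\<^sup>+k. ennreal_powr (\<beta> k) p \<partial>counting) * ennreal_powr ?s p"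
      by (rule ennreal_powr_pred'[OF p])
    finally show "(\<integral>\<^sup>+l. ennreal_powr (\<integral>\<^sup>+k. \<beta> k * a (x + int_vec l + int_vec k) \<partial>counting) p \<partial>counting)
      \<le> (\<integral>\<^sup>+k. ennreal_powr (\<beta> k) p \<partial>counting) * ennreal_powr ?s p" .
  qed
  also have "\<dots> = (\<integral>\<^sup>+k. ennreal_powr (\<beta> k) p \<partial>counting) * (\<integral>\<^sup>+x. ennreal_powr (periodization a x) p \<partial>lcube)"
    by (rule nn_integral_cmult) measurable
  finally show ?thesis .
qed

text \<open>For \<open>p = 1\<close> the sum and the integral can be interchanged.\<close>

lemma analysis_bound_L1:
  fixes b f :: "real^'d \<Rightarrow> ennreal"
  assumes [measurable]: "b \<in> borel_measurable borel" "f \<in> borel_measurable borel"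
    and b: "AE x in lcube. periodization b x \<le> S"
  shows "(\<integral>\<^sup>+k. (\<integral>\<^sup>+y. f y * b (y + int_vec k) \<partial>lborel) \<partial>counting) \<le> S * (\<integral>\<^sup>+y. f y \<partial>lborel)"
proof -
  have "AE x in lborel. periodization b x \<le> S"
    using b by (rule AE_periodic) (auto simp: periodization_translate)
  have "(\<integral>\<^sup>+k. (\<integral>\<^sup>+y. f y * b (y + int_vec k) \<partial>lborel) \<partial>counting)
     = (\<integral>\<^sup>+y. (\<integral>\<^sup>+k. f y * b (y + int_vec k) \<partial>counting) \<partial>lborel)"
    by (rule lborel_counting.Fubini') measurable
  also have "\<dots> = (\<integral>\<^sup>+y. f y * periodization b y \<partial>lborel)"
    by (simp add: nn_integral_cmult)
  also have "\<dots> \<le> (\<integral>\<^sup>+y. f y * S \<partial>lborel)"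
    by (intro nn_integral_mono_AE, use \<open>AE x in lborel. _\<close> in eventually_elim) (rule mult_left_mono, auto)
  also have "\<dots> = S * (\<integral>\<^sup>+y. f y \<partial>lborel)" by (subst nn_integral_multc) (auto simp: mult.commute)
  finally show ?thesis .
qed

text \<open>With \<open>s\<close> the periodization of \<open>b\<close>, write \<open>f b = (f / s\<^sup>q\<^sup>-\<^sup>1) (b s\<^sup>q\<^sup>-\<^sup>1)\<close>. The second factor has
  the same mass \<open>\<integral> s\<^sup>q\<close> (over the cube) for each translate, and the sum over \<open>k\<close> of its translates is
  \<open>s\<^sup>q\<close>, which the factor \<open>s\<^sup>-\<^sup>(\<^sup>q\<^sup>-\<^sup>1\<^sup>)\<^sup>p = s\<^sup>-\<^sup>q\<close> left by Jensen's inequality cancels.\<close>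

lemma analysis_bound_Lp:
  fixes b f :: "real^'d \<Rightarrow> ennreal"
  assumes p: "1 < p" and q: "q = p / (p - 1)"
    and [measurable]: "b \<in> borel_measurable borel" "f \<in> borel_measurable borel"
    and fin: "(\<integral>\<^sup>+x. ennreal_powr (periodization b x) q \<partial>lcube) < \<infinity>"
  shows "(\<integral>\<^sup>+k. ennreal_powr (\<integral>\<^sup>+y. f y * b (y + int_vec k) \<partial>lborel) p \<partial>counting)
    \<le> ennreal_powr (\<integral>\<^sup>+x. ennreal_powr (periodization b x) q \<partial>lcube) (p - 1) * (\<integral>\<^sup>+y. ennreal_powr (f y) p \<partial>lborel)"
proof -
  define s where "s = periodization b"
  have [measurable]: "s \<in> borel_measurable borel" unfolding s_def by measurable
  have q1: "1 < q" and qp: "(q - 1) * p = q" using p by (auto simp: q field_simps)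
  let ?W = "\<integral>\<^sup>+x. ennreal_powr (s x) q \<partial>lcube"
  have "AE x in lcube. ennreal_powr (s x) q \<noteq> \<infinity>"
    using fin by (intro nn_integral_PInf_AE) (auto simp: s_def)
  then have "AE x in lcube. s x \<noteq> \<infinity>" by simp
  then have sfin: "AE x in lborel. s x \<noteq> \<infinity>"
    by (rule AE_periodic) (auto simp: s_def periodization_translate)
  (* Where s vanishes, so do all translates of b, and the convention for the inverse of zero does no harm. *)
  define g where "g y = f y * inverse (ennreal_powr (s y) (q - 1))" for y
  define w where "w k y = b (y + int_vec k) * ennreal_powr (s y) (q - 1)" for k y
  have [measurable]: "g \<in> borel_measurable borel" "\<And>k. w k \<in> borel_measurable borel"
    unfolding g_def w_def by measurable
  have bz: "b (y + int_vec k) = 0" if "s y = 0" for y k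
    using that unfolding s_def by (subst (asm) nn_integral_0_iff_AE) (auto simp: AE_count_space)
  have gw: "AE y in lborel. f y * b (y + int_vec k) = g y * w k y" for k
    using sfin
  proof eventually_elim
    case (elim y)
    show ?case
    proof (cases "s y = 0")
      case True then show ?thesis using bz by (simp add: w_def)
    next
      case False
      then have "inverse (ennreal_powr (s y) (q - 1)) * ennreal_powr (s y) (q - 1) = 1"
        using elim by (intro ennreal_inverse_mult_self) auto
      then show ?thesis unfolding g_def w_def
        by (metis mult.assoc mult.commute mult.right_neutral)
    qed
  qed
  have wint: "(\<integral>\<^sup>+y. w k y \<partial>lborel) = ?W" for k
  proof -
    have "(\<integral>\<^sup>+y. w k y \<partial>lborel) = (\<integral>\<^sup>+x. (\<integral>\<^sup>+l. w k (x + int_vec l) \<partial>counting) \<partial>lcube)"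
      by (rule nn_integral_tiling) measurable
    also have "\<dots> = (\<integral>\<^sup>+x. ennreal_powr (s x) q \<partial>lcube)"
    proof (intro nn_integral_cong)
      fix x :: "real^'d"
      have "(\<integral>\<^sup>+l. w k (x + int_vec l) \<partial>counting) = (\<integral>\<^sup>+l. b (x + int_vec l + int_vec k) * ennreal_powr (s x) (q - 1) \<partial>counting)"
        unfolding w_def s_def by (simp add: periodization_translate)
      also have "\<dots> = (\<integral>\<^sup>+l. b (x + int_vec (k + l)) \<partial>counting) * ennreal_powr (s x) (q - 1)"
        by (subst nn_integral_multc) (auto simp: int_vec_add algebra_simps)
      also have "\<dots> = s x * ennreal_powr (s x) (q - 1)"
        using nn_integral_count_shift[of "\<lambda>l. b (x + int_vec l)" k] by (simp add: s_def)
      also have "\<dots> = ennreal_powr (s x) q"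
        using ennreal_powr_pred[of q "s x"] q1 by (simp add: mult.commute)
      finally show "(\<integral>\<^sup>+l. w k (x + int_vec l) \<partial>counting) = ennreal_powr (s x) q" .
    qed
    finally show ?thesis .
  qed
  have "(\<integral>\<^sup>+k. ennreal_powr (\<integral>\<^sup>+y. f y * b (y + int_vec k) \<partial>lborel) p \<partial>counting)
    = (\<integral>\<^sup>+k. ennreal_powr (\<integral>\<^sup>+y. g y * w k y \<partial>lborel) p \<partial>counting)"
    using gw by (intro nn_integral_cong arg_cong2[where f=ennreal_powr] refl nn_integral_cong_AE) auto
  also have "\<dots> \<le> (\<integral>\<^sup>+k. ennreal_powr ?W (p - 1) * (\<integral>\<^sup>+y. ennreal_powr (g y) p * w k y \<partial>lborel) \<partial>counting)"
    using nn_integral_jensen_powr[of p g lborel "w _"] p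
    by (intro nn_integral_mono) (simp add: wint)
  also have "\<dots> = ennreal_powr ?W (p - 1) * (\<integral>\<^sup>+k. (\<integral>\<^sup>+y. ennreal_powr (g y) p * w k y \<partial>lborel) \<partial>counting)"
    by (rule nn_integral_cmult) simp
  also have "(\<integral>\<^sup>+k. (\<integral>\<^sup>+y. ennreal_powr (g y) p * w k y \<partial>lborel) \<partial>counting)
      = (\<integral>\<^sup>+y. (\<integral>\<^sup>+k. ennreal_powr (g y) p * w k y \<partial>counting) \<partial>lborel)"
    unfolding w_def by (rule lborel_counting.Fubini') measurable
  also have "\<dots> \<le> (\<integral>\<^sup>+y. ennreal_powr (f y) p \<partial>lborel)"
  proof (rule nn_integral_mono_AE)
    show "AE y in lborel. (\<integral>\<^sup>+k. ennreal_powr (g y) p * w k y \<partial>counting) \<le> ennreal_powr (f y) p"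
      using sfin
    proof eventually_elim
      case (elim y)
      have eq: "(\<integral>\<^sup>+k. ennreal_powr (g y) p * w k y \<partial>counting) = ennreal_powr (g y) p * (s y * ennreal_powr (s y) (q - 1))"
        unfolding w_def s_def by (simp add: nn_integral_cmult nn_integral_multc)
      also have "\<dots> = ennreal_powr (g y) p * ennreal_powr (s y) q"
        using ennreal_powr_pred[of q "s y"] q1 by (simp add: mult.commute)
      also have "\<dots> = ennreal_powr (g y * ennreal_powr (s y) (q - 1)) p"
        using p qp by (simp add: ennreal_powr_mult ennreal_powr_powr)
      also have "\<dots> \<le> ennreal_powr (f y) p"
      proof (intro ennreal_powr_mono)
        have "inverse (ennreal_powr (s y) (q - 1)) * ennreal_powr (s y) (q - 1) \<le> 1"
        proof (cases "s y = 0")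
          case False
          then have "inverse (ennreal_powr (s y) (q - 1)) * ennreal_powr (s y) (q - 1) = 1"
            using elim by (intro ennreal_inverse_mult_self) auto
          then show ?thesis by simp
        qed simp
        then show "g y * ennreal_powr (s y) (q - 1) \<le> f y"
          unfolding g_def mult.assoc by (metis mult.right_neutral mult_left_mono zero_le)
      qed (use p in auto)
      finally show ?case .
    qed
  qed
  finally show ?thesis unfolding s_def by (simp add: mult_left_mono)
qed

section \<open>Uniqueness of Fourier coefficients on the torus\<close>

definition char :: "real^'d \<Rightarrow> real^'d \<Rightarrow> complex" where
  "char x \<xi> = cis (2 * pi * (x \<bullet> \<xi>))"

lemma norm_char [simp]: "cmod (char x \<xi>) = 1"
  by (simp add: char_def)

lemma char_0 [simp]: "char 0 \<xi> = 1" "char x 0 = 1"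
  by (simp_all add: char_def)

lemma char_commute: "char x \<xi> = char \<xi> x"
  by (simp add: char_def inner_commute)

lemma char_add_left: "char (x + y) \<xi> = char x \<xi> * char y \<xi>"
  by (simp add: char_def cis_mult inner_add_left distrib_left)

lemma char_add_right: "char x (\<xi> + \<eta>) = char x \<xi> * char x \<eta>"
  by (simp add: char_def cis_mult inner_add_right distrib_left)

lemma char_minus_right: "char x (- \<xi>) = cnj (char x \<xi>)"
  by (simp add: char_def cis_cnj)

lemma char_minus_left: "char (- x) \<xi> = cnj (char x \<xi>)"
  by (simp add: char_def cis_cnj)

lemma char_mult_cnj [simp]: "char x \<xi> * cnj (char x \<xi>) = 1" "cnj (char x \<xi>) * char x \<xi> = 1"
  by (simp_all add: char_def cis_cnj cis_mult)

lemma int_vec_inner: "int_vec k \<bullet> int_vec l = real_of_int (\<Sum>i\<in>UNIV. k $ i * l $ i)"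
  by (simp add: inner_vec_def int_vec_def)

lemma char_int_vec [simp]: "char (int_vec k) (int_vec l) = 1"
  unfolding int_vec_inner char_def by (rule cis_multiple_2pi) (rule Ints_of_int)

lemma continuous_on_char [continuous_intros]:
  "continuous_on S f \<Longrightarrow> continuous_on S g \<Longrightarrow> continuous_on S (\<lambda>x. char (f x) (g x))"
  unfolding char_def by (intro continuous_intros)

lemma cnj_measurable [measurable]: "cnj \<in> borel_measurable borel"
  by (intro borel_measurable_continuous_onI continuous_intros)

lemma char_measurable [measurable]:
  assumes [measurable]: "f \<in> borel_measurable M" "g \<in> borel_measurable M"
  shows "(\<lambda>x. char (f x) (g x)) \<in> borel_measurable M"
proof -
  have [measurable]: "cis \<in> borel_measurable borel"
    by (intro borel_measurable_continuous_onI continuous_intros)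
  show ?thesis unfolding char_def by measurable
qed

lemma lcube_eq: "lcube = density lborel (\<lambda>x. ennreal (indicator unit_cube x))"
  by (intro density_cong) (auto simp: ennreal_indicator)

lemma integral_lcube:
  fixes f :: "real^'d \<Rightarrow> complex"
  assumes "f \<in> borel_measurable borel"
  shows "(\<integral>x. f x \<partial>lcube) = (\<integral>x. indicator unit_cube x *\<^sub>R f x \<partial>lborel)"
  unfolding lcube_eq using assms by (intro integral_density) auto

lemma AE_lcube: "(AE x in lcube. P x) \<longleftrightarrow> (AE x in lborel. x \<in> unit_cube \<longrightarrow> P x)"
  by (subst AE_density) (auto simp: indicator_def)

lemma integral_translate:
  fixes f :: "real^'d \<Rightarrow> complex"
  assumes [measurable]: "f \<in> borel_measurable borel"
  shows "(\<integral>x. f (x + c) \<partial>lborel) = (\<integral>x. f x \<partial>lborel)"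
proof -
  have "(\<integral>x. f x \<partial>lborel) = (\<integral>x. f x \<partial>distr lborel borel ((+) c))"
    by (simp only: lborel_distr_plus)
  also have "\<dots> = (\<integral>x. f (c + x) \<partial>lborel)"
    by (rule integral_distr) auto
  finally show ?thesis by (simp add: add.commute)
qed

lemma integrable_translate:
  fixes f :: "real^'d \<Rightarrow> complex"
  assumes f: "integrable lborel f"
  shows "integrable lborel (\<lambda>x. f (x + c))"
proof -
  have [measurable]: "f \<in> borel_measurable borel" using f by auto
  have "integrable (distr lborel borel ((+) c)) f" using f by (simp only: lborel_distr_plus)
  then have "integrable lborel (\<lambda>x. f (c + x))"
    by (subst (asm) integrable_distr_eq) auto
  then show ?thesis by (simp add: add.commute)
qed

inductive_set trig_poly :: "(real^'d \<Rightarrow> complex) set" where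
  "(\<lambda>x. c * char (int_vec l) x) \<in> trig_poly"
| "f \<in> trig_poly \<Longrightarrow> g \<in> trig_poly \<Longrightarrow> (\<lambda>x. f x + g x) \<in> trig_poly"

lemma trig_poly_const: "(\<lambda>x. c) \<in> trig_poly"
  using trig_poly.intros(1)[of c 0] by simp

lemma trig_poly_mult_char:
  assumes "f \<in> trig_poly" shows "(\<lambda>x. (c * char (int_vec l) x) * f x) \<in> trig_poly"
  using assms
proof induction
  case (1 c' l')
  have "(\<lambda>x. (c * char (int_vec l) x) * (c' * char (int_vec l') x))
      = (\<lambda>x. (c * c') * char (int_vec (l + l')) x)"
    by (simp add: int_vec_add char_add_left mult_ac)
  then show ?case by (simp only: trig_poly.intros)
next
  case (2 f g)
  have "(\<lambda>x. (c * char (int_vec l) x) * (f x + g x))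
      = (\<lambda>x. (c * char (int_vec l) x) * f x + (c * char (int_vec l) x) * g x)" by (simp add: distrib_left)
  then show ?case using trig_poly.intros(2)[OF 2(3,4)] by simp
qed

lemma trig_poly_mult:
  assumes "f \<in> trig_poly" "g \<in> trig_poly" shows "(\<lambda>x. f x * g x) \<in> trig_poly"
  using assms(1)
proof induction
  case (1 c l) show ?case by (rule trig_poly_mult_char[OF assms(2)])
next
  case (2 f f')
  have "(\<lambda>x. (f x + f' x) * g x) = (\<lambda>x. f x * g x + f' x * g x)" by (simp add: distrib_right)
  then show ?case using trig_poly.intros(2)[OF 2(3,4)] by simp
qed

lemma trig_poly_sum: "(\<And>i. i \<in> I \<Longrightarrow> f i \<in> trig_poly) \<Longrightarrow> (\<lambda>x. \<Sum>i\<in>I. f i x) \<in> trig_poly"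
proof (induction I rule: infinite_finite_induct)
  case (insert i I)
  then show ?case using trig_poly.intros(2)[of "f i" "\<lambda>x. \<Sum>i\<in>I. f i x"] by simp
qed (simp_all add: trig_poly_const)

text \<open>The torus is realized inside \<open>\<complex>\<^sup>d\<close>, where polynomial functions restrict to trigonometric
  polynomials and the Stone-Weierstrass theorem applies.\<close>

definition torus_map :: "real^'d \<Rightarrow> complex^'d" where
  "torus_map x = (\<chi> i. cis (2 * pi * x $ i))"

lemma trig_poly_coord: "(\<lambda>x::real^'d. c * cis (2 * pi * x $ i)) \<in> trig_poly"
  "(\<lambda>x. c * cis (- (2 * pi * x $ i))) \<in> trig_poly"
proof -
  have *: "int_vec (axis i m :: int^'d) \<bullet> x = real_of_int m * x $ i" for x :: "real^'d" and m
  proof -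
    have "int_vec (axis i m) = axis i (real_of_int m)"
      by (simp add: int_vec_def vec_eq_iff axis_def)
    then show ?thesis by (simp add: inner_axis')
  qed
  show "(\<lambda>x. c * cis (2 * pi * x $ i)) \<in> trig_poly"
    using trig_poly.intros(1)[of c "axis i 1"] by (simp add: * char_def)
  show "(\<lambda>x. c * cis (- (2 * pi * x $ i))) \<in> trig_poly"
    using trig_poly.intros(1)[of c "axis i (- 1)"] by (simp add: * char_def)
qed

lemma cos_sin_combination_cis:
  "complex_of_real (cos t * a + sin t * b)
    = (complex_of_real (a / 2) - \<i> * complex_of_real b / 2) * cis t
      + (complex_of_real (a / 2) + \<i> * complex_of_real b / 2) * cis (- t)"
proof -
  define A where "A = complex_of_real (a / 2)"
  define B where "B = \<i> * complex_of_real b / 2"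
  have 1: "cis t + cis (- t) = 2 * complex_of_real (cos t)" by (rule complex_eqI) auto
  have 2: "cis t - cis (- t) = 2 * \<i> * complex_of_real (sin t)" by (rule complex_eqI) auto
  have "(A - B) * cis t + (A + B) * cis (- t) = A * (cis t + cis (- t)) - B * (cis t - cis (- t))"
    by (simp add: algebra_simps)
  also have "\<dots> = complex_of_real (cos t * a + sin t * b)"
    unfolding 1 2 A_def B_def by (simp add: algebra_simps)
  finally show ?thesis unfolding A_def B_def by (rule sym)
qed

lemma trig_poly_polynomial:
  fixes g :: "complex^'d \<Rightarrow> real"
  assumes "real_polynomial_function g"
  shows "(\<lambda>x. complex_of_real (g (torus_map x))) \<in> trig_poly"
  using assms
proof induction
  case (linear f)
  interpret bounded_linear f by fact
  have eq: "complex_of_real (f (torus_map x)) = (\<Sum>i\<in>UNIV.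
      (f (axis i 1) / 2 - \<i> * f (axis i \<i>) / 2) * cis (2 * pi * x $ i)
      + (f (axis i 1) / 2 + \<i> * f (axis i \<i>) / 2) * cis (- (2 * pi * x $ i)))" for x :: "real^'d"
  proof -
    have "torus_map x = (\<Sum>i\<in>UNIV. cos (2 * pi * x $ i) *\<^sub>R axis i 1 + sin (2 * pi * x $ i) *\<^sub>R axis i \<i>)"
      by (auto simp: torus_map_def vec_eq_iff axis_def if_distrib[where f="\<lambda>z. _ *\<^sub>R z"] 
           sum.distrib sum.delta complex_eq_iff cong: if_cong)
    then have *: "f (torus_map x) = (\<Sum>i\<in>UNIV. cos (2 * pi * x $ i) * f (axis i 1) + sin (2 * pi * x $ i) * f (axis i \<i>))"
      by (simp add: sum add scaleR)
    show ?thesis unfolding * of_real_sum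
      by (rule sum.cong[OF refl]) (rule cos_sin_combination_cis)
  qed
  show ?case unfolding eq
    by (rule trig_poly_sum, rule trig_poly.intros(2)[OF trig_poly_coord])
next
  case (const c) show ?case by (rule trig_poly_const)
next
  case (add f g)
  then show ?case using trig_poly.intros(2)[OF add(3,4)] by simp
next
  case (mult f g)
  then show ?case using trig_poly_mult[OF mult(3,4)] by simp
qed

lemma continuous_on_torus_map: "continuous_on S torus_map"
  unfolding torus_map_def by (intro continuous_intros)

lemma torus_map_measurable [measurable]: "torus_map \<in> borel_measurable borel"
  by (rule borel_measurable_continuous_onI[OF continuous_on_torus_map])

text \<open>Injectivity needs the half-open cube.\<close>

lemma torus_map_inj: "inj_on torus_map unit_cube"
proof (rule inj_onI)
  fix x y :: "real^'d" assume x: "x \<in> unit_cube" and y: "y \<in> unit_cube"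
    and eq: "torus_map x = torus_map y"
  have "x $ i = y $ i" for i
  proof -
    have "cis (2 * pi * x $ i) = cis (2 * pi * y $ i)" using eq by (simp add: torus_map_def vec_eq_iff)
    then have "sin (2 * pi * x $ i) = sin (2 * pi * y $ i)" "cos (2 * pi * x $ i) = cos (2 * pi * y $ i)"
      by (simp_all add: complex_eq_iff)
    then obtain m :: int where "2 * pi * x $ i = 2 * pi * y $ i + 2 * pi * real_of_int m"
      using sin_cos_eq_iff[of "2 * pi * x $ i" "2 * pi * y $ i"] by auto
    then have "2 * pi * x $ i = 2 * pi * (y $ i + real_of_int m)" by (simp add: algebra_simps)
    then have "x $ i = y $ i + m" by simp
    moreover have "-1 < x $ i - y $ i" "x $ i - y $ i < 1"
      using x[unfolded unit_cube_def, simplified, rule_format, of i]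
        y[unfolded unit_cube_def, simplified, rule_format, of i] by auto
    ultimately show "x $ i = y $ i" by auto
  qed
  then show "x = y" by (simp add: vec_eq_iff)
qed

lemma AE_lcube_in_unit_cube: "AE x in lcube. x \<in> unit_cube"
  by (simp add: AE_lcube)

lemma integral_trig_poly_eq_0:
  fixes h :: "real^'d \<Rightarrow> complex"
  assumes h: "integrable lcube h" and 0: "\<And>l. (\<integral>x. h x * char (int_vec l) x \<partial>lcube) = 0"
    and "t \<in> trig_poly"
  shows "integrable lcube (\<lambda>x. h x * t x) \<and> (\<integral>x. h x * t x \<partial>lcube) = 0"
  using assms(3)
proof induction
  case (1 c l)
  have [measurable]: "h \<in> borel_measurable borel" using h by (auto dest: borel_measurable_integrable)
  have "integrable lcube (\<lambda>x. h x * char (int_vec l) x)"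
    by (rule Bochner_Integration.integrable_bound[OF h]) (auto simp: norm_mult)
  then show ?case using 0[of l] by (simp add: mult.left_commute)
qed (simp add: distrib_left)

lemma integral_torus_continuous_eq_0:
  fixes h :: "real^'d \<Rightarrow> complex" and G :: "complex^'d \<Rightarrow> real"
  assumes h: "integrable lcube h" and 0: "\<And>l. (\<integral>x. h x * char (int_vec l) x \<partial>lcube) = 0"
    and G: "continuous_on UNIV G" and bd: "\<And>z. \<bar>G z\<bar> \<le> 1"
  shows "(\<integral>x. h x * G (torus_map x) \<partial>lcube) = 0"
proof -
  have [measurable]: "h \<in> borel_measurable borel" using h by (auto dest: borel_measurable_integrable)
  have [measurable]: "G \<in> borel_measurable borel" using G by (rule borel_measurable_continuous_onI)
  let ?T = "torus_map ` cbox ((\<chi> i. - 1 / 2) :: real^'d) (\<chi> i. 1 / 2)"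
  have T: "torus_map x \<in> ?T" if "x \<in> unit_cube" for x :: "real^'d"
    using that by (intro imageI) (auto simp: unit_cube_def mem_box_cart less_imp_le)
  have "compact ?T" by (intro compact_continuous_image continuous_on_torus_map compact_cbox)
  have hG: "integrable lcube (\<lambda>x. h x * G (torus_map x))"
    using bd by (intro Bochner_Integration.integrable_bound[OF h])
      (auto simp: norm_mult intro!: mult_left_le)
  define X where "X = norm (\<integral>x. h x * G (torus_map x) \<partial>lcube)"
  have le: "X \<le> e * (\<integral>x. norm (h x) \<partial>lcube)" if e: "0 < e" for e
  proof -
    obtain g where g: "real_polynomial_function g" "\<And>z. z \<in> ?T \<Longrightarrow> \<bar>G z - g z\<bar> < e"
      by (rule Stone_Weierstrass_real_polynomial_function
          [OF \<open>compact ?T\<close> continuous_on_subset[OF G subset_UNIV] e]) (rule that)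
    have hg: "integrable lcube (\<lambda>x. h x * g (torus_map x))" "(\<integral>x. h x * g (torus_map x) \<partial>lcube) = 0"
      using integral_trig_poly_eq_0[OF h 0 trig_poly_polynomial[OF g(1)]] by auto
    have "X = norm (\<integral>x. h x * G (torus_map x) - h x * g (torus_map x) \<partial>lcube)"
      using hG hg by (simp add: X_def)
    also have "\<dots> \<le> (\<integral>x. norm (h x * G (torus_map x) - h x * g (torus_map x)) \<partial>lcube)"
      by (rule integral_norm_bound)
    also have "\<dots> \<le> (\<integral>x. e * norm (h x) \<partial>lcube)"
    proof (rule integral_mono_AE)
      show "AE x in lcube. norm (h x * G (torus_map x) - h x * g (torus_map x)) \<le> e * norm (h x)"
        using AE_lcube_in_unit_cube
      proof eventually_elim
        case (elim x)
        have "norm (h x * G (torus_map x) - h x * g (torus_map x)) = norm (h x) * \<bar>G (torus_map x) - g (torus_map x)\<bar>"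
          by (simp add: right_diff_distrib[symmetric] of_real_diff[symmetric] norm_mult del: of_real_diff)
        also have "\<dots> \<le> norm (h x) * e"
          using g(2)[OF T[OF elim]] by (intro mult_left_mono) auto
        finally show ?case by (simp add: mult.commute)
      qed
    qed (use hG hg h in auto)
    finally show ?thesis by simp
  qed
  have "X \<le> 0"
  proof (rule field_le_epsilon)
    fix e :: real assume e: "0 < e"
    let ?I = "\<integral>x. norm (h x) \<partial>lcube"
    have I: "0 \<le> ?I" by simp
    then have "0 < ?I + 1" by linarith
    have "X \<le> e / (?I + 1) * ?I" using \<open>0 < ?I + 1\<close> e by (intro le divide_pos_pos)
    also have "\<dots> \<le> e" using I e \<open>0 < ?I + 1\<close> by (simp add: field_simps)
    finally show "X \<le> 0 + e" by simp
  qed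
  then show ?thesis by (simp add: X_def)
qed

text \<open>The indicator of \<open>C\<close> is the limit of continuous functions of the distance to \<open>C\<close>, measured on the
  torus.\<close>

lemma torus_integral_compact_eq_0:
  fixes h :: "real^'d \<Rightarrow> complex"
  assumes h: "integrable lcube h" and 0: "\<And>l. (\<integral>x. h x * char (int_vec l) x \<partial>lcube) = 0"
    and C: "compact C" "C \<subseteq> unit_cube"
  shows "(\<integral>x. h x * indicator C x \<partial>lcube) = 0"
proof (cases "C = {}")
  case False
  have [measurable]: "h \<in> borel_measurable borel" using h by (auto dest: borel_measurable_integrable)
  have [measurable]: "C \<in> sets borel" using C by (simp add: borel_compact)
  let ?D = "torus_map ` C"
  have D: "closed ?D" "?D \<noteq> {}" 
    using C False by (auto intro!: compact_imp_closed compact_continuous_image continuous_on_torus_map)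
  (* Continuous functions decreasing to the indicator of the image of C. *)
  define F where "F m z = max 0 (1 - real m * infdist z ?D)" for m z
  have F: "continuous_on UNIV (F m)" "\<bar>F m z\<bar> \<le> 1" for m z
    unfolding F_def by (auto intro!: continuous_intros simp: abs_if infdist_nonneg)
  then have [measurable]: "F m \<in> borel_measurable borel" for m 
    by (intro borel_measurable_continuous_onI)
  have "(\<lambda>m. \<integral>x. h x * F m (torus_map x) \<partial>lcube) \<longlonglongrightarrow> (\<integral>x. h x * indicator C x \<partial>lcube)"
  proof (rule integral_dominated_convergence[where w="\<lambda>x. norm (h x)"])
    show "AE x in lcube. norm (h x * F m (torus_map x)) \<le> norm (h x)" for m
      using F(2) by (auto simp: norm_mult intro!: mult_left_le)
    show "AE x in lcube. (\<lambda>m. h x * F m (torus_map x)) \<longlonglongrightarrow> h x * indicator C x"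
      using AE_lcube_in_unit_cube
    proof eventually_elim
      case (elim x)
      have "(\<lambda>m. F m (torus_map x)) \<longlonglongrightarrow> indicator C x"
      proof (cases "x \<in> C")
        case True
        then have "infdist (torus_map x) ?D = 0" by simp
        then show ?thesis using True by (simp add: F_def)
      next
        case False
        then have "torus_map x \<notin> ?D" using torus_map_inj elim C(2) by (auto dest: inj_onD)
        then have pos: "0 < infdist (torus_map x) ?D"
          using D in_closed_iff_infdist_zero[of ?D "torus_map x"] infdist_nonneg[of "torus_map x" ?D] by auto
        obtain N where N: "1 < real N * infdist (torus_map x) ?D" using reals_Archimedean3[OF pos] by blast
        have "F m (torus_map x) = 0" if "m \<ge> N" for m
        proof -
          have "real N * infdist (torus_map x) ?D \<le> real m * infdist (torus_map x) ?D"
            using that pos by (intro mult_right_mono) auto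
          then show ?thesis using N by (simp add: F_def)
        qed
        then have "(\<lambda>m. F m (torus_map x)) \<longlonglongrightarrow> 0"
          by (intro tendsto_eventually) (auto simp: eventually_sequentially)
        then show ?thesis using False by simp
      qed
      then have "(\<lambda>m. complex_of_real (F m (torus_map x))) \<longlonglongrightarrow> complex_of_real (indicator C x)"
        by (rule tendsto_of_real)
      then have "(\<lambda>m. h x * complex_of_real (F m (torus_map x))) \<longlonglongrightarrow> h x * complex_of_real (indicator C x)"
        by (intro tendsto_mult tendsto_const)
      then show ?case by (cases "x \<in> C") simp_all
    qed
  qed (use h in auto)
  moreover have "(\<lambda>m. \<integral>x. h x * F m (torus_map x) \<partial>lcube) = (\<lambda>m. 0)"
    by (rule ext) (rule integral_torus_continuous_eq_0[OF h 0 F])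
  ultimately show ?thesis by (simp only: LIMSEQ_const_iff)
qed simp

text \<open>If \<open>Re (c h)\<close> were positive on a set of positive measure, it would be so on a compact subset of
  positive measure, over which the integral of \<open>h\<close> is zero.\<close>

lemma torus_uniqueness:
  fixes h :: "real^'d \<Rightarrow> complex"
  assumes h: "integrable lcube h" and 0: "\<And>l. (\<integral>x. h x * char (int_vec l) x \<partial>lcube) = 0"
  shows "AE x in lcube. h x = 0"
proof -
  have [measurable]: "h \<in> borel_measurable borel" using h by (auto dest: borel_measurable_integrable)
  have main: "AE x in lcube. \<not> 0 < Re (c * h x)" for c
  proof (rule ccontr)
    assume neg: "\<not> ?thesis"
    define S where "S = {x \<in> unit_cube. 0 < Re (c * h x)}"
    have [measurable]: "S \<in> sets borel" unfolding S_def by measurable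
    have "emeasure lborel S \<noteq> 0"
    proof
      assume "emeasure lborel S = 0"
      then have "AE x in lborel. x \<notin> S" by (intro AE_I[of _ _ S]) auto
      then have "AE x in lborel. x \<in> unit_cube \<longrightarrow> \<not> 0 < Re (c * h x)"
        by eventually_elim (auto simp: S_def)
      then show False using neg by (simp only: AE_lcube) simp
    qed
    then have pos: "0 < emeasure lebesgue S" by (simp add: zero_less_iff_neq_zero)
    moreover have "emeasure lebesgue S \<le> 1"
      using emeasure_mono[of S unit_cube lborel] by (auto simp: S_def emeasure_unit_cube)
    ultimately obtain e where e: "0 < e" "emeasure lebesgue S = ennreal e"
      by (cases "emeasure lebesgue S") (auto simp: top_unique)
    obtain C where C: "closed C" "C \<subseteq> S" "S - C \<in> lmeasurable" "emeasure lebesgue (S - C) < ennreal e"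
      using sets_lebesgue_inner_closed[of S e] e by auto
    have "bounded (unit_cube :: (real^'d) set)"
      by (rule bounded_subset[OF bounded_cbox[of "\<chi> i. - 1 / 2" "\<chi> i. 1 / 2"]])
         (auto simp: unit_cube_def mem_box_cart less_imp_le)
    then have Cc: "compact C" "C \<subseteq> unit_cube"
      using C by (auto simp: compact_eq_bounded_closed S_def intro: bounded_subset)
    have [measurable]: "C \<in> sets borel" using C by simp
    have i0: "integrable lcube (\<lambda>x. h x * indicator C x)"
      by (rule Bochner_Integration.integrable_bound[OF h]) (auto simp: norm_mult indicator_def)
    then have i: "integrable lcube (\<lambda>x. c * (h x * indicator C x))" by simp
    then have iR: "integrable lcube (\<lambda>x. Re (c * (h x * indicator C x)))" by (rule integrable_Re)
    have "(\<integral>x. Re (c * (h x * indicator C x)) \<partial>lcube) = Re (\<integral>x. c * (h x * indicator C x) \<partial>lcube)"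
      using i by (rule integral_Re)
    also have "(\<integral>x. c * (h x * indicator C x) \<partial>lcube) = 0"
      using torus_integral_compact_eq_0[OF h 0 Cc] by simp
    finally have "(\<integral>x. Re (c * (h x * indicator C x)) \<partial>lcube) = 0" by simp
    then have "AE x in lcube. Re (c * (h x * indicator C x)) = 0"
    proof (subst (asm) integral_nonneg_eq_0_iff_AE[OF iR])
      have "0 \<le> Re (c * (h x * indicator C x))" for x
        using C(2) by (cases "x \<in> C") (auto simp: S_def less_imp_le)
      then show "AE x in lcube. 0 \<le> Re (c * (h x * indicator C x))" by simp
    qed auto
    then have "AE x in lborel. x \<notin> C"
      unfolding AE_lcube
    proof eventually_elim
      case (elim x) then show ?case using C(2) by (auto simp: S_def)
    qed
    then have "emeasure lborel C = 0"
      using AE_iff_measurable[of C lborel "\<lambda>x. x \<notin> C"] by simp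
    moreover have "emeasure lborel S \<le> emeasure lborel (S - C) + emeasure lborel C"
      using emeasure_subadditive[of "S - C" lborel C] C(2) by (simp add: Un_absorb2)
    ultimately have "emeasure lebesgue S \<le> emeasure lebesgue (S - C)" by simp
    then show False using C(4) e by simp
  qed
  from main[of 1] main[of "-1"] main[of "\<i>"] main[of "-\<i>"] show ?thesis
  proof eventually_elim
    case (elim x) then show ?case by (intro complex_eqI) simp_all
  qed
qed

text \<open>A translation by a point where the character is \<open>-1\<close> changes the sign of the integral; the
  integral over a translated cube is the same by periodicity.\<close>

lemma integral_char_lcube:
  "(\<integral>x. char (int_vec l) x \<partial>(lcube :: (real^'d) measure)) = (if l = 0 then 1 else 0)"
proof (cases "l = 0")
  case False
  then obtain i where i: "l $ i \<noteq> 0" by (auto simp: vec_eq_iff)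
  let ?J = "\<integral>x. char (int_vec l) x \<partial>(lcube :: (real^'d) measure)"
  define y :: "real^'d" where "y = axis i (1 / (2 * real_of_int (l $ i)))"
  have "int_vec l \<bullet> y = 1 / 2" using i by (simp add: y_def inner_axis int_vec_def)
  then have "2 * pi * (int_vec l \<bullet> y) = pi" by (simp only:)
  then have y: "char (int_vec l) y = - 1" unfolding char_def by (simp only: cis_pi)
  define g where "g x = (indicator unit_cube x :: real) *\<^sub>R char (int_vec l) (x + y)" for x :: "real^'d"
  define g' where "g' x = (indicator unit_cube (x - y) :: real) *\<^sub>R char (int_vec l) x" for x :: "real^'d"
  have [measurable]: "g \<in> borel_measurable borel" "g' \<in> borel_measurable borel"
    unfolding g_def g'_def by measurable
  have shift: "g (x + - y) = g' x" for x
    by (simp add: g_def g'_def)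
  have "integrable lborel g" unfolding g_def
    by (rule Bochner_Integration.integrable_bound[of _ "indicator unit_cube :: _ \<Rightarrow> real"])
       (auto simp: emeasure_unit_cube)
  from integrable_translate[OF this, of "- y"] have ig': "integrable lborel g'"
    by (simp only: shift)
  have "- ?J = (\<integral>x. char (int_vec l) (x + y) \<partial>(lcube :: (real^'d) measure))"
    using y by (simp only: char_add_right integral_mult_left_zero) simp
  also have "\<dots> = (\<integral>x. g x \<partial>lborel)"
    unfolding g_def by (rule integral_lcube) measurable
  also have "\<dots> = (\<integral>x. g' x \<partial>lborel)"
    using integral_translate[of g "- y"] by (simp only: shift) simp
  also have "\<dots> = (\<integral>x. (\<integral>k. g' (x + int_vec k) \<partial>counting) \<partial>lcube)"
    by (rule integral_tiling[OF ig'])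
  also have "(\<lambda>x. \<integral>k. g' (x + int_vec k) \<partial>counting) = (\<lambda>x. char (int_vec l) x)"
  proof
    fix x :: "real^'d"
    obtain k0 where k0: "{k. x - y - int_vec k \<in> unit_cube} = {k0}"
      using unit_cube_unique_translate[of "x - y"] by (elim ex1E) blast
    have mem: "x + int_vec k - y \<in> unit_cube \<longleftrightarrow> k = - k0" for k
    proof -
      have "x + int_vec k - y = x - y - int_vec (- k)" by (simp add: int_vec_uminus)
      then have "x + int_vec k - y \<in> unit_cube \<longleftrightarrow> - k \<in> {k. x - y - int_vec k \<in> unit_cube}"
        by (simp only: mem_Collect_eq)
      also have "\<dots> \<longleftrightarrow> k = - k0" unfolding k0 by (metis minus_minus singleton_iff)
      finally show ?thesis .
    qed
    have "g' (x + int_vec k) = indicator {- k0} k *\<^sub>R char (int_vec l) x" for k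
      unfolding g'_def indicator_def mem by (simp add: char_add_right)
    then show "(\<integral>k. g' (x + int_vec k) \<partial>counting) = char (int_vec l) x"
      by simp
  qed
  finally show ?thesis using False by simp
qed (simp add: measure_def)

lemma char_diff_right: "char x (\<xi> - \<eta>) = char x \<xi> * cnj (char x \<eta>)"
  using char_add_right[of x \<xi> "- \<eta>"] by (simp add: char_minus_right)

lemma char_diff_left: "char (x - y) \<xi> = char x \<xi> * cnj (char y \<xi>)"
  using char_add_left[of x "- y" \<xi>] by (simp add: char_minus_left)

section \<open>Poisson summation and Fourier inversion\<close>

definition fourier_lborel :: "(real^'d \<Rightarrow> complex) \<Rightarrow> real^'d \<Rightarrow> complex" where
  "fourier_lborel f \<xi> = (\<integral>x. f x * cnj (char x \<xi>) \<partial>lborel)"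

definition inv_fourier :: "(real^'d \<Rightarrow> complex) \<Rightarrow> real^'d \<Rightarrow> complex" where
  "inv_fourier b x = (\<integral>\<xi>. b \<xi> * char x \<xi> \<partial>lborel)"

lemma fourier_eq_fourier_lborel:
  fixes f :: "real^'d \<Rightarrow> complex"
  assumes [measurable]: "f \<in> borel_measurable borel"
  shows "fourier f \<xi> = fourier_lborel f \<xi>"
proof -
  have "exp (- 2 * of_real pi * \<i> * of_real (x \<bullet> \<xi>)) = cnj (char x \<xi>)" for x
  proof -
    have "cnj (char x \<xi>) = cis (- (2 * pi * (x \<bullet> \<xi>)))" by (simp add: char_def cis_cnj)
    then show ?thesis by (simp only: cis_conv_exp) (simp add: mult_ac)
  qed
  then have "fourier f \<xi> = (\<integral>x. f x * cnj (char x \<xi>) \<partial>lebesgue)"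
    unfolding fourier_def by simp
  also have "\<dots> = fourier_lborel f \<xi>"
    unfolding fourier_lborel_def by (rule integral_completion) measurable
  finally show ?thesis .
qed

interpretation lcube2: pair_sigma_finite "lcube :: (real^'d) measure" "lcube :: (real^'d) measure" ..

lemma integrable_mult_char:
  assumes "integrable M f" "g \<in> borel_measurable M" "\<And>x. cmod (g x) = 1"
  shows "integrable M (\<lambda>x. f x * g x)"
  by (rule Bochner_Integration.integrable_bound[OF assms(1)])
     (use assms in \<open>auto simp: norm_mult intro!: borel_measurable_times\<close>)

lemma integral_counting_shift:
  fixes g :: "int^'d \<Rightarrow> complex"
  shows "(\<integral>k. g (l + k) \<partial>counting) = (\<integral>k. g k \<partial>counting)"
proof -
  have "bij_betw (\<lambda>k::int^'d. l + k) UNIV UNIV"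
    by (rule bij_betwI[of _ _ _ "\<lambda>k. k - l"]) auto
  from integral_bij_count_space[OF this, of g] show ?thesis .
qed

text \<open>Both sides, divided by the character, are functions on the torus with the same Fourier coefficients:
  those of the periodization are the values of the transform at \<open>\<xi> + l\<close>, of which only \<open>l = 0\<close>
  survives.\<close>

lemma poisson_single_frequency:
  fixes \<phi> :: "real^'d \<Rightarrow> complex"
  assumes \<phi>: "integrable lborel \<phi>" and 0: "\<And>l. l \<noteq> 0 \<Longrightarrow> fourier_lborel \<phi> (\<xi> + int_vec l) = 0"
  shows "AE x in lborel. (\<integral>k. \<phi> (x + int_vec k) * cnj (char (int_vec k) \<xi>) \<partial>counting)
    = fourier_lborel \<phi> \<xi> * char x \<xi>"
proof -
  have [measurable]: "\<phi> \<in> borel_measurable borel" using \<phi> by auto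
  define G where "G \<eta> x = \<phi> x * cnj (char x \<eta>)" for \<eta> x
  have G: "integrable lborel (G \<eta>)" for \<eta>
    unfolding G_def by (rule integrable_mult_char[OF \<phi>]) auto
  define P where "P x = (\<integral>k. G \<xi> (x + int_vec k) \<partial>counting)" for x
  have [measurable]: "G \<eta> \<in> borel_measurable borel" for \<eta> unfolding G_def by measurable
  have [measurable]: "P \<in> borel_measurable borel" unfolding P_def by measurable
  have P: "integrable lcube P" unfolding P_def by (rule integrable_tiling[OF G])
  have coeff: "(\<integral>x. P x * char (int_vec l) x \<partial>lcube) = fourier_lborel \<phi> (\<xi> + int_vec (- l))" for l
  proof -
    have "P x * char (int_vec l) x = (\<integral>k. G (\<xi> + int_vec (- l)) (x + int_vec k) \<partial>counting)" for x
    proof -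
      have "G (\<xi> + int_vec (- l)) (x + int_vec k) = G \<xi> (x + int_vec k) * char (int_vec l) x" for k
        unfolding G_def
        by (simp add: char_add_left char_diff_right int_vec_uminus char_commute[of x "int_vec l"])
      then show ?thesis unfolding P_def by simp
    qed
    then have "(\<integral>x. P x * char (int_vec l) x \<partial>lcube) = (\<integral>x. G (\<xi> + int_vec (- l)) x \<partial>lborel)"
      by (simp add: integral_tiling[OF G])
    then show ?thesis by (simp add: G_def fourier_lborel_def)
  qed
  have ic: "integrable lcube (\<lambda>x. fourier_lborel \<phi> \<xi> * char (int_vec l) x)" for l :: "int^'d"
    by (intro integrable_mult_right lcube.integrable_const_bound[where B=1]) auto
  have iP: "integrable lcube (\<lambda>x. P x * char (int_vec l) x)" for l :: "int^'d"
    by (rule integrable_mult_char[OF P]) auto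
  have "AE x in lcube. P x - fourier_lborel \<phi> \<xi> = 0"
  proof (rule torus_uniqueness)
    show "integrable lcube (\<lambda>x. P x - fourier_lborel \<phi> \<xi>)" using P by simp
    show "(\<integral>x. (P x - fourier_lborel \<phi> \<xi>) * char (int_vec l) x \<partial>lcube) = 0" for l
      unfolding left_diff_distrib Bochner_Integration.integral_diff[OF iP ic] coeff
      using 0[of "- l"] by (simp add: integral_char_lcube)
  qed
  then have "AE x in lborel. P x - fourier_lborel \<phi> \<xi> = 0"
  proof (rule AE_periodic)
    fix x k assume "P x - fourier_lborel \<phi> \<xi> = 0"
    moreover have "P (x + int_vec k) = P x"
      using integral_counting_shift[of "\<lambda>l. G \<xi> (x + int_vec l)" k]
      by (simp add: P_def int_vec_add add.assoc)
    ultimately show "P (x + int_vec k) - fourier_lborel \<phi> \<xi> = 0" by simp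
  qed measurable
  then show ?thesis
  proof eventually_elim
    case (elim x)
    have "\<phi> (x + int_vec k) * cnj (char (int_vec k) \<xi>) = G \<xi> (x + int_vec k) * char x \<xi>" for k
      by (simp add: G_def char_add_left mult.assoc)
    then have "(\<integral>k. \<phi> (x + int_vec k) * cnj (char (int_vec k) \<xi>) \<partial>counting) = P x * char x \<xi>"
      unfolding P_def by simp
    then show ?case using elim by simp
  qed
qed

lemma continuous_on_fourier_lborel:
  fixes f :: "real^'d \<Rightarrow> complex"
  assumes f: "integrable lborel f" shows "continuous_on S (fourier_lborel f)"
proof -
  have [measurable]: "f \<in> borel_measurable borel" using f by auto
  have "(fourier_lborel f \<circ> X) \<longlonglongrightarrow> fourier_lborel f \<xi>" if X: "X \<longlonglongrightarrow> \<xi>" for X \<xi>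
    unfolding fourier_lborel_def o_def
  proof (rule integral_dominated_convergence[where w="\<lambda>x. norm (f x)"])
    show "AE x in lborel. (\<lambda>i. f x * cnj (char x (X i))) \<longlonglongrightarrow> f x * cnj (char x \<xi>)"
      using X unfolding char_def by (intro AE_I2 tendsto_intros)
  qed (use f in \<open>auto simp: norm_mult\<close>)
  then show ?thesis by (auto simp: continuous_on_sequentially)
qed

lemma continuous_AE_eq_imp_eq:
  fixes f g :: "real^'d \<Rightarrow> complex"
  assumes "open U" "continuous_on U f" "continuous_on U g" 
    and AE: "AE x in lborel. x \<in> U \<longrightarrow> f x = g x" and x: "x \<in> U"
  shows "f x = g x"
proof (rule ccontr)
  assume ne: "f x \<noteq> g x"
  let ?V = "{x \<in> U. f x - g x \<noteq> 0}"
  have "open ?V"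
  proof -
    have "continuous_on U (\<lambda>x. f x - g x)" using assms by (intro continuous_intros)
    then have "open (U \<inter> (\<lambda>x. f x - g x) -` (- {0}))"
      by (rule continuous_open_preimage[OF _ \<open>open U\<close>]) auto
    also have "U \<inter> (\<lambda>x. f x - g x) -` (- {0}) = ?V" by auto
    finally show ?thesis .
  qed
  then have "\<not> negligible ?V" using ne x by (intro open_not_negligible) auto
  moreover have "AE x in lebesgue. x \<notin> ?V"
    using AE_completion[OF AE] by eventually_elim auto
  then have "negligible ?V" using \<open>open ?V\<close> 
    by (subst negligible_iff_null_sets) (auto simp: AE_iff_null_sets)
  ultimately show False by simp
qed

text \<open>As \<open>b\<close> is supported inside the unit cube, the values of \<open>inv_fourier b\<close> at \<open>x + k\<close> are the Fourier
  coefficients of \<open>b\<close> times a character. Uniqueness on the torus identifies \<open>b\<close> with its Fourier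
  series for almost every \<open>x\<close>; integration over \<open>x\<close> in the cube turns the series into the integral.\<close>

theorem fourier_inversion_small_support:
  fixes b :: "real^'d \<Rightarrow> complex"
  assumes b: "continuous_on UNIV b" and supp: "\<And>\<xi>. r \<le> norm \<xi> \<Longrightarrow> b \<xi> = 0" and r: "r < 1 / 2"
    and B: "integrable lborel (inv_fourier b)" and \<xi>: "norm \<xi> < 1 / 2"
  shows "fourier_lborel (inv_fourier b) \<xi> = b \<xi>"
proof -
  let ?B = "inv_fourier b"
  have [measurable]: "b \<in> borel_measurable borel" using b by (rule borel_measurable_continuous_onI)
  have [measurable]: "?B \<in> borel_measurable borel" using B by auto
  have inside: "\<xi> \<in> unit_cube" if "norm \<xi> < 1 / 2" for \<xi> :: "real^'d"
  proof -
    have "- (1 / 2) \<le> \<xi> $ i \<and> \<xi> $ i < 1 / 2" for i using component_le_norm_cart[of \<xi> i] that by linarith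
    then show ?thesis unfolding unit_cube_def by simp
  qed
  have ib: "b \<xi> * y = indicator unit_cube \<xi> *\<^sub>R (b \<xi> * y)" for \<xi> y
    using supp[of \<xi>] inside[of \<xi>] r by (cases "r \<le> norm \<xi>") (auto simp: indicator_def)
  have bint: "integrable lcube b"
  proof -
    have "bounded (b ` cball 0 r)" 
      using b by (intro compact_imp_bounded compact_continuous_image) (auto intro: continuous_on_subset)
    then obtain K where "\<forall>y \<in> b ` cball 0 r. norm y \<le> K" by (auto simp: bounded_iff)
    then have "norm (b \<xi>) \<le> K" if "norm \<xi> \<le> r" for \<xi> using that by simp
    then have "norm (b \<xi>) \<le> max 0 K" for \<xi>
      using supp[of \<xi>] by (cases "r \<le> norm \<xi>") (auto simp: le_max_iff_disj)
    then show ?thesis by (intro lcube.integrable_const_bound[of _ "max 0 K"]) auto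
  qed
  have coeff: "(\<integral>\<xi>. b \<xi> * char x \<xi> \<partial>lcube) = ?B x" for x
    unfolding inv_fourier_def by (subst integral_lcube) (measurable, simp only: ib[symmetric])
  define S where "S x \<xi> = (\<integral>k. ?B (x + int_vec k) * cnj (char (x + int_vec k) \<xi>) \<partial>counting)" for x \<xi>
  have [measurable]: "(\<lambda>z. S (fst z) (snd z)) \<in> borel_measurable (borel \<Otimes>\<^sub>M borel)"
    "\<And>\<xi>. (\<lambda>x. S x \<xi>) \<in> borel_measurable borel"
    unfolding S_def by measurable
  have "AE x in lcube. AE \<xi> in lcube. b \<xi> = S x \<xi>"
    using AE_integrable_tiling[OF B]
  proof eventually_elim
    case (elim x)
    define T where "T \<xi> = (\<integral>k. ?B (x + int_vec k) * cnj (char (int_vec k) \<xi>) \<partial>counting)" for \<xi>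
    have T0: "integrable (lcube \<Otimes>\<^sub>M counting) (\<lambda>(\<xi>, k). ?B (x + int_vec k) * (cnj (char (int_vec k) \<xi>) * char (int_vec l) \<xi>))" for l
    proof (rule lcube_counting.Fubini_integrable)
      show "AE \<xi> in lcube. integrable counting (\<lambda>k. case (\<xi>, k) of (\<xi>, k) \<Rightarrow> ?B (x + int_vec k) * (cnj (char (int_vec k) \<xi>) * char (int_vec l) \<xi>))"
        using elim by (auto intro!: integrable_mult_char simp: norm_mult)
      show "integrable lcube (\<lambda>\<xi>. \<integral>k. cmod (case (\<xi>, k) of (\<xi>, k) \<Rightarrow> ?B (x + int_vec k) * (cnj (char (int_vec k) \<xi>) * char (int_vec l) \<xi>)) \<partial>counting)"
        by (simp add: norm_mult lcube.integrable_const)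
    qed measurable
    have T: "(\<integral>\<xi>. T \<xi> * char (int_vec l) \<xi> \<partial>lcube) = ?B (x + int_vec l)" and iT: "integrable lcube (\<lambda>\<xi>. T \<xi> * char (int_vec l) \<xi>)" for l
    proof -
      have eq: "(\<integral>k. ?B (x + int_vec k) * (cnj (char (int_vec k) \<xi>) * char (int_vec l) \<xi>) \<partial>counting) = T \<xi> * char (int_vec l) \<xi>" for \<xi>
        unfolding T_def by (simp add: mult.assoc[symmetric])
      show "integrable lcube (\<lambda>\<xi>. T \<xi> * char (int_vec l) \<xi>)"
        using lcube_counting.integrable_fst[OF T0[of l]] by (simp add: eq)
      have orth: "(\<integral>\<xi>. cnj (char (int_vec k) \<xi>) * char (int_vec l) \<xi> \<partial>lcube) = indicator {l} k" for k
        using integral_char_lcube[of "l - k"]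
        by (simp add: char_minus_left[symmetric] int_vec_uminus[symmetric] char_add_left[symmetric] int_vec_add[symmetric]
             del: char_minus_left) 
      have "(\<integral>\<xi>. T \<xi> * char (int_vec l) \<xi> \<partial>lcube)
        = (\<integral>k. (\<integral>\<xi>. ?B (x + int_vec k) * (cnj (char (int_vec k) \<xi>) * char (int_vec l) \<xi>) \<partial>lcube) \<partial>counting)"
        unfolding eq[symmetric] by (rule lcube_counting.Fubini_integral[OF T0, symmetric])
      also have "\<dots> = (\<integral>k. indicator {l} k *\<^sub>R ?B (x + int_vec l) \<partial>counting)"
        unfolding integral_mult_right_zero orth
        by (intro Bochner_Integration.integral_cong) (auto simp: indicator_def)
      finally show "(\<integral>\<xi>. T \<xi> * char (int_vec l) \<xi> \<partial>lcube) = ?B (x + int_vec l)" by simp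
    qed
    have b': "integrable lcube (\<lambda>\<xi>. b \<xi> * char y \<xi>)" for y
      by (rule integrable_mult_char[OF bint]) auto
    have "AE \<xi> in lcube. b \<xi> * char x \<xi> - T \<xi> = 0"
    proof (rule torus_uniqueness)
      show "integrable lcube (\<lambda>\<xi>. b \<xi> * char x \<xi> - T \<xi>)" using b'[of x] iT[of 0] by simp
      have "(b \<xi> * char x \<xi> - T \<xi>) * char (int_vec l) \<xi> = b \<xi> * char (x + int_vec l) \<xi> - T \<xi> * char (int_vec l) \<xi>" for \<xi> l
        by (simp add: char_add_left algebra_simps)
      then show "(\<integral>\<xi>. (b \<xi> * char x \<xi> - T \<xi>) * char (int_vec l) \<xi> \<partial>lcube) = 0" for l
        using Bochner_Integration.integral_diff[OF b'[of "x + int_vec l"] iT[of l]] by (simp add: coeff T)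
    qed
    then show ?case
    proof eventually_elim
      case (elim \<xi>)
      have "S x \<xi> = T \<xi> * cnj (char x \<xi>)"
      proof -
        have "?B (x + int_vec k) * cnj (char (x + int_vec k) \<xi>) = ?B (x + int_vec k) * cnj (char (int_vec k) \<xi>) * cnj (char x \<xi>)" for k
          by (simp add: char_add_left)
        then show ?thesis unfolding S_def T_def by (simp only: integral_mult_left_zero)
      qed
      moreover have "b \<xi> * char x \<xi> = T \<xi>" using elim by simp
      then have "T \<xi> * cnj (char x \<xi>) = b \<xi> * (char x \<xi> * cnj (char x \<xi>))"
        by (metis mult.assoc)
      ultimately show ?case by simp
    qed
  qed
  then have "AE \<xi> in lcube. AE x in lcube. b \<xi> = S x \<xi>"
    by (subst (asm) lcube2.AE_commute) measurable
  then have "AE \<xi> in lcube. fourier_lborel ?B \<xi> = b \<xi>"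
  proof eventually_elim
    case (elim \<xi>)
    have "integrable lborel (\<lambda>x. ?B x * cnj (char x \<xi>))" by (rule integrable_mult_char[OF B]) auto
    then have "fourier_lborel ?B \<xi> = (\<integral>x. S x \<xi> \<partial>lcube)"
      unfolding fourier_lborel_def S_def by (rule integral_tiling)
    also have "\<dots> = (\<integral>x. b \<xi> \<partial>(lcube :: (real^'d) measure))"
      using elim by (intro integral_cong_AE) auto
    finally show ?case by (simp add: measure_def)
  qed
  then have "AE \<xi> in lborel. \<xi> \<in> ball 0 (1 / 2) \<longrightarrow> fourier_lborel ?B \<xi> = b \<xi>"
    unfolding AE_lcube by eventually_elim (use inside in simp)
  then show ?thesis
    using \<xi> b by (intro continuous_AE_eq_imp_eq[of "ball 0 (1 / 2)"] continuous_on_fourier_lborel B)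
      (auto intro: continuous_on_subset)
qed

section \<open>Functions with bounded partial derivatives\<close>

text \<open>A quantitative form of \<open>k\<close>-fold differentiability on an open set, in which one constant bounds all
  partial derivatives of order at most \<open>k\<close>; the estimates use nothing else about the derivatives.\<close>

primrec smooth_bd :: "nat \<Rightarrow> (real^'d) set \<Rightarrow> real \<Rightarrow> (real^'d \<Rightarrow> complex) \<Rightarrow> bool" where
  "smooth_bd 0 U C f \<longleftrightarrow> (\<forall>x\<in>U. cmod (f x) \<le> C)"
| "smooth_bd (Suc k) U C f \<longleftrightarrow> (\<forall>x\<in>U. cmod (f x) \<le> C) \<and>
     (\<forall>i. (\<forall>x\<in>U. ((\<lambda>t. f (x + t *\<^sub>R axis i 1)) has_vector_derivative partial_deriv i f x) (at 0)) \<and>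
        smooth_bd k U C (partial_deriv i f))"

lemma smooth_bd_bound: "smooth_bd k U C f \<Longrightarrow> x \<in> U \<Longrightarrow> cmod (f x) \<le> C"
  by (cases k) auto

lemma smooth_bd_SucD: "smooth_bd (Suc k) U C f \<Longrightarrow> smooth_bd k U C f"
  by (induction k arbitrary: f) auto

lemma smooth_bd_mono_order: "smooth_bd k U C f \<Longrightarrow> l \<le> k \<Longrightarrow> smooth_bd l U C f"
  by (induction k) (auto simp: le_Suc_eq simp del: smooth_bd.simps dest: smooth_bd_SucD)

lemma smooth_bd_mono_bound: "smooth_bd k U C f \<Longrightarrow> C \<le> D \<Longrightarrow> smooth_bd k U D f"
  by (induction k arbitrary: f) (auto intro: order_trans)

lemma smooth_bd_subset: "smooth_bd k U C f \<Longrightarrow> V \<subseteq> U \<Longrightarrow> smooth_bd k V C f"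
  by (induction k arbitrary: f) (auto simp: subset_eq)

lemma smooth_bd_Un: "smooth_bd k U C f \<Longrightarrow> smooth_bd k V C f \<Longrightarrow> smooth_bd k (U \<union> V) C f"
  by (induction k arbitrary: f) auto

lemma partial_derivI:
  "((\<lambda>t. f (x + t *\<^sub>R axis i 1)) has_vector_derivative D) (at 0) \<Longrightarrow> partial_deriv i f x = D"
  unfolding partial_deriv_def by (rule vector_derivative_at)

lemma line_derivative_cong:
  fixes f g :: "real^'d \<Rightarrow> complex"
  assumes U: "open U" "x \<in> U" and eq: "\<And>y. y \<in> U \<Longrightarrow> f y = g y"
    and f: "((\<lambda>t. f (x + t *\<^sub>R v)) has_vector_derivative D) (at 0)"
  shows "((\<lambda>t. g (x + t *\<^sub>R v)) has_vector_derivative D) (at 0)"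
proof (rule has_vector_derivative_transform_within_open[OF f])
  show "open ((\<lambda>t. x + t *\<^sub>R v) -` U)"
    using U by (intro open_vimage continuous_intros)
qed (use U eq in auto)

lemma smooth_bd_cong:
  assumes "open U" and "\<And>y. y \<in> U \<Longrightarrow> f y = g y" and "smooth_bd k U C f"
  shows "smooth_bd k U C g"
  using assms(2,3)
proof (induction k arbitrary: f g)
  case (Suc k)
  have d: "((\<lambda>t. g (x + t *\<^sub>R axis i 1)) has_vector_derivative partial_deriv i f x) (at 0)" if "x \<in> U" for x i
    using Suc.prems that by (intro line_derivative_cong[where f=f and g=g, OF assms(1) that]) auto
  have p: "partial_deriv i g x = partial_deriv i f x" if "x \<in> U" for x i
    using d[OF that] by (rule partial_derivI)
  have "smooth_bd k U C (partial_deriv i g)" for i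
    by (rule Suc.IH[of "partial_deriv i f"]) (use Suc.prems(2) in \<open>simp_all add: p\<close>)
  then show ?case using Suc.prems d p by auto
qed auto

lemma smooth_bd_intro_deriv:
  assumes "open U" and "\<And>x. x \<in> U \<Longrightarrow> cmod (f x) \<le> C"
    and "\<And>i x. x \<in> U \<Longrightarrow> ((\<lambda>t. f (x + t *\<^sub>R axis i 1)) has_vector_derivative D i x) (at 0)"
    and "\<And>i. smooth_bd k U C (D i)"
  shows "smooth_bd (Suc k) U C f"
proof -
  have p: "partial_deriv i f x = D i x" if "x \<in> U" for x i
    using assms(3)[OF that] by (rule partial_derivI)
  have "smooth_bd k U C (partial_deriv i f)" for i
    by (rule smooth_bd_cong[OF assms(1) _ assms(4)]) (simp add: p)
  then show ?thesis using assms p by auto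
qed

lemma smooth_bd_const: "open U \<Longrightarrow> cmod c \<le> C \<Longrightarrow> smooth_bd k U C (\<lambda>x. c)"
proof (induction k arbitrary: c)
  case (Suc k)
  then have "0 \<le> C" using norm_ge_zero order_trans by blast
  then show ?case using Suc by (intro smooth_bd_intro_deriv[where D="\<lambda>i x. 0"]) auto
qed auto

lemma smooth_bd_add:
  assumes "open U" "smooth_bd k U C f" "smooth_bd k U D g"
  shows "smooth_bd k U (C + D) (\<lambda>x. f x + g x)"
  using assms(2,3)
proof (induction k arbitrary: f g)
  case 0 then show ?case
    by (auto intro!: order_trans[OF norm_triangle_ineq add_mono])
next
  case (Suc k)
  show ?case
  proof (rule smooth_bd_intro_deriv[OF assms(1)])
    show "cmod (f x + g x) \<le> C + D" if "x \<in> U" for x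
      using smooth_bd_bound[OF Suc.prems(1) that] smooth_bd_bound[OF Suc.prems(2) that]
      by (rule order_trans[OF norm_triangle_ineq add_mono])
    show "((\<lambda>t. f (x + t *\<^sub>R axis i 1) + g (x + t *\<^sub>R axis i 1)) has_vector_derivative
        partial_deriv i f x + partial_deriv i g x) (at 0)" if "x \<in> U" for i x
      using Suc.prems that by (intro has_vector_derivative_add) auto
    show "smooth_bd k U (C + D) (\<lambda>x. partial_deriv i f x + partial_deriv i g x)" for i
      using Suc.prems by (intro Suc.IH) auto
  qed
qed

text \<open>The factor \<open>2\<^sup>k\<close> counts the terms of the Leibniz rule.\<close>

lemma smooth_bd_mult:
  assumes "open U" "smooth_bd k U C f" "smooth_bd k U D g" "0 \<le> C" "0 \<le> D"
  shows "smooth_bd k U (2 ^ k * C * D) (\<lambda>x. f x * g x)"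
  using assms(2,3)
proof (induction k arbitrary: f g)
  case 0 then show ?case using assms by (auto simp: norm_mult intro: mult_mono)
next
  case (Suc k)
  show ?case
  proof (rule smooth_bd_intro_deriv[OF assms(1)])
    show "cmod (f x * g x) \<le> 2 ^ Suc k * C * D" if "x \<in> U" for x
    proof -
      have "cmod (f x * g x) \<le> C * D"
        using Suc.prems that assms by (auto simp: norm_mult intro: mult_mono)
      also have "\<dots> \<le> 2 ^ Suc k * (C * D)"
        using assms mult_right_mono[of 1 "2 ^ Suc k :: real" "C * D"] one_le_power[of "2::real" "Suc k"] by simp
      finally show ?thesis by (simp add: mult.assoc)
    qed
    show "((\<lambda>t. f (x + t *\<^sub>R axis i 1) * g (x + t *\<^sub>R axis i 1)) has_vector_derivative
        f x * partial_deriv i g x + partial_deriv i f x * g x) (at 0)" if "x \<in> U" for i x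
      using has_vector_derivative_mult[of "\<lambda>t. f (x + t *\<^sub>R axis i 1)" "partial_deriv i f x" 0 UNIV
          "\<lambda>t. g (x + t *\<^sub>R axis i 1)" "partial_deriv i g x"] Suc.prems that by simp
    have "smooth_bd k U (2 ^ k * C * D + 2 ^ k * C * D) (\<lambda>x. f x * partial_deriv i g x + partial_deriv i f x * g x)" for i
      using Suc.prems smooth_bd_SucD[OF Suc.prems(1)] smooth_bd_SucD[OF Suc.prems(2)]
      by (intro smooth_bd_add[OF assms(1)] Suc.IH) auto
    moreover have "2 ^ Suc k * C * D = 2 ^ k * C * D + 2 ^ k * C * D" by simp
    ultimately show "smooth_bd k U (2 ^ Suc k * C * D) (\<lambda>x. f x * partial_deriv i g x + partial_deriv i f x * g x)" for i
      by (simp only:)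
  qed
qed

lemma smooth_bd_cnj:
  assumes "open U" "smooth_bd k U C f" shows "smooth_bd k U C (\<lambda>x. cnj (f x))"
  using assms(2)
proof (induction k arbitrary: f)
  case (Suc k)
  show ?case
  proof (rule smooth_bd_intro_deriv[OF assms(1)])
    show "((\<lambda>t. cnj (f (x + t *\<^sub>R axis i 1))) has_vector_derivative cnj (partial_deriv i f x)) (at 0)"
      if "x \<in> U" for i x
      using Suc.prems that by (intro has_vector_derivative_cnj) auto
  qed (use Suc in auto)
qed auto

lemma smooth_bd_power:
  assumes "open U" "smooth_bd k U C f" "0 \<le> C"
  shows "smooth_bd k U ((2 ^ k * C) ^ n) (\<lambda>x. f x ^ n)"
proof (induction n)
  case (Suc n)
  have "smooth_bd k U (2 ^ k * C * (2 ^ k * C) ^ n) (\<lambda>x. f x * f x ^ n)"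
    using Suc assms by (intro smooth_bd_mult) auto
  then show ?case by simp
qed (use assms in \<open>auto intro: smooth_bd_const\<close>)

lemma smooth_bd_sum:
  assumes "open U" "finite I" "\<And>i. i \<in> I \<Longrightarrow> smooth_bd k U (C i) (f i)"
  shows "smooth_bd k U (\<Sum>i\<in>I. C i) (\<lambda>x. \<Sum>i\<in>I. f i x)"
  using assms(2,3)
  by (induction I rule: finite_induct) (auto intro: smooth_bd_const[OF assms(1)] smooth_bd_add[OF assms(1)])

lemma smooth_bd_inner:
  assumes "0 \<le> R"
  shows "smooth_bd k (ball 0 R) (norm h * (R + 1)) (\<lambda>\<xi>. complex_of_real (h \<bullet> \<xi>))"
proof -
  have b: "cmod (complex_of_real (h \<bullet> \<xi>)) \<le> norm h * (R + 1)" if "\<xi> \<in> ball 0 R" for \<xi>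
  proof -
    have "cmod (complex_of_real (h \<bullet> \<xi>)) \<le> norm h * norm \<xi>" by (simp add: Cauchy_Schwarz_ineq2)
    also have "\<dots> \<le> norm h * (R + 1)" using that by (intro mult_left_mono) auto
    finally show ?thesis .
  qed
  show ?thesis
  proof (cases k)
    case (Suc l)
    show ?thesis unfolding Suc
    proof (rule smooth_bd_intro_deriv)
      show "((\<lambda>t. complex_of_real (h \<bullet> (x + t *\<^sub>R axis i 1))) has_vector_derivative complex_of_real (h $ i)) (at 0)" for i x
        unfolding inner_add_right inner_scaleR_right inner_axis of_real_add of_real_mult
        by (auto intro!: derivative_eq_intros simp: has_vector_derivative_def scaleR_conv_of_real)
      have "\<bar>h $ i\<bar> \<le> norm h * (R + 1)" for i
        using component_le_norm_cart[of h i] mult_left_mono[of 1 "R + 1" "norm h"] assms by simp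
      then show "smooth_bd l (ball 0 R) (norm h * (R + 1)) (\<lambda>x. complex_of_real (h $ i))" for i
        by (intro smooth_bd_const) auto
    qed (use b in auto)
  qed (use b in auto)
qed

text \<open>Smoothness of \<open>f\<close> on a ball suffices for a product with a function supported in a smaller ball.\<close>

lemma smooth_bd_cutoff:
  assumes \<kappa>: "smooth_bd k UNIV C \<kappa>" and supp: "\<And>\<xi>. \<delta> < norm \<xi> \<Longrightarrow> \<kappa> \<xi> = 0"
    and f: "smooth_bd k (ball 0 \<epsilon>) D f" and "\<delta> < \<epsilon>" and nn: "0 \<le> C" "0 \<le> D"
  shows "smooth_bd k UNIV (2 ^ k * C * D) (\<lambda>\<xi>. \<kappa> \<xi> * f \<xi>)"
proof -
  have "smooth_bd k (ball 0 \<epsilon>) (2 ^ k * C * D) (\<lambda>\<xi>. \<kappa> \<xi> * f \<xi>)"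
    using \<kappa> f nn by (intro smooth_bd_mult) (auto intro: smooth_bd_subset)
  moreover have "smooth_bd k (- cball 0 \<delta>) (2 ^ k * C * D) (\<lambda>\<xi>. \<kappa> \<xi> * f \<xi>)"
    by (rule smooth_bd_cong[of _ "\<lambda>_. 0"]) (use nn supp in \<open>auto intro: smooth_bd_const\<close>)
  ultimately have "smooth_bd k (ball 0 \<epsilon> \<union> - cball 0 \<delta>) (2 ^ k * C * D) (\<lambda>\<xi>. \<kappa> \<xi> * f \<xi>)"
    by (rule smooth_bd_Un)
  also have "ball 0 \<epsilon> \<union> - cball 0 \<delta> = UNIV" using \<open>\<delta> < \<epsilon>\<close> by auto
  finally show ?thesis .
qed

lemma Ck_on_imp_smooth_bd:
  assumes "Ck_on k (cball 0 \<epsilon>) f" and "0 < \<epsilon>"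
  shows "\<exists>C\<ge>0. smooth_bd k (ball 0 \<epsilon>) C f"
proof -
  have bound: "\<exists>C\<ge>0. \<forall>x\<in>ball 0 \<epsilon>. cmod (f x) \<le> C" if "continuous_on (cball 0 \<epsilon>) f" for f :: "real^'d \<Rightarrow> complex"
  proof -
    have "bounded (f ` cball 0 \<epsilon>)" 
      using that by (intro compact_imp_bounded compact_continuous_image) auto
    then obtain C where "\<forall>y \<in> f ` cball 0 \<epsilon>. norm y \<le> C" by (auto simp: bounded_iff)
    then show ?thesis by (intro exI[of _ "max 0 C"]) (auto simp: le_max_iff_disj)
  qed
  show ?thesis using assms(1)
  proof (induction k arbitrary: f)
    case 0 then show ?case using bound[of f] by auto
  next
    case (Suc k)
    obtain C where C: "0 \<le> C" "\<And>x. x \<in> ball 0 \<epsilon> \<Longrightarrow> cmod (f x) \<le> C"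
      using bound[of f] Suc.prems by auto
    have "\<forall>i. \<exists>g. Ck_on k (cball 0 \<epsilon>) g \<and>
        (\<forall>x\<in>ball 0 \<epsilon>. ((\<lambda>t. f (x + t *\<^sub>R axis i 1)) has_vector_derivative g x) (at 0))"
      using Suc.prems by simp
    then obtain g where g: "\<And>i. Ck_on k (cball 0 \<epsilon>) (g i)"
      "\<And>i x. x \<in> ball 0 \<epsilon> \<Longrightarrow> ((\<lambda>t. f (x + t *\<^sub>R axis i 1)) has_vector_derivative g i x) (at 0)"
      by metis
    have "\<forall>i. \<exists>D\<ge>0. smooth_bd k (ball 0 \<epsilon>) D (g i)" using Suc.IH g(1) by auto
    then obtain D where D: "\<And>i. 0 \<le> D i" "\<And>i. smooth_bd k (ball 0 \<epsilon>) (D i) (g i)" by metis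
    have le: "D i \<le> C + sum D UNIV" for i
      using C D member_le_sum[of i UNIV D] by (simp add: add_increasing)
    have "C \<le> C + sum D UNIV" using D by (simp add: sum_nonneg)
    then have "cmod (f x) \<le> C + sum D UNIV" if "x \<in> ball 0 \<epsilon>" for x
      using C(2)[OF that] by linarith
    then have "smooth_bd (Suc k) (ball 0 \<epsilon>) (C + sum D UNIV) f"
      by (intro smooth_bd_intro_deriv[where D=g] g open_ball smooth_bd_mono_bound[OF D(2) le])
    then show ?case using \<open>C \<le> _\<close> C(1) by (intro exI[of _ "C + sum D UNIV"]) auto
  qed
qed

lemma line_derivative_shift:
  fixes f :: "real^'d \<Rightarrow> complex"
  assumes "smooth_bd (Suc k) U C f" "x + s *\<^sub>R axis i 1 \<in> U"
  shows "((\<lambda>t. f (x + t *\<^sub>R axis i 1)) has_vector_derivative partial_deriv i f (x + s *\<^sub>R axis i 1)) (at s)"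
proof -
  have "((\<lambda>t. f ((x + s *\<^sub>R axis i 1) + t *\<^sub>R axis i 1)) has_vector_derivative partial_deriv i f (x + s *\<^sub>R axis i 1)) (at (s - s))"
    using assms by simp
  then have "((\<lambda>t. f ((x + s *\<^sub>R axis i 1) + (t - s) *\<^sub>R axis i 1)) has_vector_derivative
      1 *\<^sub>R partial_deriv i f (x + s *\<^sub>R axis i 1)) (at s)"
  proof -
    assume *: "((\<lambda>t. f ((x + s *\<^sub>R axis i 1) + t *\<^sub>R axis i 1)) has_vector_derivative
      partial_deriv i f (x + s *\<^sub>R axis i 1)) (at (s - s))"
    have "((\<lambda>t. t - s) has_vector_derivative 1) (at s)"
      by (auto intro!: derivative_eq_intros simp: has_vector_derivative_def)
    from vector_diff_chain_at[OF this *] show ?thesis by (simp only: o_def)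
  qed
  then show ?thesis by (simp add: algebra_simps)
qed

lemma norm_diff_le_vector_derivative:
  fixes g :: "real \<Rightarrow> complex"
  assumes "convex S" "a \<in> S" "b \<in> S" "0 \<le> B"
    and "\<And>s. s \<in> S \<Longrightarrow> (g has_vector_derivative g' s) (at s)"
    and "\<And>s. s \<in> S \<Longrightarrow> cmod (g' s) \<le> B"
  shows "cmod (g a - g b) \<le> B * \<bar>a - b\<bar>"
proof -
  have "norm (g a - g b) \<le> B * norm (a - b)"
  proof (rule differentiable_bound[OF assms(1) _ _ assms(2,3)])
    show "(g has_derivative (\<lambda>t. t *\<^sub>R g' s)) (at s within S)" if "s \<in> S" for s
      using assms(5)[OF that] by (simp add: has_vector_derivative_def has_derivative_at_withinI)
    show "onorm (\<lambda>t. t *\<^sub>R g' s) \<le> B" if "s \<in> S" for s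
    proof (rule onorm_bound[OF assms(4)])
      show "norm (x *\<^sub>R g' s) \<le> B * norm x" for x
        using mult_left_mono[OF assms(6)[OF that], of "\<bar>x\<bar>"] by (simp add: mult.commute)
    qed
  qed
  then show ?thesis by simp
qed

section \<open>Finite differences and decay of inverse Fourier transforms\<close>

lemma fin_diff_Suc: "fin_diff (Suc n) h f x = fin_diff n h f x - fin_diff n h f (x + h)"
proof -
  define a where "a \<nu> = f (x + real \<nu> *\<^sub>R h)" for \<nu>
  have s: "f (x + h + real \<nu> *\<^sub>R h) = a (Suc \<nu>)" for \<nu> by (simp add: a_def algebra_simps)
  have "fin_diff (Suc n) h f x = (\<Sum>\<nu>\<le>Suc n. (-1) ^ \<nu> * of_nat (Suc n choose \<nu>) * a \<nu>)"
    by (simp add: fin_diff_def a_def)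
  also have "\<dots> = a 0 + (\<Sum>\<nu>\<le>n. (-1) ^ Suc \<nu> * of_nat (Suc n choose Suc \<nu>) * a (Suc \<nu>))"
    by (subst sum.atMost_Suc_shift) simp
  also have "\<dots> = (a 0 + (\<Sum>\<nu>\<le>n. (-1) ^ Suc \<nu> * of_nat (n choose Suc \<nu>) * a (Suc \<nu>)))
      - (\<Sum>\<nu>\<le>n. (-1) ^ \<nu> * of_nat (n choose \<nu>) * a (Suc \<nu>))"
    by (simp add: sum.distrib[symmetric] sum_subtractf[symmetric] sum_negf[symmetric] algebra_simps)
  also have "a 0 + (\<Sum>\<nu>\<le>n. (-1) ^ Suc \<nu> * of_nat (n choose Suc \<nu>) * a (Suc \<nu>))
      = (\<Sum>\<nu>\<le>Suc n. (-1) ^ \<nu> * of_nat (n choose \<nu>) * a \<nu>)"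
    by (subst sum.atMost_Suc_shift) simp
  also have "\<dots> = fin_diff n h f x" by (simp add: fin_diff_def a_def)
  finally show ?thesis by (simp add: fin_diff_def s)
qed

lemma fin_diff_0: "fin_diff 0 h f x = f x"
  by (simp add: fin_diff_def)

text \<open>The mean value inequality, once for each order.\<close>

lemma fin_diff_axis_bound:
  fixes f :: "real^'d \<Rightarrow> complex"
  assumes "smooth_bd n UNIV C f"
  shows "cmod (fin_diff n (h *\<^sub>R axis i 1) f x) \<le> C * \<bar>h\<bar> ^ n"
  using assms
proof (induction n arbitrary: f x)
  case (Suc n)
  let ?e = "axis i 1 :: real^'d"
  have nn: "0 \<le> C" using smooth_bd_bound[OF Suc.prems, of 0] norm_ge_zero order_trans by blast
  let ?G = "\<lambda>s. fin_diff n (h *\<^sub>R ?e) f (x + s *\<^sub>R ?e)"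
  have "cmod (?G 0 - ?G h) \<le> C * \<bar>h\<bar> ^ n * \<bar>0 - h\<bar>"
  proof (rule norm_diff_le_vector_derivative[of UNIV _ _ _ _ "\<lambda>s. fin_diff n (h *\<^sub>R ?e) (partial_deriv i f) (x + s *\<^sub>R ?e)"])
    show "(?G has_vector_derivative fin_diff n (h *\<^sub>R ?e) (partial_deriv i f) (x + s *\<^sub>R ?e)) (at s)" for s
      unfolding fin_diff_def
    proof (rule has_vector_derivative_sum)
      fix \<nu>
      have "((\<lambda>t. f (x + (real \<nu> * h) *\<^sub>R ?e + t *\<^sub>R ?e)) has_vector_derivative partial_deriv i f (x + (real \<nu> * h) *\<^sub>R ?e + s *\<^sub>R ?e)) (at s)"
        by (rule line_derivative_shift[OF Suc.prems]) simp
      then have "((\<lambda>t. f (x + t *\<^sub>R ?e + real \<nu> *\<^sub>R h *\<^sub>R ?e)) has_vector_derivative partial_deriv i f (x + s *\<^sub>R ?e + real \<nu> *\<^sub>R h *\<^sub>R ?e)) (at s)"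
        by (simp add: add_ac)
      then show "((\<lambda>t. (-1) ^ \<nu> * of_nat (n choose \<nu>) * f (x + t *\<^sub>R ?e + real \<nu> *\<^sub>R h *\<^sub>R ?e)) has_vector_derivative
        (-1) ^ \<nu> * of_nat (n choose \<nu>) * partial_deriv i f (x + s *\<^sub>R ?e + real \<nu> *\<^sub>R h *\<^sub>R ?e)) (at s)"
        by (rule has_vector_derivative_mult_right)
    qed
    show "cmod (fin_diff n (h *\<^sub>R ?e) (partial_deriv i f) (x + s *\<^sub>R ?e)) \<le> C * \<bar>h\<bar> ^ n" for s
      using Suc.prems by (intro Suc.IH) auto
  qed (use nn in auto)
  then show ?case unfolding fin_diff_Suc by (simp add: mult_ac)
qed (auto simp: fin_diff_0)

lemma integrable_bounded_support:
  fixes f :: "real^'d \<Rightarrow> complex"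
  assumes [measurable]: "f \<in> borel_measurable borel" and C: "\<And>x. cmod (f x) \<le> C"
    and supp: "\<And>x. R < norm x \<Longrightarrow> f x = 0"
  shows "integrable lborel f"
    and "cmod (\<integral>x. f x \<partial>lborel) \<le> C * measure lborel (cball 0 R :: (real^'d) set)"
proof -
  have "emeasure lborel (cball 0 R :: (real^'d) set) < \<infinity>"
    by (rule emeasure_bounded_finite) (rule bounded_cball)
  then have i: "integrable lborel (\<lambda>x. C * indicator (cball 0 R :: (real^'d) set) x)"
    by (intro integrable_mult_right integrable_real_indicator) auto
  have le: "cmod (f x) \<le> C * indicator (cball 0 R) x" for x
    using C[of x] supp[of x] by (cases "norm x \<le> R") (auto simp: indicator_def)
  show fi: "integrable lborel f"
    by (rule Bochner_Integration.integrable_bound[OF i]) (auto intro!: AE_I2 order_trans[OF le abs_ge_self])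
  have "cmod (\<integral>x. f x \<partial>lborel) \<le> (\<integral>x. cmod (f x) \<partial>lborel)" by (rule integral_norm_bound)
  also have "\<dots> \<le> (\<integral>x. C * indicator (cball 0 R :: (real^'d) set) x \<partial>lborel)"
    using i fi le by (intro integral_mono) auto
  finally show "cmod (\<integral>x. f x \<partial>lborel) \<le> C * measure lborel (cball 0 R :: (real^'d) set)" by simp
qed

text \<open>The step \<open>h = 1 / (2 x\<^sub>i)\<close> in the direction of the largest coordinate multiplies the character by
  \<open>-1\<close>. The difference of order \<open>n\<close> of \<open>b\<close> with this step therefore has inverse transform
  \<open>2\<^sup>n inv_fourier b x\<close>, and it is bounded by \<open>C \<bar>h\<bar>\<^sup>n\<close>.\<close>

lemma inv_fourier_decay:
  fixes R :: real
  assumes R: "0 \<le> R"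
  shows "\<exists>A\<ge>0. \<forall>(b :: real^'d \<Rightarrow> complex) C. b \<in> borel_measurable borel \<longrightarrow> smooth_bd n UNIV C b \<longrightarrow>
    (\<forall>\<xi>. R < norm \<xi> \<longrightarrow> b \<xi> = 0) \<longrightarrow> (\<forall>x. cmod (inv_fourier b x) * (1 + norm x) ^ n \<le> A * C)"
proof -
  define V where "V = measure lborel (cball 0 (R + n) :: (real^'d) set)"
  have V0: "0 \<le> V" by (simp add: V_def)
  have "cmod (inv_fourier b x) * (1 + norm x) ^ n \<le> real CARD('d) ^ n * 2 ^ n * V * C"
    if [measurable]: "b \<in> borel_measurable borel" and sm: "smooth_bd n UNIV C b"
      and supp: "\<And>\<xi>. R < norm \<xi> \<Longrightarrow> b \<xi> = 0" for b :: "real^'d \<Rightarrow> complex" and C x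
  proof -
    let ?B = "inv_fourier b"
    have C: "cmod (b \<xi>) \<le> C" for \<xi> using smooth_bd_bound[OF sm] by simp
    then have C0: "0 \<le> C" using norm_ge_zero order_trans by blast
    have coord: "cmod (?B x) * (1 + \<bar>x $ i\<bar>) ^ n \<le> 2 ^ n * V * C" for i
    proof (cases "\<bar>x $ i\<bar> < 1")
      case True
      have "cmod (?B x) \<le> C * V"
        unfolding inv_fourier_def V_def
        by (rule integrable_bounded_support) (use C supp in \<open>auto simp: norm_mult\<close>)
      then have "cmod (?B x) * (1 + \<bar>x $ i\<bar>) ^ n \<le> (C * V) * 2 ^ n"
        using True C0 V0 by (intro mult_mono power_mono) auto
      then show ?thesis by (simp add: mult_ac)
    next
      case False
      (* This step multiplies the character by -1. *)
      define h where "h = 1 / (2 * x $ i)"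
      let ?e = "axis i 1 :: real^'d"
      have x0: "x $ i \<noteq> 0" using False by auto
      have h: "\<bar>h\<bar> = 1 / (2 * \<bar>x $ i\<bar>)" "\<bar>h\<bar> \<le> 1" 
        using False by (auto simp: h_def abs_mult divide_simps)
      have ib: "integrable lborel (\<lambda>\<xi>. b \<xi> * char x \<xi>)"
        by (rule integrable_bounded_support) (use C supp in \<open>auto simp: norm_mult\<close>)
      have shift: "(\<integral>\<xi>. b (\<xi> + real \<nu> *\<^sub>R h *\<^sub>R ?e) * char x \<xi> \<partial>lborel) = (-1) ^ \<nu> * ?B x"
        "integrable lborel (\<lambda>\<xi>. b (\<xi> + real \<nu> *\<^sub>R h *\<^sub>R ?e) * char x \<xi>)" for \<nu> :: nat
      proof -
        let ?y = "real \<nu> *\<^sub>R h *\<^sub>R ?e"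
        have "2 * pi * (x \<bullet> ?y) = real \<nu> * pi" using x0 by (simp add: h_def inner_axis)
        then have "char x ?y = cis (real \<nu> * pi)" by (simp only: char_def)
        also have "\<dots> = (-1) ^ \<nu>" by (subst Complex.DeMoivre[symmetric]) (simp only: cis_pi)
        finally have cy: "char x ?y = (-1) ^ \<nu>" .
        have eq: "b (\<xi> + ?y) * char x \<xi> = (-1) ^ \<nu> * (b (\<xi> + ?y) * char x (\<xi> + ?y))" for \<xi>
          unfolding char_add_right cy by (simp add: mult.left_commute power_mult_distrib[symmetric])
        show "(\<integral>\<xi>. b (\<xi> + ?y) * char x \<xi> \<partial>lborel) = (-1) ^ \<nu> * ?B x"
          unfolding eq inv_fourier_def using integral_translate[of "\<lambda>\<xi>. b \<xi> * char x \<xi>" ?y] by simp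
        show "integrable lborel (\<lambda>\<xi>. b (\<xi> + ?y) * char x \<xi>)"
          unfolding eq by (rule integrable_mult_right) (rule integrable_translate[OF ib])
      qed
      have "(\<integral>\<xi>. fin_diff n (h *\<^sub>R ?e) b \<xi> * char x \<xi> \<partial>lborel)
        = (\<Sum>\<nu>\<le>n. (-1) ^ \<nu> * of_nat (n choose \<nu>) * ((-1) ^ \<nu> * ?B x))"
        unfolding fin_diff_def sum_distrib_right mult.assoc
        by (subst Bochner_Integration.integral_sum) (auto simp: shift simp del: scaleR_scaleR)
      also have "\<dots> = (\<Sum>\<nu>\<le>n. of_nat (n choose \<nu>) * ?B x)"
      proof (intro sum.cong refl)
        fix \<nu>
        have "(-1) ^ \<nu> * (-1) ^ \<nu> = (1 :: complex)" by (simp add: power_mult_distrib[symmetric])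
        then show "(-1) ^ \<nu> * of_nat (n choose \<nu>) * ((-1) ^ \<nu> * ?B x) = of_nat (n choose \<nu>) * ?B x"
          by (metis (no_types, lifting) mult.assoc mult.commute mult_1)
      qed
      also have "\<dots> = 2 ^ n * ?B x"
      proof -
        have "(\<Sum>\<nu>\<le>n. of_nat (n choose \<nu>)) = (2 ^ n :: complex)"
          by (simp only: of_nat_sum[symmetric] choose_row_sum of_nat_power of_nat_numeral)
        then show ?thesis by (simp add: sum_distrib_right[symmetric])
      qed
      finally have "2 ^ n * cmod (?B x) = cmod (\<integral>\<xi>. fin_diff n (h *\<^sub>R ?e) b \<xi> * char x \<xi> \<partial>lborel)"
        by (simp add: norm_mult norm_power)
      also have "\<dots> \<le> C * \<bar>h\<bar> ^ n * V"
        unfolding V_def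
      proof (rule integrable_bounded_support)
        show "(\<lambda>\<xi>. fin_diff n (h *\<^sub>R ?e) b \<xi> * char x \<xi>) \<in> borel_measurable borel"
          unfolding fin_diff_def by measurable
        show "cmod (fin_diff n (h *\<^sub>R ?e) b \<xi> * char x \<xi>) \<le> C * \<bar>h\<bar> ^ n" for \<xi>
          using fin_diff_axis_bound[OF sm] by (simp add: norm_mult)
        fix \<xi> :: "real^'d" assume \<xi>: "R + real n < norm \<xi>"
        have "b (\<xi> + real \<nu> *\<^sub>R h *\<^sub>R ?e) = 0" if "\<nu> \<le> n" for \<nu>
        proof (rule supp)
          have "norm (real \<nu> *\<^sub>R h *\<^sub>R ?e) \<le> real n * 1"
          proof -
            have "norm (real \<nu> *\<^sub>R h *\<^sub>R ?e) = real \<nu> * \<bar>h\<bar>" by (simp add: norm_axis_1 abs_mult)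
            also have "\<dots> \<le> real n * 1" using that h(2) by (intro mult_mono) auto
            finally show ?thesis .
          qed
          moreover have "norm \<xi> \<le> norm (\<xi> + real \<nu> *\<^sub>R h *\<^sub>R ?e) + norm (real \<nu> *\<^sub>R h *\<^sub>R ?e)"
            by (metis add_diff_cancel norm_triangle_ineq4)
          ultimately show "R < norm (\<xi> + real \<nu> *\<^sub>R h *\<^sub>R ?e)" using \<xi> by linarith
        qed
        then show "fin_diff n (h *\<^sub>R ?e) b \<xi> * char x \<xi> = 0" by (simp add: fin_diff_def)
      qed
      finally have *: "2 ^ n * cmod (?B x) \<le> C * \<bar>h\<bar> ^ n * V" .
      have "2 ^ n * (cmod (?B x) * (1 + \<bar>x $ i\<bar>) ^ n) = (2 ^ n * cmod (?B x)) * (1 + \<bar>x $ i\<bar>) ^ n" by simp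
      also have "\<dots> \<le> (C * \<bar>h\<bar> ^ n * V) * (2 * \<bar>x $ i\<bar>) ^ n"
        by (rule mult_mono[OF * power_mono]) (use False C0 V0 in auto)
      also have "\<dots> = C * V * (\<bar>h\<bar> * (2 * \<bar>x $ i\<bar>)) ^ n" by (simp add: power_mult_distrib)
      also have "\<bar>h\<bar> * (2 * \<bar>x $ i\<bar>) = 1" unfolding h(1) using x0 by simp
      finally have "2 ^ n * (cmod (?B x) * (1 + \<bar>x $ i\<bar>) ^ n) \<le> C * V" by simp
      moreover have pow: "y \<le> 2 ^ n * y" if "0 \<le> y" for y :: real
        using mult_right_mono[OF one_le_power[of 2 n] that] by simp
      have "cmod (?B x) * (1 + \<bar>x $ i\<bar>) ^ n \<le> 2 ^ n * (cmod (?B x) * (1 + \<bar>x $ i\<bar>) ^ n)"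
        by (rule pow) simp
      moreover have "C * V \<le> 2 ^ n * V * C"
        using pow[of "C * V"] C0 V0 by (simp add: mult_ac)
      ultimately show ?thesis by linarith
    qed
    have "Max (range (\<lambda>j. \<bar>x $ j\<bar>)) \<in> range (\<lambda>j. \<bar>x $ j\<bar>)" by (rule Max_in) auto
    then obtain i where "Max (range (\<lambda>j. \<bar>x $ j\<bar>)) = \<bar>x $ i\<bar>" by (rule imageE)
    then have i: "\<bar>x $ j\<bar> \<le> \<bar>x $ i\<bar>" for j
      using Max_ge[of "range (\<lambda>j. \<bar>x $ j\<bar>)" "\<bar>x $ j\<bar>"] by auto
    have "norm x \<le> (\<Sum>j\<in>UNIV. \<bar>x $ j\<bar>)" by (rule norm_le_l1_cart)
    also have "\<dots> \<le> (\<Sum>j\<in>(UNIV :: 'd set). \<bar>x $ i\<bar>)" by (intro sum_mono i)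
    finally have "norm x \<le> real CARD('d) * \<bar>x $ i\<bar>" by simp
    moreover have "1 \<le> real CARD('d)" by (simp add: Suc_leI)
    ultimately have "1 + norm x \<le> real CARD('d) * (1 + \<bar>x $ i\<bar>)" unfolding distrib_left by linarith
    then have "(1 + norm x) ^ n \<le> (real CARD('d) * (1 + \<bar>x $ i\<bar>)) ^ n" by (intro power_mono) auto
    then have "cmod (?B x) * (1 + norm x) ^ n \<le> cmod (?B x) * (real CARD('d) * (1 + \<bar>x $ i\<bar>)) ^ n"
      by (intro mult_left_mono) auto
    also have "\<dots> = real CARD('d) ^ n * (cmod (?B x) * (1 + \<bar>x $ i\<bar>) ^ n)" by (simp add: power_mult_distrib)
    also have "\<dots> \<le> real CARD('d) ^ n * (2 ^ n * V * C)" by (intro mult_left_mono coord) auto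
    finally show ?thesis by (simp add: mult.assoc)
  qed
  then show ?thesis using V0 by (intro exI[of _ "real CARD('d) ^ n * 2 ^ n * V"]) auto
qed

section \<open>A compactly supported bump function\<close>

text \<open>A cutoff of finite smoothness, whose derivatives are again of this form.\<close>

definition bump :: "real \<Rightarrow> nat \<Rightarrow> real^'d \<Rightarrow> complex" where
  "bump r m \<xi> = complex_of_real (max 0 (1 - (norm \<xi> / r)\<^sup>2) ^ m)"

lemma bump_eq_0: "0 < r \<Longrightarrow> r < norm \<xi> \<Longrightarrow> 0 < m \<Longrightarrow> bump r m \<xi> = 0"
proof -
  assume "0 < r" "r < norm \<xi>" "0 < m"
  then have "1 \<le> (norm \<xi> / r)\<^sup>2" by (intro one_le_power) (simp add: field_simps)
  then show ?thesis using \<open>0 < m\<close> by (simp add: bump_def max_def)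
qed

lemma bump_0 [simp]: "bump r m 0 = 1"
  by (simp add: bump_def)

lemma continuous_on_bump: "continuous_on S (bump r m)"
  unfolding bump_def by (cases "r = 0") (auto intro!: continuous_intros)

lemma norm_bump_le: "cmod (bump r m \<xi>) \<le> 1"
proof -
  have "max 0 (1 - (norm \<xi> / r)\<^sup>2) ^ m \<le> 1" by (intro power_le_one) auto
  then show ?thesis unfolding bump_def by (simp only: norm_of_real) simp
qed

lemma has_real_derivative_max_power:
  assumes "2 \<le> m"
  shows "((\<lambda>s::real. max 0 s ^ m) has_real_derivative real m * max 0 s ^ (m - 1)) (at s)"
proof -
  consider "0 < s" | "s < 0" | "s = 0" by linarith
  then show ?thesis
  proof cases
    case 1
    have "((\<lambda>s::real. s ^ m) has_real_derivative real m * s ^ (m - 1)) (at s)"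
      by (auto intro!: derivative_eq_intros)
    then have "((\<lambda>s::real. max 0 s ^ m) has_real_derivative real m * s ^ (m - 1)) (at s)"
      by (rule has_field_derivative_transform_within_open[of _ _ _ "{0<..}"]) (use 1 in auto)
    then show ?thesis using 1 by simp
  next
    case 2
    have "((\<lambda>s::real. 0) has_real_derivative 0) (at s)" by simp
    then have "((\<lambda>s::real. max 0 s ^ m) has_real_derivative 0) (at s)"
      by (rule has_field_derivative_transform_within_open[of _ _ _ "{..<0}"]) (use 2 assms in auto)
    moreover have "real m * max 0 s ^ (m - 1) = 0" using 2 assms by simp
    ultimately show ?thesis by (simp only:)
  next
    case 3
    have eq: "max 0 z ^ m = max 0 z ^ (m - 1) * z" for z :: real
      using assms by (cases m; cases "0 \<le> z") (auto simp: max_def)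
    have "isCont (\<lambda>z::real. max 0 z ^ (m - 1)) 0" by (intro continuous_intros)
    moreover have "\<forall>z. max 0 z ^ m - max 0 0 ^ m = max 0 z ^ (m - 1) * (z - (0::real))"
      using assms eq by simp
    ultimately have "((\<lambda>z::real. max 0 z ^ m) has_real_derivative max 0 0 ^ (m - 1)) (at 0)"
      unfolding CARAT_DERIV by (intro exI[of _ "\<lambda>z::real. max 0 z ^ (m - 1)"]) auto
    moreover have "real m * max 0 s ^ (m - 1) = 0" "max 0 0 ^ (m - 1) = (0::real)" using 3 assms by simp_all
    ultimately show ?thesis using 3 by (simp only:)
  qed
qed

lemma bump_line_derivative:
  assumes "2 \<le> m" "0 < r"
  shows "((\<lambda>t. bump r m (x + t *\<^sub>R axis i 1)) has_vector_derivative
    (complex_of_real (axis i (- 2 * real m / r\<^sup>2) \<bullet> x) * bump r (m - 1) x)) (at 0)"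
proof -
  have eq: "(norm (x + t *\<^sub>R axis i 1) / r)\<^sup>2 = ((norm x)\<^sup>2 + 2 * t * x $ i + t\<^sup>2) / r\<^sup>2" for t
    unfolding power_divide power2_norm_eq_inner inner_add_left inner_add_right inner_scaleR_left inner_scaleR_right
    by (simp add: inner_axis inner_axis' power2_eq_square algebra_simps)
  have "((\<lambda>t. 1 - ((norm x)\<^sup>2 + 2 * t * x $ i + t\<^sup>2) / r\<^sup>2) has_real_derivative - (2 * x $ i) / r\<^sup>2) (at 0)"
    using assms by (auto intro!: derivative_eq_intros simp: field_simps power2_eq_square power4_eq_xxxx)
  from DERIV_chain2[OF has_real_derivative_max_power[OF assms(1)] this]
  have "((\<lambda>t. max 0 (1 - (norm (x + t *\<^sub>R axis i 1) / r)\<^sup>2) ^ m) has_real_derivative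
      real m * max 0 (1 - (norm x / r)\<^sup>2) ^ (m - 1) * (- (2 * x $ i) / r\<^sup>2)) (at 0)"
    unfolding eq by (simp add: power_divide)
  then have "((\<lambda>t. bump r m (x + t *\<^sub>R axis i 1)) has_vector_derivative
      complex_of_real (real m * max 0 (1 - (norm x / r)\<^sup>2) ^ (m - 1) * (- (2 * x $ i) / r\<^sup>2))) (at 0)"
    unfolding bump_def by (rule has_vector_derivative_of_real)
  then show ?thesis by (simp add: bump_def inner_axis' field_simps)
qed

text \<open>Each derivative costs one power of \<open>1 - \<bar>\<xi>\<bar>\<^sup>2 / r\<^sup>2\<close>.\<close>

lemma smooth_bd_bump:
  assumes r: "0 < r" and "k < m"
  shows "\<exists>C\<ge>0. smooth_bd k UNIV C (bump r m :: real^'d \<Rightarrow> complex)"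
proof -
  have "\<exists>C\<ge>0. smooth_bd k (ball 0 (2 * r)) C (bump r m :: real^'d \<Rightarrow> complex)"
    using \<open>k < m\<close>
  proof (induction k arbitrary: m)
    case 0 show ?case using norm_bump_le by (intro exI[of _ 1]) auto
  next
    case (Suc k)
    obtain C where C: "0 \<le> C" "smooth_bd k (ball 0 (2 * r)) C (bump r (m - 1) :: real^'d \<Rightarrow> complex)"
      using Suc.IH[of "m - 1"] Suc.prems by (metis Suc_less_eq2 diff_Suc_1)
    define L where "L = (2 * real m / r\<^sup>2) * (2 * r + 1)"
    have L0: "0 \<le> L" using r by (simp add: L_def)
    have "norm (axis i (- 2 * real m / r\<^sup>2) :: real^'d) = 2 * real m / r\<^sup>2" for i
    proof -
      have "axis i (- 2 * real m / r\<^sup>2) = (- 2 * real m / r\<^sup>2) *\<^sub>R (axis i 1 :: real^'d)"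
        by (simp add: vec_eq_iff axis_def)
      then show ?thesis by (simp add: norm_axis_1)
    qed
    then have lin: "smooth_bd k (ball 0 (2 * r)) L (\<lambda>x. complex_of_real (axis i (- 2 * real m / r\<^sup>2) \<bullet> x))" for i :: 'd
      unfolding L_def using smooth_bd_inner[of "2 * r" k "axis i (- 2 * real m / r\<^sup>2)"] r by simp
    let ?K = "1 + 2 ^ k * L * C"
    have "0 \<le> 2 ^ k * L * C" using L0 C by simp
    then have "smooth_bd (Suc k) (ball 0 (2 * r)) ?K (bump r m :: real^'d \<Rightarrow> complex)"
      using Suc.prems r
      by (intro smooth_bd_intro_deriv[OF _ _ bump_line_derivative]
            smooth_bd_mono_bound[OF smooth_bd_mult[OF _ lin C(2) L0 C(1)]] order_trans[OF norm_bump_le]) auto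
    then show ?case using \<open>0 \<le> 2 ^ k * L * C\<close> by (intro exI[of _ ?K]) auto
  qed
  then obtain C where C: "0 \<le> C" "smooth_bd k (ball 0 (2 * r)) C (bump r m :: real^'d \<Rightarrow> complex)" by auto
  have "smooth_bd k (- cball 0 r) C (bump r m :: real^'d \<Rightarrow> complex)"
    by (rule smooth_bd_cong[of _ "\<lambda>_. 0"])
       (use C assms in \<open>auto intro!: smooth_bd_const simp: bump_eq_0 not_le\<close>)
  then have "smooth_bd k (ball 0 (2 * r) \<union> - cball 0 r) C (bump r m :: real^'d \<Rightarrow> complex)"
    by (intro smooth_bd_Un C)
  also have "ball 0 (2 * r) \<union> - cball 0 r = (UNIV :: (real^'d) set)" using r by auto
  finally show ?thesis using C by auto
qed

section \<open>Order of vanishing at the origin\<close>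

text \<open>The statement on the coordinate subspace spanned by \<open>xs\<close>, with the derivatives taken in
  the order in which \<open>multi_deriv\<close> takes them.\<close>

definition vanishing_estimate :: "'d::finite list \<Rightarrow> nat \<Rightarrow> real \<Rightarrow> real \<Rightarrow> bool" where
  "vanishing_estimate xs n \<epsilon> K \<longleftrightarrow> (\<forall>(f :: real^'d \<Rightarrow> complex) C \<xi>. 0 \<le> C \<longrightarrow> smooth_bd n (ball 0 \<epsilon>) C f \<longrightarrow>
    (\<forall>\<beta>. (\<forall>i. i \<notin> set xs \<longrightarrow> \<beta> $ i = 0) \<longrightarrow> multi_order \<beta> < n \<longrightarrow>
       foldr (\<lambda>i. partial_deriv i ^^ (\<beta> $ i)) xs f 0 = 0) \<longrightarrow>
    \<xi> \<in> ball 0 \<epsilon> \<longrightarrow> (\<forall>i. i \<notin> set xs \<longrightarrow> \<xi> $ i = 0) \<longrightarrow> cmod (f \<xi>) \<le> K * C * norm \<xi> ^ n)"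

lemma vanishing_estimateD:
  fixes f :: "real^'d \<Rightarrow> complex"
  assumes "vanishing_estimate xs n \<epsilon> K" "0 \<le> C" "smooth_bd n (ball 0 \<epsilon>) C f"
    "\<And>\<beta>. (\<And>i. i \<notin> set xs \<Longrightarrow> \<beta> $ i = 0) \<Longrightarrow> multi_order \<beta> < n \<Longrightarrow>
       foldr (\<lambda>i. partial_deriv i ^^ (\<beta> $ i)) xs f 0 = 0"
    "\<xi> \<in> ball 0 \<epsilon>" "\<And>i. i \<notin> set xs \<Longrightarrow> \<xi> $ i = 0"
  shows "cmod (f \<xi>) \<le> K * C * norm \<xi> ^ n"
  using assms(1)[unfolded vanishing_estimate_def, rule_format, OF assms(2,3) _ assms(5,6)] assms(4) by blast

text \<open>Induction on the number of coordinates and on the order: move along the last coordinate from the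
  smaller subspace, and apply the estimate of lower order to the derivative in this direction.\<close>

lemma vanishing_order_coordinates:
  "distinct (xs :: 'd::finite list) \<Longrightarrow> \<exists>K\<ge>0. vanishing_estimate xs n \<epsilon> K"
proof (induction xs arbitrary: n rule: rev_induct)
  case Nil
  show ?case
    unfolding vanishing_estimate_def
  proof (intro exI[of _ 1] conjI allI impI)
    fix f :: "real^'d \<Rightarrow> complex" and C and \<xi> :: "real^'d"
    assume C: "0 \<le> C" "smooth_bd n (ball 0 \<epsilon>) C f" "\<xi> \<in> ball 0 \<epsilon>" "\<forall>i. i \<notin> set ([] :: 'd list) \<longrightarrow> \<xi> $ i = 0"
      and v: "\<forall>\<beta>. (\<forall>i. i \<notin> set ([] :: 'd list) \<longrightarrow> \<beta> $ i = 0) \<longrightarrow> multi_order \<beta> < n \<longrightarrow>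
       foldr (\<lambda>i. partial_deriv i ^^ (\<beta> $ i)) [] f 0 = 0"
    have "\<xi> = 0" using C(4) by (simp add: vec_eq_iff)
    show "cmod (f \<xi>) \<le> 1 * C * norm \<xi> ^ n"
    proof (cases n)
      case 0 then show ?thesis using C by simp
    next
      case (Suc m)
      then have "f 0 = 0" using v[rule_format, of 0] by (simp add: multi_order_def)
      then show ?thesis using \<open>\<xi> = 0\<close> C by simp
    qed
  qed simp
next
  case (snoc y xs)
  have y: "y \<notin> set xs" and d: "distinct xs" using snoc.prems by auto
  let ?P = "\<lambda>\<beta> :: nat^'d. \<lambda>i. partial_deriv i ^^ (\<beta> $ i)"
  show ?case
  proof (induction n)
    case 0
    show ?case unfolding vanishing_estimate_def by (intro exI[of _ 1]) auto
  next
    case (Suc m)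
    obtain K1 where K1: "0 \<le> K1" "vanishing_estimate xs (Suc m) \<epsilon> K1"
      using snoc.IH[OF d] by blast
    obtain K2 where K2: "0 \<le> K2" "vanishing_estimate (xs @ [y]) m \<epsilon> K2"
      using Suc.IH by blast
    show ?case
      unfolding vanishing_estimate_def
    proof (intro exI[of _ "K1 + K2"] conjI allI impI)
      show "0 \<le> K1 + K2" using K1 K2 by simp
      fix f :: "real^'d \<Rightarrow> complex" and C and \<xi> :: "real^'d"
      assume C: "0 \<le> C" and sm: "smooth_bd (Suc m) (ball 0 \<epsilon>) C f" and \<xi>: "\<xi> \<in> ball 0 \<epsilon>"
        and \<xi>0: "\<forall>i. i \<notin> set (xs @ [y]) \<longrightarrow> \<xi> $ i = 0"
        and v: "\<forall>\<beta>. (\<forall>i. i \<notin> set (xs @ [y]) \<longrightarrow> \<beta> $ i = 0) \<longrightarrow> multi_order \<beta> < Suc m \<longrightarrow>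
          foldr (?P \<beta>) (xs @ [y]) f 0 = 0"
      let ?e = "axis y 1 :: real^'d"
      define \<zeta> where "\<zeta> t = (\<xi> - (\<xi> $ y) *\<^sub>R ?e) + t *\<^sub>R ?e" for t
      have \<zeta>_nth: "\<zeta> t $ i = (if i = y then t else \<xi> $ i)" for t i
        by (auto simp: \<zeta>_def axis_def)
      have \<zeta>n: "norm (\<zeta> t) \<le> norm \<xi>" if "\<bar>t\<bar> \<le> \<bar>\<xi> $ y\<bar>" for t
        by (rule norm_le_componentwise_cart) (use that in \<open>auto simp: \<zeta>_nth\<close>)
      have \<zeta>b: "\<zeta> t \<in> ball 0 \<epsilon>" if "\<bar>t\<bar> \<le> \<bar>\<xi> $ y\<bar>" for t using \<zeta>n[OF that] \<xi> by simp
      have 1: "cmod (f (\<zeta> 0)) \<le> K1 * C * norm (\<zeta> 0) ^ Suc m"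
      proof (rule vanishing_estimateD[OF K1(2) C sm])
        fix \<beta> :: "nat^'d" assume \<beta>: "\<And>i. i \<notin> set xs \<Longrightarrow> \<beta> $ i = 0" "multi_order \<beta> < Suc m"
        then have "foldr (?P \<beta>) (xs @ [y]) f 0 = 0" using v by simp
        then show "foldr (?P \<beta>) xs f 0 = 0" using \<beta> y by simp
      qed (use \<zeta>b[of 0] \<xi>0 in \<open>auto simp: \<zeta>_nth\<close>)
      have 2: "cmod (partial_deriv y f (\<zeta> t)) \<le> K2 * C * norm (\<zeta> t) ^ m" if "\<bar>t\<bar> \<le> \<bar>\<xi> $ y\<bar>" for t
      proof (rule vanishing_estimateD[OF K2(2) C])
        show "smooth_bd m (ball 0 \<epsilon>) C (partial_deriv y f)" using sm by simp
        fix \<beta> :: "nat^'d" assume \<beta>: "\<And>i. i \<notin> set (xs @ [y]) \<Longrightarrow> \<beta> $ i = 0" "multi_order \<beta> < m"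
        define \<beta>' where "\<beta>' = \<beta> + axis y 1"
        have n: "\<beta>' $ i = (if i = y then Suc (\<beta> $ y) else \<beta> $ i)" for i
          by (auto simp: \<beta>'_def axis_def)
        have "multi_order \<beta>' = Suc (multi_order \<beta>)"
          by (simp add: multi_order_def \<beta>'_def sum.distrib axis_def)
        then have "foldr (?P \<beta>') (xs @ [y]) f 0 = 0"
          by (intro v[rule_format]) (use \<beta> in \<open>auto simp: n\<close>)
        also have "foldr (?P \<beta>') (xs @ [y]) f = foldr (?P \<beta>') xs ((partial_deriv y ^^ (\<beta> $ y)) (partial_deriv y f))"
          by (simp add: n funpow_swap1)
        also have "\<dots> = foldr (?P \<beta>) xs ((partial_deriv y ^^ (\<beta> $ y)) (partial_deriv y f))"
          using y by (intro foldr_cong refl) (auto simp: n)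
        finally show "foldr (?P \<beta>) (xs @ [y]) (partial_deriv y f) 0 = 0" by simp
      qed (use \<zeta>b[OF that] \<xi>0 in \<open>auto simp: \<zeta>_nth\<close>)
      let ?S = "{- \<bar>\<xi> $ y\<bar>..\<bar>\<xi> $ y\<bar>}"
      have "cmod (f (\<zeta> (\<xi> $ y)) - f (\<zeta> 0)) \<le> K2 * C * norm \<xi> ^ m * \<bar>\<xi> $ y - 0\<bar>"
      proof (rule norm_diff_le_vector_derivative[of ?S _ _ _ "\<lambda>t. f (\<zeta> t)" "\<lambda>t. partial_deriv y f (\<zeta> t)"])
        fix s assume "s \<in> ?S" then have s: "\<bar>s\<bar> \<le> \<bar>\<xi> $ y\<bar>" by auto
        show "((\<lambda>t. f (\<zeta> t)) has_vector_derivative partial_deriv y f (\<zeta> s)) (at s)"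
          using \<zeta>b[OF s] unfolding \<zeta>_def by (intro line_derivative_shift[OF sm])
        show "cmod (partial_deriv y f (\<zeta> s)) \<le> K2 * C * norm \<xi> ^ m"
          using 2[OF s] \<zeta>n[OF s] K2(1) C
          by (elim order_trans) (intro mult_left_mono power_mono, auto)
      qed (use K2 C in auto)
      also have "\<dots> \<le> K2 * C * norm \<xi> ^ m * norm \<xi>"
        using component_le_norm_cart[of \<xi> y] K2 C by (intro mult_left_mono) auto
      finally have 3: "cmod (f \<xi> - f (\<zeta> 0)) \<le> K2 * C * norm \<xi> ^ Suc m"
        by (simp add: \<zeta>_def mult_ac)
      have "K1 * C * norm (\<zeta> 0) ^ Suc m \<le> K1 * C * norm \<xi> ^ Suc m"
        using \<zeta>n[of 0] K1(1) C by (intro mult_left_mono power_mono) auto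
      then have "cmod (f (\<zeta> 0)) \<le> K1 * C * norm \<xi> ^ Suc m" using 1 by linarith
      moreover have "cmod (f \<xi>) \<le> cmod (f \<xi> - f (\<zeta> 0)) + cmod (f (\<zeta> 0))"
        by (metis diff_add_cancel norm_triangle_ineq)
      ultimately show "cmod (f \<xi>) \<le> (K1 + K2) * C * norm \<xi> ^ Suc m"
        using 3 unfolding distrib_right by linarith
    qed
  qed
qed

lemma vanishing_order:
  fixes f :: "real^'d \<Rightarrow> complex"
  assumes "smooth_bd n (ball 0 \<epsilon>) C f" "0 \<le> C"
    and "\<And>\<beta>. multi_order \<beta> < n \<Longrightarrow> multi_deriv \<beta> f 0 = 0"
  shows "\<exists>K\<ge>0. \<forall>\<xi>\<in>ball 0 \<epsilon>. cmod (f \<xi>) \<le> K * norm \<xi> ^ n"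
proof -
  define xs where "xs = (SOME xs. distinct xs \<and> set xs = (UNIV :: 'd set))"
  have "\<exists>xs. distinct xs \<and> set xs = (UNIV :: 'd set)" using finite_distinct_list[of "UNIV :: 'd set"] by auto
  then have xs: "distinct xs" "set xs = UNIV" unfolding xs_def by (metis (mono_tags, lifting) someI_ex)+
  from vanishing_order_coordinates[OF xs(1)] obtain K where K: "0 \<le> K" "vanishing_estimate xs n \<epsilon> K"
    by blast
  have "cmod (f \<xi>) \<le> K * C * norm \<xi> ^ n" if "\<xi> \<in> ball 0 \<epsilon>" for \<xi>
    by (rule vanishing_estimateD[OF K(2) assms(2,1) _ that])
       (use assms(3)[unfolded multi_deriv_def xs_def[symmetric]] xs(2) in auto)
  then show ?thesis using assms(2) K(1) by (intro exI[of _ "K * C"]) auto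
qed

section \<open>Polynomially decaying kernels\<close>

lemma one_plus_norm [simp]: "0 < 1 + norm x" "1 + norm x \<noteq> 0"
  using norm_ge_zero[of x] by linarith+

lemma nn_integral_decay_real:
  assumes r: "1 < r"
  shows "(\<integral>\<^sup>+t. ennreal ((1 + \<bar>t\<bar>) powr (- r)) \<partial>lborel) < \<infinity>"
proof -
  let ?f = "\<lambda>t::real. (1 + t) powr (- r)"
  have half: "(\<integral>\<^sup>+t. ennreal (?f t) * indicator {0..} t \<partial>lborel) = ennreal (0 - (- 1 / (r - 1)) * (1 + 0) powr (1 - r))"
  proof (rule nn_integral_FTC_atLeast)
    show "((\<lambda>t. (- 1 / (r - 1)) * (1 + t) powr (1 - r)) has_real_derivative ?f t) (at t)" if "0 \<le> t" for t
    proof -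
      have "((\<lambda>t. (1 + t) powr (1 - r)) has_real_derivative (1 - r) * (1 + t) powr (1 - r - 1) * 1) (at t)"
        using that by (intro DERIV_chain2[OF has_real_derivative_powr]) (auto intro!: derivative_eq_intros)
      from DERIV_cmult[OF this, of "- 1 / (r - 1)"]
      have *: "((\<lambda>t. (- 1 / (r - 1)) * (1 + t) powr (1 - r)) has_real_derivative
          (- 1 / (r - 1)) * ((1 - r) * (1 + t) powr (1 - r - 1) * 1)) (at t)" .
      have "(- 1 / (r - 1)) * (1 - r) = 1" using r by (simp add: field_simps)
      then have "(- 1 / (r - 1)) * ((1 - r) * (1 + t) powr (1 - r - 1) * 1) = (1 + t) powr (- r)"
        by (simp only: mult.assoc[symmetric] mult_1_left mult_1_right) simp
      with * show ?thesis by (simp only:)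
    qed
    have "((\<lambda>t. (1 + t) powr (- (r - 1))) \<longlongrightarrow> 0) at_top"
      using r by (intro tendsto_neg_powr filterlim_tendsto_add_at_top[OF tendsto_const filterlim_ident]) auto
    then show "((\<lambda>t. (- 1 / (r - 1)) * (1 + t) powr (1 - r)) \<longlongrightarrow> 0) at_top"
      using tendsto_mult_left[of "\<lambda>t. (1 + t) powr (- (r - 1))" 0 at_top "- 1 / (r - 1)"] by simp
  qed auto
  have "(\<integral>\<^sup>+t. ennreal ((1 + \<bar>t\<bar>) powr (- r)) \<partial>lborel)
    \<le> (\<integral>\<^sup>+t. ennreal (?f t) * indicator {0..} t + ennreal (?f (- t)) * indicator {0..} (- t) \<partial>lborel)"
    by (intro nn_integral_mono) (auto simp: indicator_def abs_if)
  also have "\<dots> = (\<integral>\<^sup>+t. ennreal (?f t) * indicator {0..} t \<partial>lborel) + (\<integral>\<^sup>+t. ennreal (?f (- t)) * indicator {0..} (- t) \<partial>lborel)"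
    by (rule nn_integral_add) auto
  also have "(\<integral>\<^sup>+t. ennreal (?f (- t)) * indicator {0..} (- t) \<partial>lborel) = (\<integral>\<^sup>+t. ennreal (?f t) * indicator {0..} t \<partial>lborel)"
    using nn_integral_real_affine[of "\<lambda>t. ennreal (?f t) * indicator {0..} t" "-1" 0] by simp
  finally show ?thesis unfolding half by (auto simp: order_le_less_trans simp flip: ennreal_plus)
qed

text \<open>The factors \<open>1 + \<bar>x\<^sub>i\<bar>\<close> are at most \<open>1 + \<bar>x\<bar>\<close>, which reduces the claim to dimension one.\<close>

lemma nn_integral_decay:
  assumes s: "real CARD('d) < s"
  shows "(\<integral>\<^sup>+x. ennreal ((1 + norm x) powr (- s)) \<partial>(lborel :: (real^'d) measure)) < \<infinity>"
proof -
  let ?d = "real CARD('d)" and ?B = "Basis :: (real^'d) set"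
  have d: "0 < ?d" by simp
  have cB: "real (card ?B) = ?d" by simp
  have "(\<integral>\<^sup>+x. ennreal ((1 + norm x) powr (- s)) \<partial>(lborel :: (real^'d) measure))
    \<le> (\<integral>\<^sup>+x. (\<Prod>b\<in>?B. ennreal ((1 + \<bar>x \<bullet> b\<bar>) powr (- (s / ?d)))) \<partial>lborel)"
  proof (rule nn_integral_mono)
    fix x :: "real^'d"
    have "(1 + norm x) powr (- s) = ((1 + norm x) powr (- (s / ?d))) ^ card ?B"
      using d by (subst powr_power) auto
    also have "\<dots> = (\<Prod>b\<in>?B. (1 + norm x) powr (- (s / ?d)))" by simp
    also have "\<dots> \<le> (\<Prod>b\<in>?B. (1 + \<bar>x \<bullet> b\<bar>) powr (- (s / ?d)))"
      using s d by (intro prod_mono) (auto intro!: powr_mono2' Basis_le_norm)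
    finally show "ennreal ((1 + norm x) powr (- s)) \<le> (\<Prod>b\<in>?B. ennreal ((1 + \<bar>x \<bullet> b\<bar>) powr (- (s / ?d))))"
      by (simp add: prod_ennreal ennreal_leI)
  qed
  also have "\<dots> = (\<Prod>b\<in>?B. (\<integral>\<^sup>+t. ennreal ((1 + \<bar>t\<bar>) powr (- (s / ?d))) \<partial>lborel))"
    by (rule nn_integral_lborel_prod) auto
  also have "\<dots> < \<infinity>"
    using nn_integral_decay_real[of "s / ?d"] s d by (simp add: power_less_top_ennreal)
  finally show ?thesis .
qed

lemma one_plus_norm_mult: "1 + norm (x + y) \<le> (1 + norm x) * (1 + norm y)"
proof -
  have "0 \<le> norm x * norm y" by simp
  moreover have "(1 + norm x) * (1 + norm y) = 1 + norm x + norm y + norm x * norm y"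
    by (simp add: algebra_simps)
  ultimately show ?thesis using norm_triangle_ineq[of x y] by linarith
qed

lemma decay_peetre:
  fixes x y :: "'a::real_normed_vector"
  assumes "0 \<le> s" shows "(1 + norm x) powr (- s) \<le> (1 + norm y) powr s * (1 + norm (x + y)) powr (- s)"
proof -
  have "1 + norm (x + y) \<le> (1 + norm x) * (1 + norm y)" by (rule one_plus_norm_mult)
  then have "(1 + norm (x + y)) powr s \<le> ((1 + norm x) * (1 + norm y)) powr s"
    using assms by (intro powr_mono2) auto
  also have "\<dots> = (1 + norm x) powr s * (1 + norm y) powr s" by (simp add: powr_mult)
  finally have le: "(1 + norm (x + y)) powr s \<le> (1 + norm x) powr s * (1 + norm y) powr s" .
  have "0 < (1 + norm z) powr s" for z :: 'a by simp
  from this[of x] this[of "x + y"] le show ?thesis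
    unfolding powr_minus by (simp add: divide_simps mult.commute)
qed

text \<open>The decay at \<open>x + k\<close> and at \<open>x + k + y\<close> are comparable for \<open>y\<close> in the unit cube, so the sum is
  comparable with the integral.\<close>

lemma periodization_decay:
  assumes s: "real CARD('d) < s"
  shows "\<exists>S<\<infinity>. \<forall>x :: real^'d. periodization (\<lambda>x. ennreal ((1 + norm x) powr (- s))) x \<le> S"
proof -
  let ?g = "\<lambda>x :: real^'d. ennreal ((1 + norm x) powr (- s))"
  let ?K = "ennreal ((1 + real CARD('d)) powr s)"
  have s0: "0 \<le> s" using s by (meson le_less_trans less_imp_le of_nat_0_le_iff)
  have norm_cube: "norm z \<le> real CARD('d)" if "z \<in> unit_cube" for z :: "real^'d"
  proof -
    have "\<bar>z $ i\<bar> \<le> 1" for i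
      using that[unfolded unit_cube_def, simplified, rule_format, of i] by auto
    then have "(\<Sum>i\<in>UNIV. \<bar>z $ i\<bar>) \<le> (\<Sum>i\<in>(UNIV :: 'd set). 1)" by (intro sum_mono)
    then show ?thesis using norm_le_l1_cart[of z] by simp
  qed
  have pt: "?g x \<le> (\<integral>\<^sup>+z. ?K * ?g (x + z) \<partial>lcube)" for x
  proof -
    have "?g x = (\<integral>\<^sup>+z. ?g x \<partial>(lcube :: (real^'d) measure))" by simp
    also have "\<dots> \<le> (\<integral>\<^sup>+z. ?K * ?g (x + z) \<partial>lcube)"
    proof (rule nn_integral_mono_AE)
      show "AE z in lcube. ?g x \<le> ?K * ?g (x + z)"
        using AE_lcube_in_unit_cube
      proof eventually_elim
        case (elim z)
        have "(1 + norm x) powr (- s) \<le> (1 + norm z) powr s * (1 + norm (x + z)) powr (- s)"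
          by (rule decay_peetre[OF s0])
        also have "\<dots> \<le> (1 + real CARD('d)) powr s * (1 + norm (x + z)) powr (- s)"
          using norm_cube[OF elim] s0 by (intro mult_right_mono powr_mono2) auto
        finally show ?case by (simp add: ennreal_mult[symmetric] ennreal_leI)
      qed
    qed
    finally show ?thesis .
  qed
  have "periodization ?g x \<le> ?K * (\<integral>\<^sup>+y. ?g y \<partial>lborel)" for x
  proof -
    have "periodization ?g x \<le> (\<integral>\<^sup>+k. (\<integral>\<^sup>+z. ?K * ?g (x + int_vec k + z) \<partial>lcube) \<partial>counting)"
      by (intro nn_integral_mono pt)
    also have "\<dots> = (\<integral>\<^sup>+z. (\<integral>\<^sup>+k. ?K * ?g (x + int_vec k + z) \<partial>counting) \<partial>lcube)"
      by (rule lcube_counting.Fubini') measurable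
    also have "\<dots> = (\<integral>\<^sup>+z. (\<integral>\<^sup>+k. ?K * ?g (z + int_vec k + x) \<partial>counting) \<partial>lcube)"
      by (simp add: add_ac)
    also have "\<dots> = (\<integral>\<^sup>+y. ?K * ?g (y + x) \<partial>lborel)"
      by (subst nn_integral_tiling[where g="\<lambda>y. ?K * ?g (y + x)"]) auto
    also have "\<dots> = ?K * (\<integral>\<^sup>+y. ?g y \<partial>lborel)"
      by (subst nn_integral_cmult) (auto simp: nn_integral_translate[where g="?g"])
    finally show ?thesis .
  qed
  then show ?thesis
    using nn_integral_decay[OF s] by (intro exI[of _ "?K * (\<integral>\<^sup>+y. ?g y \<partial>lborel)"]) (auto simp: ennreal_mult_less_top)
qed

lemma lborel_eq_distr_reflect: "(lborel :: (real^'d) measure) = distr lborel borel (\<lambda>y. x - y)"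
  using lborel_affine[of "-1" x] by (simp add: density_1)

lemma nn_integral_reflect:
  fixes f :: "real^'d \<Rightarrow> ennreal"
  assumes [measurable]: "f \<in> borel_measurable borel"
  shows "(\<integral>\<^sup>+y. f (x - y) \<partial>lborel) = (\<integral>\<^sup>+y. f y \<partial>lborel)"
  by (subst (2) lborel_eq_distr_reflect[of x], subst nn_integral_distr) auto

section \<open>Differences with large steps\<close>

definition step_sum :: "nat \<Rightarrow> real^'d \<Rightarrow> (real^'d \<Rightarrow> complex) \<Rightarrow> real^'d \<Rightarrow> complex" where
  "step_sum m h G x = (\<Sum>i<m. G (x + real i *\<^sub>R h))"

text \<open>A telescoping sum: the difference with step \<open>m h\<close> is a sum of differences with step \<open>h\<close>.\<close>

lemma step_sum_diff:
  "step_sum m h (\<lambda>x. G x - G (x + h)) x = G x - G (x + real m *\<^sub>R h)"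
proof (induction m)
  case (Suc m)
  have "step_sum (Suc m) h (\<lambda>x. G x - G (x + h)) x
    = step_sum m h (\<lambda>x. G x - G (x + h)) x + (G (x + real m *\<^sub>R h) - G (x + real m *\<^sub>R h + h))"
    by (simp add: step_sum_def)
  also have "x + real m *\<^sub>R h + h = x + real (Suc m) *\<^sub>R h" by (simp add: algebra_simps)
  finally show ?case unfolding Suc by simp
qed (simp add: step_sum_def)

lemma step_sum_funpow_diff:
  "(step_sum m h ^^ n) (\<lambda>x. G x - G (x + h)) = (\<lambda>x. (step_sum m h ^^ n) G x - (step_sum m h ^^ n) G (x + h))"
proof (induction n)
  case (Suc n)
  have "step_sum m h (\<lambda>x. H x - H (x + h)) = (\<lambda>x. step_sum m h H x - step_sum m h H (x + h))" for H
    by (auto simp: step_sum_def sum_subtractf add_ac)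
  then show ?case using Suc by simp
qed simp

lemma fin_diff_multiple_step:
  "fin_diff n (real m *\<^sub>R h) F = (step_sum m h ^^ n) (fin_diff n h F)"
proof (induction n)
  case (Suc n)
  let ?S = "step_sum m h"
  let ?G = "(?S ^^ n) (fin_diff n h F)"
  have "fin_diff (Suc n) (real m *\<^sub>R h) F = (\<lambda>x. ?G x - ?G (x + real m *\<^sub>R h))"
    using Suc by (simp add: fin_diff_Suc fun_eq_iff)
  also have "\<dots> = ?S (\<lambda>x. ?G x - ?G (x + h))" by (simp add: step_sum_diff fun_eq_iff)
  also have "(\<lambda>x. ?G x - ?G (x + h)) = (?S ^^ n) (\<lambda>x. fin_diff n h F x - fin_diff n h F (x + h))"
    by (rule step_sum_funpow_diff[symmetric])
  also have "(\<lambda>x. fin_diff n h F x - fin_diff n h F (x + h)) = fin_diff (Suc n) h F"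
    by (simp add: fin_diff_Suc fun_eq_iff)
  finally show ?case by simp
qed (simp add: fin_diff_0 fun_eq_iff)

lemma fin_diff_measurable [measurable]:
  assumes [measurable]: "F \<in> borel_measurable borel" shows "fin_diff n h F \<in> borel_measurable borel"
  unfolding fin_diff_def by measurable

lemma step_sum_measurable [measurable]:
  assumes [measurable]: "F \<in> borel_measurable borel" shows "step_sum m h F \<in> borel_measurable borel"
  unfolding step_sum_def by measurable

lemma step_sum_funpow_measurable [measurable]:
  "F \<in> borel_measurable borel \<Longrightarrow> (step_sum m h ^^ n) F \<in> borel_measurable borel"
  by (induction n) auto

section \<open>Weighted integrals of powers\<close>

text \<open>The \<open>p\<close>-th power of the norm of \<open>L\<^sub>p\<close> with weight \<open>1 / v\<close>.\<close>

definition weighted_power :: "real \<Rightarrow> (real^'d \<Rightarrow> real) \<Rightarrow> (real^'d \<Rightarrow> complex) \<Rightarrow> ennreal" where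
  "weighted_power p v F = (\<integral>\<^sup>+x. ennreal_powr (ennreal (cmod (F x) / v x)) p \<partial>lborel)"

lemma ennreal_powr_cmult:
  "0 \<le> a \<Longrightarrow> 0 \<le> b \<Longrightarrow> ennreal_powr (ennreal (a * b)) r = ennreal (a powr r) * ennreal_powr (ennreal b) r"
  by (simp add: powr_mult ennreal_mult[symmetric])

locale moderate_weight =
  fixes p \<alpha> c :: real and v :: "real^'d \<Rightarrow> real"
  assumes p: "1 \<le> p" and \<alpha>: "0 \<le> \<alpha>" and c: "0 < c"
    and v_measurable [measurable]: "v \<in> borel_measurable borel"
    and v_ge_1: "\<And>x. 1 \<le> v x"
    and v_add: "\<And>x y. v (x + y) \<le> c * (1 + norm x) powr \<alpha> * v y"
begin

abbreviation "J \<equiv> weighted_power p v"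

lemma v_pos: "0 < v x" using v_ge_1[of x] by linarith

lemma J_cong_AE: "AE x in lborel. F x = G x \<Longrightarrow> J F = J G"
  unfolding weighted_power_def by (rule nn_integral_cong_AE) (auto elim: eventually_mono)

lemma J_add:
  assumes [measurable]: "F \<in> borel_measurable borel" "G \<in> borel_measurable borel"
  shows "J (\<lambda>x. F x + G x) \<le> ennreal (2 powr p) * (J F + J G)"
proof -
  have "J (\<lambda>x. F x + G x) \<le> (\<integral>\<^sup>+x. ennreal (2 powr p) * (ennreal_powr (ennreal (cmod (F x) / v x)) p
      + ennreal_powr (ennreal (cmod (G x) / v x)) p) \<partial>lborel)"
    unfolding weighted_power_def
  proof (intro nn_integral_mono)
    fix x
    have "ennreal (cmod (F x + G x) / v x) \<le> ennreal (cmod (F x) / v x) + ennreal (cmod (G x) / v x)"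
      using v_pos[of x] norm_triangle_ineq[of "F x" "G x"]
      by (simp add: ennreal_plus[symmetric] add_divide_distrib[symmetric] divide_right_mono ennreal_leI less_imp_le del: ennreal_plus)
    then have "ennreal_powr (ennreal (cmod (F x + G x) / v x)) p \<le> ennreal_powr (ennreal (cmod (F x) / v x) + ennreal (cmod (G x) / v x)) p"
      using p by (intro ennreal_powr_mono) auto
    also have "\<dots> \<le> ennreal (2 powr p) * (ennreal_powr (ennreal (cmod (F x) / v x)) p + ennreal_powr (ennreal (cmod (G x) / v x)) p)"
      by (rule ennreal_powr_add_le[OF p])
    finally show "ennreal_powr (ennreal (cmod (F x + G x) / v x)) p \<le> \<dots>" .
  qed
  also have "\<dots> = ennreal (2 powr p) * (J F + J G)"
    unfolding weighted_power_def by (simp add: nn_integral_cmult nn_integral_add)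
  finally show ?thesis .
qed

lemma J_minus: "J (\<lambda>x. - F x) = J F"
  by (simp add: weighted_power_def)

lemma J_translate:
  assumes [measurable]: "F \<in> borel_measurable borel"
  shows "J (\<lambda>x. F (x + y)) \<le> ennreal ((c * (1 + norm y) powr \<alpha>) powr p) * J F"
proof -
  let ?U = "c * (1 + norm y) powr \<alpha>"
  have U: "0 \<le> ?U" using c by simp
  have "J (\<lambda>x. F (x + y)) \<le> (\<integral>\<^sup>+x. ennreal (?U powr p) * ennreal_powr (ennreal (cmod (F (x + y)) / v (x + y))) p \<partial>lborel)"
    unfolding weighted_power_def
  proof (intro nn_integral_mono)
    fix x
    have "v (x + y) \<le> ?U * v x" using v_add[of y x] by (simp add: add.commute)
    then have "1 / v x \<le> ?U / v (x + y)" using v_pos[of x] v_pos[of "x + y"] by (simp add: field_simps)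
    then have "cmod (F (x + y)) * (1 / v x) \<le> cmod (F (x + y)) * (?U / v (x + y))" by (intro mult_left_mono) auto
    then have "ennreal_powr (ennreal (cmod (F (x + y)) / v x)) p \<le> ennreal_powr (ennreal (?U * (cmod (F (x + y)) / v (x + y)))) p"
      using p by (intro ennreal_powr_mono ennreal_leI) (auto simp: field_simps)
    also have "\<dots> = ennreal (?U powr p) * ennreal_powr (ennreal (cmod (F (x + y)) / v (x + y))) p"
      using U v_pos[of "x + y"] by (intro ennreal_powr_cmult) auto
    finally show "ennreal_powr (ennreal (cmod (F (x + y)) / v x)) p \<le> \<dots>" .
  qed
  also have "\<dots> = ennreal (?U powr p) * J F"
    unfolding weighted_power_def
    by (subst nn_integral_cmult) (auto simp: nn_integral_translate[where g="\<lambda>x. ennreal_powr (ennreal (cmod (F x) / v x)) p"])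
  finally show ?thesis .
qed

text \<open>Minkowski's integral inequality for functions whose slices \<open>H \<sqdot> y\<close> have norms growing like \<open>W y\<close>,
  as translates and differences do.\<close>

lemma J_minkowski:
  fixes H :: "real^'d \<Rightarrow> 'b \<Rightarrow> complex" and k :: "'b \<Rightarrow> ennreal" and W :: "'b \<Rightarrow> real"
  assumes N: "sigma_finite_measure N"
    and [measurable]: "case_prod H \<in> borel_measurable (borel \<Otimes>\<^sub>M N)" "k \<in> borel_measurable N" "W \<in> borel_measurable N"
    and W: "\<And>y. y \<in> space N \<Longrightarrow> 0 < W y"
    and G: "AE x in lborel. ennreal (cmod (G x)) \<le> (\<integral>\<^sup>+y. ennreal (cmod (H x y)) * k y \<partial>N)"
    and H: "\<And>y. y \<in> space N \<Longrightarrow> J (\<lambda>x. H x y) \<le> ennreal (W y powr p) * R"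
  shows "J G \<le> ennreal_powr (\<integral>\<^sup>+y. ennreal (W y) * k y \<partial>N) p * R"
proof -
  let ?H = "\<lambda>x y. ennreal (cmod (H x y) / v x / W y)"
  have [measurable]: "(\<lambda>y. H x y) \<in> borel_measurable N" for x
    using measurable_Pair2[of "case_prod H" borel N borel x] by simp
  have "J G \<le> (\<integral>\<^sup>+x. ennreal_powr (\<integral>\<^sup>+y. ?H x y * (ennreal (W y) * k y) \<partial>N) p \<partial>lborel)"
    unfolding weighted_power_def
  proof (rule nn_integral_mono_AE)
    show "AE x in lborel. ennreal_powr (ennreal (cmod (G x) / v x)) p \<le> ennreal_powr (\<integral>\<^sup>+y. ?H x y * (ennreal (W y) * k y) \<partial>N) p"
      using G
    proof eventually_elim
      case (elim x)
      have "ennreal (cmod (G x) / v x) = ennreal (cmod (G x)) * ennreal (1 / v x)"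
        using v_pos[of x] by (subst ennreal_mult[symmetric]) auto
      also have "\<dots> \<le> (\<integral>\<^sup>+y. ennreal (cmod (H x y)) * k y \<partial>N) * ennreal (1 / v x)"
        using elim by (intro mult_right_mono) auto
      also have "\<dots> = (\<integral>\<^sup>+y. ennreal (cmod (H x y)) * k y * ennreal (1 / v x) \<partial>N)"
        by (rule nn_integral_multc[symmetric]) measurable
      also have "\<dots> = (\<integral>\<^sup>+y. ?H x y * (ennreal (W y) * k y) \<partial>N)"
      proof (intro nn_integral_cong)
        fix y assume "y \<in> space N"
        then have "ennreal (cmod (H x y)) * ennreal (1 / v x) = ?H x y * ennreal (W y)"
          using v_pos[of x] W[of y] by (subst (1 2) ennreal_mult[symmetric]) auto
        then show "ennreal (cmod (H x y)) * k y * ennreal (1 / v x) = ?H x y * (ennreal (W y) * k y)"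
          by (metis mult.assoc mult.commute)
      qed
      finally show ?case using p by (intro ennreal_powr_mono) auto
    qed
  qed
  also have "\<dots> \<le> ennreal_powr (\<integral>\<^sup>+y. ennreal (W y) * k y \<partial>N) p * R"
  proof (rule nn_integral_minkowski_powr[OF p _ N])
    show "sigma_finite_measure (lborel :: (real^'d) measure)" by (rule sigma_finite_lborel)
    fix y assume y: "y \<in> space N"
    have [measurable]: "(\<lambda>x. H x y) \<in> borel_measurable borel"
      using measurable_Pair1[of "case_prod H" borel N borel y] y by simp
    have "?H x y = ennreal (cmod (H x y) / v x) * ennreal (1 / W y)" for x
      using v_pos[of x] W[OF y] by (subst ennreal_mult[symmetric]) auto
    then have "(\<integral>\<^sup>+x. ennreal_powr (?H x y) p \<partial>lborel) = (\<integral>\<^sup>+x. ennreal_powr (ennreal (cmod (H x y) / v x)) p * ennreal ((1 / W y) powr p) \<partial>lborel)"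
      using p W[OF y] by (simp add: ennreal_powr_mult)
    also have "\<dots> = J (\<lambda>x. H x y) * ennreal ((1 / W y) powr p)"
      unfolding weighted_power_def by (rule nn_integral_multc) measurable
    also have "\<dots> \<le> ennreal (W y powr p) * R * ennreal ((1 / W y) powr p)"
      by (intro mult_right_mono H[OF y]) auto
    also have "\<dots> = R * (ennreal (W y powr p) * ennreal ((1 / W y) powr p))" by (simp add: mult_ac)
    also have "ennreal (W y powr p) * ennreal ((1 / W y) powr p) = 1"
      using W[OF y] by (simp add: ennreal_mult[symmetric] powr_mult[symmetric])
    finally show "(\<integral>\<^sup>+x. ennreal_powr (?H x y) p \<partial>lborel) \<le> R" by simp
  qed measurable
  finally show ?thesis .
qed

lemma abs_convolution_bound:
  fixes F :: "real^'d \<Rightarrow> complex" and k :: "real^'d \<Rightarrow> ennreal"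
  assumes [measurable]: "F \<in> borel_measurable borel" "k \<in> borel_measurable borel"
    and G: "AE x in lborel. ennreal (cmod (G x)) \<le> (\<integral>\<^sup>+y. ennreal (cmod (F (x - y))) * k y \<partial>lborel)"
  shows "J G \<le> ennreal_powr (\<integral>\<^sup>+y. ennreal (c * (1 + norm y) powr \<alpha>) * k y \<partial>lborel) p * J F"
proof (rule J_minkowski[OF sigma_finite_lborel, where H="\<lambda>x y. F (x - y)"])
  show "J (\<lambda>x. F (x - y)) \<le> ennreal ((c * (1 + norm y) powr \<alpha>) powr p) * J F" for y
    using J_translate[of F "- y"] by simp
qed (use G c in \<open>auto simp: add_pos_nonneg intro!: mult_pos_pos\<close>)

text \<open>By Minkowski's inequality the integral is finite for almost every \<open>x\<close>, hence for some \<open>x\<close>; Peetre's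
  inequality for the kernel carries finiteness to all other points.\<close>

lemma convolution_integrable_everywhere:
  fixes F :: "real^'d \<Rightarrow> complex"
  assumes [measurable]: "F \<in> borel_measurable borel" and F: "J F < \<infinity>" and s: "\<alpha> + real CARD('d) < s"
  shows "(\<integral>\<^sup>+y. ennreal (cmod (F (x - y))) * ennreal ((1 + norm y) powr (- s)) \<partial>lborel) < \<infinity>"
proof -
  define k where "k y = ennreal ((1 + norm y) powr (- s))" for y :: "real^'d"
  have [measurable]: "k \<in> borel_measurable borel" unfolding k_def by measurable
  define G where "G x = (\<integral>\<^sup>+y. ennreal (cmod (F (x - y))) * k y \<partial>lborel)" for x
  have [measurable]: "G \<in> borel_measurable borel" unfolding G_def by measurable
  have I: "(\<integral>\<^sup>+y. ennreal (c * (1 + norm y) powr \<alpha>) * k y \<partial>(lborel :: (real^'d) measure)) < \<infinity>"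
  proof -
    have "(\<integral>\<^sup>+y. ennreal (c * (1 + norm y) powr \<alpha>) * k y \<partial>(lborel :: (real^'d) measure))
      = (\<integral>\<^sup>+y. ennreal c * ennreal ((1 + norm y) powr (- (s - \<alpha>))) \<partial>(lborel :: (real^'d) measure))"
      unfolding k_def using c
      by (intro nn_integral_cong) (simp add: ennreal_mult[symmetric] powr_add[symmetric] mult.assoc)
    also have "\<dots> = ennreal c * (\<integral>\<^sup>+y. ennreal ((1 + norm y) powr (- (s - \<alpha>))) \<partial>(lborel :: (real^'d) measure))"
      by (rule nn_integral_cmult) measurable
    finally show ?thesis using nn_integral_decay[where 'd='d, of "s - \<alpha>"] s by (simp add: ennreal_mult_less_top)
  qed
  have "(\<integral>\<^sup>+x. ennreal_powr (\<integral>\<^sup>+y. ennreal (cmod (F (x - y)) / v (x - y)) * (ennreal (c * (1 + norm y) powr \<alpha>) * k y) \<partial>lborel) p \<partial>lborel)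
     \<le> ennreal_powr (\<integral>\<^sup>+y. ennreal (c * (1 + norm y) powr \<alpha>) * k y \<partial>lborel) p * J F" (is "?L \<le> _")
  proof (rule nn_integral_minkowski_powr[OF p sigma_finite_lborel sigma_finite_lborel])
    show "(\<integral>\<^sup>+x. ennreal_powr (ennreal (cmod (F (x - y)) / v (x - y))) p \<partial>lborel) \<le> J F" for y
      using nn_integral_translate[of "\<lambda>x. ennreal_powr (ennreal (cmod (F x) / v x)) p" "- y"]
      by (simp add: weighted_power_def)
  qed measurable
  also have "\<dots> < \<infinity>" using I F by (simp add: ennreal_mult_less_top)
  finally have L: "?L < \<infinity>" .
  have fin: "AE x in lborel. ennreal_powr (\<integral>\<^sup>+y. ennreal (cmod (F (x - y)) / v (x - y)) * (ennreal (c * (1 + norm y) powr \<alpha>) * k y) \<partial>lborel) p \<noteq> \<infinity>"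
    using L by (intro nn_integral_PInf_AE) auto
  have nontrivial: "ae_filter (lborel :: (real^'d) measure) \<noteq> bot"
    by (simp add: ae_filter_eq_bot_iff)
  obtain x0 where x0: "(\<integral>\<^sup>+y. ennreal (cmod (F (x0 - y)) / v (x0 - y)) * (ennreal (c * (1 + norm y) powr \<alpha>) * k y) \<partial>lborel) < \<infinity>"
    using eventually_happens'[OF nontrivial fin] by (auto simp: less_top)
  have "G x0 \<le> (\<integral>\<^sup>+y. ennreal (v x0) * (ennreal (cmod (F (x0 - y)) / v (x0 - y)) * (ennreal (c * (1 + norm y) powr \<alpha>) * k y)) \<partial>lborel)"
    unfolding G_def
  proof (rule nn_integral_mono)
    fix y
    have "v (x0 - y) \<le> c * (1 + norm y) powr \<alpha> * v x0" using v_add[of "- y" x0] by simp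
    then have "cmod (F (x0 - y)) / v (x0 - y) * v (x0 - y) \<le> cmod (F (x0 - y)) / v (x0 - y) * (c * (1 + norm y) powr \<alpha> * v x0)"
      using v_pos by (intro mult_left_mono) (auto simp: less_imp_le)
    then have "cmod (F (x0 - y)) \<le> v x0 * (cmod (F (x0 - y)) / v (x0 - y) * (c * (1 + norm y) powr \<alpha>))"
      using v_pos[of "x0 - y"] by (simp add: field_simps)
    then have "ennreal (cmod (F (x0 - y))) \<le> ennreal (v x0) * (ennreal (cmod (F (x0 - y)) / v (x0 - y)) * ennreal (c * (1 + norm y) powr \<alpha>))"
      using v_pos c by (simp add: ennreal_mult[symmetric] less_imp_le ennreal_leI)
    then show "ennreal (cmod (F (x0 - y))) * k y \<le> ennreal (v x0) * (ennreal (cmod (F (x0 - y)) / v (x0 - y)) * (ennreal (c * (1 + norm y) powr \<alpha>) * k y))"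
      by (metis mult.assoc mult_right_mono zero_le)
  qed
  also have "\<dots> < \<infinity>" using x0 by (subst nn_integral_cmult) (auto simp: ennreal_mult_less_top)
  finally have G0: "G x0 < \<infinity>" .
  have s0: "0 \<le> s" using s \<alpha> of_nat_0_le_iff[of "CARD('d)", where 'a=real] by linarith
  have refl: "(\<integral>\<^sup>+y. g (x - y) \<partial>lborel) = (\<integral>\<^sup>+y. g y \<partial>lborel)" if [measurable]: "g \<in> borel_measurable borel" for g :: "real^'d \<Rightarrow> ennreal" and x
    by (rule nn_integral_reflect) measurable
  have "G x = (\<integral>\<^sup>+y. ennreal (cmod (F y)) * k (x - y) \<partial>lborel)" for x
    unfolding G_def using refl[of "\<lambda>y. ennreal (cmod (F y)) * k (x - y)" x] by simp
  note Geq = this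
  have "G x \<le> (\<integral>\<^sup>+y. ennreal ((1 + norm (x0 - x)) powr s) * (ennreal (cmod (F y)) * k (x0 - y)) \<partial>lborel)"
    unfolding Geq
  proof (rule nn_integral_mono)
    fix y
    have "(1 + norm (x - y)) powr (- s) \<le> (1 + norm (x0 - x)) powr s * (1 + norm ((x - y) + (x0 - x))) powr (- s)"
      by (rule decay_peetre[OF s0])
    then have "k (x - y) \<le> ennreal ((1 + norm (x0 - x)) powr s) * k (x0 - y)"
      unfolding k_def by (simp add: ennreal_mult[symmetric] ennreal_leI)
    then show "ennreal (cmod (F y)) * k (x - y) \<le> ennreal ((1 + norm (x0 - x)) powr s) * (ennreal (cmod (F y)) * k (x0 - y))"
      by (metis mult.left_commute mult_left_mono zero_le)
  qed
  also have "\<dots> = ennreal ((1 + norm (x0 - x)) powr s) * G x0"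
    unfolding Geq by (rule nn_integral_cmult) measurable
  also have "\<dots> < \<infinity>" using G0 by (simp add: ennreal_mult_less_top)
  finally show ?thesis unfolding G_def k_def .
qed

lemma J_step_sum:
  assumes [measurable]: "G \<in> borel_measurable borel"
  shows "J (step_sum m h G) \<le> ennreal ((real m * (c * (1 + real m * norm h) powr \<alpha>)) powr p) * J G"
proof -
  let ?N = "count_space {..<m}" and ?U = "c * (1 + real m * norm h) powr \<alpha>"
  have "1 + real m * norm h \<noteq> 0" by (smt (verit) mult_nonneg_nonneg norm_ge_zero of_nat_0_le_iff)
  then have U: "0 < ?U" using c by simp
  have "J (step_sum m h G) \<le> ennreal_powr (\<integral>\<^sup>+i. ennreal ?U * 1 \<partial>?N) p * J G"
  proof (rule J_minkowski[where H="\<lambda>x i. G (x + real i *\<^sub>R h)"])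
    show "sigma_finite_measure ?N" by (rule sigma_finite_measure_count_space_finite) simp
    show "AE x in lborel. ennreal (cmod (step_sum m h G x)) \<le> (\<integral>\<^sup>+i. ennreal (cmod (G (x + real i *\<^sub>R h))) * 1 \<partial>?N)"
    proof (rule AE_I2)
      fix x
      have "cmod (step_sum m h G x) \<le> (\<Sum>i<m. cmod (G (x + real i *\<^sub>R h)))"
        unfolding step_sum_def by (rule norm_sum)
      then show "ennreal (cmod (step_sum m h G x)) \<le> (\<integral>\<^sup>+i. ennreal (cmod (G (x + real i *\<^sub>R h))) * 1 \<partial>?N)"
        by (simp add: nn_integral_count_space_finite sum_ennreal ennreal_leI)
    qed
    fix i assume "i \<in> space ?N"
    then have "i < m" by simp
    have "J (\<lambda>x. G (x + real i *\<^sub>R h)) \<le> ennreal ((c * (1 + norm (real i *\<^sub>R h)) powr \<alpha>) powr p) * J G"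
      by (rule J_translate) measurable
    also have "\<dots> \<le> ennreal (?U powr p) * J G"
      using \<open>i < m\<close> c \<alpha> p
      by (intro mult_right_mono ennreal_leI powr_mono2 mult_left_mono) (auto intro!: mult_right_mono)
    finally show "J (\<lambda>x. G (x + real i *\<^sub>R h)) \<le> ennreal (?U powr p) * J G" .
  next
    have [measurable]: "real \<in> borel_measurable ?N" by simp
    show "(\<lambda>(x, i). G (x + real i *\<^sub>R h)) \<in> borel_measurable (borel \<Otimes>\<^sub>M ?N)" by measurable
  qed (use U in auto)
  also have "(\<integral>\<^sup>+i. ennreal ?U * 1 \<partial>?N) = ennreal (real m * ?U)"
    using U by (simp add: nn_integral_count_space_finite ennreal_mult ennreal_of_nat_eq_real_of_nat mult.commute)
  finally show ?thesis using U by simp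
qed

lemma J_step_sum_funpow:
  assumes [measurable]: "G \<in> borel_measurable borel"
  shows "J ((step_sum m h ^^ n) G) \<le> ennreal (((real m * (c * (1 + real m * norm h) powr \<alpha>)) ^ n) powr p) * J G"
proof (induction n)
  case (Suc n)
  let ?W = "real m * (c * (1 + real m * norm h) powr \<alpha>)"
  have W: "0 \<le> ?W" using c by simp
  have "J ((step_sum m h ^^ Suc n) G) \<le> ennreal (?W powr p) * J ((step_sum m h ^^ n) G)"
    using J_step_sum[of "(step_sum m h ^^ n) G" m h] by simp
  also have "\<dots> \<le> ennreal (?W powr p) * (ennreal ((?W ^ n) powr p) * J G)"
    by (intro mult_left_mono Suc) auto
  also have "\<dots> = ennreal ((?W ^ Suc n) powr p) * J G"
    using W by (simp add: mult.assoc[symmetric] ennreal_mult[symmetric] powr_mult)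
  finally show ?case .
qed (simp)

text \<open>A step \<open>t\<close> is \<open>m\<close> times a step of length less than one, with \<open>m\<close> at most of size
  \<open>1 + \<bar>t\<bar>\<close>. This gives \<open>n\<close> factors \<open>m\<close> and \<open>n\<close> factors from the growth of the weight.\<close>

lemma J_fin_diff_large:
  assumes [measurable]: "F \<in> borel_measurable borel"
    and small: "\<And>h. norm h < 1 \<Longrightarrow> J (fin_diff n h F) \<le> \<Omega>"
  shows "J (fin_diff n t F) \<le> ennreal (((c * (1 + norm t) powr (1 + \<alpha>)) ^ n) powr p) * \<Omega>"
proof -
  define m where "m = nat \<lfloor>norm t\<rfloor> + 1"
  have m: "0 < m" "norm t < real m" "real m \<le> 1 + norm t"
    unfolding m_def by (auto, linarith+)
  define h where "h = (1 / real m) *\<^sub>R t"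
  have h: "real m *\<^sub>R h = t" "norm h < 1" "real m * norm h = norm t" using m by (auto simp: h_def)
  have "J (fin_diff n t F) \<le> ennreal (((real m * (c * (1 + norm t) powr \<alpha>)) ^ n) powr p) * J (fin_diff n h F)"
    using J_step_sum_funpow[of "fin_diff n h F" n m h] by (simp add: fin_diff_multiple_step[symmetric] h)
  also have "\<dots> \<le> ennreal (((c * (1 + norm t) powr (1 + \<alpha>)) ^ n) powr p) * \<Omega>"
  proof (intro mult_mono ennreal_leI small h(2))
    have "real m * (c * (1 + norm t) powr \<alpha>) \<le> (1 + norm t) * (c * (1 + norm t) powr \<alpha>)"
      using m c by (intro mult_right_mono) auto
    also have "\<dots> = c * (1 + norm t) powr (1 + \<alpha>)" by (simp add: powr_add)
    finally have "real m * (c * (1 + norm t) powr \<alpha>) \<le> c * (1 + norm t) powr (1 + \<alpha>)" .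
    then have "(real m * (c * (1 + norm t) powr \<alpha>)) ^ n \<le> (c * (1 + norm t) powr (1 + \<alpha>)) ^ n"
      using c by (intro power_mono) auto
    then show "((real m * (c * (1 + norm t) powr \<alpha>)) ^ n) powr p \<le> ((c * (1 + norm t) powr (1 + \<alpha>)) ^ n) powr p"
      using c p by (intro powr_mono2) auto
  qed auto
  finally show ?thesis .
qed

end

lemma cis_measurable [measurable]: "cis \<in> borel_measurable borel"
  by (intro borel_measurable_continuous_onI continuous_intros)

section \<open>Taylor remainders and vanishing moments\<close>

text \<open>The density of the integral form of Taylor's remainder of order \<open>n\<close>.\<close>

definition taylor_weight :: "nat \<Rightarrow> real \<Rightarrow> real" where
  "taylor_weight n t = indicator {0..1} t * ((1 - t) ^ (n - 1) / fact (n - 1))"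

lemma taylor_weight_measurable [measurable]: "taylor_weight n \<in> borel_measurable borel"
  unfolding taylor_weight_def by measurable

lemma taylor_weight_bounds: "0 \<le> taylor_weight n t" "taylor_weight n t \<le> indicator {0..1} t"
proof -
  have "(1 - t) ^ (n - 1) / fact (n - 1) \<le> 1" if "0 \<le> t" "t \<le> 1"
  proof -
    have "(1 - t) ^ (n - 1) \<le> 1" using that by (intro power_le_one) auto
    also have "1 \<le> (fact (n - 1) :: real)" by (rule fact_ge_1)
    finally show ?thesis by (simp add: divide_le_eq)
  qed
  then show "taylor_weight n t \<le> indicator {0..1} t" by (simp add: taylor_weight_def indicator_def)
  show "0 \<le> taylor_weight n t" by (simp add: taylor_weight_def indicator_def)
qed

lemma integrable_indicator_01: "integrable lborel (\<lambda>t::real. indicator {0..1} t :: real)"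
  by (rule integrable_real_indicator) auto

lemma integrable_taylor_weight: "integrable lborel (taylor_weight n)"
  by (rule Bochner_Integration.integrable_bound[OF integrable_indicator_01])
     (use taylor_weight_bounds in \<open>auto intro!: AE_I2 simp: abs_of_nonneg\<close>)

lemma nn_integral_taylor_weight_le: "(\<integral>\<^sup>+t. ennreal (taylor_weight n t) \<partial>lborel) \<le> 1"
proof -
  have "(\<integral>\<^sup>+t. ennreal (taylor_weight n t) \<partial>lborel) \<le> (\<integral>\<^sup>+t. indicator {0..1::real} t \<partial>lborel)"
    by (intro nn_integral_mono) (metis ennreal_indicator ennreal_leI taylor_weight_bounds(2))
  then show ?thesis by simp
qed

lemma cis_taylor_remainder:
  assumes "1 \<le> n"
  shows "cis x = (\<Sum>l<n. (\<i> * of_real x) ^ l / fact l)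
    + (\<i> * of_real x) ^ n * (\<integral>t. taylor_weight n t *\<^sub>R cis (t * x) \<partial>lborel)"
proof -
  define D where "D m t = (\<i> * of_real x) ^ m * cis (t * x)" for m and t :: real
  have der: "(D m has_vector_derivative D (Suc m) t) (at t within S)" for m t S
  proof -
    have "((\<lambda>t. cis (t * x)) has_vector_derivative \<i> * of_real x * cis (t * x)) (at t within S)"
    proof -
      have "((\<lambda>z. exp (\<i> * of_real x * z)) has_field_derivative \<i> * of_real x * exp (\<i> * of_real x * of_real t)) (at (of_real t))"
        by (auto intro!: derivative_eq_intros)
      from has_vector_derivative_real_field[OF this, of S] show ?thesis
        by (simp add: cis_conv_exp mult_ac)
    qed
    from has_vector_derivative_mult_right[OF this, of "(\<i> * of_real x) ^ m"]
    show ?thesis unfolding D_def by (simp add: mult_ac)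
  qed
  define g where "g t = ((1 - t) ^ (n - 1) / fact (n - 1)) *\<^sub>R D n t" for t :: real
  have g: "(g has_integral D 0 1 - (\<Sum>i<n. ((1 - 0) ^ i / fact i) *\<^sub>R D i 0)) {0..1}"
    unfolding g_def[abs_def] using assms der by (intro Taylor_has_integral[where f="D 0" and Df=D]) auto
  have "continuous_on {0..1} g" unfolding g_def D_def by (intro continuous_intros) auto
  then have "(LINT t:{0..1}|lborel. g t) = integral {0..1} g"
    by (intro set_borel_integral_eq_integral(2) borel_integrable_atLeastAtMost')
  also have "\<dots> = D 0 1 - (\<Sum>i<n. ((1 - 0) ^ i / fact i) *\<^sub>R D i 0)" using g by (rule integral_unique)
  finally have "D 0 1 = (\<Sum>i<n. ((1 - 0) ^ i / fact i) *\<^sub>R D i 0) + (LINT t:{0..1}|lborel. g t)" by simp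
  moreover have "(\<Sum>i<n. ((1 - 0) ^ i / fact i) *\<^sub>R D i 0) = (\<Sum>l<n. (\<i> * of_real x) ^ l / fact l)"
    by (intro sum.cong refl) (simp add: D_def scaleR_conv_of_real)
  moreover have "(LINT t:{0..1}|lborel. g t) = (\<i> * of_real x) ^ n * (\<integral>t. taylor_weight n t *\<^sub>R cis (t * x) \<partial>lborel)"
  proof -
    have "(LINT t:{0..1}|lborel. g t) = (\<integral>t. (\<i> * of_real x) ^ n * (taylor_weight n t *\<^sub>R cis (t * x)) \<partial>lborel)"
      unfolding set_lebesgue_integral_def g_def D_def taylor_weight_def
      by (intro Bochner_Integration.integral_cong refl) (simp add: scaleR_conv_of_real mult_ac)
    then show ?thesis by (simp only: integral_mult_right_zero)
  qed
  ultimately show ?thesis by (simp add: D_def)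
qed

text \<open>The lowest nonzero coefficient would dominate as \<open>s\<close> tends to zero.\<close>

lemma polynomial_small_imp_zero:
  fixes m :: "nat \<Rightarrow> complex"
  assumes "0 < s0" and "\<And>s. 0 < s \<Longrightarrow> s \<le> s0 \<Longrightarrow> cmod (\<Sum>l<n. of_real s ^ l * m l) \<le> C * s ^ n"
    and "l < n"
  shows "m l = 0"
  using assms(2,3)
proof (induction n arbitrary: m l)
  case (Suc n)
  have le: "cmod (m 0 + of_real s * (\<Sum>l<n. of_real s ^ l * m (Suc l))) \<le> C * s ^ Suc n" if "0 < s" "s \<le> s0" for s
  proof -
    have "(\<Sum>l<Suc n. of_real s ^ l * m l) = m 0 + of_real s * (\<Sum>l<n. of_real s ^ l * m (Suc l))"
      by (subst sum.lessThan_Suc_shift) (simp add: sum_distrib_left mult.assoc)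
    then show ?thesis using Suc.prems(1)[OF that] by (simp only:)
  qed
  have m0: "m 0 = 0"
  proof -
    have "((\<lambda>s. cmod (m 0 + of_real s * (\<Sum>l<n. of_real s ^ l * m (Suc l)))) \<longlongrightarrow>
        cmod (m 0 + of_real 0 * (\<Sum>l<n. of_real 0 ^ l * m (Suc l)))) (at_right 0)"
      by (intro tendsto_intros)
    moreover have "((\<lambda>s. C * s ^ Suc n) \<longlongrightarrow> C * 0 ^ Suc n) (at_right (0::real))"
      by (intro tendsto_intros)
    moreover have "\<forall>\<^sub>F s in at_right 0. cmod (m 0 + of_real s * (\<Sum>l<n. of_real s ^ l * m (Suc l))) \<le> C * s ^ Suc n"
      unfolding eventually_at_right_field using le \<open>0 < s0\<close> by (intro exI[of _ s0]) auto
    ultimately have "cmod (m 0 + of_real 0 * (\<Sum>l<n. of_real 0 ^ l * m (Suc l))) \<le> C * 0 ^ Suc n"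
      using tendsto_le[of "at_right (0::real)"] trivial_limit_at_right_real by blast
    then show ?thesis by simp
  qed
  show ?case
  proof (cases l)
    case (Suc l')
    have "cmod (\<Sum>l<n. of_real s ^ l * m (Suc l)) \<le> C * s ^ n" if "0 < s" "s \<le> s0" for s
    proof -
      have "s * cmod (\<Sum>l<n. of_real s ^ l * m (Suc l)) \<le> s * (C * s ^ n)"
        using le[OF that] that by (simp add: m0 norm_mult mult_ac)
      then show ?thesis using that by simp
    qed
    from Suc.IH[OF this, of l'] show ?thesis using Suc Suc.prems(2) by simp
  qed (use m0 in simp)
qed simp

text \<open>A constant that is finite for \<open>r\<close> above the dimension; a name for it keeps the bounds readable
  and uniform in the weight.\<close>

definition decay_integral :: "(real^'d) itself \<Rightarrow> real \<Rightarrow> ennreal" where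
  "decay_integral _ r = (\<integral>\<^sup>+x. ennreal ((1 + norm x) powr (- r)) \<partial>(lborel :: (real^'d) measure))"

lemma decay_integral_finite: "real CARD('d) < r \<Longrightarrow> decay_integral TYPE(real^'d) r < \<infinity>"
  unfolding decay_integral_def by (rule nn_integral_decay)

lemma decay_powr:
  assumes "cmod z * (1 + norm x) ^ N \<le> A"
  shows "cmod z \<le> A * (1 + norm x) powr (- real N)"
proof -
  have "(1 + norm x) powr (- real N) = 1 / (1 + norm x) ^ N"
    by (simp add: powr_minus powr_realpow divide_inverse)
  then have "(1 + norm x) ^ N * (1 + norm x) powr (- real N) = 1" by simp
  then have "cmod z = cmod z * (1 + norm x) ^ N * (1 + norm x) powr (- real N)" by (simp add: mult.assoc)
  also have "\<dots> \<le> A * (1 + norm x) powr (- real N)" by (rule mult_right_mono[OF assms]) simp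
  finally show ?thesis .
qed

lemma nn_integral_decay_weight:
  fixes k :: "real^'d \<Rightarrow> complex"
  assumes [measurable]: "k \<in> borel_measurable borel"
    and A: "\<And>x. cmod (k x) * (1 + norm x) ^ N \<le> A" and C: "0 \<le> C"
  shows "(\<integral>\<^sup>+x. ennreal (C * (1 + norm x) powr r) * ennreal (cmod (k x)) \<partial>lborel)
    \<le> ennreal (C * A) * decay_integral TYPE(real^'d) (real N - r)"
proof -
  have A0: "0 \<le> A" by (rule order_trans[OF _ A[of 0]]) simp
  have "(\<integral>\<^sup>+x. ennreal (C * (1 + norm x) powr r) * ennreal (cmod (k x)) \<partial>lborel)
    \<le> (\<integral>\<^sup>+x. ennreal (C * A) * ennreal ((1 + norm x) powr (- (real N - r))) \<partial>(lborel :: (real^'d) measure))"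
  proof (intro nn_integral_mono)
    fix x :: "real^'d"
    have "C * (1 + norm x) powr r * cmod (k x) \<le> C * (1 + norm x) powr r * (A * (1 + norm x) powr (- real N))"
      using C decay_powr[OF A] by (intro mult_left_mono) auto
    also have "\<dots> = C * A * (1 + norm x) powr (- (real N - r))"
      by (simp add: powr_add[symmetric] mult_ac)
    finally show "ennreal (C * (1 + norm x) powr r) * ennreal (cmod (k x)) \<le> ennreal (C * A) * ennreal ((1 + norm x) powr (- (real N - r)))"
      using C A0 by (simp add: ennreal_mult[symmetric] ennreal_leI)
  qed
  also have "\<dots> = ennreal (C * A) * decay_integral TYPE(real^'d) (real N - r)"
    unfolding decay_integral_def by (rule nn_integral_cmult) measurable
  finally show ?thesis .
qed

lemma integrable_decay:
  fixes k :: "real^'d \<Rightarrow> complex"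
  assumes [measurable]: "k \<in> borel_measurable borel"
    and A: "\<And>x. cmod (k x) * (1 + norm x) ^ N \<le> A" and r: "real CARD('d) + real l < real N"
  shows "integrable lborel (\<lambda>x. (norm x) ^ l * cmod (k x))"
proof (rule integrableI_bounded)
  have "(\<integral>\<^sup>+x. ennreal (norm (norm x ^ l * cmod (k x))) \<partial>lborel)
    \<le> (\<integral>\<^sup>+x. ennreal (1 * (1 + norm x) powr real l) * ennreal (cmod (k x)) \<partial>lborel)"
    by (intro nn_integral_mono)
       (auto simp: ennreal_mult[symmetric] powr_realpow intro!: ennreal_leI mult_right_mono power_mono)
  also have "\<dots> \<le> ennreal (1 * A) * decay_integral TYPE(real^'d) (real N - real l)"
    by (rule nn_integral_decay_weight[OF _ A]) auto
  also have "\<dots> < \<infinity>" using decay_integral_finite[where 'd='d, of "real N - real l"] r by (simp add: ennreal_mult_less_top)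
  finally show "(\<integral>\<^sup>+x. ennreal (norm (norm x ^ l * cmod (k x))) \<partial>lborel) < \<infinity>" .
qed measurable

lemma integrable_decay_0:
  fixes k :: "real^'d \<Rightarrow> complex"
  assumes [measurable]: "k \<in> borel_measurable borel"
    and A: "\<And>x. cmod (k x) * (1 + norm x) ^ N \<le> A" and r: "real CARD('d) < real N"
  shows "integrable lborel k"
  using integrable_decay[OF assms(1) A, of 0] r by (simp add: integrable_norm_iff)

lemma inv_fourier_measurable [measurable]:
  assumes [measurable]: "b \<in> borel_measurable borel" shows "inv_fourier b \<in> borel_measurable borel"
  unfolding inv_fourier_def by measurable

lemma integrable_moment:
  fixes k :: "real^'d \<Rightarrow> complex"
  assumes [measurable]: "k \<in> borel_measurable borel"
    and A: "\<And>x. cmod (k x) * (1 + norm x) ^ N \<le> A" and r: "real CARD('d) + real l < real N"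
  shows "integrable lborel (\<lambda>x. k x * of_real (x \<bullet> \<xi>) ^ l)"
proof (rule Bochner_Integration.integrable_bound[of _ "\<lambda>x. norm \<xi> ^ l * ((norm x) ^ l * cmod (k x))"])
  show "integrable lborel (\<lambda>x. norm \<xi> ^ l * ((norm x) ^ l * cmod (k x)))"
    by (intro integrable_mult_right integrable_decay[OF _ A r]) measurable
  show "AE x in lborel. norm (k x * of_real (x \<bullet> \<xi>) ^ l) \<le> norm (norm \<xi> ^ l * ((norm x) ^ l * cmod (k x)))"
  proof (rule AE_I2)
    fix x
    have "\<bar>x \<bullet> \<xi>\<bar> ^ l \<le> (norm x * norm \<xi>) ^ l" by (intro power_mono Cauchy_Schwarz_ineq2) auto
    then have "cmod (k x) * \<bar>x \<bullet> \<xi>\<bar> ^ l \<le> cmod (k x) * (norm x * norm \<xi>) ^ l" by (intro mult_left_mono) auto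
    then show "norm (k x * of_real (x \<bullet> \<xi>) ^ l) \<le> norm (norm \<xi> ^ l * ((norm x) ^ l * cmod (k x)))"
      by (simp add: norm_mult norm_power power_mult_distrib mult_ac)
  qed
qed measurable

text \<open>Up to constants, the moments along \<open>\<xi>\<close> are the Taylor coefficients of \<open>s \<mapsto> b (s \<xi>)\<close>, by expansion of the
  character in the Fourier inversion formula; a function of size \<open>s\<^sup>n\<close> has none below order \<open>n\<close>.\<close>

lemma vanishing_moments:
  fixes b :: "real^'d \<Rightarrow> complex"
  assumes b: "continuous_on UNIV b" and supp: "\<And>\<xi>. r \<le> norm \<xi> \<Longrightarrow> b \<xi> = 0" and r: "r < 1 / 2"
    and A: "\<And>x. cmod (inv_fourier b x) * (1 + norm x) ^ N \<le> A" and N: "real CARD('d) + real n < real N"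
    and van: "\<And>\<xi>. norm \<xi> < \<rho> \<Longrightarrow> cmod (b \<xi>) \<le> K * norm \<xi> ^ n" and \<rho>: "0 < \<rho>" and n: "1 \<le> n" "l < n"
  shows "(\<integral>x. inv_fourier b x * of_real (x \<bullet> \<xi>) ^ l \<partial>lborel) = 0"
proof -
  have [measurable]: "b \<in> borel_measurable borel" using b by (rule borel_measurable_continuous_onI)
  let ?B = "inv_fourier b"
  have iB: "integrable lborel ?B" using N by (intro integrable_decay_0[OF _ A]) auto
  define m where "m l = (- 2 * pi * \<i>) ^ l / fact l * (\<integral>x. ?B x * of_real (x \<bullet> \<xi>) ^ l \<partial>lborel)" for l
  define M where "M = (\<integral>x. (norm x) ^ n * cmod (?B x) \<partial>lborel)"
  define s0 where "s0 = min (1/4) (\<rho> / 2) / (norm \<xi> + 1)"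
  have s0: "0 < s0" using \<rho> by (simp add: s0_def add_nonneg_pos)
  have small: "norm (s *\<^sub>R \<xi>) < 1 / 2" "norm (s *\<^sub>R \<xi>) < \<rho>" if "0 < s" "s \<le> s0" for s
  proof -
    have "norm (s *\<^sub>R \<xi>) \<le> s0 * (norm \<xi> + 1)" using that by (simp add: mult_mono)
    also have "\<dots> = min (1/4) (\<rho> / 2)" unfolding s0_def by (simp add: add_nonneg_pos less_imp_neq[symmetric])
    finally show "norm (s *\<^sub>R \<xi>) < 1 / 2" "norm (s *\<^sub>R \<xi>) < \<rho>" using \<rho> by auto
  qed
  have ii: "integrable lborel (\<lambda>x. ?B x * of_real (x \<bullet> \<xi>) ^ l)" if "l \<le> n" for l
    using N that by (intro integrable_moment[OF _ A]) auto
  have iM: "integrable lborel (\<lambda>x. (norm x) ^ n * cmod (?B x))"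
    using N by (intro integrable_decay[OF _ A]) auto
  have "cmod (\<Sum>l<n. of_real s ^ l * m l) \<le> (K * norm \<xi> ^ n + (2 * pi * norm \<xi>) ^ n * M) * s ^ n"
    if s: "0 < s" "s \<le> s0" for s
  proof -
    define R where "R x = cis (- (2 * pi * s * (x \<bullet> \<xi>))) - (\<Sum>l<n. (\<i> * of_real (- (2 * pi * s * (x \<bullet> \<xi>)))) ^ l / fact l)" for x :: "real^'d"
    have Rle: "cmod (R x) \<le> (2 * pi * norm \<xi>) ^ n * s ^ n * norm x ^ n" for x
    proof -
      let ?y = "- (2 * pi * s * (x \<bullet> \<xi>))"
      have "cmod (\<integral>t. taylor_weight n t *\<^sub>R cis (t * ?y) \<partial>lborel) \<le> (\<integral>t. norm (taylor_weight n t *\<^sub>R cis (t * ?y)) \<partial>lborel)"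
        by (rule integral_norm_bound)
      also have "\<dots> \<le> (\<integral>t. indicator {0..1::real} t \<partial>lborel)"
        using integrable_taylor_weight taylor_weight_bounds
        by (intro integral_mono integrable_indicator_01) (auto simp: abs_of_nonneg)
      finally have 1: "cmod (\<integral>t. taylor_weight n t *\<^sub>R cis (t * ?y) \<partial>lborel) \<le> 1" by simp
      have "R x = (\<i> * of_real ?y) ^ n * (\<integral>t. taylor_weight n t *\<^sub>R cis (t * ?y) \<partial>lborel)"
        unfolding R_def using cis_taylor_remainder[OF n(1), of ?y] by simp
      then have "cmod (R x) = \<bar>?y\<bar> ^ n * cmod (\<integral>t. taylor_weight n t *\<^sub>R cis (t * ?y) \<partial>lborel)"
        by (simp only: norm_mult norm_power norm_ii norm_of_real mult_1_left real_norm_def)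
      also have "\<dots> \<le> \<bar>?y\<bar> ^ n * 1" by (intro mult_left_mono 1) auto
      also have "\<dots> \<le> (2 * pi * s * (norm x * norm \<xi>)) ^ n * 1"
      proof (intro mult_right_mono power_mono)
        show "\<bar>?y\<bar> \<le> 2 * pi * s * (norm x * norm \<xi>)"
          using s Cauchy_Schwarz_ineq2[of x \<xi>] by (simp add: abs_mult)
      qed auto
      also have "\<dots> = (2 * pi * norm \<xi>) ^ n * s ^ n * norm x ^ n" by (simp add: power_mult_distrib mult_ac)
      finally show ?thesis .
    qed
    have [measurable]: "R \<in> borel_measurable borel" unfolding R_def by measurable
    have iR: "integrable lborel (\<lambda>x. ?B x * R x)"
    proof (rule Bochner_Integration.integrable_bound[OF integrable_mult_right[OF iM, of "(2 * pi * norm \<xi>) ^ n * s ^ n"]])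
      show "AE x in lborel. norm (?B x * R x) \<le> norm ((2 * pi * norm \<xi>) ^ n * s ^ n * (norm x ^ n * cmod (?B x)))"
        using mult_left_mono[OF Rle norm_ge_zero[of "?B _"]] s by (intro AE_I2) (simp add: norm_mult mult_ac abs_mult)
    qed measurable
    have expand: "(\<i> * of_real (- (2 * pi * s * (x \<bullet> \<xi>)))) ^ l / fact l
        = of_real s ^ l * ((- 2 * pi * \<i>) ^ l / fact l) * of_real (x \<bullet> \<xi>) ^ l" for l and x :: "real^'d"
    proof -
      have e: "\<i> * of_real (- (2 * pi * s * (x \<bullet> \<xi>))) = of_real s * (- 2 * pi * \<i>) * of_real (x \<bullet> \<xi>)" by simp
      show ?thesis unfolding e power_mult_distrib by (simp only: times_divide_eq_left times_divide_eq_right)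
    qed
    have "b (s *\<^sub>R \<xi>) = fourier_lborel ?B (s *\<^sub>R \<xi>)"
      using fourier_inversion_small_support[OF b supp r iB small(1)[OF s]] by simp
    also have "\<dots> = (\<integral>x. (\<Sum>l<n. of_real s ^ l * ((- 2 * pi * \<i>) ^ l / fact l) * (?B x * of_real (x \<bullet> \<xi>) ^ l)) + ?B x * R x \<partial>lborel)"
      unfolding fourier_lborel_def
    proof (rule Bochner_Integration.integral_cong[OF refl])
      fix x :: "real^'d"
      have "cnj (char x (s *\<^sub>R \<xi>)) = (\<Sum>l<n. of_real s ^ l * ((- 2 * pi * \<i>) ^ l / fact l) * of_real (x \<bullet> \<xi>) ^ l) + R x"
        unfolding R_def expand[symmetric] by (simp add: char_def cis_cnj mult_ac)
      then show "?B x * cnj (char x (s *\<^sub>R \<xi>)) = (\<Sum>l<n. of_real s ^ l * ((- 2 * pi * \<i>) ^ l / fact l) * (?B x * of_real (x \<bullet> \<xi>) ^ l)) + ?B x * R x"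
        by (simp add: distrib_left sum_distrib_left mult_ac)
    qed
    also have "\<dots> = (\<Sum>l<n. of_real s ^ l * ((- 2 * pi * \<i>) ^ l / fact l) * (\<integral>x. ?B x * of_real (x \<bullet> \<xi>) ^ l \<partial>lborel)) + (\<integral>x. ?B x * R x \<partial>lborel)"
      using ii iR by (subst Bochner_Integration.integral_add) (auto intro!: Bochner_Integration.integrable_sum)
    also have "\<dots> = (\<Sum>l<n. of_real s ^ l * m l) + (\<integral>x. ?B x * R x \<partial>lborel)" by (simp add: m_def mult.assoc)
    finally have "(\<Sum>l<n. of_real s ^ l * m l) = b (s *\<^sub>R \<xi>) - (\<integral>x. ?B x * R x \<partial>lborel)" by simp
    then have "cmod (\<Sum>l<n. of_real s ^ l * m l) \<le> cmod (b (s *\<^sub>R \<xi>)) + cmod (\<integral>x. ?B x * R x \<partial>lborel)"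
      using norm_triangle_ineq4 by metis
    also have "cmod (b (s *\<^sub>R \<xi>)) \<le> K * norm \<xi> ^ n * s ^ n"
      using van[OF small(2)[OF s]] s by (simp add: power_mult_distrib mult_ac)
    also have "cmod (\<integral>x. ?B x * R x \<partial>lborel) \<le> (\<integral>x. cmod (?B x * R x) \<partial>lborel)" by (rule integral_norm_bound)
    also have "\<dots> \<le> (\<integral>x. (2 * pi * norm \<xi>) ^ n * s ^ n * (norm x ^ n * cmod (?B x)) \<partial>lborel)"
      using iR iM mult_left_mono[OF Rle norm_ge_zero[of "?B _"]]
      by (intro integral_mono integrable_norm integrable_mult_right) (auto simp: norm_mult mult_ac)
    also have "\<dots> = (2 * pi * norm \<xi>) ^ n * s ^ n * M" unfolding M_def by simp
    finally show ?thesis by (simp add: algebra_simps)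
  qed
  from polynomial_small_imp_zero[OF s0 this n(2)] show ?thesis
    unfolding m_def by simp
qed

section \<open>Dilations\<close>

lemma integral_scale:
  fixes g :: "real^'d \<Rightarrow> complex"
  assumes [measurable]: "g \<in> borel_measurable borel" and r: "0 < r"
  shows "(\<integral>x. g (r *\<^sub>R x) \<partial>lborel) = of_real (1 / r ^ CARD('d)) * (\<integral>x. g x \<partial>lborel)"
    and "integrable lborel g \<Longrightarrow> integrable lborel (\<lambda>x. g (r *\<^sub>R x))"
proof -
  have L: "(lborel :: (real^'d) measure) = density (distr lborel borel (\<lambda>x. r *\<^sub>R x)) (\<lambda>_. ennreal (r ^ CARD('d)))"
    using lborel_affine[of r "0 :: real^'d"] r by simp
  have "(\<integral>x. g x \<partial>lborel) = (\<integral>x. (r ^ CARD('d)) *\<^sub>R g x \<partial>distr lborel borel (\<lambda>x. r *\<^sub>R x))"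
    by (subst L, subst integral_density) (use r in auto)
  also have "\<dots> = (\<integral>x. (r ^ CARD('d)) *\<^sub>R g (r *\<^sub>R x) \<partial>lborel)"
    by (rule integral_distr) auto
  finally show "(\<integral>x. g (r *\<^sub>R x) \<partial>lborel) = of_real (1 / r ^ CARD('d)) * (\<integral>x. g x \<partial>lborel)"
    using r by (simp add: scaleR_conv_of_real)
  assume "integrable lborel g"
  then have "integrable (distr lborel borel (\<lambda>x. r *\<^sub>R x)) (\<lambda>x. (r ^ CARD('d)) *\<^sub>R g x)"
    by (subst (asm) L, subst (asm) integrable_density) (use r in auto)
  then have "integrable lborel (\<lambda>x. (r ^ CARD('d)) *\<^sub>R g (r *\<^sub>R x))"
    by (subst (asm) integrable_distr_eq) auto
  then have "integrable lborel (\<lambda>x. (1 / r ^ CARD('d)) *\<^sub>R ((r ^ CARD('d)) *\<^sub>R g (r *\<^sub>R x)))"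
    by (rule integrable_scaleR_right)
  then show "integrable lborel (\<lambda>x. g (r *\<^sub>R x))" using r by simp
qed

lemma inv_fourier_scale:
  fixes b :: "real^'d \<Rightarrow> complex"
  assumes [measurable]: "b \<in> borel_measurable borel" and r: "0 < r"
  shows "inv_fourier (\<lambda>\<xi>. b (r *\<^sub>R \<xi>)) x = of_real (1 / r ^ CARD('d)) * inv_fourier b ((1 / r) *\<^sub>R x)"
proof -
  have "char x \<xi> = char ((1 / r) *\<^sub>R x) (r *\<^sub>R \<xi>)" for \<xi> :: "real^'d"
    using r by (simp add: char_def)
  then show ?thesis
    unfolding inv_fourier_def using integral_scale(1)[of "\<lambda>\<xi>. b \<xi> * char ((1 / r) *\<^sub>R x) \<xi>" r] r by simp
qed

section \<open>Convolution with differences\<close>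

definition convol :: "(real^'d \<Rightarrow> complex) \<Rightarrow> (real^'d \<Rightarrow> complex) \<Rightarrow> real^'d \<Rightarrow> complex" where
  "convol F k x = (\<integral>y. F (x - y) * k y \<partial>lborel)"

lemma convol_measurable [measurable]:
  assumes [measurable]: "F \<in> borel_measurable borel" "k \<in> borel_measurable borel"
  shows "convol F k \<in> borel_measurable borel"
  unfolding convol_def by measurable

text \<open>The coefficients of \<open>\<Delta>\<^sup>n\<close>.\<close>

definition diff_coeff :: "nat \<Rightarrow> nat \<Rightarrow> complex" where
  "diff_coeff n \<nu> = (-1) ^ \<nu> * of_nat (n choose \<nu>)"

text \<open>\<open>\<Delta>\<^sup>n\<close> applied to the step variable, without the term \<open>\<nu> = 0\<close>. The inverse transform of
  \<open>\<kappa> (\<nu> \<xi>)\<close> is that of \<open>\<kappa>\<close> dilated by \<open>\<nu>\<close>.\<close>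

definition diff_symbol :: "nat \<Rightarrow> (real^'d \<Rightarrow> complex) \<Rightarrow> real^'d \<Rightarrow> complex" where
  "diff_symbol n \<kappa> \<xi> = (\<Sum>\<nu>\<in>{1..n}. diff_coeff n \<nu> * \<kappa> (real \<nu> *\<^sub>R \<xi>))"

context moderate_weight
begin

lemma integrable_convolution:
  assumes [measurable]: "F \<in> borel_measurable borel" "k \<in> borel_measurable borel" and F: "J F < \<infinity>"
    and A: "\<And>x. cmod (k x) * (1 + norm x) ^ N \<le> A" and N: "\<alpha> + real CARD('d) < real N"
  shows "integrable lborel (\<lambda>y. F (x - y) * k y)"
proof (rule integrableI_bounded)
  have A0: "0 \<le> A" by (rule order_trans[OF _ A[of 0]]) simp
  have "(\<integral>\<^sup>+y. ennreal (norm (F (x - y) * k y)) \<partial>lborel)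
    \<le> (\<integral>\<^sup>+y. ennreal A * (ennreal (cmod (F (x - y))) * ennreal ((1 + norm y) powr (- real N))) \<partial>lborel)"
  proof (intro nn_integral_mono)
    fix y
    have "cmod (F (x - y)) * cmod (k y) \<le> cmod (F (x - y)) * (A * (1 + norm y) powr (- real N))"
      by (intro mult_left_mono decay_powr A) auto
    then show "ennreal (norm (F (x - y) * k y)) \<le> ennreal A * (ennreal (cmod (F (x - y))) * ennreal ((1 + norm y) powr (- real N)))"
      using A0 by (simp add: norm_mult ennreal_mult[symmetric] ennreal_leI mult_ac)
  qed
  also have "\<dots> = ennreal A * (\<integral>\<^sup>+y. ennreal (cmod (F (x - y))) * ennreal ((1 + norm y) powr (- real N)) \<partial>lborel)"
    by (rule nn_integral_cmult) measurable
  also have "\<dots> < \<infinity>"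
    using convolution_integrable_everywhere[OF assms(1) F N, of x] by (simp add: ennreal_mult_less_top)
  finally show "(\<integral>\<^sup>+y. ennreal (norm (F (x - y) * k y)) \<partial>lborel) < \<infinity>" .
qed measurable

lemma J_convol:
  assumes [measurable]: "F \<in> borel_measurable borel" "k \<in> borel_measurable borel"
    and A: "\<And>x. cmod (k x) * (1 + norm x) ^ N \<le> A"
  shows "J (convol F k) \<le> ennreal_powr (ennreal (c * A) * decay_integral TYPE(real^'d) (real N - \<alpha>)) p * J F"
proof -
  have "J (convol F k) \<le> ennreal_powr (\<integral>\<^sup>+y. ennreal (c * (1 + norm y) powr \<alpha>) * ennreal (cmod (k y)) \<partial>lborel) p * J F"
  proof (rule abs_convolution_bound)
    show "AE x in lborel. ennreal (cmod (convol F k x)) \<le> (\<integral>\<^sup>+y. ennreal (cmod (F (x - y))) * ennreal (cmod (k y)) \<partial>lborel)"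
    proof (rule AE_I2)
      fix x
      have "ennreal (cmod (convol F k x)) \<le> (\<integral>\<^sup>+y. ennreal (cmod (F (x - y) * k y)) \<partial>lborel)"
        unfolding convol_def by (cases "integrable lborel (\<lambda>y. F (x - y) * k y)")
          (auto intro: integral_norm_bound_ennreal simp: not_integrable_integral_eq)
      then show "ennreal (cmod (convol F k x)) \<le> (\<integral>\<^sup>+y. ennreal (cmod (F (x - y))) * ennreal (cmod (k y)) \<partial>lborel)"
        by (simp add: norm_mult ennreal_mult)
    qed
  qed measurable
  also have "\<dots> \<le> ennreal_powr (ennreal (c * A) * decay_integral TYPE(real^'d) (real N - \<alpha>)) p * J F"
    using c p by (intro mult_right_mono ennreal_powr_mono nn_integral_decay_weight[OF _ A]) auto
  finally show ?thesis .
qed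

text \<open>Minkowski's inequality, with the growth of large differences absorbed by the decay of \<open>\<eta>\<close>.\<close>

lemma J_difference_average:
  assumes [measurable]: "F \<in> borel_measurable borel" "\<eta> \<in> borel_measurable borel"
    and A: "\<And>x. cmod (\<eta> x) * (1 + norm x) ^ N \<le> A"
    and small: "\<And>h. norm h < 1 \<Longrightarrow> J (fin_diff n h F) \<le> \<Omega>"
  shows "J (\<lambda>x. \<integral>s. \<eta> s * fin_diff n (- s) F x \<partial>lborel)
    \<le> ennreal_powr (ennreal (c ^ n * A) * decay_integral TYPE(real^'d) (real N - real n * (1 + \<alpha>))) p * \<Omega>"
proof -
  have Weq: "(c * (1 + norm s) powr (1 + \<alpha>)) ^ n = c ^ n * (1 + norm s) powr (real n * (1 + \<alpha>))" for s :: "real^'d"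
    by (simp add: power_mult_distrib powr_power)
  have "J (\<lambda>x. \<integral>s. \<eta> s * fin_diff n (- s) F x \<partial>lborel)
    \<le> ennreal_powr (\<integral>\<^sup>+s. ennreal ((c * (1 + norm s) powr (1 + \<alpha>)) ^ n) * ennreal (cmod (\<eta> s)) \<partial>lborel) p * \<Omega>"
  proof (rule J_minkowski[OF sigma_finite_lborel, where H="\<lambda>x s. fin_diff n (- s) F x"])
    show "(\<lambda>(x, s). fin_diff n (- s) F x) \<in> borel_measurable (borel \<Otimes>\<^sub>M lborel)"
      unfolding fin_diff_def by measurable
    show "AE x in lborel. ennreal (cmod (\<integral>s. \<eta> s * fin_diff n (- s) F x \<partial>lborel))
        \<le> (\<integral>\<^sup>+s. ennreal (cmod (fin_diff n (- s) F x)) * ennreal (cmod (\<eta> s)) \<partial>lborel)"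
    proof (rule AE_I2)
      fix x
      have "ennreal (cmod (\<integral>s. \<eta> s * fin_diff n (- s) F x \<partial>lborel)) \<le> (\<integral>\<^sup>+s. ennreal (cmod (\<eta> s * fin_diff n (- s) F x)) \<partial>lborel)"
        by (cases "integrable lborel (\<lambda>s. \<eta> s * fin_diff n (- s) F x)")
          (auto intro: integral_norm_bound_ennreal simp: not_integrable_integral_eq)
      then show "ennreal (cmod (\<integral>s. \<eta> s * fin_diff n (- s) F x \<partial>lborel))
        \<le> (\<integral>\<^sup>+s. ennreal (cmod (fin_diff n (- s) F x)) * ennreal (cmod (\<eta> s)) \<partial>lborel)"
        by (simp add: norm_mult ennreal_mult mult.commute)
    qed
    show "J (fin_diff n (- s) F) \<le> ennreal (((c * (1 + norm s) powr (1 + \<alpha>)) ^ n) powr p) * \<Omega>" for s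
      using J_fin_diff_large[OF assms(1) small, where t="- s"] by simp
    show "0 < (c * (1 + norm s) powr (1 + \<alpha>)) ^ n" for s :: "real^'d" using c by simp
  qed measurable
  also have "\<dots> \<le> ennreal_powr (ennreal (c ^ n * A) * decay_integral TYPE(real^'d) (real N - real n * (1 + \<alpha>))) p * \<Omega>"
    unfolding Weq using c p by (intro mult_right_mono ennreal_powr_mono nn_integral_decay_weight[OF _ A]) auto
  finally show ?thesis .
qed

text \<open>Averaging \<open>\<Delta>\<^sub>-\<^sub>s\<^sup>n F\<close> over \<open>s\<close> with density \<open>inv_fourier \<kappa>\<close> produces \<open>F\<close> itself from
  \<open>\<nu> = 0\<close>, with the factor \<open>\<integral> inv_fourier \<kappa> = \<kappa> 0\<close>, and convolutions with dilated kernels from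
  the other terms.\<close>

lemma convol_diff_symbol:
  fixes \<kappa> :: "real^'d \<Rightarrow> complex"
  assumes [measurable]: "F \<in> borel_measurable borel" and F: "J F < \<infinity>"
    and \<kappa>: "continuous_on UNIV \<kappa>" and supp: "\<And>\<xi>. r \<le> norm \<xi> \<Longrightarrow> \<kappa> \<xi> = 0" and r: "r < 1 / 2"
    and A: "\<And>x. cmod (inv_fourier \<kappa> x) * (1 + norm x) ^ N \<le> A" and N: "\<alpha> + real CARD('d) < real N"
  shows "convol F (inv_fourier (diff_symbol n \<kappa>)) x
    = (\<integral>s. inv_fourier \<kappa> s * fin_diff n (- s) F x \<partial>lborel) - \<kappa> 0 * F x"
proof -
  have [measurable]: "\<kappa> \<in> borel_measurable borel" using \<kappa> by (rule borel_measurable_continuous_onI)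
  let ?\<eta> = "inv_fourier \<kappa>"
  have A0: "0 \<le> A" by (rule order_trans[OF _ A[of 0]]) simp
  have i\<eta>: "integrable lborel ?\<eta>" using N \<alpha> by (intro integrable_decay_0[OF _ A]) auto
  have int\<eta>: "(\<integral>s. ?\<eta> s \<partial>lborel) = \<kappa> 0"
    using fourier_inversion_small_support[OF \<kappa> supp r i\<eta>, of 0] by (simp add: fourier_lborel_def)
  have i\<kappa>: "integrable lborel \<kappa>"
  proof -
    have "bounded (\<kappa> ` cball 0 r)"
      using \<kappa> by (intro compact_imp_bounded compact_continuous_image) (auto intro: continuous_on_subset)
    then obtain B where B: "\<forall>y \<in> \<kappa> ` cball 0 r. norm y \<le> B" by (auto simp: bounded_iff)
    have "cmod (\<kappa> \<xi>) \<le> max 0 B" for \<xi>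
      using B supp[of \<xi>] by (cases "r \<le> norm \<xi>") (auto simp: le_max_iff_disj)
    then show ?thesis by (rule integrable_bounded_support(1)[rotated, where R=r]) (use supp in auto)
  qed
  define d where "d \<nu> = complex_of_real (1 / real \<nu> ^ CARD('d))" for \<nu> :: nat
  have K: "inv_fourier (diff_symbol n \<kappa>) y = (\<Sum>\<nu>\<in>{1..n}. diff_coeff n \<nu> * (d \<nu> * ?\<eta> ((1 / real \<nu>) *\<^sub>R y)))" for y
  proof -
    have "inv_fourier (diff_symbol n \<kappa>) y = (\<integral>\<xi>. (\<Sum>\<nu>\<in>{1..n}. diff_coeff n \<nu> * (\<kappa> (real \<nu> *\<^sub>R \<xi>) * char y \<xi>)) \<partial>lborel)"
      unfolding inv_fourier_def diff_symbol_def by (simp add: sum_distrib_right mult.assoc)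
    also have "\<dots> = (\<Sum>\<nu>\<in>{1..n}. diff_coeff n \<nu> * (\<integral>\<xi>. \<kappa> (real \<nu> *\<^sub>R \<xi>) * char y \<xi> \<partial>lborel))"
      using i\<kappa> by (subst Bochner_Integration.integral_sum)
        (auto intro!: integrable_mult_right integrable_mult_char integral_scale(2))
    also have "\<dots> = (\<Sum>\<nu>\<in>{1..n}. diff_coeff n \<nu> * (d \<nu> * ?\<eta> ((1 / real \<nu>) *\<^sub>R y)))"
      using inv_fourier_scale[of \<kappa> "real _" y] by (intro sum.cong refl) (simp add: inv_fourier_def[of "\<lambda>\<xi>. \<kappa> (_ *\<^sub>R \<xi>)"] d_def)
    finally show ?thesis .
  qed
  have sc: "integrable lborel (\<lambda>y. F (x - y) * ?\<eta> ((1 / real \<nu>) *\<^sub>R y))"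
      "(\<integral>y. F (x - y) * (d \<nu> * ?\<eta> ((1 / real \<nu>) *\<^sub>R y)) \<partial>lborel) = (\<integral>s. F (x - real \<nu> *\<^sub>R s) * ?\<eta> s \<partial>lborel)"
      "integrable lborel (\<lambda>s. F (x - real \<nu> *\<^sub>R s) * ?\<eta> s)" if "\<nu> \<in> {1..n}" for \<nu>
  proof -
    have \<nu>: "1 \<le> real \<nu>" "0 < real \<nu>" using that by auto
    have dec: "cmod (?\<eta> ((1 / real \<nu>) *\<^sub>R y)) * (1 + norm y) ^ N \<le> real \<nu> ^ N * A" for y
    proof -
      have "1 + norm y \<le> real \<nu> * (1 + norm ((1 / real \<nu>) *\<^sub>R y))" using \<nu> by (simp add: algebra_simps)
      then have "(1 + norm y) ^ N \<le> (real \<nu> * (1 + norm ((1 / real \<nu>) *\<^sub>R y))) ^ N" by (intro power_mono) auto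
      then have "cmod (?\<eta> ((1 / real \<nu>) *\<^sub>R y)) * (1 + norm y) ^ N \<le> cmod (?\<eta> ((1 / real \<nu>) *\<^sub>R y)) * (real \<nu> * (1 + norm ((1 / real \<nu>) *\<^sub>R y))) ^ N"
        by (intro mult_left_mono) auto
      also have "\<dots> = real \<nu> ^ N * (cmod (?\<eta> ((1 / real \<nu>) *\<^sub>R y)) * (1 + norm ((1 / real \<nu>) *\<^sub>R y)) ^ N)"
        by (simp add: power_mult_distrib)
      also have "\<dots> \<le> real \<nu> ^ N * A" by (intro mult_left_mono A) auto
      finally show ?thesis .
    qed
    show i1: "integrable lborel (\<lambda>y. F (x - y) * ?\<eta> ((1 / real \<nu>) *\<^sub>R y))"
      by (rule integrable_convolution[OF _ _ F dec N]) measurable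
    have "integrable lborel (\<lambda>s. (\<lambda>y. F (x - y) * ?\<eta> ((1 / real \<nu>) *\<^sub>R y)) (real \<nu> *\<^sub>R s))"
      by (rule integral_scale(2)[OF _ \<nu>(2) i1]) measurable
    then show "integrable lborel (\<lambda>s. F (x - real \<nu> *\<^sub>R s) * ?\<eta> s)" using \<nu> by simp
    have "(\<integral>s. F (x - real \<nu> *\<^sub>R s) * ?\<eta> s \<partial>lborel) = d \<nu> * (\<integral>y. F (x - y) * ?\<eta> ((1 / real \<nu>) *\<^sub>R y) \<partial>lborel)"
      using integral_scale(1)[OF _ \<nu>(2), of "\<lambda>y. F (x - y) * ?\<eta> ((1 / real \<nu>) *\<^sub>R y)"] \<nu> by (simp add: d_def)
    then show "(\<integral>y. F (x - y) * (d \<nu> * ?\<eta> ((1 / real \<nu>) *\<^sub>R y)) \<partial>lborel) = (\<integral>s. F (x - real \<nu> *\<^sub>R s) * ?\<eta> s \<partial>lborel)"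
      by (simp add: mult.left_commute)
  qed
  have "convol F (inv_fourier (diff_symbol n \<kappa>)) x
      = (\<integral>y. (\<Sum>\<nu>\<in>{1..n}. diff_coeff n \<nu> * (F (x - y) * (d \<nu> * ?\<eta> ((1 / real \<nu>) *\<^sub>R y)))) \<partial>lborel)"
    unfolding convol_def K by (simp add: sum_distrib_left mult.left_commute)
  also have "\<dots> = (\<Sum>\<nu>\<in>{1..n}. diff_coeff n \<nu> * (\<integral>s. F (x - real \<nu> *\<^sub>R s) * ?\<eta> s \<partial>lborel))"
  proof (subst Bochner_Integration.integral_sum)
    show "integrable lborel (\<lambda>y. diff_coeff n \<nu> * (F (x - y) * (d \<nu> * ?\<eta> ((1 / real \<nu>) *\<^sub>R y))))" if "\<nu> \<in> {1..n}" for \<nu>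
      using integrable_mult_right[OF sc(1)[OF that], of "diff_coeff n \<nu> * d \<nu>"] by (simp add: mult_ac)
  qed (simp add: sc(2))
  finally have 1: "convol F (inv_fourier (diff_symbol n \<kappa>)) x = (\<Sum>\<nu>\<in>{1..n}. diff_coeff n \<nu> * (\<integral>s. F (x - real \<nu> *\<^sub>R s) * ?\<eta> s \<partial>lborel))" .
  have fd: "?\<eta> s * fin_diff n (- s) F x = F x * ?\<eta> s + (\<Sum>\<nu>\<in>{1..n}. diff_coeff n \<nu> * (F (x - real \<nu> *\<^sub>R s) * ?\<eta> s))" for s
  proof -
    have "{..n} = insert 0 {1..n}" by auto
    then have "fin_diff n (- s) F x = F x + (\<Sum>\<nu>\<in>{1..n}. diff_coeff n \<nu> * F (x - real \<nu> *\<^sub>R s))"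
      by (simp add: fin_diff_def diff_coeff_def)
    then show ?thesis by (simp add: distrib_left sum_distrib_left mult_ac)
  qed
  have "(\<integral>s. ?\<eta> s * fin_diff n (- s) F x \<partial>lborel) = F x * \<kappa> 0 + (\<Sum>\<nu>\<in>{1..n}. diff_coeff n \<nu> * (\<integral>s. F (x - real \<nu> *\<^sub>R s) * ?\<eta> s \<partial>lborel))"
    unfolding fd using i\<eta> sc(3)
    by (subst Bochner_Integration.integral_add) (auto simp: int\<eta> intro!: Bochner_Integration.integrable_sum)
  then show ?thesis using 1 by (simp add: mult.commute)
qed

end

section \<open>Convolution with a kernel whose moments vanish\<close>

lemma norm_integral_le_nn_integral:
  fixes f :: "'a \<Rightarrow> complex"
  shows "ennreal (cmod (\<integral>x. f x \<partial>M)) \<le> (\<integral>\<^sup>+x. ennreal (cmod (f x)) \<partial>M)"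
  by (cases "integrable M f") (auto intro: integral_norm_bound_ennreal simp: not_integrable_integral_eq)

lemma (in pair_sigma_finite) integrable_pair_bound:
  fixes f :: "'a \<times> 'b \<Rightarrow> complex"
  assumes [measurable]: "f \<in> borel_measurable (M1 \<Otimes>\<^sub>M M2)"
    and g: "integrable M1 g" and k: "integrable M2 k"
    and le: "\<And>x y. cmod (f (x, y)) \<le> g x * k y" and nn: "\<And>x. 0 \<le> g x" "\<And>y. 0 \<le> k y"
  shows "integrable (M1 \<Otimes>\<^sub>M M2) f"
proof (rule integrableI_bounded)
  have [measurable]: "g \<in> borel_measurable M1" "k \<in> borel_measurable M2" using g k by auto
  have "(\<integral>\<^sup>+z. ennreal (norm (f z)) \<partial>(M1 \<Otimes>\<^sub>M M2)) = (\<integral>\<^sup>+x. \<integral>\<^sup>+y. ennreal (norm (f (x, y))) \<partial>M2 \<partial>M1)"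
    by (rule M2.nn_integral_fst[symmetric]) measurable
  also have "\<dots> \<le> (\<integral>\<^sup>+x. \<integral>\<^sup>+y. ennreal (g x) * ennreal (k y) \<partial>M2 \<partial>M1)"
    using le nn by (intro nn_integral_mono) (simp add: ennreal_mult[symmetric] ennreal_leI)
  also have "\<dots> = (\<integral>\<^sup>+x. ennreal (g x) \<partial>M1) * (\<integral>\<^sup>+y. ennreal (k y) \<partial>M2)"
    by (simp add: nn_integral_cmult nn_integral_multc)
  also have "\<dots> < \<infinity>"
    using integrableD(2)[OF g] integrableD(2)[OF k] nn
    by (simp add: ennreal_mult_less_top nn_integral_eq_integral[OF g] nn_integral_eq_integral[OF k])
  finally show "(\<integral>\<^sup>+z. ennreal (norm (f z)) \<partial>(M1 \<Otimes>\<^sub>M M2)) < \<infinity>" .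
qed measurable

definition dir_symbol :: "real^'d \<Rightarrow> real^'d \<Rightarrow> complex" where
  "dir_symbol h \<xi> = \<i> * of_real (- (2 * pi * (h \<bullet> \<xi>)))"

lemma dir_symbol_measurable [measurable]:
  assumes [measurable]: "f \<in> borel_measurable M" "g \<in> borel_measurable M"
  shows "(\<lambda>x. dir_symbol (f x) (g x)) \<in> borel_measurable M"
  unfolding dir_symbol_def by measurable

lemma norm_dir_symbol_le: "cmod (dir_symbol h \<xi>) \<le> 2 * pi * (norm h * norm \<xi>)"
  using Cauchy_Schwarz_ineq2[of h \<xi>] by (simp add: dir_symbol_def norm_mult abs_mult)

lemma dir_symbol_scale: "dir_symbol h (r *\<^sub>R \<xi>) = of_real r * dir_symbol h \<xi>"
  by (simp add: dir_symbol_def)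

text \<open>The \<open>l\<close>-th directional derivative along \<open>-h\<close> of \<open>inv_fourier k\<close>.\<close>

definition dir_kernel :: "(real^'d \<Rightarrow> complex) \<Rightarrow> nat \<Rightarrow> real^'d \<Rightarrow> real^'d \<Rightarrow> complex" where
  "dir_kernel k l h = inv_fourier (\<lambda>\<xi>. k \<xi> * dir_symbol h \<xi> ^ l)"

lemma dir_kernel_measurable [measurable]:
  assumes [measurable]: "k \<in> borel_measurable borel" "f \<in> borel_measurable M" "g \<in> borel_measurable M"
  shows "(\<lambda>x. dir_kernel k l (f x) (g x)) \<in> borel_measurable M"
  unfolding dir_kernel_def inv_fourier_def by measurable

lemma integrable_compact_support:
  fixes k :: "real^'d \<Rightarrow> complex"
  assumes k: "continuous_on UNIV k" and supp: "\<And>\<xi>. \<delta> \<le> norm \<xi> \<Longrightarrow> k \<xi> = 0"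
  shows "integrable lborel k"
proof -
  have [measurable]: "k \<in> borel_measurable borel" using k by (rule borel_measurable_continuous_onI)
  have "bounded (k ` cball 0 \<delta>)"
    using k by (intro compact_imp_bounded compact_continuous_image) (auto intro: continuous_on_subset)
  then obtain B where B: "\<forall>y \<in> k ` cball 0 \<delta>. norm y \<le> B" by (auto simp: bounded_iff)
  have "cmod (k \<xi>) \<le> max 0 B" for \<xi>
    using B supp[of \<xi>] by (cases "\<delta> \<le> norm \<xi>") (auto simp: le_max_iff_disj)
  then show ?thesis by (rule integrable_bounded_support(1)[rotated, where R=\<delta>]) (use supp in auto)
qed

lemma integrable_dir_symbol:
  fixes k :: "real^'d \<Rightarrow> complex"
  assumes k: "continuous_on UNIV k" and supp: "\<And>\<xi>. \<delta> \<le> norm \<xi> \<Longrightarrow> k \<xi> = 0"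
  shows "integrable lborel (\<lambda>\<xi>. k \<xi> * dir_symbol h \<xi> ^ l)"
  by (rule integrable_compact_support[where \<delta>=\<delta>])
     (use assms in \<open>auto simp: dir_symbol_def intro!: continuous_intros\<close>)

text \<open>Taylor's formula for the character \<open>char (y - h) \<xi>\<close> in \<open>h\<close>, integrated against \<open>k\<close>.\<close>

lemma inv_fourier_taylor:
  fixes k :: "real^'d \<Rightarrow> complex"
  assumes k: "continuous_on UNIV k" and supp: "\<And>\<xi>. \<delta> \<le> norm \<xi> \<Longrightarrow> k \<xi> = 0" and n: "1 \<le> n"
  shows "inv_fourier k (y - h) = (\<Sum>l<n. dir_kernel k l h y / fact l)
    + (\<integral>t. taylor_weight n t *\<^sub>R dir_kernel k n h (y - t *\<^sub>R h) \<partial>lborel)"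
proof -
  have [measurable]: "k \<in> borel_measurable borel" using k by (rule borel_measurable_continuous_onI)
  have ik: "integrable lborel (\<lambda>\<xi>. k \<xi> * dir_symbol h \<xi> ^ l)" for l
    by (rule integrable_dir_symbol[OF k supp])
  have ic: "integrable lborel (\<lambda>\<xi>. k \<xi> * dir_symbol h \<xi> ^ l * char y \<xi>)" for l
    by (rule integrable_mult_char[OF ik]) auto
  define G where "G \<xi> t = k \<xi> * dir_symbol h \<xi> ^ n * char y \<xi> * (taylor_weight n t *\<^sub>R cis (t * - (2 * pi * (h \<bullet> \<xi>))))" for \<xi> t
  have G: "integrable (lborel \<Otimes>\<^sub>M lborel) (\<lambda>(\<xi>, t). G \<xi> t)"
  proof (rule lborel_pair.integrable_pair_bound)
    show "(\<lambda>(\<xi>, t). G \<xi> t) \<in> borel_measurable (lborel \<Otimes>\<^sub>M lborel)" unfolding G_def by measurable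
    show "integrable lborel (\<lambda>\<xi>. cmod (k \<xi> * dir_symbol h \<xi> ^ n))" using ik by (rule integrable_norm)
    show "integrable lborel (taylor_weight n)" by (rule integrable_taylor_weight)
  qed (auto simp: G_def norm_mult taylor_weight_bounds(1))
  have iG: "integrable lborel (\<lambda>\<xi>. \<integral>t. G \<xi> t \<partial>lborel)"
    using lborel_pair.integrable_fst[OF G] .
  have expand: "k \<xi> * char (y - h) \<xi> = (\<Sum>l<n. k \<xi> * dir_symbol h \<xi> ^ l * char y \<xi> / fact l) + (\<integral>t. G \<xi> t \<partial>lborel)" for \<xi>
  proof -
    have "char (y - h) \<xi> = char y \<xi> * cis (- (2 * pi * (h \<bullet> \<xi>)))"
      unfolding char_diff_left by (simp add: char_def cis_cnj)
    also have "cis (- (2 * pi * (h \<bullet> \<xi>))) = (\<Sum>l<n. dir_symbol h \<xi> ^ l / fact l)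
        + dir_symbol h \<xi> ^ n * (\<integral>t. taylor_weight n t *\<^sub>R cis (t * - (2 * pi * (h \<bullet> \<xi>))) \<partial>lborel)"
      unfolding dir_symbol_def by (rule cis_taylor_remainder[OF n])
    finally have "k \<xi> * char (y - h) \<xi> = (\<Sum>l<n. k \<xi> * dir_symbol h \<xi> ^ l * char y \<xi> / fact l)
      + k \<xi> * dir_symbol h \<xi> ^ n * char y \<xi> * (\<integral>t. taylor_weight n t *\<^sub>R cis (t * - (2 * pi * (h \<bullet> \<xi>))) \<partial>lborel)"
      by (simp add: distrib_left sum_distrib_left mult_ac)
    then show ?thesis unfolding G_def integral_mult_right_zero .
  qed
  have "inv_fourier k (y - h) = (\<Sum>l<n. dir_kernel k l h y / fact l) + (\<integral>\<xi>. (\<integral>t. G \<xi> t \<partial>lborel) \<partial>lborel)"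
    unfolding inv_fourier_def[of k] expand dir_kernel_def inv_fourier_def[of "\<lambda>\<xi>. k \<xi> * _ \<xi>"]
    using ic iG by (subst Bochner_Integration.integral_add) (auto intro!: Bochner_Integration.integrable_sum)
  also have "(\<integral>\<xi>. (\<integral>t. G \<xi> t \<partial>lborel) \<partial>lborel) = (\<integral>t. (\<integral>\<xi>. G \<xi> t \<partial>lborel) \<partial>lborel)"
    by (rule lborel_pair.Fubini_integral[OF G, symmetric])
  also have "(\<lambda>t. \<integral>\<xi>. G \<xi> t \<partial>lborel) = (\<lambda>t. taylor_weight n t *\<^sub>R dir_kernel k n h (y - t *\<^sub>R h))"
  proof
    fix t :: real
    have "G \<xi> t = taylor_weight n t *\<^sub>R (k \<xi> * dir_symbol h \<xi> ^ n * char (y - t *\<^sub>R h) \<xi>)" for \<xi>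
    proof -
      have "char (y - t *\<^sub>R h) \<xi> = char y \<xi> * cis (t * - (2 * pi * (h \<bullet> \<xi>)))"
        unfolding char_diff_left by (simp add: char_def cis_cnj mult_ac)
      then show ?thesis by (simp add: G_def mult.assoc)
    qed
    then show "(\<integral>\<xi>. G \<xi> t \<partial>lborel) = taylor_weight n t *\<^sub>R dir_kernel k n h (y - t *\<^sub>R h)"
      by (simp add: dir_kernel_def inv_fourier_def)
  qed
  finally show ?thesis .
qed

text \<open>As a function of \<open>h\<close>, the kernel \<open>dir_kernel k l h y\<close> is a homogeneous polynomial of degree \<open>l\<close>, an integral of
  the powers \<open>(h \<bullet> \<xi>)\<^sup>l\<close>.\<close>

lemma moments_kill_dir_kernel:
  fixes k B :: "real^'d \<Rightarrow> complex"
  assumes k: "continuous_on UNIV k" and supp: "\<And>\<xi>. \<delta> \<le> norm \<xi> \<Longrightarrow> k \<xi> = 0" and "\<delta> \<le> 1"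
    and [measurable]: "B \<in> borel_measurable borel" and iB: "integrable lborel (\<lambda>x. norm x ^ l * cmod (B x))"
    and mom: "\<And>\<xi>. (\<integral>x. B x * of_real (x \<bullet> \<xi>) ^ l \<partial>lborel) = 0"
  shows "(\<integral>h. B h * dir_kernel k l h y \<partial>lborel) = 0"
proof -
  have [measurable]: "k \<in> borel_measurable borel" using k by (rule borel_measurable_continuous_onI)
  have ik: "integrable lborel k" by (rule integrable_compact_support[OF k supp])
  define G where "G h \<xi> = B h * (k \<xi> * dir_symbol h \<xi> ^ l * char y \<xi>)" for h \<xi>
  have G: "integrable (lborel \<Otimes>\<^sub>M lborel) (\<lambda>(h, \<xi>). G h \<xi>)"
  proof (rule lborel_pair.integrable_pair_bound)
    show "(\<lambda>(h, \<xi>). G h \<xi>) \<in> borel_measurable (lborel \<Otimes>\<^sub>M lborel)" unfolding G_def by measurable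
    show "integrable lborel (\<lambda>h. (2 * pi) ^ l * (norm h ^ l * cmod (B h)))" using iB by simp
    show "integrable lborel (\<lambda>\<xi>. cmod (k \<xi>))" using ik by simp
    fix h \<xi> :: "real^'d"
    have "cmod (k \<xi>) * cmod (dir_symbol h \<xi>) ^ l \<le> cmod (k \<xi>) * (2 * pi * norm h) ^ l"
    proof (cases "\<delta> \<le> norm \<xi>")
      case False
      have "norm h * norm \<xi> \<le> norm h * 1" using False \<open>\<delta> \<le> 1\<close> by (intro mult_left_mono) auto
      then have "2 * pi * (norm h * norm \<xi>) \<le> 2 * pi * (norm h * 1)" by (rule mult_left_mono) auto
      then have "cmod (dir_symbol h \<xi>) \<le> 2 * pi * norm h"
        using norm_dir_symbol_le[of h \<xi>] by linarith
      then show ?thesis by (intro mult_left_mono power_mono) auto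
    qed (simp add: supp)
    from mult_left_mono[OF this norm_ge_zero[of "B h"]]
    show "cmod (case (h, \<xi>) of (h, \<xi>) \<Rightarrow> G h \<xi>) \<le> (2 * pi) ^ l * (norm h ^ l * cmod (B h)) * cmod (k \<xi>)"
      by (simp add: G_def norm_mult norm_power power_mult_distrib mult_ac)
  qed auto
  have "(\<integral>h. B h * dir_kernel k l h y \<partial>lborel) = (\<integral>h. (\<integral>\<xi>. G h \<xi> \<partial>lborel) \<partial>lborel)"
    by (simp add: dir_kernel_def inv_fourier_def G_def)
  also have "\<dots> = (\<integral>\<xi>. (\<integral>h. G h \<xi> \<partial>lborel) \<partial>lborel)"
    by (rule lborel_pair.Fubini_integral[OF G, symmetric])
  also have "\<dots> = (\<integral>\<xi>. 0 \<partial>(lborel :: (real^'d) measure))"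
  proof (rule Bochner_Integration.integral_cong[OF refl])
    fix \<xi> :: "real^'d"
    have "dir_symbol h \<xi> ^ l = (- 2 * pi * \<i>) ^ l * of_real (h \<bullet> \<xi>) ^ l" for h
    proof -
      have "dir_symbol h \<xi> = (- 2 * pi * \<i>) * of_real (h \<bullet> \<xi>)" by (simp add: dir_symbol_def)
      then show ?thesis by (simp only: power_mult_distrib)
    qed
    then have "G h \<xi> = (k \<xi> * (- 2 * pi * \<i>) ^ l * char y \<xi>) * (B h * of_real (h \<bullet> \<xi>) ^ l)" for h
      by (simp add: G_def mult_ac)
    then show "(\<integral>h. G h \<xi> \<partial>lborel) = 0"
      by (simp only: integral_mult_right_zero mom mult_zero_right)
  qed
  finally show ?thesis by simp
qed

context moderate_weight
begin

lemma convol_shift: "convol F k (x - h) = (\<integral>y. F (x - y) * k (y - h) \<partial>lborel)"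
  if [measurable]: "F \<in> borel_measurable borel" "k \<in> borel_measurable borel"
  unfolding convol_def
  using integral_translate[of "\<lambda>y. F (x - h - y) * k y" "- h"] by (simp add: algebra_simps)

lemma convol_taylor_expansion:
  fixes k :: "real^'d \<Rightarrow> complex"
  assumes [measurable]: "F \<in> borel_measurable borel" and F: "J F < \<infinity>" and n: "1 \<le> n"
    and k: "continuous_on UNIV k" and supp: "\<And>\<xi>. \<delta> \<le> norm \<xi> \<Longrightarrow> k \<xi> = 0"
    and A: "\<And>l h y. l \<le> n \<Longrightarrow> cmod (dir_kernel k l h y) * (1 + norm y) ^ N \<le> A * norm h ^ l"
    and N: "\<alpha> + real CARD('d) < real N"
  shows "convol F (inv_fourier k) (x - h) = (\<Sum>l<n. convol F (dir_kernel k l h) x / fact l)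
    + (\<integral>t. taylor_weight n t *\<^sub>R convol F (dir_kernel k n h) (x - t *\<^sub>R h) \<partial>lborel)"
proof -
  have [measurable]: "k \<in> borel_measurable borel" using k by (rule borel_measurable_continuous_onI)
  have ic: "integrable lborel (\<lambda>y. F (x - y) * dir_kernel k l h y)" if "l \<le> n" for l
    by (rule integrable_convolution[OF _ _ F A[OF that] N]) measurable
  define G where "G y t = F (x - y) * (taylor_weight n t *\<^sub>R dir_kernel k n h (y - t *\<^sub>R h))" for y t
  define \<Phi> where "\<Phi> y = cmod (F (x - y)) * (1 + norm y) powr (- real N)" for y
  have i\<Phi>: "integrable lborel \<Phi>"
  proof (rule integrableI_bounded)
    show "(\<integral>\<^sup>+y. ennreal (norm (\<Phi> y)) \<partial>lborel) < \<infinity>"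
      using convolution_integrable_everywhere[OF assms(1) F N, of x] by (simp add: \<Phi>_def abs_mult ennreal_mult)
  qed (unfold \<Phi>_def, measurable)
  have A0: "0 \<le> A" by (rule order_trans[OF _ A[of 0 0 0, simplified]]) auto
  have G: "integrable (lborel \<Otimes>\<^sub>M lborel) (\<lambda>(y, t). G y t)"
  proof (rule lborel_pair.integrable_pair_bound)
    show "(\<lambda>(y, t). G y t) \<in> borel_measurable (lborel \<Otimes>\<^sub>M lborel)" unfolding G_def by measurable
    show "integrable lborel (\<lambda>y. A * norm h ^ n * (1 + norm h) powr real N * \<Phi> y)" using i\<Phi> by simp
    show "integrable lborel (taylor_weight n)" by (rule integrable_taylor_weight)
    show "0 \<le> A * norm h ^ n * (1 + norm h) powr real N * \<Phi> y" for y using A0 by (simp add: \<Phi>_def)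
    fix y :: "real^'d" and t :: real
    have "cmod (dir_kernel k n h (y - t *\<^sub>R h)) * taylor_weight n t
        \<le> (A * norm h ^ n * (1 + norm h) powr real N * (1 + norm y) powr (- real N)) * taylor_weight n t"
    proof (cases "t \<in> {0..1}")
      case True
      have "cmod (dir_kernel k n h (y - t *\<^sub>R h)) \<le> A * norm h ^ n * (1 + norm (y - t *\<^sub>R h)) powr (- real N)"
        by (rule decay_powr[OF A]) simp
      also have "(1 + norm (y - t *\<^sub>R h)) powr (- real N) \<le> (1 + norm (t *\<^sub>R h)) powr real N * (1 + norm ((y - t *\<^sub>R h) + t *\<^sub>R h)) powr (- real N)"
        by (rule decay_peetre) simp
      also have "(y - t *\<^sub>R h) + t *\<^sub>R h = y" by simp
      also have "(1 + norm (t *\<^sub>R h)) powr real N * (1 + norm y) powr (- real N) \<le> (1 + norm h) powr real N * (1 + norm y) powr (- real N)"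
        using True by (intro mult_right_mono powr_mono2) (auto simp: mult_left_le_one_le)
      finally have "cmod (dir_kernel k n h (y - t *\<^sub>R h)) \<le> A * norm h ^ n * ((1 + norm h) powr real N * (1 + norm y) powr (- real N))"
        using A0 by (simp add: mult_left_mono)
      then show ?thesis using taylor_weight_bounds(1) by (intro mult_right_mono) (simp_all add: mult.assoc)
    qed (simp add: taylor_weight_def)
    from mult_left_mono[OF this norm_ge_zero[of "F (x - y)"]]
    show "cmod (case (y, t) of (y, t) \<Rightarrow> G y t) \<le> A * norm h ^ n * (1 + norm h) powr real N * \<Phi> y * taylor_weight n t"
      using taylor_weight_bounds(1)[of n t] by (simp add: G_def \<Phi>_def norm_mult mult_ac)
  qed (rule taylor_weight_bounds(1))
  have iG: "integrable lborel (\<lambda>y. \<integral>t. G y t \<partial>lborel)" using lborel_pair.integrable_fst[OF G] .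
  have "convol F (inv_fourier k) (x - h) = (\<integral>y. F (x - y) * inv_fourier k (y - h) \<partial>lborel)"
    by (rule convol_shift) measurable
  also have "\<dots> = (\<integral>y. (\<Sum>l<n. F (x - y) * dir_kernel k l h y / fact l) + (\<integral>t. G y t \<partial>lborel) \<partial>lborel)"
  proof (rule Bochner_Integration.integral_cong[OF refl])
    fix y
    have "(\<integral>t. G y t \<partial>lborel) = F (x - y) * (\<integral>t. taylor_weight n t *\<^sub>R dir_kernel k n h (y - t *\<^sub>R h) \<partial>lborel)"
      unfolding G_def by (rule integral_mult_right_zero)
    then show "F (x - y) * inv_fourier k (y - h) = (\<Sum>l<n. F (x - y) * dir_kernel k l h y / fact l) + (\<integral>t. G y t \<partial>lborel)"
      using inv_fourier_taylor[where k=k and y=y and h=h, OF k supp n] by (simp add: distrib_left sum_distrib_left)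
  qed
  also have "\<dots> = (\<Sum>l<n. convol F (dir_kernel k l h) x / fact l) + (\<integral>y. (\<integral>t. G y t \<partial>lborel) \<partial>lborel)"
    unfolding convol_def using ic iG
    by (subst Bochner_Integration.integral_add) (auto intro!: Bochner_Integration.integrable_sum)
  also have "(\<integral>y. (\<integral>t. G y t \<partial>lborel) \<partial>lborel) = (\<integral>t. (\<integral>y. G y t \<partial>lborel) \<partial>lborel)"
    by (rule lborel_pair.Fubini_integral[OF G, symmetric])
  also have "(\<lambda>t. \<integral>y. G y t \<partial>lborel) = (\<lambda>t. taylor_weight n t *\<^sub>R convol F (dir_kernel k n h) (x - t *\<^sub>R h))"
  proof
    fix t
    have "G y t = taylor_weight n t *\<^sub>R (F (x - y) * dir_kernel k n h (y - t *\<^sub>R h))" for y by (simp add: G_def)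
    then show "(\<integral>y. G y t \<partial>lborel) = taylor_weight n t *\<^sub>R convol F (dir_kernel k n h) (x - t *\<^sub>R h)"
      by (simp add: convol_shift)
  qed
  finally show ?thesis .
qed

text \<open>In \<open>\<integral> (F * k\<^sup>\<or>)(x - h) B h\<close>, with \<open>B = inv_fourier b\<close>, expand \<open>F * k\<^sup>\<or>\<close> in \<open>h\<close>. The moments of \<open>B\<close> remove the Taylor
  polynomial, and the remainder contains the \<open>n\<close>-th derivatives \<open>F * dir_kernel k n h\<close>. The
  representation of \<open>k\<close> by \<open>\<theta>\<close> turns these into averages of \<open>\<Delta>\<^sub>-\<^sub>s\<^sup>n F\<close> with density
  \<open>dir_kernel \<theta> n h\<close>: the factor \<open>\<nu>\<^sup>n\<close> is what dilation does to a homogeneous symbol of degree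
  \<open>n\<close>, and the term \<open>\<nu> = 0\<close> contributes nothing as that symbol vanishes at the origin. Their size \<open>\<bar>h\<bar>\<^sup>n\<close> and the
  growth of the weight are paid for by the decay of \<open>B\<close>.\<close>

lemma J_taylor_convol:
  fixes k \<theta> b :: "real^'d \<Rightarrow> complex"
  assumes [measurable]: "F \<in> borel_measurable borel" and F: "J F < \<infinity>" and n: "1 \<le> n"
    and small: "\<And>h. norm h < 1 \<Longrightarrow> J (fin_diff n h F) \<le> \<Omega>"
    and k: "continuous_on UNIV k" "\<And>\<xi>. \<delta> \<le> norm \<xi> \<Longrightarrow> k \<xi> = 0"
    and \<theta>: "continuous_on UNIV \<theta>" "\<And>\<xi>. \<delta> \<le> norm \<xi> \<Longrightarrow> \<theta> \<xi> = 0"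
    and b: "continuous_on UNIV b" "\<And>\<xi>. \<delta> \<le> norm \<xi> \<Longrightarrow> b \<xi> = 0"
    and \<delta>: "\<delta> < 1 / 2"
    and k\<theta>: "\<And>\<xi>. k \<xi> = (\<Sum>\<nu>\<in>{1..n}. diff_coeff n \<nu> * of_nat \<nu> ^ n * \<theta> (real \<nu> *\<^sub>R \<xi>))"
    and Ak: "\<And>l h y. l \<le> n \<Longrightarrow> cmod (dir_kernel k l h y) * (1 + norm y) ^ N \<le> A * norm h ^ l"
    and A\<theta>: "\<And>h y. cmod (dir_kernel \<theta> n h y) * (1 + norm y) ^ N \<le> A * norm h ^ n"
    and Ab: "\<And>y. cmod (inv_fourier b y) * (1 + norm y) ^ \<gamma> \<le> A"
    and van: "\<And>\<xi>. norm \<xi> < \<rho> \<Longrightarrow> cmod (b \<xi>) \<le> K * norm \<xi> ^ n" "0 < \<rho>"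
    and N: "\<alpha> + real CARD('d) < real N" and \<gamma>: "real n + \<alpha> + real CARD('d) < real \<gamma>"
  shows "J (convol (convol F (inv_fourier k)) (inv_fourier b))
    \<le> ennreal_powr (ennreal (c * A) * decay_integral TYPE(real^'d) (real \<gamma> - (\<alpha> + real n))) p
      * (ennreal_powr (ennreal (c ^ n * A) * decay_integral TYPE(real^'d) (real N - real n * (1 + \<alpha>))) p * \<Omega>)"
proof -
  have [measurable]: "k \<in> borel_measurable borel" "\<theta> \<in> borel_measurable borel" "b \<in> borel_measurable borel"
    using k \<theta> b by (auto intro: borel_measurable_continuous_onI)
  have A0: "0 \<le> A" by (rule order_trans[OF _ Ab[of 0]]) simp
  let ?B = "inv_fourier b" and ?K = "inv_fourier k"
  let ?C1 = "ennreal (c ^ n * A) * decay_integral TYPE(real^'d) (real N - real n * (1 + \<alpha>))"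
  let ?g = "\<lambda>h. convol F (dir_kernel k n h)"
  have Jg: "J (?g h) \<le> ennreal ((norm h ^ n) powr p) * (ennreal_powr ?C1 p * \<Omega>)" for h
  proof -
    let ?\<kappa> = "\<lambda>\<xi>. \<theta> \<xi> * dir_symbol h \<xi> ^ n"
    have ds: "(\<lambda>\<xi>. k \<xi> * dir_symbol h \<xi> ^ n) = diff_symbol n ?\<kappa>"
      unfolding k\<theta> diff_symbol_def dir_symbol_scale
      by (simp add: fun_eq_iff sum_distrib_right sum_distrib_left power_mult_distrib mult_ac)
    have cont: "continuous_on UNIV ?\<kappa>" unfolding dir_symbol_def by (intro continuous_intros \<theta>)
    have "?g h x = (\<integral>s. dir_kernel \<theta> n h s * fin_diff n (- s) F x \<partial>lborel)" for x
    proof -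
      have "?g h x = (\<integral>s. inv_fourier ?\<kappa> s * fin_diff n (- s) F x \<partial>lborel) - ?\<kappa> 0 * F x"
        unfolding dir_kernel_def[of k] ds
        by (rule convol_diff_symbol[OF _ F cont _ \<delta> A\<theta>[unfolded dir_kernel_def] N]) (auto simp: \<theta>)
      then show ?thesis using n by (simp add: dir_kernel_def dir_symbol_def)
    qed
    then have "J (?g h) = J (\<lambda>x. \<integral>s. dir_kernel \<theta> n h s * fin_diff n (- s) F x \<partial>lborel)" by presburger
    also have "\<dots> \<le> ennreal_powr (ennreal (c ^ n * (A * norm h ^ n)) * decay_integral TYPE(real^'d) (real N - real n * (1 + \<alpha>))) p * \<Omega>"
      by (rule J_difference_average[OF _ _ A\<theta> small]) measurable
    also have "ennreal (c ^ n * (A * norm h ^ n)) * decay_integral TYPE(real^'d) (real N - real n * (1 + \<alpha>)) = ennreal (norm h ^ n) * ?C1"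
      using c A0 by (simp add: ennreal_mult[symmetric] mult.assoc[symmetric]) (simp add: mult_ac)
    also have "ennreal_powr (ennreal (norm h ^ n) * ?C1) p = ennreal ((norm h ^ n) powr p) * ennreal_powr ?C1 p"
      using p by (simp add: ennreal_powr_mult del: powr_realpow)
    finally show ?thesis by (simp add: mult.assoc)
  qed
  have mom: "(\<integral>x. ?B x * of_real (x \<bullet> \<xi>) ^ l \<partial>lborel) = 0" if "l < n" for l \<xi>
  proof -
    have "real CARD('d) + real n < real \<gamma>" using \<gamma> \<alpha> by linarith
    from vanishing_moments[OF b \<delta> Ab this van n that] show ?thesis .
  qed
  have pt: "ennreal (cmod (convol (convol F ?K) ?B x))
      \<le> (\<integral>\<^sup>+z. ennreal (cmod (case z of (h, t) \<Rightarrow> ?g h (x - t *\<^sub>R h))) * (case z of (h, t) \<Rightarrow> ennreal (cmod (?B h)) * ennreal (taylor_weight n t)) \<partial>(lborel \<Otimes>\<^sub>M lborel))" (is "_ \<le> ?I") for x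
  proof (cases "integrable lborel (\<lambda>h. convol F ?K (x - h) * ?B h)")
    case False then show ?thesis by (simp add: convol_def not_integrable_integral_eq)
  next
    case True
    define R where "R h = (\<integral>t. taylor_weight n t *\<^sub>R ?g h (x - t *\<^sub>R h) \<partial>lborel)" for h
    have exp: "convol F ?K (x - h) = (\<Sum>l<n. convol F (dir_kernel k l h) x / fact l) + R h" for h
      unfolding R_def by (rule convol_taylor_expansion[OF _ F n k Ak N]) measurable
    define \<Phi> where "\<Phi> y = cmod (F (x - y)) * (1 + norm y) powr (- real N)" for y
    have i\<Phi>: "integrable lborel \<Phi>"
    proof (rule integrableI_bounded)
      show "(\<integral>\<^sup>+y. ennreal (norm (\<Phi> y)) \<partial>lborel) < \<infinity>"
        using convolution_integrable_everywhere[OF assms(1) F N, of x] by (simp add: \<Phi>_def abs_mult ennreal_mult)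
    qed (unfold \<Phi>_def, measurable)
    have l: "integrable lborel (\<lambda>h. convol F (dir_kernel k l h) x * ?B h)"
      "(\<integral>h. convol F (dir_kernel k l h) x * ?B h \<partial>lborel) = 0" if l: "l < n" for l
    proof -
      have iB: "integrable lborel (\<lambda>h. norm h ^ l * cmod (?B h))"
        using l \<gamma> \<alpha> by (intro integrable_decay[OF _ Ab]) auto
      define G where "G h y = F (x - y) * dir_kernel k l h y * ?B h" for h y
      have G: "integrable (lborel \<Otimes>\<^sub>M lborel) (\<lambda>(h, y). G h y)"
      proof (rule lborel_pair.integrable_pair_bound)
        show "(\<lambda>(h, y). G h y) \<in> borel_measurable (lborel \<Otimes>\<^sub>M lborel)" unfolding G_def by measurable
        show "integrable lborel (\<lambda>h. A * (norm h ^ l * cmod (?B h)))" using iB by simp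
        show "integrable lborel \<Phi>" by (rule i\<Phi>)
        show "0 \<le> \<Phi> y" for y by (simp add: \<Phi>_def)
        fix h y :: "real^'d"
        have "cmod (dir_kernel k l h y) \<le> A * norm h ^ l * (1 + norm y) powr (- real N)"
          by (rule decay_powr[OF Ak]) (use l in simp)
        then have "(cmod (F (x - y)) * cmod (?B h)) * cmod (dir_kernel k l h y) \<le> (cmod (F (x - y)) * cmod (?B h)) * (A * norm h ^ l * (1 + norm y) powr (- real N))"
          by (intro mult_left_mono) auto
        then show "cmod (case (h, y) of (h, y) \<Rightarrow> G h y) \<le> A * (norm h ^ l * cmod (?B h)) * \<Phi> y"
          by (simp add: G_def \<Phi>_def norm_mult mult_ac)
      qed (use A0 in auto)
      have eq: "(\<integral>y. G h y \<partial>lborel) = convol F (dir_kernel k l h) x * ?B h" for h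
        unfolding G_def convol_def by (rule integral_mult_left_zero)
      show "integrable lborel (\<lambda>h. convol F (dir_kernel k l h) x * ?B h)"
        using lborel_pair.integrable_fst[OF G] by (simp add: eq)
      have "(\<integral>h. convol F (dir_kernel k l h) x * ?B h \<partial>lborel) = (\<integral>y. (\<integral>h. G h y \<partial>lborel) \<partial>lborel)"
        unfolding eq[symmetric] by (rule lborel_pair.Fubini_integral[OF G, symmetric])
      also have "\<dots> = (\<integral>y. 0 \<partial>(lborel :: (real^'d) measure))"
      proof (rule Bochner_Integration.integral_cong[OF refl])
        fix y
        have "G h y = F (x - y) * (?B h * dir_kernel k l h y)" for h by (simp add: G_def mult_ac)
        moreover have "(\<integral>h. ?B h * dir_kernel k l h y \<partial>lborel) = 0"
          by (rule moments_kill_dir_kernel[OF k _ _ iB mom[OF l]]) (use \<delta> in auto)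
        ultimately show "(\<integral>h. G h y \<partial>lborel) = 0" by (simp only: integral_mult_right_zero mult_zero_right)
      qed
      finally show "(\<integral>h. convol F (dir_kernel k l h) x * ?B h \<partial>lborel) = 0" by simp
    qed
    have iS: "integrable lborel (\<lambda>h. \<Sum>l<n. (convol F (dir_kernel k l h) x * ?B h) / fact l)"
      using l(1) by (intro Bochner_Integration.integrable_sum) auto
    have RB: "R h * ?B h = convol F ?K (x - h) * ?B h - (\<Sum>l<n. (convol F (dir_kernel k l h) x * ?B h) / fact l)" for h
      unfolding exp by (simp add: distrib_right sum_distrib_right)
    have iRB: "integrable lborel (\<lambda>h. R h * ?B h)" unfolding RB using True iS by (rule Bochner_Integration.integrable_diff)
    have "(\<integral>h. R h * ?B h \<partial>lborel) = convol (convol F ?K) ?B x"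
      unfolding RB Bochner_Integration.integral_diff[OF True iS]
      using l by (subst Bochner_Integration.integral_sum) (auto simp: convol_def)
    then have "ennreal (cmod (convol (convol F ?K) ?B x)) = ennreal (cmod (\<integral>h. R h * ?B h \<partial>lborel))" by simp
    also have "\<dots> \<le> (\<integral>\<^sup>+h. ennreal (cmod (R h * ?B h)) \<partial>lborel)" using iRB by (rule integral_norm_bound_ennreal)
    also have "\<dots> \<le> (\<integral>\<^sup>+h. (\<integral>\<^sup>+t. ennreal (cmod (?g h (x - t *\<^sub>R h))) * (ennreal (cmod (?B h)) * ennreal (taylor_weight n t)) \<partial>lborel) \<partial>lborel)"
    proof (rule nn_integral_mono)
      fix h
      have "ennreal (cmod (R h)) \<le> (\<integral>\<^sup>+t. ennreal (cmod (taylor_weight n t *\<^sub>R ?g h (x - t *\<^sub>R h))) \<partial>lborel)"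
        unfolding R_def by (rule norm_integral_le_nn_integral)
      then have "ennreal (cmod (R h * ?B h)) \<le> (\<integral>\<^sup>+t. ennreal (cmod (taylor_weight n t *\<^sub>R ?g h (x - t *\<^sub>R h))) \<partial>lborel) * ennreal (cmod (?B h))"
        by (simp add: norm_mult ennreal_mult mult_right_mono)
      also have "\<dots> = (\<integral>\<^sup>+t. ennreal (cmod (taylor_weight n t *\<^sub>R ?g h (x - t *\<^sub>R h))) * ennreal (cmod (?B h)) \<partial>lborel)"
        by (rule nn_integral_multc[symmetric]) (unfold convol_def, measurable)
      also have "\<dots> = (\<integral>\<^sup>+t. ennreal (cmod (?g h (x - t *\<^sub>R h))) * (ennreal (cmod (?B h)) * ennreal (taylor_weight n t)) \<partial>lborel)"
        by (intro nn_integral_cong) (simp add: taylor_weight_bounds(1) ennreal_mult mult_ac)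
      finally show "ennreal (cmod (R h * ?B h)) \<le> \<dots>" .
    qed
    also have "\<dots> = ?I"
    proof (subst lborel.nn_integral_fst[symmetric])
      show "(\<lambda>z. ennreal (cmod (case z of (h, t) \<Rightarrow> ?g h (x - t *\<^sub>R h))) * (case z of (h, t) \<Rightarrow> ennreal (cmod (?B h)) * ennreal (taylor_weight n t)))
        \<in> borel_measurable (lborel \<Otimes>\<^sub>M lborel)"
        unfolding convol_def by measurable
    qed simp
    finally show ?thesis .
  qed
  define W where "W z = (case z of (h, t) \<Rightarrow> c * (1 + norm (t *\<^sub>R h)) powr \<alpha> * (1 + norm h) ^ n)" for z :: "(real^'d) \<times> real"
  have "J (convol (convol F ?K) ?B)
    \<le> ennreal_powr (\<integral>\<^sup>+z. ennreal (W z) * (case z of (h, t) \<Rightarrow> ennreal (cmod (?B h)) * ennreal (taylor_weight n t)) \<partial>(lborel \<Otimes>\<^sub>M lborel)) p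
      * (ennreal_powr ?C1 p * \<Omega>)"
  proof (rule J_minkowski[where H="\<lambda>x z. case z of (h, t) \<Rightarrow> ?g h (x - t *\<^sub>R h)"])
    show "sigma_finite_measure (lborel \<Otimes>\<^sub>M lborel :: ((real^'d) \<times> real) measure)"
      unfolding lborel_prod by (rule sigma_finite_lborel)
    show "(\<lambda>(x, z). case z of (h, t) \<Rightarrow> ?g h (x - t *\<^sub>R h)) \<in> borel_measurable (borel \<Otimes>\<^sub>M (lborel \<Otimes>\<^sub>M lborel))"
      unfolding convol_def by measurable
    show "W \<in> borel_measurable (lborel \<Otimes>\<^sub>M lborel)" unfolding W_def by measurable
    show "0 < W z" for z
    proof (cases z)
      case (Pair h t)
      have "0 < (1 + norm (t *\<^sub>R h)) powr \<alpha>" by (simp del: norm_scaleR)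
      then show ?thesis using c by (simp add: W_def Pair del: norm_scaleR)
    qed
    show "J (\<lambda>x. case z of (h, t) \<Rightarrow> ?g h (x - t *\<^sub>R h)) \<le> ennreal (W z powr p) * (ennreal_powr ?C1 p * \<Omega>)" for z
    proof (cases z)
      case (Pair h t)
      have "J (\<lambda>x. ?g h (x - t *\<^sub>R h)) \<le> ennreal ((c * (1 + norm (t *\<^sub>R h)) powr \<alpha>) powr p) * J (?g h)"
        using J_translate[of "?g h" "- t *\<^sub>R h"] by simp
      also have "\<dots> \<le> ennreal ((c * (1 + norm (t *\<^sub>R h)) powr \<alpha>) powr p) * (ennreal (((1 + norm h) ^ n) powr p) * (ennreal_powr ?C1 p * \<Omega>))"
      proof (intro mult_left_mono order_trans[OF Jg] mult_right_mono ennreal_leI powr_mono2)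
        show "norm h ^ n \<le> (1 + norm h) ^ n" by (intro power_mono) auto
      qed (use p in auto)
      also have "\<dots> = ennreal (W z powr p) * (ennreal_powr ?C1 p * \<Omega>)"
        using c by (simp add: W_def Pair powr_mult ennreal_mult mult.assoc)
      finally show ?thesis by (simp add: Pair)
    qed
  qed (use pt in auto)
  also have "\<dots> \<le> ennreal_powr (ennreal (c * A) * decay_integral TYPE(real^'d) (real \<gamma> - (\<alpha> + real n))) p * (ennreal_powr ?C1 p * \<Omega>)"
  proof (intro mult_right_mono ennreal_powr_mono)
    have "(\<integral>\<^sup>+z. ennreal (W z) * (case z of (h, t) \<Rightarrow> ennreal (cmod (?B h)) * ennreal (taylor_weight n t)) \<partial>(lborel \<Otimes>\<^sub>M lborel))
      = (\<integral>\<^sup>+h. (\<integral>\<^sup>+t. ennreal (W (h, t)) * (ennreal (cmod (?B h)) * ennreal (taylor_weight n t)) \<partial>lborel) \<partial>lborel)"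
      by (subst lborel.nn_integral_fst[symmetric]) (unfold W_def, measurable)
    also have "\<dots> \<le> (\<integral>\<^sup>+h. (\<integral>\<^sup>+t. (ennreal (c * (1 + norm h) powr (\<alpha> + real n)) * ennreal (cmod (?B h))) * ennreal (taylor_weight n t) \<partial>lborel) \<partial>lborel)"
    proof (intro nn_integral_mono)
      fix h :: "real^'d" and t :: real
      show "ennreal (W (h, t)) * (ennreal (cmod (?B h)) * ennreal (taylor_weight n t))
        \<le> (ennreal (c * (1 + norm h) powr (\<alpha> + real n)) * ennreal (cmod (?B h))) * ennreal (taylor_weight n t)"
      proof (cases "t \<in> {0..1}")
        case True
        have "W (h, t) \<le> c * (1 + norm h) powr \<alpha> * (1 + norm h) ^ n"
          unfolding W_def prod.case using True c \<alpha>
          by (intro mult_right_mono mult_left_mono powr_mono2) (auto simp: mult_left_le_one_le)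
        also have "\<dots> = c * (1 + norm h) powr (\<alpha> + real n)" by (simp add: powr_add powr_realpow)
        finally show ?thesis unfolding mult.assoc by (intro mult_right_mono ennreal_leI) auto
      qed (simp add: taylor_weight_def)
    qed
    also have "\<dots> = (\<integral>\<^sup>+h. (ennreal (c * (1 + norm h) powr (\<alpha> + real n)) * ennreal (cmod (?B h))) * (\<integral>\<^sup>+t. ennreal (taylor_weight n t) \<partial>lborel) \<partial>lborel)"
      by (intro nn_integral_cong nn_integral_cmult) measurable
    also have "\<dots> \<le> (\<integral>\<^sup>+h. (ennreal (c * (1 + norm h) powr (\<alpha> + real n)) * ennreal (cmod (?B h))) * 1 \<partial>lborel)"
      by (intro nn_integral_mono mult_left_mono nn_integral_taylor_weight_le) auto
    also have "\<dots> \<le> ennreal (c * A) * decay_integral TYPE(real^'d) (real \<gamma> - (\<alpha> + real n))"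
      using nn_integral_decay_weight[OF _ Ab, of c "\<alpha> + real n"] c by simp
    finally show "(\<integral>\<^sup>+z. ennreal (W z) * (case z of (h, t) \<Rightarrow> ennreal (cmod (?B h)) * ennreal (taylor_weight n t)) \<partial>(lborel \<Otimes>\<^sub>M lborel)) \<le> \<dots>" .
  qed (use p in auto)
  finally show ?thesis .
qed

end

section \<open>The smoothing kernel\<close>

text \<open>\<open>\<Delta>\<^sup>n\<close> annihilates polynomials of degree less than \<open>n\<close> and maps \<open>\<nu>\<^sup>n\<close> to a constant.\<close>

lemma alternating_binomial_moments:
  assumes "j \<le> n"
  shows "(\<Sum>\<nu>\<le>n. (-1) ^ \<nu> * of_nat (n choose \<nu>) * of_nat \<nu> ^ j :: complex) = (if j < n then 0 else (-1) ^ n * fact n)"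
proof -
  define a where "a n j = (\<Sum>\<nu>\<le>n. (-1) ^ \<nu> * of_nat (n choose \<nu>) * of_nat \<nu> ^ j :: complex)" for n j :: nat
  have alg: "- 1 * s * X * (Y * P) = - W * (s * Z * P)" if "X * Y = W * Z" for s X Y P W Z :: complex
  proof -
    have "- 1 * s * X * (Y * P) = - (s * P * (X * Y))" by (simp add: mult_ac)
    also have "\<dots> = - (s * P * (W * Z))" by (simp only: that)
    also have "\<dots> = - W * (s * Z * P)" by (simp add: mult_ac)
    finally show ?thesis .
  qed
  have rec: "a (Suc n) (Suc j) = - of_nat (Suc n) * (\<Sum>i\<le>j. of_nat (j choose i) * a n i)" for n j
  proof -
    have "a (Suc n) (Suc j) = (\<Sum>\<nu>\<le>n. (-1) ^ Suc \<nu> * of_nat (Suc n choose Suc \<nu>) * of_nat (Suc \<nu>) ^ Suc j)"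
      unfolding a_def by (subst sum.atMost_Suc_shift) simp
    also have "\<dots> = (\<Sum>\<nu>\<le>n. - of_nat (Suc n) * ((-1) ^ \<nu> * of_nat (n choose \<nu>) * of_nat (Suc \<nu>) ^ j))"
    proof (intro sum.cong refl)
      fix \<nu>
      have "of_nat (Suc n choose Suc \<nu>) * of_nat (Suc \<nu>) = (of_nat (Suc n) * of_nat (n choose \<nu>) :: complex)"
        unfolding of_nat_mult[symmetric] by (metis Suc_times_binomial_eq mult.commute)
      then show "(-1) ^ Suc \<nu> * of_nat (Suc n choose Suc \<nu>) * of_nat (Suc \<nu>) ^ Suc j
        = - of_nat (Suc n) * ((-1) ^ \<nu> * of_nat (n choose \<nu>) * of_nat (Suc \<nu>) ^ j :: complex)"
        unfolding power_Suc by (rule alg)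
    qed
    also have "\<dots> = - of_nat (Suc n) * (\<Sum>\<nu>\<le>n. \<Sum>i\<le>j. of_nat (j choose i) * ((-1) ^ \<nu> * of_nat (n choose \<nu>) * of_nat \<nu> ^ i))"
      unfolding sum_distrib_left[symmetric]
      by (intro arg_cong2[where f="(*)"] sum.cong refl)
         (simp only: of_nat_Suc add.commute[of 1] binomial_ring sum_distrib_left power_one mult_1_right mult_1_left mult_ac)
    also have "\<dots> = - of_nat (Suc n) * (\<Sum>i\<le>j. of_nat (j choose i) * a n i)"
      unfolding a_def sum_distrib_left by (subst sum.swap) simp
    finally show ?thesis .
  qed
  have "(j < n \<longrightarrow> a n j = 0) \<and> (j = n \<longrightarrow> a n j = (-1) ^ n * fact n)" for n j
  proof (induction n arbitrary: j)
    case 0 show ?case by (simp add: a_def)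
  next
    case (Suc n)
    show ?case
    proof (cases j)
      case 0
      have "a (Suc n) 0 = 0" unfolding a_def using choose_alternating_sum[of "Suc n", where 'a=complex] by simp
      then show ?thesis using 0 by simp
    next
      case (Suc j')
      have "(\<Sum>i\<le>j'. of_nat (j' choose i) * a n i) = (if j' = n then (-1) ^ n * fact n else 0)" if "j' \<le> n"
      proof -
        have "(\<Sum>i\<le>j'. of_nat (j' choose i) * a n i) = (\<Sum>i\<le>j'. if i = n then (-1) ^ n * fact n else 0)"
          using that Suc.IH by (intro sum.cong refl) auto
        then show ?thesis using that by (simp add: sum.delta)
      qed
      then show ?thesis unfolding Suc rec by (auto simp: algebra_simps)
    qed
  qed
  then show ?thesis using assms unfolding a_def by (cases j n rule: linorder_cases) auto
qed

text \<open>The normalization constant of the smoothing kernel; it is not zero.\<close>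

lemma diff_coeff_moment:
  assumes "1 \<le> n"
  shows "(\<Sum>\<nu>\<in>{1..n}. diff_coeff n \<nu> * of_nat \<nu> ^ n) = (-1) ^ n * fact n"
proof -
  have "{..n} = insert 0 {1..n}" by auto
  moreover have "(0::complex) ^ n = 0" using assms by simp
  ultimately show ?thesis using alternating_binomial_moments[OF order_refl, of n]
    using assms by (simp add: diff_coeff_def zero_power)
qed

definition smooth_all :: "nat \<Rightarrow> (real^'d \<Rightarrow> complex) \<Rightarrow> bool" where
  "smooth_all N f \<longleftrightarrow> (\<exists>C\<ge>0. smooth_bd N UNIV C f)"

lemma smooth_all_cmult: "smooth_all N f \<Longrightarrow> smooth_all N (\<lambda>x. a * f x)"
proof -
  assume "smooth_all N f"
  then obtain C where "0 \<le> C" "smooth_bd N UNIV C f" by (auto simp: smooth_all_def)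
  then have "smooth_bd N UNIV (2 ^ N * cmod a * C) (\<lambda>x. a * f x)"
    by (intro smooth_bd_mult smooth_bd_const) auto
  then show ?thesis using \<open>0 \<le> C\<close> unfolding smooth_all_def by (intro exI[of _ "2 ^ N * cmod a * C"]) auto
qed

lemma smooth_all_sum:
  assumes "finite I" "\<And>i. i \<in> I \<Longrightarrow> smooth_all N (f i)"
  shows "smooth_all N (\<lambda>x. \<Sum>i\<in>I. f i x)"
proof -
  have "\<forall>i\<in>I. \<exists>C. 0 \<le> C \<and> smooth_bd N UNIV C (f i)" using assms(2) by (auto simp: smooth_all_def)
  then obtain C where C: "\<forall>i\<in>I. 0 \<le> C i \<and> smooth_bd N UNIV (C i) (f i)" by (rule bchoice[THEN exE])
  then have "smooth_bd N UNIV (sum C I) (\<lambda>x. \<Sum>i\<in>I. f i x)" using assms(1) by (intro smooth_bd_sum) auto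
  then show ?thesis using C unfolding smooth_all_def by (intro exI[of _ "sum C I"]) (auto intro: sum_nonneg)
qed

lemma smooth_all_bump_scale:
  assumes "0 < \<delta>" "0 < r" "N < m"
  shows "smooth_all N (\<lambda>\<xi> :: real^'d. bump \<delta> m (r *\<^sub>R \<xi>))"
proof -
  have "bump \<delta> m (r *\<^sub>R \<xi>) = bump (\<delta> / r) m \<xi>" for \<xi> :: "real^'d"
    using assms by (simp add: bump_def field_simps)
  then show ?thesis using smooth_bd_bump[of "\<delta> / r" N m, where 'd='d] assms unfolding smooth_all_def by simp
qed

lemma dir_kernel_decay:
  fixes k :: "real^'d \<Rightarrow> complex"
  assumes k: "continuous_on UNIV k" "\<And>\<xi>. \<delta> \<le> norm \<xi> \<Longrightarrow> k \<xi> = 0" and \<delta>: "0 < \<delta>" "\<delta> < 1"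
    and sm: "smooth_all N k"
  shows "\<exists>A\<ge>0. \<forall>l\<le>n. \<forall>h y. cmod (dir_kernel k l h y) * (1 + norm y) ^ N \<le> A * norm h ^ l"
proof -
  obtain C where C: "0 \<le> C" "smooth_bd N UNIV C k" using sm by (auto simp: smooth_all_def)
  obtain A where A: "0 \<le> A" "\<And>(b :: real^'d \<Rightarrow> complex) D x. b \<in> borel_measurable borel \<Longrightarrow> smooth_bd N UNIV D b \<Longrightarrow>
    (\<forall>\<xi>. \<delta> < norm \<xi> \<longrightarrow> b \<xi> = 0) \<Longrightarrow> cmod (inv_fourier b x) * (1 + norm x) ^ N \<le> A * D"
    using inv_fourier_decay[of \<delta> N, where 'd='d] \<delta> by (auto simp: less_imp_le)
  define E where "E = (2 :: real) ^ N * (2 ^ N * (2 * pi) * 2)"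
  have E: "0 \<le> E" by (simp add: E_def)
  have dec: "cmod (dir_kernel k l h y) * (1 + norm y) ^ N \<le> (A * (2 ^ N * C * (1 + E) ^ n)) * norm h ^ l" if "l \<le> n" for l h y
  proof -
    have "smooth_bd N (ball 0 1) (2 ^ N * (2 * pi) * (norm h * (1 + 1))) (\<lambda>\<xi>. (- 2 * pi * \<i>) * complex_of_real (h \<bullet> \<xi>))"
      by (intro smooth_bd_mult smooth_bd_const smooth_bd_inner) (auto simp: norm_mult)
    then have "smooth_bd N (ball 0 1) (2 ^ N * (2 * pi) * (norm h * (1 + 1))) (dir_symbol h)"
      by (rule smooth_bd_cong[rotated 2]) (auto simp: dir_symbol_def)
    then have "smooth_bd N (ball 0 1) ((2 ^ N * (2 ^ N * (2 * pi) * (norm h * (1 + 1)))) ^ l) (\<lambda>\<xi>. dir_symbol h \<xi> ^ l)"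
      by (intro smooth_bd_power) auto
    also have "(2 ^ N * (2 ^ N * (2 * pi) * (norm h * (1 + 1)))) ^ l = E ^ l * norm h ^ l"
      by (simp add: E_def power_mult_distrib[symmetric] mult_ac)
    finally have "smooth_bd N UNIV (2 ^ N * C * (E ^ l * norm h ^ l)) (\<lambda>\<xi>. k \<xi> * dir_symbol h \<xi> ^ l)"
      using C k E \<delta> by (intro smooth_bd_cutoff[where \<delta>=\<delta> and \<epsilon>=1]) auto
    then have "cmod (dir_kernel k l h y) * (1 + norm y) ^ N \<le> A * (2 ^ N * C * (E ^ l * norm h ^ l))"
      unfolding dir_kernel_def
      by (intro A(2)) (use k in \<open>auto simp: dir_symbol_def intro!: borel_measurable_continuous_onI continuous_intros\<close>)
    also have "\<dots> \<le> A * (2 ^ N * C * ((1 + E) ^ n * norm h ^ l))"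
    proof -
      have "E ^ l \<le> (1 + E) ^ l" using E by (intro power_mono) auto
      also have "\<dots> \<le> (1 + E) ^ n" using E that by (intro power_increasing) auto
      finally show ?thesis using A(1) C(1) by (intro mult_left_mono mult_right_mono) auto
    qed
    finally show ?thesis by (simp add: mult_ac)
  qed
  show ?thesis using dec A(1) C(1) E by (intro exI[of _ "A * (2 ^ N * C * (1 + E) ^ n)"]) auto
qed

text \<open>Start from a bump \<open>\<beta>\<close> and form \<open>\<Sum>\<^sub>\<mu> c\<^sub>\<mu> \<mu>\<^sup>n \<beta> (\<mu> \<xi>)\<close>, normalized to one at the origin, to get
  \<open>\<kappa>\<close>; then \<open>k = -\<Sum>\<^sub>\<nu> c\<^sub>\<nu> \<kappa> (\<nu> \<xi>)\<close>. The double sum contains \<open>\<beta>\<close> only in the form \<open>\<beta> (\<mu> \<nu> \<xi>)\<close>, so \<open>k\<close> can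
  equally be written with the factors \<open>\<mu>\<^sup>n\<close> outside, which gives \<open>\<theta>\<close>. The first form expresses
  \<open>F - F * k\<^sup>\<or>\<close>, the second the \<open>n\<close>-th derivatives of \<open>F * k\<^sup>\<or>\<close>, by differences of \<open>F\<close>.\<close>

lemma smoothing_kernel_exists:
  fixes n N :: nat
  assumes n: "1 \<le> n" and \<delta>: "0 < \<delta>" "\<delta> < 1"
  obtains \<kappa> \<theta> k :: "real^'d \<Rightarrow> complex" and A :: real
  where "continuous_on UNIV \<kappa>" "\<And>\<xi>. \<delta> \<le> norm \<xi> \<Longrightarrow> \<kappa> \<xi> = 0" "\<kappa> 0 = 1"
    and "continuous_on UNIV \<theta>" "\<And>\<xi>. \<delta> \<le> norm \<xi> \<Longrightarrow> \<theta> \<xi> = 0"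
    and "continuous_on UNIV k" "\<And>\<xi>. \<delta> \<le> norm \<xi> \<Longrightarrow> k \<xi> = 0" "smooth_all N k"
    and "\<And>\<xi>. k \<xi> = - diff_symbol n \<kappa> \<xi>"
    and "\<And>\<xi>. k \<xi> = (\<Sum>\<nu>\<in>{1..n}. diff_coeff n \<nu> * of_nat \<nu> ^ n * \<theta> (real \<nu> *\<^sub>R \<xi>))"
    and "\<And>y. cmod (inv_fourier \<kappa> y) * (1 + norm y) ^ N \<le> A"
    and "\<And>l h y. l \<le> n \<Longrightarrow> cmod (dir_kernel k l h y) * (1 + norm y) ^ N \<le> A * norm h ^ l"
    and "\<And>h y. cmod (dir_kernel \<theta> n h y) * (1 + norm y) ^ N \<le> A * norm h ^ n"
proof -
  (* The value of the unnormalized sum at the origin. *)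
  define c0 where "c0 = (-1) ^ n * (fact n :: complex)"
  have c0: "c0 \<noteq> 0" by (simp add: c0_def)
  let ?m = "Suc N"
  let ?\<beta> = "bump \<delta> ?m :: real^'d \<Rightarrow> complex"
  define \<kappa> where "\<kappa> \<xi> = (1 / c0) * (\<Sum>\<mu>\<in>{1..n}. (diff_coeff n \<mu> * of_nat \<mu> ^ n) * ?\<beta> (real \<mu> *\<^sub>R \<xi>))" for \<xi>
  define \<theta> where "\<theta> \<xi> = (- 1 / c0) * (\<Sum>\<nu>\<in>{1..n}. diff_coeff n \<nu> * ?\<beta> (real \<nu> *\<^sub>R \<xi>))" for \<xi>
  define k where "k \<xi> = (-1) * (\<Sum>\<nu>\<in>{1..n}. diff_coeff n \<nu> * \<kappa> (real \<nu> *\<^sub>R \<xi>))" for \<xi>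
  have scale0: "\<delta> \<le> norm (real \<mu> *\<^sub>R \<xi>)" if "\<mu> \<in> {1..n}" "\<delta> \<le> norm \<xi>" for \<mu> and \<xi> :: "real^'d"
  proof -
    have "norm \<xi> \<le> real \<mu> * norm \<xi>" using that mult_right_mono[of 1 "real \<mu>" "norm \<xi>"] by simp
    then show ?thesis using that by simp
  qed
  have b0: "?\<beta> \<xi> = 0" if "\<delta> \<le> norm \<xi>" for \<xi>
  proof -
    have "1 \<le> (norm \<xi> / \<delta>)\<^sup>2" using that \<delta> by (intro one_le_power) (simp add: field_simps)
    then show ?thesis by (simp add: bump_def max_def)
  qed
  have cont: "continuous_on UNIV (\<lambda>\<xi>. ?\<beta> (r *\<^sub>R \<xi>))" for r
    by (rule continuous_on_compose2[OF continuous_on_bump[of UNIV \<delta> ?m]]) (auto intro!: continuous_intros)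
  have c\<kappa>: "continuous_on UNIV \<kappa>" unfolding \<kappa>_def by (intro continuous_intros cont)
  have c\<theta>: "continuous_on UNIV \<theta>" unfolding \<theta>_def by (intro continuous_intros cont)
  have "continuous_on UNIV (\<lambda>\<xi>. \<kappa> (r *\<^sub>R \<xi>))" for r
    by (rule continuous_on_compose2[OF c\<kappa>]) (auto intro!: continuous_intros)
  then have ck: "continuous_on UNIV k" unfolding k_def by (intro continuous_intros)
  have s\<kappa>: "\<kappa> \<xi> = 0" if "\<delta> \<le> norm \<xi>" for \<xi> using b0 scale0[OF _ that] by (simp add: \<kappa>_def)
  have s\<theta>: "\<theta> \<xi> = 0" if "\<delta> \<le> norm \<xi>" for \<xi> using b0 scale0[OF _ that] by (simp add: \<theta>_def)
  have sk: "k \<xi> = 0" if "\<delta> \<le> norm \<xi>" for \<xi> using s\<kappa> scale0[OF _ that] by (simp add: k_def)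
  have \<kappa>0: "\<kappa> 0 = 1" using diff_coeff_moment[OF n] c0 by (simp add: \<kappa>_def c0_def)
  have k\<kappa>: "k \<xi> = - diff_symbol n \<kappa> \<xi>" for \<xi> by (simp add: k_def diff_symbol_def)
  have k\<theta>: "k \<xi> = (\<Sum>\<mu>\<in>{1..n}. diff_coeff n \<mu> * of_nat \<mu> ^ n * \<theta> (real \<mu> *\<^sub>R \<xi>))" for \<xi>
  proof -
    have "k \<xi> = (\<Sum>\<nu>\<in>{1..n}. \<Sum>\<mu>\<in>{1..n}. (- 1 / c0) * (diff_coeff n \<nu> * (diff_coeff n \<mu> * of_nat \<mu> ^ n)) * ?\<beta> ((real \<mu> * real \<nu>) *\<^sub>R \<xi>))"
      unfolding k_def \<kappa>_def sum_distrib_left by (intro sum.cong refl) (simp add: mult_ac)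
    also have "\<dots> = (\<Sum>\<mu>\<in>{1..n}. \<Sum>\<nu>\<in>{1..n}. (- 1 / c0) * (diff_coeff n \<nu> * (diff_coeff n \<mu> * of_nat \<mu> ^ n)) * ?\<beta> ((real \<mu> * real \<nu>) *\<^sub>R \<xi>))"
      by (rule sum.swap)
    also have "\<dots> = (\<Sum>\<mu>\<in>{1..n}. diff_coeff n \<mu> * of_nat \<mu> ^ n * \<theta> (real \<mu> *\<^sub>R \<xi>))"
      unfolding \<theta>_def sum_distrib_left by (intro sum.cong refl) (simp add: mult_ac)
    finally show ?thesis .
  qed
  have b_sm: "smooth_all N (\<lambda>\<xi>. ?\<beta> (r *\<^sub>R \<xi>))" if "0 < r" for r
    using that \<delta> by (intro smooth_all_bump_scale) auto
  have sm\<kappa>': "smooth_all N (\<lambda>\<xi>. \<kappa> (r *\<^sub>R \<xi>))" if "0 < r" for r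
    unfolding \<kappa>_def scaleR_scaleR
    by (intro smooth_all_cmult smooth_all_sum b_sm) (use that in auto)
  have smk: "smooth_all N k" unfolding k_def by (intro smooth_all_cmult smooth_all_sum sm\<kappa>') auto
  have sm\<kappa>: "smooth_all N \<kappa>" using sm\<kappa>'[of 1] by simp
  have sm\<theta>: "smooth_all N \<theta>" unfolding \<theta>_def by (intro smooth_all_cmult smooth_all_sum b_sm) auto
  obtain A1 where A1: "0 \<le> A1" "\<And>l h y. l \<le> n \<Longrightarrow> cmod (dir_kernel k l h y) * (1 + norm y) ^ N \<le> A1 * norm h ^ l"
    using dir_kernel_decay[OF ck sk \<delta> smk, of n] by blast
  obtain A2 where A2: "0 \<le> A2" "\<And>l h y. l \<le> n \<Longrightarrow> cmod (dir_kernel \<theta> l h y) * (1 + norm y) ^ N \<le> A2 * norm h ^ l"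
    using dir_kernel_decay[OF c\<theta> s\<theta> \<delta> sm\<theta>, of n] by blast
  obtain A3 where A3: "0 \<le> A3" "\<And>l h y. l \<le> n \<Longrightarrow> cmod (dir_kernel \<kappa> l h y) * (1 + norm y) ^ N \<le> A3 * norm h ^ l"
    using dir_kernel_decay[OF c\<kappa> s\<kappa> \<delta> sm\<kappa>, of n] by blast
  let ?A = "A1 + A2 + A3"
  show ?thesis
  proof (rule that[OF c\<kappa> s\<kappa> \<kappa>0 c\<theta> s\<theta> ck sk smk k\<kappa> k\<theta>, of ?A])
    show "cmod (inv_fourier \<kappa> y) * (1 + norm y) ^ N \<le> ?A" for y
      using A3(2)[of 0 0 y] A1(1) A2(1) by (simp add: dir_kernel_def)
    show "cmod (dir_kernel k l h y) * (1 + norm y) ^ N \<le> ?A * norm h ^ l" if "l \<le> n" for l h y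
      by (rule order_trans[OF A1(2)[OF that]]) (use A2 A3 in \<open>auto intro: mult_right_mono\<close>)
    show "cmod (dir_kernel \<theta> n h y) * (1 + norm y) ^ N \<le> ?A * norm h ^ n" for h y
      by (rule order_trans[OF A2(2)[OF order_refl]]) (use A1 A3 in \<open>auto intro: mult_right_mono\<close>)
  qed
qed

section \<open>Quasi-projection at unit scale\<close>

text \<open>Coefficients and operator at unit scale. The sum over \<open>k\<close> is a Bochner integral over the counting
  measure, for which Fubini's theorem is available.\<close>

definition qcoeff :: "(real^'d \<Rightarrow> complex) \<Rightarrow> (real^'d \<Rightarrow> complex) \<Rightarrow> int^'d \<Rightarrow> complex" where
  "qcoeff \<psi> F k = (\<integral>y. F y * cnj (\<psi> (y + int_vec k)) \<partial>lborel)"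

definition qop :: "(real^'d \<Rightarrow> complex) \<Rightarrow> (real^'d \<Rightarrow> complex) \<Rightarrow> (real^'d \<Rightarrow> complex) \<Rightarrow> real^'d \<Rightarrow> complex" where
  "qop \<phi> \<psi> F x = (\<integral>k. qcoeff \<psi> F k * \<phi> (x + int_vec k) \<partial>counting)"

lemma AE_translate:
  fixes P :: "real^'d \<Rightarrow> bool"
  assumes "AE x in lborel. P x" shows "AE x in lborel. P (x + c)"
proof -
  have "AE x in distr lborel borel ((+) c). P x" using assms by (simp only: lborel_distr_plus)
  then have "AE x in lborel. P (c + x)" by (rule AE_distrD[rotated]) simp
  then show ?thesis by (simp add: add.commute)
qed

lemma AE_translates:
  fixes P :: "real^'d \<Rightarrow> bool"
  assumes "AE x in lborel. P x" shows "AE x in lborel. \<forall>k :: int^'d. P (x + int_vec k)"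
  by (subst AE_all_countable) (intro allI AE_translate assms)

lemma integral_reflect:
  fixes f :: "real^'d \<Rightarrow> complex"
  assumes [measurable]: "f \<in> borel_measurable borel"
  shows "(\<integral>y. f (x - y) \<partial>lborel) = (\<integral>y. f y \<partial>lborel)"
  by (subst (2) lborel_eq_distr_reflect[of x], subst integral_distr) auto

lemma qop_measurable [measurable]:
  assumes [measurable]: "\<phi> \<in> borel_measurable borel"
  shows "qop \<phi> \<psi> F \<in> borel_measurable borel"
  unfolding qop_def by measurable

locale quasi_projection_bounds = moderate_weight p \<alpha> c v for p \<alpha> c :: real and v :: "real^'d \<Rightarrow> real" +
  fixes u :: "real^'d \<Rightarrow> real" and \<phi> \<psi> :: "real^'d \<Rightarrow> complex" and a b :: "real^'d \<Rightarrow> ennreal" and S :: ennreal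
  assumes u_ge_1: "\<And>x. 1 \<le> u x" and u_even: "\<And>x. u (- x) = u x" and v_u: "\<And>x y. v (x + y) \<le> u x * v y"
    and meas [measurable]: "\<phi> \<in> borel_measurable borel" "\<psi> \<in> borel_measurable borel"
      "a \<in> borel_measurable borel" "b \<in> borel_measurable borel"
    and a: "AE x in lborel. ennreal (cmod (\<phi> x) * u x) \<le> a x"
    and b: "AE x in lborel. ennreal (cmod (\<psi> x) * u x) \<le> b x"
    and S: "\<And>f. f \<in> borel_measurable borel \<Longrightarrow>
      (\<integral>\<^sup>+k. ennreal_powr (\<integral>\<^sup>+y. f y * b (y + int_vec k) \<partial>lborel) p \<partial>counting) \<le> S * (\<integral>\<^sup>+y. ennreal_powr (f y) p \<partial>lborel)"
begin

abbreviation "abs_coeff F k \<equiv> (\<integral>\<^sup>+y. ennreal (cmod (F y * cnj (\<psi> (y + int_vec k)))) \<partial>lborel)"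

abbreviation "amalgam \<equiv> (\<integral>\<^sup>+x. ennreal_powr (periodization a x) p \<partial>lcube)"

lemma u_nonneg: "0 \<le> u x" using u_ge_1[of x] by linarith

text \<open>The growth of \<open>v\<close> splits into a factor absorbed by \<open>\<psi>\<close> and a value of \<open>v\<close> at the integer point.\<close>

lemma abs_coeff_le:
  assumes [measurable]: "F \<in> borel_measurable borel"
  shows "abs_coeff F k \<le> ennreal (v (- int_vec k)) * (\<integral>\<^sup>+y. ennreal (cmod (F y) / v y) * b (y + int_vec k) \<partial>lborel)"
proof -
  have "abs_coeff F k \<le> (\<integral>\<^sup>+y. ennreal (v (- int_vec k)) * (ennreal (cmod (F y) / v y) * b (y + int_vec k)) \<partial>lborel)"
  proof (rule nn_integral_mono_AE)
    show "AE y in lborel. ennreal (cmod (F y * cnj (\<psi> (y + int_vec k)))) \<le> ennreal (v (- int_vec k)) * (ennreal (cmod (F y) / v y) * b (y + int_vec k))"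
      using AE_translates[OF b]
    proof eventually_elim
      case (elim y)
      have "v y \<le> u (y + int_vec k) * v (- int_vec k)" using v_u[of "y + int_vec k" "- int_vec k"] by simp
      then have "1 \<le> u (y + int_vec k) * v (- int_vec k) / v y" using v_pos[of y] by (simp add: field_simps)
      from mult_left_mono[OF this, of "cmod (F y) * cmod (\<psi> (y + int_vec k))"]
      have "cmod (F y * cnj (\<psi> (y + int_vec k))) \<le> v (- int_vec k) * (cmod (F y) / v y * (cmod (\<psi> (y + int_vec k)) * u (y + int_vec k)))"
        by (simp add: norm_mult mult_ac)
      then have "ennreal (cmod (F y * cnj (\<psi> (y + int_vec k)))) \<le> ennreal (v (- int_vec k)) * (ennreal (cmod (F y) / v y) * ennreal (cmod (\<psi> (y + int_vec k)) * u (y + int_vec k)))"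
        using v_pos u_nonneg by (simp add: ennreal_mult[symmetric] less_imp_le ennreal_leI)
      also have "\<dots> \<le> ennreal (v (- int_vec k)) * (ennreal (cmod (F y) / v y) * b (y + int_vec k))"
        using elim by (intro mult_left_mono) auto
      finally show ?case .
    qed
  qed
  then show ?thesis by (simp add: nn_integral_cmult)
qed

lemma abs_coeff_finite:
  assumes [measurable]: "F \<in> borel_measurable borel" and F: "J F < \<infinity>" and "S < \<infinity>"
  shows "abs_coeff F k < \<infinity>"
proof -
  let ?\<beta> = "\<lambda>k. \<integral>\<^sup>+y. ennreal (cmod (F y) / v y) * b (y + int_vec k) \<partial>lborel"
  have "ennreal_powr (?\<beta> k) p \<le> (\<integral>\<^sup>+k. ennreal_powr (?\<beta> k) p \<partial>counting)"
    using nn_integral_ge_point[of k UNIV "\<lambda>k. ennreal_powr (?\<beta> k) p"] by simp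
  also have "\<dots> \<le> S * J F" unfolding weighted_power_def by (rule S) measurable
  also have "\<dots> < \<infinity>" using F assms(3) by (simp add: ennreal_mult_less_top)
  finally have "?\<beta> k < \<infinity>" by simp
  then have "ennreal (v (- int_vec k)) * ?\<beta> k < \<infinity>" by (simp add: ennreal_mult_less_top)
  then show ?thesis using abs_coeff_le[OF assms(1), of k] by (rule le_less_trans[rotated])
qed

lemma qcoeff_integrable:
  assumes [measurable]: "F \<in> borel_measurable borel" and F: "J F < \<infinity>" and "S < \<infinity>"
  shows "integrable lborel (\<lambda>y. F y * cnj (\<psi> (y + int_vec k)))"
  using abs_coeff_finite[OF assms] by (intro integrableI_bounded) auto

text \<open>The bound for \<open>Q\<close> with absolute values inside all sums and integrals. It yields the norm estimate,
  the convergence of the series, and the integrability needed to interchange sums and integrals.\<close>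

lemma abs_qop_bound:
  assumes [measurable]: "F \<in> borel_measurable borel"
  shows "(\<integral>\<^sup>+x. ennreal_powr ((\<integral>\<^sup>+k. abs_coeff F k * ennreal (cmod (\<phi> (x + int_vec k))) \<partial>counting) * ennreal (1 / v x)) p \<partial>lborel)
    \<le> S * J F * amalgam"
proof -
  let ?\<beta> = "\<lambda>k. \<integral>\<^sup>+y. ennreal (cmod (F y) / v y) * b (y + int_vec k) \<partial>lborel"
  have "(\<integral>\<^sup>+x. ennreal_powr ((\<integral>\<^sup>+k. abs_coeff F k * ennreal (cmod (\<phi> (x + int_vec k))) \<partial>counting) * ennreal (1 / v x)) p \<partial>lborel)
    \<le> (\<integral>\<^sup>+x. ennreal_powr (\<integral>\<^sup>+k. ?\<beta> k * a (x + int_vec k) \<partial>counting) p \<partial>lborel)"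
  proof (rule nn_integral_mono_AE)
    show "AE x in lborel. ennreal_powr ((\<integral>\<^sup>+k. abs_coeff F k * ennreal (cmod (\<phi> (x + int_vec k))) \<partial>counting) * ennreal (1 / v x)) p
      \<le> ennreal_powr (\<integral>\<^sup>+k. ?\<beta> k * a (x + int_vec k) \<partial>counting) p"
      using AE_translates[OF a]
    proof eventually_elim
      case (elim x)
      have "abs_coeff F k * ennreal (cmod (\<phi> (x + int_vec k))) * ennreal (1 / v x) \<le> ?\<beta> k * a (x + int_vec k)" for k
      proof -
        let ?z = "int_vec k"
        have "v (- ?z) \<le> u (x + ?z) * v x" using v_u[of "- (x + ?z)" x] by (simp add: u_even del: minus_add_distrib)
        then have "v (- ?z) * (1 / v x) \<le> u (x + ?z)" using v_pos[of x] by (simp add: field_simps)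
        from mult_left_mono[OF this, of "cmod (\<phi> (x + ?z))"]
        have "ennreal (v (- ?z)) * ennreal (cmod (\<phi> (x + ?z))) * ennreal (1 / v x) \<le> ennreal (cmod (\<phi> (x + ?z)) * u (x + ?z))"
          using v_pos[of x] v_pos[of "- ?z"] by (simp add: ennreal_mult[symmetric] less_imp_le ennreal_leI mult_ac)
        also have "\<dots> \<le> a (x + ?z)" using elim by auto
        finally have *: "ennreal (v (- ?z)) * ennreal (cmod (\<phi> (x + ?z))) * ennreal (1 / v x) \<le> a (x + ?z)" .
        have "abs_coeff F k * ennreal (cmod (\<phi> (x + ?z))) * ennreal (1 / v x)
          \<le> (ennreal (v (- ?z)) * ?\<beta> k) * ennreal (cmod (\<phi> (x + ?z))) * ennreal (1 / v x)"
          by (intro mult_right_mono abs_coeff_le assms) auto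
        also have "\<dots> = ?\<beta> k * (ennreal (v (- ?z)) * ennreal (cmod (\<phi> (x + ?z))) * ennreal (1 / v x))"
          by (simp only: mult_ac)
        also have "\<dots> \<le> ?\<beta> k * a (x + ?z)" by (intro mult_left_mono *) auto
        finally show ?thesis .
      qed
      then show ?case using p
        by (subst nn_integral_multc[symmetric]) (auto intro!: ennreal_powr_mono nn_integral_mono)
    qed
  qed
  also have "\<dots> \<le> (\<integral>\<^sup>+k. ennreal_powr (?\<beta> k) p \<partial>counting) * amalgam"
    by (rule synthesis_bound[OF p]) measurable
  also have "\<dots> \<le> S * J F * amalgam"
    unfolding weighted_power_def by (intro mult_right_mono S) auto
  finally show ?thesis .
qed

lemma AE_abs_qop_finite:
  assumes [measurable]: "F \<in> borel_measurable borel" and F: "J F < \<infinity>" and "S < \<infinity>" "amalgam < \<infinity>"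
  shows "AE x in lborel. (\<integral>\<^sup>+k. abs_coeff F k * ennreal (cmod (\<phi> (x + int_vec k))) \<partial>counting) < \<infinity>"
proof -
  have "(\<integral>\<^sup>+x. ennreal_powr ((\<integral>\<^sup>+k. abs_coeff F k * ennreal (cmod (\<phi> (x + int_vec k))) \<partial>counting) * ennreal (1 / v x)) p \<partial>lborel) < \<infinity>"
    using abs_qop_bound[OF assms(1)] F assms(3,4) by (auto simp: ennreal_mult_less_top intro: le_less_trans)
  then have "AE x in lborel. ennreal_powr ((\<integral>\<^sup>+k. abs_coeff F k * ennreal (cmod (\<phi> (x + int_vec k))) \<partial>counting) * ennreal (1 / v x)) p \<noteq> \<infinity>"
    by (intro nn_integral_PInf_AE) auto
  then show ?thesis
  proof eventually_elim
    case (elim x)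
    have "ennreal (1 / v x) \<noteq> 0" using v_pos[of x] by simp
    then show ?case using elim by (auto simp: less_top[symmetric] ennreal_mult_eq_top_iff)
  qed
qed

lemma qcoeff_le: "ennreal (cmod (qcoeff \<psi> F k)) \<le> abs_coeff F k"
  unfolding qcoeff_def by (rule norm_integral_le_nn_integral)

lemma abs_qop_term: "ennreal (norm (qcoeff \<psi> F k * z)) \<le> abs_coeff F k * ennreal (cmod z)"
proof -
  have "ennreal (norm (qcoeff \<psi> F k * z)) = ennreal (cmod (qcoeff \<psi> F k)) * ennreal (cmod z)"
    by (simp add: norm_mult ennreal_mult)
  also have "\<dots> \<le> abs_coeff F k * ennreal (cmod z)" by (rule mult_right_mono[OF qcoeff_le]) simp
  finally show ?thesis .
qed

lemma AE_qop_summable: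
  assumes [measurable]: "F \<in> borel_measurable borel" and F: "J F < \<infinity>" and "S < \<infinity>" "amalgam < \<infinity>"
  shows "AE x in lborel. integrable counting (\<lambda>k. qcoeff \<psi> F k * \<phi> (x + int_vec k))"
  using AE_abs_qop_finite[OF assms]
proof eventually_elim
  case (elim x)
  show ?case
  proof (rule integrableI_bounded)
    have "(\<integral>\<^sup>+k. ennreal (norm (qcoeff \<psi> F k * \<phi> (x + int_vec k))) \<partial>counting) \<le> (\<integral>\<^sup>+k. abs_coeff F k * ennreal (cmod (\<phi> (x + int_vec k))) \<partial>counting)"
      by (intro nn_integral_mono abs_qop_term)
    then show "(\<integral>\<^sup>+k. ennreal (norm (qcoeff \<psi> F k * \<phi> (x + int_vec k))) \<partial>counting) < \<infinity>" using elim by (rule le_less_trans)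
  qed simp
qed

lemma J_qop:
  assumes [measurable]: "F \<in> borel_measurable borel"
  shows "J (qop \<phi> \<psi> F) \<le> S * J F * amalgam"
proof (rule order_trans[OF _ abs_qop_bound[OF assms]])
  show "J (qop \<phi> \<psi> F) \<le> (\<integral>\<^sup>+x. ennreal_powr ((\<integral>\<^sup>+k. abs_coeff F k * ennreal (cmod (\<phi> (x + int_vec k))) \<partial>counting) * ennreal (1 / v x)) p \<partial>lborel)"
    unfolding weighted_power_def
  proof (intro nn_integral_mono ennreal_powr_mono)
    fix x
    have "ennreal (cmod (qop \<phi> \<psi> F x)) \<le> (\<integral>\<^sup>+k. ennreal (cmod (qcoeff \<psi> F k * \<phi> (x + int_vec k))) \<partial>counting)"
      unfolding qop_def by (rule norm_integral_le_nn_integral)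
    also have "\<dots> \<le> (\<integral>\<^sup>+k. abs_coeff F k * ennreal (cmod (\<phi> (x + int_vec k))) \<partial>counting)"
      by (intro nn_integral_mono abs_qop_term)
    finally have "ennreal (cmod (qop \<phi> \<psi> F x)) * ennreal (1 / v x) \<le> (\<integral>\<^sup>+k. abs_coeff F k * ennreal (cmod (\<phi> (x + int_vec k))) \<partial>counting) * ennreal (1 / v x)"
      by (intro mult_right_mono) auto
    then show "ennreal (cmod (qop \<phi> \<psi> F x) / v x) \<le> \<dots>"
      using v_pos[of x] by (subst (asm) ennreal_mult[symmetric]) auto
  qed (use p in auto)
qed

end

section \<open>The quasi-projection of a band-limited function\<close>

text \<open>The pairing of a translate of \<open>inv_fourier k\<close> with \<open>\<psi>\<close>. Through it the coefficients of a convolution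
  with \<open>inv_fourier k\<close> become coefficients of the original function.\<close>

definition transfer_kernel :: "(real^'d \<Rightarrow> complex) \<Rightarrow> (real^'d \<Rightarrow> complex) \<Rightarrow> real^'d \<Rightarrow> complex" where
  "transfer_kernel k \<psi> s = inv_fourier (\<lambda>\<xi>. k \<xi> * cnj (fourier_lborel \<psi> \<xi>)) (- s)"

lemma fourier_lborel_measurable [measurable]:
  assumes [measurable]: "f \<in> borel_measurable borel"
  shows "fourier_lborel f \<in> borel_measurable borel"
  unfolding fourier_lborel_def by measurable

lemma transfer_kernel_measurable [measurable]:
  assumes [measurable]: "k \<in> borel_measurable borel" "\<psi> \<in> borel_measurable borel"
  shows "transfer_kernel k \<psi> \<in> borel_measurable borel"
  unfolding transfer_kernel_def by measurable

lemma integral_inv_fourier_shift: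
  fixes k \<psi> :: "real^'d \<Rightarrow> complex"
  assumes ik: "integrable lborel k" and i\<psi>: "integrable lborel \<psi>"
  shows "(\<integral>z. inv_fourier k (z - s) * cnj (\<psi> z) \<partial>lborel) = transfer_kernel k \<psi> s"
proof -
  have [measurable]: "k \<in> borel_measurable borel" "\<psi> \<in> borel_measurable borel" using ik i\<psi> by auto
  define G where "G z \<xi> = k \<xi> * char (z - s) \<xi> * cnj (\<psi> z)" for z \<xi>
  have G: "integrable (lborel \<Otimes>\<^sub>M lborel) (\<lambda>(z, \<xi>). G z \<xi>)"
  proof (rule lborel_pair.integrable_pair_bound)
    show "(\<lambda>(z, \<xi>). G z \<xi>) \<in> borel_measurable (lborel \<Otimes>\<^sub>M lborel)" unfolding G_def by measurable
    show "integrable lborel (\<lambda>z. cmod (\<psi> z))" "integrable lborel (\<lambda>\<xi>. cmod (k \<xi>))" using ik i\<psi> by auto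
  qed (auto simp: G_def norm_mult)
  have "(\<integral>z. inv_fourier k (z - s) * cnj (\<psi> z) \<partial>lborel) = (\<integral>z. (\<integral>\<xi>. G z \<xi> \<partial>lborel) \<partial>lborel)"
    unfolding G_def inv_fourier_def by (simp only: integral_mult_left_zero)
  moreover have "(\<integral>\<xi>. (\<integral>z. G z \<xi> \<partial>lborel) \<partial>lborel) = (\<integral>z. (\<integral>\<xi>. G z \<xi> \<partial>lborel) \<partial>lborel)"
    by (rule lborel_pair.Fubini_integral[OF G])
  moreover have "(\<integral>z. G z \<xi> \<partial>lborel) = k \<xi> * cnj (fourier_lborel \<psi> \<xi>) * char (- s) \<xi>" for \<xi>
  proof -
    have "(\<integral>z. G z \<xi> \<partial>lborel) = (\<integral>z. (k \<xi> * char (- s) \<xi>) * cnj (\<psi> z * cnj (char z \<xi>)) \<partial>lborel)"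
      unfolding G_def by (intro Bochner_Integration.integral_cong) (simp_all add: char_diff_left char_minus_left mult_ac)
    also have "\<dots> = (k \<xi> * char (- s) \<xi>) * cnj (fourier_lborel \<psi> \<xi>)"
      unfolding fourier_lborel_def
      by (subst integral_mult_right_zero, subst Bochner_Integration.integral_cnj) (rule refl)
    finally show ?thesis by (simp add: mult_ac)
  qed
  ultimately show ?thesis unfolding transfer_kernel_def inv_fourier_def by simp
qed

text \<open>Exchange the sum over \<open>l\<close> with the frequency integral and apply Poisson summation at each frequency
  in the support of \<open>k\<close>. The exceptional null set of Poisson summation depends on the frequency; by Fubini's
  theorem, for almost every \<open>x\<close> almost all frequencies are good, and the set of such \<open>x\<close> does not depend
  on \<open>y\<close>.\<close>

lemma sum_transfer_kernel:
  fixes k \<phi> \<psi> :: "real^'d \<Rightarrow> complex"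
  assumes k: "continuous_on UNIV k" "\<And>\<xi>. \<delta> \<le> norm \<xi> \<Longrightarrow> k \<xi> = 0"
    and \<phi>: "integrable lborel \<phi>" and \<psi>: "integrable lborel \<psi>"
    and supp: "\<And>\<xi> l. norm \<xi> < \<delta> \<Longrightarrow> l \<noteq> 0 \<Longrightarrow> fourier_lborel \<phi> (\<xi> + int_vec l) = 0"
  shows "AE x in lborel. \<forall>y. (\<integral>l. transfer_kernel k \<psi> (y + int_vec l) * \<phi> (x + int_vec l) \<partial>counting)
    = inv_fourier (\<lambda>\<xi>. k \<xi> * (fourier_lborel \<phi> \<xi> * cnj (fourier_lborel \<psi> \<xi>))) (x - y)"
proof -
  have [measurable]: "k \<in> borel_measurable borel" using k(1) by (rule borel_measurable_continuous_onI)
  have [measurable]: "\<phi> \<in> borel_measurable borel" "\<psi> \<in> borel_measurable borel" using \<phi> \<psi> by auto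
  let ?q = "\<lambda>\<xi>. k \<xi> * cnj (fourier_lborel \<psi> \<xi>)"
  have q: "integrable lborel ?q"
  proof (rule integrable_compact_support[where \<delta>=\<delta>])
    show "continuous_on UNIV ?q" by (intro continuous_intros k(1) continuous_on_fourier_lborel[OF \<psi>])
  qed (use k(2) in simp)
  have "AE x in lborel. k \<xi> = 0 \<or>
      (\<integral>l. \<phi> (x + int_vec l) * cnj (char (int_vec l) \<xi>) \<partial>counting) = fourier_lborel \<phi> \<xi> * char x \<xi>" for \<xi>
  proof (cases "\<delta> \<le> norm \<xi>")
    case False
    then have "AE x in lborel. (\<integral>l. \<phi> (x + int_vec l) * cnj (char (int_vec l) \<xi>) \<partial>counting) = fourier_lborel \<phi> \<xi> * char x \<xi>"
      by (intro poisson_single_frequency[OF \<phi>] supp) auto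
    then show ?thesis by eventually_elim simp
  qed (simp add: k(2))
  then have "AE \<xi> in lborel. AE x in lborel. k \<xi> = 0 \<or>
      (\<integral>l. \<phi> (x + int_vec l) * cnj (char (int_vec l) \<xi>) \<partial>counting) = fourier_lborel \<phi> \<xi> * char x \<xi>"
    by (rule AE_I2)
  then have poisson: "AE x in lborel. AE \<xi> in lborel. k \<xi> = 0 \<or>
      (\<integral>l. \<phi> (x + int_vec l) * cnj (char (int_vec l) \<xi>) \<partial>counting) = fourier_lborel \<phi> \<xi> * char x \<xi>"
    by (subst (asm) lborel_pair.AE_commute) measurable
  have "AE x in lborel. periodization (\<lambda>x. ennreal (cmod (\<phi> x))) x < \<infinity>"
  proof (rule AE_periodic)
    show "AE x in lcube. periodization (\<lambda>x. ennreal (cmod (\<phi> x))) x < \<infinity>"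
      using AE_integrable_tiling[OF \<phi>] by eventually_elim (simp add: integrable_iff_bounded)
  qed (simp_all add: periodization_translate[of "\<lambda>x. ennreal (cmod (\<phi> x))"])
  then have "AE x in lborel. integrable counting (\<lambda>l. \<phi> (x + int_vec l))"
    by eventually_elim (intro integrableI_bounded, auto)
  with poisson show ?thesis
  proof eventually_elim
    case (elim x)
    show ?case
    proof
      fix y
      define G where "G l \<xi> = ?q \<xi> * char (- (y + int_vec l)) \<xi> * \<phi> (x + int_vec l)" for l \<xi>
      have G: "integrable (counting \<Otimes>\<^sub>M lborel) (\<lambda>(l, \<xi>). G l \<xi>)"
      proof (rule counting_lborel.integrable_pair_bound)
        show "(\<lambda>(l, \<xi>). G l \<xi>) \<in> borel_measurable (counting \<Otimes>\<^sub>M lborel)" unfolding G_def by measurable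
        show "integrable counting (\<lambda>l. cmod (\<phi> (x + int_vec l)))" using elim by auto
        show "integrable lborel (\<lambda>\<xi>. cmod (?q \<xi>))" using q by (rule integrable_norm)
      qed (auto simp: G_def norm_mult mult_ac)
      have "(\<integral>l. transfer_kernel k \<psi> (y + int_vec l) * \<phi> (x + int_vec l) \<partial>counting) = (\<integral>l. (\<integral>\<xi>. G l \<xi> \<partial>lborel) \<partial>counting)"
        unfolding G_def transfer_kernel_def inv_fourier_def by (simp only: integral_mult_left_zero)
      moreover have "(\<integral>\<xi>. (\<integral>l. G l \<xi> \<partial>counting) \<partial>lborel) = (\<integral>l. (\<integral>\<xi>. G l \<xi> \<partial>lborel) \<partial>counting)"
        by (rule counting_lborel.Fubini_integral[OF G])
      moreover have "(\<integral>\<xi>. (\<integral>l. G l \<xi> \<partial>counting) \<partial>lborel)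
        = (\<integral>\<xi>. k \<xi> * (fourier_lborel \<phi> \<xi> * cnj (fourier_lborel \<psi> \<xi>)) * char (x - y) \<xi> \<partial>lborel)"
      proof (rule integral_cong_AE)
        show "(\<lambda>\<xi>. \<integral>l. G l \<xi> \<partial>counting) \<in> borel_measurable lborel" unfolding G_def by measurable
        show "AE \<xi> in lborel. (\<integral>l. G l \<xi> \<partial>counting) = k \<xi> * (fourier_lborel \<phi> \<xi> * cnj (fourier_lborel \<psi> \<xi>)) * char (x - y) \<xi>"
          using elim(1)
        proof eventually_elim
          case (elim \<xi>)
          have "(\<integral>l. G l \<xi> \<partial>counting) = (\<integral>l. (?q \<xi> * cnj (char y \<xi>)) * (\<phi> (x + int_vec l) * cnj (char (int_vec l) \<xi>)) \<partial>counting)"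
            unfolding G_def by (intro Bochner_Integration.integral_cong) (simp_all only: char_minus_left char_add_left complex_cnj_mult mult_ac)
          also have "\<dots> = (?q \<xi> * cnj (char y \<xi>)) * (\<integral>l. \<phi> (x + int_vec l) * cnj (char (int_vec l) \<xi>) \<partial>counting)"
            by (rule integral_mult_right_zero)
          also have "\<dots> = k \<xi> * (fourier_lborel \<phi> \<xi> * cnj (fourier_lborel \<psi> \<xi>)) * char (x - y) \<xi>"
            using elim by (auto simp: char_diff_left)
          finally show ?case .
        qed
      qed measurable
      ultimately show "(\<integral>l. transfer_kernel k \<psi> (y + int_vec l) * \<phi> (x + int_vec l) \<partial>counting)
        = inv_fourier (\<lambda>\<xi>. k \<xi> * (fourier_lborel \<phi> \<xi> * cnj (fourier_lborel \<psi> \<xi>))) (x - y)"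
        unfolding inv_fourier_def by simp
    qed
  qed
qed

lemma integrable_reflect:
  fixes f :: "real^'d \<Rightarrow> complex"
  assumes f: "integrable lborel f"
  shows "integrable lborel (\<lambda>y. f (x - y))"
proof -
  have "integrable (distr lborel borel (\<lambda>y. x - y)) f"
    using f by (subst lborel_eq_distr_reflect[of x, symmetric])
  then show ?thesis by (rule integrable_distr[rotated]) simp
qed

lemma convol_reflect:
  assumes [measurable]: "F \<in> borel_measurable borel" "K \<in> borel_measurable borel"
  shows "convol F K x = (\<integral>y. F y * K (x - y) \<partial>lborel)"
  unfolding convol_def using integral_reflect[of "\<lambda>y. F y * K (x - y)" x] by simp

context quasi_projection_bounds
begin

text \<open>Fubini's theorem. Absolute convergence comes from the bound for the coefficients of
  \<open>\<bar>F\<bar> * \<bar>k\<^sup>\<or>\<bar>\<close>.\<close>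

lemma qcoeff_convol:
  assumes [measurable]: "F \<in> borel_measurable borel" and F: "J F < \<infinity>" and Sfin: "S < \<infinity>"
    and k: "continuous_on UNIV k" "\<And>\<xi>. \<delta> \<le> norm \<xi> \<Longrightarrow> k \<xi> = 0"
    and A: "\<And>x. cmod (inv_fourier k x) * (1 + norm x) ^ N \<le> A" and N: "\<alpha> + real CARD('d) < real N"
    and \<psi>: "integrable lborel \<psi>"
  shows "qcoeff \<psi> (convol F (inv_fourier k)) l = (\<integral>y. F y * transfer_kernel k \<psi> (y + int_vec l) \<partial>lborel)"
proof -
  have [measurable]: "k \<in> borel_measurable borel" using k(1) by (rule borel_measurable_continuous_onI)
  have ik: "integrable lborel k" by (rule integrable_compact_support[OF k])
  let ?K = "inv_fourier k"
  define G where "G x y = F y * ?K (x - y) * cnj (\<psi> (x + int_vec l))" for x y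
  let ?aF = "\<lambda>x. complex_of_real (cmod (F x))" and ?aK = "\<lambda>x. complex_of_real (cmod (?K x))"
  have JF: "J ?aF = J F" by (simp add: weighted_power_def)
  have fin: "decay_integral TYPE(real^'d) (real N - \<alpha>) < \<infinity>" using N by (intro decay_integral_finite) simp
  have "J (convol ?aF ?aK) \<le> ennreal_powr (ennreal (c * A) * decay_integral TYPE(real^'d) (real N - \<alpha>)) p * J ?aF"
    by (rule J_convol) (use A in auto)
  also have "\<dots> < \<infinity>" unfolding JF using F fin by (simp add: ennreal_mult_less_top)
  finally have Jc: "J (convol ?aF ?aK) < \<infinity>" .
  have i: "integrable lborel (\<lambda>y. ?aF (x - y) * ?aK y)" for x
    by (rule integrable_convolution[where A=A and N=N]) (use A N JF F in auto)
  have i': "integrable lborel (\<lambda>y. cmod (F (x - y)) * cmod (?K y))" for x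
    using integrable_norm[OF i[of x]] by (simp add: norm_mult)
  have "(\<integral>\<^sup>+x. \<integral>\<^sup>+y. ennreal (cmod (G x y)) \<partial>lborel \<partial>lborel) = abs_coeff (convol ?aF ?aK) l"
  proof (rule nn_integral_cong)
    fix x
    have c: "convol ?aF ?aK x = of_real (\<integral>y. cmod (F (x - y)) * cmod (?K y) \<partial>lborel)"
      unfolding convol_def by (simp only: of_real_mult[symmetric] integral_complex_of_real)
    have "(\<integral>\<^sup>+y. ennreal (cmod (G x y)) \<partial>lborel) = (\<integral>\<^sup>+y. ennreal (cmod (F y) * cmod (?K (x - y))) * ennreal (cmod (\<psi> (x + int_vec l))) \<partial>lborel)"
      by (simp add: G_def norm_mult ennreal_mult)
    also have "\<dots> = (\<integral>\<^sup>+y. ennreal (cmod (F y) * cmod (?K (x - y))) \<partial>lborel) * ennreal (cmod (\<psi> (x + int_vec l)))"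
      by (rule nn_integral_multc) measurable
    also have "(\<integral>\<^sup>+y. ennreal (cmod (F y) * cmod (?K (x - y))) \<partial>lborel) = (\<integral>\<^sup>+y. ennreal (cmod (F (x - y)) * cmod (?K y)) \<partial>lborel)"
      using nn_integral_reflect[of "\<lambda>y. ennreal (cmod (F y) * cmod (?K (x - y)))" x] by simp
    also have "\<dots> = ennreal (\<integral>y. cmod (F (x - y)) * cmod (?K y) \<partial>lborel)"
      by (rule nn_integral_eq_integral[OF i']) simp
    also have "\<dots> = ennreal (cmod (convol ?aF ?aK x))" unfolding c by (simp add: abs_of_nonneg)
    finally show "(\<integral>\<^sup>+y. ennreal (cmod (G x y)) \<partial>lborel) = ennreal (cmod (convol ?aF ?aK x * cnj (\<psi> (x + int_vec l))))"
      by (simp add: norm_mult ennreal_mult)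
  qed
  then have G: "integrable (lborel \<Otimes>\<^sub>M lborel) (\<lambda>(x, y). G x y)"
  proof (intro integrableI_bounded)
    assume *: "(\<integral>\<^sup>+x. \<integral>\<^sup>+y. ennreal (cmod (G x y)) \<partial>lborel \<partial>lborel) = abs_coeff (convol ?aF ?aK) l"
    show m: "(\<lambda>(x, y). G x y) \<in> borel_measurable (lborel \<Otimes>\<^sub>M lborel)" unfolding G_def by measurable
    have "(\<integral>\<^sup>+z. ennreal (norm (case z of (x, y) \<Rightarrow> G x y)) \<partial>(lborel \<Otimes>\<^sub>M lborel)) = (\<integral>\<^sup>+x. \<integral>\<^sup>+y. ennreal (cmod (G x y)) \<partial>lborel \<partial>lborel)"
      by (subst lborel.nn_integral_fst[symmetric]) (use m in auto)
    also have "\<dots> < \<infinity>" unfolding * by (rule abs_coeff_finite[OF _ Jc Sfin]) measurable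
    finally show "(\<integral>\<^sup>+z. ennreal (norm (case z of (x, y) \<Rightarrow> G x y)) \<partial>(lborel \<Otimes>\<^sub>M lborel)) < \<infinity>" .
  qed
  have "qcoeff \<psi> (convol F ?K) l = (\<integral>x. (\<integral>y. G x y \<partial>lborel) \<partial>lborel)"
    unfolding qcoeff_def G_def by (simp only: integral_mult_left_zero convol_reflect[OF assms(1) inv_fourier_measurable[OF \<open>k \<in> borel_measurable borel\<close>]])
  moreover have "(\<integral>y. (\<integral>x. G x y \<partial>lborel) \<partial>lborel) = (\<integral>x. (\<integral>y. G x y \<partial>lborel) \<partial>lborel)"
    by (rule lborel_pair.Fubini_integral[OF G])
  moreover have "(\<integral>x. G x y \<partial>lborel) = F y * transfer_kernel k \<psi> (y + int_vec l)" for y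
  proof -
    have "(\<integral>x. G x y \<partial>lborel) = F y * (\<integral>x. ?K (x - y) * cnj (\<psi> (x + int_vec l)) \<partial>lborel)"
      unfolding G_def mult.assoc by (rule integral_mult_right_zero)
    also have "(\<integral>x. ?K (x - y) * cnj (\<psi> (x + int_vec l)) \<partial>lborel) = (\<integral>z. ?K (z - (y + int_vec l)) * cnj (\<psi> z) \<partial>lborel)"
      using integral_translate[of "\<lambda>z. ?K (z - (y + int_vec l)) * cnj (\<psi> z)" "int_vec l"] by simp
    also have "\<dots> = transfer_kernel k \<psi> (y + int_vec l)" by (rule integral_inv_fourier_shift[OF ik \<psi>])
    finally show ?thesis .
  qed
  ultimately show ?thesis by simp
qed

text \<open>\<open>Q (F * k\<^sup>\<or>)\<close> is the operator \<open>Q\<close> with \<open>\<psi>\<close> replaced by the transfer kernel, applied to \<open>F\<close>. For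
  this pair the sum over \<open>k\<close> may be carried out first, and it depends on \<open>x - y\<close> only.\<close>

lemma qop_convol:
  fixes bD :: "real^'d \<Rightarrow> ennreal" and SD :: ennreal
  assumes [measurable]: "F \<in> borel_measurable borel" and F: "J F < \<infinity>" and Sfin: "S < \<infinity>"
    and k: "continuous_on UNIV k" "\<And>\<xi>. \<delta> \<le> norm \<xi> \<Longrightarrow> k \<xi> = 0"
    and A: "\<And>x. cmod (inv_fourier k x) * (1 + norm x) ^ N \<le> A" and N: "\<alpha> + real CARD('d) < real N"
    and \<phi>: "integrable lborel \<phi>" and \<psi>: "integrable lborel \<psi>"
    and supp: "\<And>\<xi> l. norm \<xi> < \<delta> \<Longrightarrow> l \<noteq> 0 \<Longrightarrow> fourier_lborel \<phi> (\<xi> + int_vec l) = 0"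
    and D: "quasi_projection_bounds p \<alpha> c v u \<phi> (\<lambda>s. cnj (transfer_kernel k \<psi> s)) a bD SD"
    and fin: "SD < \<infinity>" "amalgam < \<infinity>"
  shows "AE x in lborel. convol F (inv_fourier k) x - qop \<phi> \<psi> (convol F (inv_fourier k)) x
    = convol F (inv_fourier (\<lambda>\<xi>. k \<xi> * (1 - fourier_lborel \<phi> \<xi> * cnj (fourier_lborel \<psi> \<xi>)))) x"
proof -
  interpret D: quasi_projection_bounds p \<alpha> c v u \<phi> "\<lambda>s. cnj (transfer_kernel k \<psi> s)" a bD SD by (rule D)
  have [measurable]: "k \<in> borel_measurable borel" using k(1) by (rule borel_measurable_continuous_onI)
  have ik: "integrable lborel k" by (rule integrable_compact_support[OF k])
  let ?T = "transfer_kernel k \<psi>" and ?K = "inv_fourier k"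
  define r where "r \<xi> = k \<xi> * (fourier_lborel \<phi> \<xi> * cnj (fourier_lborel \<psi> \<xi>))" for \<xi>
  have [measurable]: "r \<in> borel_measurable borel" unfolding r_def by measurable
  have ir: "integrable lborel r" unfolding r_def
  proof (rule integrable_compact_support[where \<delta>=\<delta>])
    show "continuous_on UNIV (\<lambda>\<xi>. k \<xi> * (fourier_lborel \<phi> \<xi> * cnj (fourier_lborel \<psi> \<xi>)))"
      by (intro continuous_intros k(1) continuous_on_fourier_lborel \<phi> \<psi>)
  qed (use k(2) in simp)
  have bsplit: "inv_fourier (\<lambda>\<xi>. k \<xi> * (1 - fourier_lborel \<phi> \<xi> * cnj (fourier_lborel \<psi> \<xi>))) z = ?K z - inv_fourier r z" for z
  proof -
    have "integrable lborel (\<lambda>\<xi>. k \<xi> * char z \<xi>)" "integrable lborel (\<lambda>\<xi>. r \<xi> * char z \<xi>)"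
      by (auto intro!: integrable_mult_char ik ir)
    from Bochner_Integration.integral_diff[OF this] show ?thesis
      unfolding inv_fourier_def r_def by (simp add: algebra_simps)
  qed
  have coeff: "qcoeff \<psi> (convol F ?K) l = (\<integral>y. F y * ?T (y + int_vec l) \<partial>lborel)" for l
    by (rule qcoeff_convol[OF assms(1) F Sfin k A N \<psi>])
  have "AE x in lborel. \<forall>y. (\<integral>l. ?T (y + int_vec l) * \<phi> (x + int_vec l) \<partial>counting) = inv_fourier r (x - y)"
    unfolding r_def by (rule sum_transfer_kernel) (use k \<phi> \<psi> supp in auto)
  then show ?thesis
    using D.AE_abs_qop_finite[OF assms(1) F fin]
  proof eventually_elim
    case (elim x)
    define G where "G y l = F y * ?T (y + int_vec l) * \<phi> (x + int_vec l)" for y l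
    have m: "(\<lambda>(l, y). G y l) \<in> borel_measurable (counting \<Otimes>\<^sub>M lborel)" unfolding G_def by measurable
    have G: "integrable (counting \<Otimes>\<^sub>M lborel) (\<lambda>(l, y). G y l)"
    proof (rule integrableI_bounded[OF m])
      have "(\<integral>\<^sup>+z. ennreal (norm (case z of (l, y) \<Rightarrow> G y l)) \<partial>(counting \<Otimes>\<^sub>M lborel)) = (\<integral>\<^sup>+l. \<integral>\<^sup>+y. ennreal (cmod (G y l)) \<partial>lborel \<partial>counting)"
        by (subst lborel.nn_integral_fst[symmetric]) (use m in auto)
      also have "\<dots> = (\<integral>\<^sup>+l. D.abs_coeff F l * ennreal (cmod (\<phi> (x + int_vec l))) \<partial>counting)"
        unfolding G_def by (subst nn_integral_multc[symmetric]) (auto simp: norm_mult ennreal_mult)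
      also have "\<dots> < \<infinity>" by (rule elim(2))
      finally show "(\<integral>\<^sup>+z. ennreal (norm (case z of (l, y) \<Rightarrow> G y l)) \<partial>(counting \<Otimes>\<^sub>M lborel)) < \<infinity>" .
    qed
    have inner: "(\<integral>l. G y l \<partial>counting) = F y * inv_fourier r (x - y)" for y
    proof -
      have "(\<integral>l. G y l \<partial>counting) = F y * (\<integral>l. ?T (y + int_vec l) * \<phi> (x + int_vec l) \<partial>counting)"
        unfolding G_def mult.assoc by (rule integral_mult_right_zero)
      then show ?thesis using elim(1) by simp
    qed
    have "qop \<phi> \<psi> (convol F ?K) x = (\<integral>l. (\<integral>y. G y l \<partial>lborel) \<partial>counting)"
      unfolding qop_def coeff G_def by (simp only: integral_mult_left_zero)
    also have "\<dots> = (\<integral>y. (\<integral>l. G y l \<partial>counting) \<partial>lborel)"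
      by (rule counting_lborel.Fubini_integral[OF G, symmetric])
    finally have q: "qop \<phi> \<psi> (convol F ?K) x = (\<integral>y. F y * inv_fourier r (x - y) \<partial>lborel)" by (simp add: inner)
    have i1: "integrable lborel (\<lambda>y. F y * inv_fourier r (x - y))"
      using counting_lborel.integrable_snd[OF G] by (simp add: inner)
    have "integrable lborel (\<lambda>y. F (x - y) * ?K y)" by (rule integrable_convolution[OF assms(1) _ F A N]) measurable
    then have i2: "integrable lborel (\<lambda>y. F y * ?K (x - y))"
      using integrable_reflect[of "\<lambda>y. F (x - y) * ?K y" x] by simp
    have "convol F ?K x - qop \<phi> \<psi> (convol F ?K) x = (\<integral>y. F y * ?K (x - y) - F y * inv_fourier r (x - y) \<partial>lborel)"
      unfolding q by (subst convol_reflect, measurable) (rule Bochner_Integration.integral_diff[OF i2 i1, symmetric])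
    also have "\<dots> = convol F (inv_fourier (\<lambda>\<xi>. k \<xi> * (1 - fourier_lborel \<phi> \<xi> * cnj (fourier_lborel \<psi> \<xi>)))) x"
      by (subst convol_reflect, measurable) (simp only: bsplit, simp only: right_diff_distrib)
    finally show ?case .
  qed
qed

end

section \<open>The approximation error at unit scale\<close>

lemma analysis_bound_bounded:
  fixes b :: "real^'d \<Rightarrow> ennreal"
  assumes p: "1 \<le> p" and [measurable]: "b \<in> borel_measurable borel"
    and b: "\<And>x. periodization b x \<le> S0" and S0: "S0 < \<infinity>"
  shows "\<exists>S<\<infinity>. \<forall>f\<in>borel_measurable borel.
    (\<integral>\<^sup>+k. ennreal_powr (\<integral>\<^sup>+y. f y * b (y + int_vec k) \<partial>lborel) p \<partial>counting) \<le> S * (\<integral>\<^sup>+y. ennreal_powr (f y) p \<partial>lborel)"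
proof (cases "p = 1")
  case True
  have "(\<integral>\<^sup>+k. (\<integral>\<^sup>+y. f y * b (y + int_vec k) \<partial>lborel) \<partial>counting) \<le> S0 * (\<integral>\<^sup>+y. f y \<partial>lborel)"
    if [measurable]: "f \<in> borel_measurable borel" for f
    by (rule analysis_bound_L1) (use b in auto)
  then show ?thesis using True S0 by (intro exI[of _ S0]) simp
next
  case False
  then have p1: "1 < p" using p by simp
  define q where "q = p / (p - 1)"
  let ?W = "\<integral>\<^sup>+x. ennreal_powr (periodization b x) q \<partial>lcube"
  have "0 \<le> q" using p1 by (simp add: q_def)
  then have "?W \<le> (\<integral>\<^sup>+x. ennreal_powr S0 q \<partial>(lcube :: (real^'d) measure))"
    by (intro nn_integral_mono ennreal_powr_mono b) auto
  also have "\<dots> = ennreal_powr S0 q" by simp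
  also have "\<dots> < \<infinity>" using S0 by simp
  finally have fin: "?W < \<infinity>" .
  have "(\<integral>\<^sup>+k. ennreal_powr (\<integral>\<^sup>+y. f y * b (y + int_vec k) \<partial>lborel) p \<partial>counting)
      \<le> ennreal_powr ?W (p - 1) * (\<integral>\<^sup>+y. ennreal_powr (f y) p \<partial>lborel)" if "f \<in> borel_measurable borel" for f
    by (rule analysis_bound_Lp[OF p1 q_def _ _ fin]) (use that in auto)
  moreover have "ennreal_powr ?W (p - 1) < \<infinity>" using fin by simp
  ultimately show ?thesis by (intro exI[of _ "ennreal_powr ?W (p - 1)"]) auto
qed

context quasi_projection_bounds
begin

lemma qop_diff:
  assumes [measurable]: "F \<in> borel_measurable borel" "G \<in> borel_measurable borel"
    and F: "J F < \<infinity>" and G: "J G < \<infinity>" and fin: "S < \<infinity>" "amalgam < \<infinity>"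
  shows "AE x in lborel. qop \<phi> \<psi> (\<lambda>x. F x - G x) x = qop \<phi> \<psi> F x - qop \<phi> \<psi> G x"
  using AE_qop_summable[OF assms(1) F fin] AE_qop_summable[OF assms(2) G fin]
proof eventually_elim
  case (elim x)
  have "qcoeff \<psi> (\<lambda>x. F x - G x) k = qcoeff \<psi> F k - qcoeff \<psi> G k" for k
    unfolding qcoeff_def left_diff_distrib
    by (rule Bochner_Integration.integral_diff[OF qcoeff_integrable[OF assms(1) F fin(1)] qcoeff_integrable[OF assms(2) G fin(1)]])
  then show ?case unfolding qop_def
    by (simp only: left_diff_distrib Bochner_Integration.integral_diff[OF elim])
qed

end

lemma (in moderate_weight) J_fin_convol:
  assumes [measurable]: "F \<in> borel_measurable borel" "k \<in> borel_measurable borel" and F: "J F < \<infinity>"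
    and A: "\<And>x. cmod (k x) * (1 + norm x) ^ N \<le> A" and N: "\<alpha> + real CARD('d) < real N"
  shows "J (convol F k) < \<infinity>"
proof -
  have "decay_integral TYPE(real^'d) (real N - \<alpha>) < \<infinity>" using N by (intro decay_integral_finite) simp
  then have "ennreal_powr (ennreal (c * A) * decay_integral TYPE(real^'d) (real N - \<alpha>)) p * J F < \<infinity>"
    using F by (simp add: ennreal_mult_less_top)
  with J_convol[OF assms(1,2) A] show ?thesis by (rule le_less_trans)
qed

lemma (in moderate_weight) convol_diff:
  assumes [measurable]: "F \<in> borel_measurable borel" "G \<in> borel_measurable borel" "k \<in> borel_measurable borel"
    and F: "J F < \<infinity>" and G: "J G < \<infinity>"
    and A: "\<And>x. cmod (k x) * (1 + norm x) ^ N \<le> A" and N: "\<alpha> + real CARD('d) < real N"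
  shows "convol F k x - convol G k x = convol (\<lambda>x. F x - G x) k x"
  unfolding convol_def left_diff_distrib
  by (rule Bochner_Integration.integral_diff[symmetric]; rule integrable_convolution[OF _ _ _ A N]) (use F G in auto)

text \<open>The Borel functions \<open>a\<close> and \<open>b\<close> stand in for \<open>\<bar>\<phi>\<bar> u\<close> and \<open>\<bar>\<psi>\<bar> u\<close>, since \<open>u\<close> is only a bound and may
  fail to be measurable. The constant is chosen before \<open>v\<close>, which makes the result uniform over all
  scales.\<close>

theorem quasi_projection_error_unit_scale:
  fixes \<phi> \<psi> :: "real^'d \<Rightarrow> complex" and u :: "real^'d \<Rightarrow> real" and a b :: "real^'d \<Rightarrow> ennreal" and S :: ennreal
    and p \<alpha> c \<epsilon> \<delta>\<^sub>0 K :: real and n \<gamma> :: nat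
  assumes p: "1 \<le> p" and \<alpha>: "0 \<le> \<alpha>" and c: "0 < c" and n: "1 \<le> n"
    and u: "\<And>x. 1 \<le> u x" "\<And>x. u (- x) = u x" "\<And>x. u x \<le> c * (1 + norm x) powr \<alpha>"
    and \<phi>: "integrable lborel \<phi>" and \<psi>: "integrable lborel \<psi>"
    and [measurable]: "a \<in> borel_measurable borel" "b \<in> borel_measurable borel"
    and a: "AE x in lborel. ennreal (cmod (\<phi> x) * u x) \<le> a x"
    and b: "AE x in lborel. ennreal (cmod (\<psi> x) * u x) \<le> b x"
    and S: "\<And>f. f \<in> borel_measurable borel \<Longrightarrow>
      (\<integral>\<^sup>+k. ennreal_powr (\<integral>\<^sup>+y. f y * b (y + int_vec k) \<partial>lborel) p \<partial>counting) \<le> S * (\<integral>\<^sup>+y. ennreal_powr (f y) p \<partial>lborel)"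
    and Sfin: "S < \<infinity>" and afin: "(\<integral>\<^sup>+x. ennreal_powr (periodization a x) p \<partial>lcube) < \<infinity>"
    and \<epsilon>: "0 < \<epsilon>" and C\<phi>: "0 \<le> C\<phi>" "smooth_bd \<gamma> (ball 0 \<epsilon>) C\<phi> (fourier_lborel \<phi>)"
    and C\<psi>: "0 \<le> C\<psi>" "smooth_bd \<gamma> (ball 0 \<epsilon>) C\<psi> (fourier_lborel \<psi>)"
    and \<gamma>: "real n + \<alpha> + real CARD('d) < real \<gamma>"
    and van: "\<And>\<xi>. norm \<xi> < \<epsilon> \<Longrightarrow> cmod (1 - fourier_lborel \<phi> \<xi> * cnj (fourier_lborel \<psi> \<xi>)) \<le> K * norm \<xi> ^ n"
    and \<delta>0: "0 < \<delta>\<^sub>0" "\<And>\<xi> l. norm \<xi> < \<delta>\<^sub>0 \<Longrightarrow> l \<noteq> 0 \<Longrightarrow> fourier_lborel \<phi> (\<xi> + int_vec l) = 0"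
  shows "\<exists>C<\<infinity>. \<forall>v F \<Omega>. v \<in> borel_measurable borel \<longrightarrow> (\<forall>x. 1 \<le> v x) \<longrightarrow> (\<forall>x y. v (x + y) \<le> u x * v y) \<longrightarrow>
    F \<in> borel_measurable borel \<longrightarrow> weighted_power p v F < \<infinity> \<longrightarrow>
    (\<forall>h. norm h < 1 \<longrightarrow> weighted_power p v (fin_diff n h F) \<le> \<Omega>) \<longrightarrow>
    weighted_power p v (\<lambda>x. F x - qop \<phi> \<psi> F x) \<le> C * \<Omega>"
proof -
  have [measurable]: "\<phi> \<in> borel_measurable borel" "\<psi> \<in> borel_measurable borel" using \<phi> \<psi> by auto
  (* Small enough for smoothness and vanishing of the symbol, for the absence of aliasing, and for Fourier inversion inside the unit cube. *)
  define \<delta> where "\<delta> = min (min \<epsilon> \<delta>\<^sub>0) (1 / 2) / 2"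
  have \<delta>: "0 < \<delta>" "\<delta> < 1" "\<delta> < 1 / 2" "\<delta> < \<epsilon>" "\<delta> < \<delta>\<^sub>0" using \<epsilon> \<delta>0(1) by (auto simp: \<delta>_def)
  (* The decay order of the smoothing kernels is at our disposal: it must absorb the growth of large differences and be at least the decay order of the error kernel. *)
  define N where "N = \<gamma> + nat \<lceil>real n * (1 + \<alpha>) + real CARD('d)\<rceil> + 1"
  have "real n * (1 + \<alpha>) + real CARD('d) \<le> real (nat \<lceil>real n * (1 + \<alpha>) + real CARD('d)\<rceil>)"
    using real_nat_ceiling_ge by blast
  then have N: "real n * (1 + \<alpha>) + real CARD('d) < real N" unfolding N_def by linarith
  have N': "\<alpha> + real CARD('d) < real N" using \<gamma> unfolding N_def by linarith
  have \<gamma>N: "\<gamma> \<le> N" by (simp add: N_def)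
  obtain \<kappa> \<theta> k A where ker: "continuous_on UNIV \<kappa>" "\<And>\<xi>. \<delta> \<le> norm \<xi> \<Longrightarrow> \<kappa> \<xi> = (0::complex)" "\<kappa> 0 = 1"
      "continuous_on UNIV \<theta>" "\<And>\<xi>. \<delta> \<le> norm \<xi> \<Longrightarrow> \<theta> \<xi> = (0::complex)"
      "continuous_on UNIV k" "\<And>\<xi>. \<delta> \<le> norm \<xi> \<Longrightarrow> k \<xi> = (0::complex)" "smooth_all N k"
      "\<And>\<xi> :: real^'d. k \<xi> = - diff_symbol n \<kappa> \<xi>"
      "\<And>\<xi>. k \<xi> = (\<Sum>\<nu>\<in>{1..n}. diff_coeff n \<nu> * of_nat \<nu> ^ n * \<theta> (real \<nu> *\<^sub>R \<xi>))"
      "\<And>y. cmod (inv_fourier \<kappa> y) * (1 + norm y) ^ N \<le> A"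
      "\<And>l h y. l \<le> n \<Longrightarrow> cmod (dir_kernel k l h y) * (1 + norm y) ^ N \<le> A * norm h ^ l"
      "\<And>h y. cmod (dir_kernel \<theta> n h y) * (1 + norm y) ^ N \<le> A * norm h ^ n"
    using smoothing_kernel_exists[OF n \<delta>(1,2), of N] by blast
  have [measurable]: "k \<in> borel_measurable borel" "\<kappa> \<in> borel_measurable borel"
    using ker(1,6) by (auto intro: borel_measurable_continuous_onI)
  have kA: "cmod (inv_fourier k y) * (1 + norm y) ^ N \<le> A" for y
    using ker(12)[of 0 0 y] by (simp add: dir_kernel_def)
  obtain Ck where Ck: "0 \<le> Ck" "smooth_bd \<gamma> UNIV Ck k"
    using ker(8) smooth_bd_mono_order[OF _ \<gamma>N] by (auto simp: smooth_all_def)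
  obtain A0 where A0: "0 \<le> A0" "\<And>(b :: real^'d \<Rightarrow> complex) D x. b \<in> borel_measurable borel \<Longrightarrow> smooth_bd \<gamma> UNIV D b \<Longrightarrow>
    (\<forall>\<xi>. \<delta> < norm \<xi> \<longrightarrow> b \<xi> = 0) \<Longrightarrow> cmod (inv_fourier b x) * (1 + norm x) ^ \<gamma> \<le> A0 * D"
    using inv_fourier_decay[of \<delta> \<gamma>, where 'd='d] \<delta> by (auto simp: less_imp_le)

  let ?T = "transfer_kernel k \<psi>"
  have cn\<psi>: "smooth_bd \<gamma> (ball 0 \<epsilon>) C\<psi> (\<lambda>\<xi>. cnj (fourier_lborel \<psi> \<xi>))"
    by (rule smooth_bd_cnj[OF open_ball C\<psi>(2)])
  define A1 where "A1 = A0 * (2 ^ \<gamma> * Ck * C\<psi>)"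
  have "smooth_bd \<gamma> UNIV (2 ^ \<gamma> * Ck * C\<psi>) (\<lambda>\<xi>. k \<xi> * cnj (fourier_lborel \<psi> \<xi>))"
    by (rule smooth_bd_cutoff[OF Ck(2) _ cn\<psi> \<delta>(4) Ck(1) C\<psi>(1)]) (use ker(7) in auto)
  then have T: "cmod (?T s) * (1 + norm s) ^ \<gamma> \<le> A1" for s
    unfolding transfer_kernel_def A1_def
    using A0(2)[of "\<lambda>\<xi>. k \<xi> * cnj (fourier_lborel \<psi> \<xi>)" "2 ^ \<gamma> * Ck * C\<psi>" "- s"] ker(7) by auto
  have A1: "0 \<le> A1" using A0(1) Ck(1) C\<psi>(1) by (simp add: A1_def)

  define f where "f \<xi> = k \<xi> * (1 - fourier_lborel \<phi> \<xi> * cnj (fourier_lborel \<psi> \<xi>))" for \<xi>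
  have fc: "continuous_on UNIV f" unfolding f_def
    by (intro continuous_intros ker(6) continuous_on_fourier_lborel \<phi> \<psi>)
  have [measurable]: "f \<in> borel_measurable borel" using fc by (rule borel_measurable_continuous_onI)
  have f0: "f \<xi> = 0" if "\<delta> \<le> norm \<xi>" for \<xi> using ker(7)[OF that] by (simp add: f_def)
  define Df where "Df = 1 + 2 ^ \<gamma> * 1 * (2 ^ \<gamma> * C\<phi> * C\<psi>)"
  have "smooth_bd \<gamma> (ball 0 \<epsilon>) Df (\<lambda>\<xi>. 1 + (- 1) * (fourier_lborel \<phi> \<xi> * cnj (fourier_lborel \<psi> \<xi>)))"
    unfolding Df_def
    by (intro smooth_bd_add smooth_bd_mult smooth_bd_const C\<phi> cn\<psi> open_ball) (use C\<phi> C\<psi> in auto)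
  then have "smooth_bd \<gamma> UNIV (2 ^ \<gamma> * Ck * Df) (\<lambda>\<xi>. k \<xi> * (1 + (- 1) * (fourier_lborel \<phi> \<xi> * cnj (fourier_lborel \<psi> \<xi>))))"
    using C\<phi> C\<psi> Ck ker(7) \<delta>(4) by (intro smooth_bd_cutoff[where \<delta>=\<delta> and \<epsilon>=\<epsilon>]) (auto simp: Df_def)
  then have fsm: "smooth_bd \<gamma> UNIV (2 ^ \<gamma> * Ck * Df) f" by (simp add: f_def[abs_def])
  define A2 where "A2 = A + A0 * (2 ^ \<gamma> * Ck * Df)"
  have Apos: "0 \<le> A" by (rule order_trans[OF _ kA[of 0]]) simp
  have A2: "A \<le> A2" using A0(1) Ck(1) C\<phi>(1) C\<psi>(1) by (simp add: A2_def Df_def)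
  have fA: "cmod (inv_fourier f y) * (1 + norm y) ^ \<gamma> \<le> A2" for y
    using A0(2)[OF borel_measurable_continuous_onI[OF fc] fsm, of y] f0 Apos by (auto simp: A2_def)
  obtain Bk where Bk: "0 \<le> Bk" "\<And>\<xi>. cmod (k \<xi>) \<le> Bk"
    using Ck smooth_bd_mono_order[OF Ck(2), of 0] by (auto intro: that[of Ck])
  have fvan: "cmod (f \<xi>) \<le> (Bk * K) * norm \<xi> ^ n" if "norm \<xi> < \<epsilon>" for \<xi>
  proof -
    have "cmod (f \<xi>) \<le> Bk * (K * norm \<xi> ^ n)" unfolding f_def norm_mult
      using Bk by (intro mult_mono van that) auto
    then show ?thesis by (simp add: mult.assoc)
  qed

  (* The transfer kernel takes the place of \<psi>; its decay makes the periodization of its weighted absolute value bounded. *)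
  define bD where "bD x = ennreal (c * A1) * ennreal ((1 + norm x) powr (- (real \<gamma> - \<alpha>)))" for x :: "real^'d"
  have [measurable]: "bD \<in> borel_measurable borel" unfolding bD_def by measurable
  have bD: "ennreal (cmod (cnj (?T x)) * u x) \<le> bD x" for x
  proof -
    have "cmod (?T x) * u x \<le> (A1 * (1 + norm x) powr (- real \<gamma>)) * (c * (1 + norm x) powr \<alpha>)"
      using u(1)[of x] A1 by (intro mult_mono decay_powr T u(3)) auto
    also have "\<dots> = (c * A1) * ((1 + norm x) powr (- real \<gamma>) * (1 + norm x) powr \<alpha>)" by (simp add: mult_ac)
    also have "(1 + norm x) powr (- real \<gamma>) * (1 + norm x) powr \<alpha> = (1 + norm x) powr (- (real \<gamma> - \<alpha>))"
      by (subst powr_add[symmetric]) simp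
    finally show ?thesis unfolding bD_def using c A1 by (subst ennreal_mult[symmetric]) (auto intro: ennreal_leI)
  qed
  obtain S0 where S0: "S0 < \<infinity>" "\<And>x :: real^'d. periodization (\<lambda>x. ennreal ((1 + norm x) powr (- (real \<gamma> - \<alpha>)))) x \<le> S0"
    using periodization_decay[of "real \<gamma> - \<alpha>", where 'd='d] \<gamma> by auto
  have "periodization bD x \<le> ennreal (c * A1) * S0" for x
  proof -
    have "periodization bD x = ennreal (c * A1) * periodization (\<lambda>x. ennreal ((1 + norm x) powr (- (real \<gamma> - \<alpha>)))) x"
      unfolding bD_def by (rule nn_integral_cmult) measurable
    also have "\<dots> \<le> ennreal (c * A1) * S0" by (intro mult_left_mono S0) simp
    finally show ?thesis .
  qed
  then obtain SD where SD: "SD < \<infinity>" "\<forall>f\<in>borel_measurable borel.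
    (\<integral>\<^sup>+k. ennreal_powr (\<integral>\<^sup>+y. f y * bD (y + int_vec k) \<partial>lborel) p \<partial>counting) \<le> SD * (\<integral>\<^sup>+y. ennreal_powr (f y) p \<partial>lborel)"
    using analysis_bound_bounded[OF p, of bD "ennreal (c * A1) * S0"] S0(1) by (auto simp: ennreal_mult_less_top)

  define am where "am = (\<integral>\<^sup>+x. ennreal_powr (periodization a x) p \<partial>lcube)"
  define c1 where "c1 = ennreal_powr (ennreal (c ^ n * A) * decay_integral TYPE(real^'d) (real N - real n * (1 + \<alpha>))) p"
  define cK where "cK = ennreal_powr (ennreal (c * A) * decay_integral TYPE(real^'d) (real N - \<alpha>)) p"
  define cR where "cR = ennreal (2 powr p) * (c1 + cK * c1)"
  define cb where "cb = ennreal_powr (ennreal (c * A2) * decay_integral TYPE(real^'d) (real \<gamma> - (\<alpha> + real n))) p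
      * ennreal_powr (ennreal (c ^ n * A2) * decay_integral TYPE(real^'d) (real N - real n * (1 + \<alpha>))) p"
  (* The factors 2 powr p come from the quasi-triangle inequality for p-th powers of norms; cR bounds the distance to the smoothed function, cb the error of the smoothed function. *)
  define C where "C = ennreal (2 powr p) * (cR + ennreal (2 powr p) * (cb + S * cR * am))"
  have d1: "decay_integral TYPE(real^'d) (real N - real n * (1 + \<alpha>)) < \<infinity>" using N by (intro decay_integral_finite) simp
  have d2: "decay_integral TYPE(real^'d) (real N - \<alpha>) < \<infinity>" using N' by (intro decay_integral_finite) simp
  have d3: "decay_integral TYPE(real^'d) (real \<gamma> - (\<alpha> + real n)) < \<infinity>" using \<gamma> by (intro decay_integral_finite) simp
  have "c1 < \<infinity>" "cK < \<infinity>" "cb < \<infinity>" using d1 d2 d3 unfolding c1_def cK_def cb_def by (simp_all add: ennreal_mult_less_top)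
  moreover from this have "cR < \<infinity>" unfolding cR_def by (simp add: ennreal_mult_less_top)
  ultimately have Cfin: "C < \<infinity>" using Sfin afin unfolding C_def am_def by (simp add: ennreal_mult_less_top)

  have main: "weighted_power p v (\<lambda>x. F x - qop \<phi> \<psi> F x) \<le> C * \<Omega>"
    if v [measurable]: "v \<in> borel_measurable borel" and v1: "\<And>x. 1 \<le> v x" and vu: "\<And>x y. v (x + y) \<le> u x * v y"
      and F [measurable]: "F \<in> borel_measurable borel" and JF: "weighted_power p v F < \<infinity>"
      and \<Omega>: "\<And>h. norm h < 1 \<Longrightarrow> weighted_power p v (fin_diff n h F) \<le> \<Omega>" for v F \<Omega>
  proof -
    interpret moderate_weight p \<alpha> c v
    proof
      fix x y
      have "v (x + y) \<le> u x * v y" by (rule vu)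
      also have "\<dots> \<le> c * (1 + norm x) powr \<alpha> * v y" using v1[of y] by (intro mult_right_mono u(3)) auto
      finally show "v (x + y) \<le> c * (1 + norm x) powr \<alpha> * v y" .
    qed (use p \<alpha> c v v1 in auto)
    interpret quasi_projection_bounds p \<alpha> c v u \<phi> \<psi> a b S
      by unfold_locales (use u vu a b S in auto)
    have D: "quasi_projection_bounds p \<alpha> c v u \<phi> (\<lambda>s. cnj (?T s)) a bD SD"
    proof unfold_locales
      show "(\<lambda>s. cnj (?T s)) \<in> borel_measurable borel" by measurable
      show "AE x in lborel. ennreal (cmod (cnj (?T x)) * u x) \<le> bD x" using bD by (intro AE_I2)
      show "(\<integral>\<^sup>+k. ennreal_powr (\<integral>\<^sup>+y. f y * bD (y + int_vec k) \<partial>lborel) p \<partial>counting) \<le> SD * (\<integral>\<^sup>+y. ennreal_powr (f y) p \<partial>lborel)"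
        if "f \<in> borel_measurable borel" for f using SD(2) that by blast
    qed (use u vu a in auto)
    have fin: "amalgam < \<infinity>" using afin .
    let ?K = "inv_fourier k"
    (* R = E + E * K is the distance of F from its twofold smoothing. *)
    define E where "E x = F x - convol F ?K x" for x
    define R where "R x = F x - convol (convol F ?K) ?K x" for x
    have [measurable]: "E \<in> borel_measurable borel" "R \<in> borel_measurable borel" unfolding E_def R_def by measurable
    have JF1: "J (convol F ?K) < \<infinity>" by (rule J_fin_convol[OF _ _ JF kA N']) measurable
    have Jg: "J (convol (convol F ?K) ?K) < \<infinity>" by (rule J_fin_convol[OF _ _ JF1 kA N']) measurable
    have E_eq: "E x = (\<integral>s. inv_fourier \<kappa> s * fin_diff n (- s) F x \<partial>lborel)" for x
    proof -
      have "?K y = - inv_fourier (diff_symbol n \<kappa>) y" for y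
        unfolding inv_fourier_def by (simp add: ker(9))
      then have "convol F ?K x = - convol F (inv_fourier (diff_symbol n \<kappa>)) x" unfolding convol_def by simp
      then show ?thesis unfolding E_def
        using convol_diff_symbol[OF F JF ker(1,2) \<delta>(3) ker(11) N', of n x] ker(3) by simp
    qed
    have JE: "J E \<le> c1 * \<Omega>" unfolding E_eq[abs_def] c1_def
      by (rule J_difference_average[OF F _ ker(11) \<Omega>]) measurable
    have JE': "J (convol E ?K) \<le> cK * (c1 * \<Omega>)"
    proof -
      have "J (convol E ?K) \<le> cK * J E" unfolding cK_def by (rule J_convol[OF _ _ kA]) measurable
      also have "\<dots> \<le> cK * (c1 * \<Omega>)" by (intro mult_left_mono JE) simp
      finally show ?thesis .
    qed
    have R_eq: "R x = E x + convol E ?K x" for x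
    proof -
      have "convol F ?K x - convol (convol F ?K) ?K x = convol E ?K x" unfolding E_def
        by (rule convol_diff[OF _ _ _ JF JF1 kA N']) measurable
      then show ?thesis by (simp add: R_def E_def algebra_simps)
    qed
    have JR: "J R \<le> cR * \<Omega>"
    proof -
      have "J R \<le> ennreal (2 powr p) * (J E + J (convol E ?K))"
        unfolding R_eq[abs_def] by (rule J_add) measurable
      also have "\<dots> \<le> ennreal (2 powr p) * (c1 * \<Omega> + cK * (c1 * \<Omega>))" by (intro mult_left_mono add_mono JE JE') simp
      also have "\<dots> = cR * \<Omega>" unfolding cR_def by (simp add: distrib_left distrib_right mult.assoc)
      finally show ?thesis .
    qed
    let ?g = "convol (convol F ?K) ?K"
    have g_eq: "AE x in lborel. ?g x - qop \<phi> \<psi> ?g x = convol (convol F ?K) (inv_fourier f) x"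
      unfolding f_def
      by (rule qop_convol[OF _ JF1 Sfin ker(6,7) kA N' \<phi> \<psi> _ D SD(1) fin]) (measurable, use \<delta>0(2) \<delta>(5) in auto)
    have Jg_err: "J (convol (convol F ?K) (inv_fourier f)) \<le> cb * \<Omega>"
    proof -
      have "J (convol (convol F ?K) (inv_fourier f))
        \<le> ennreal_powr (ennreal (c * A2) * decay_integral TYPE(real^'d) (real \<gamma> - (\<alpha> + real n))) p
        * (ennreal_powr (ennreal (c ^ n * A2) * decay_integral TYPE(real^'d) (real N - real n * (1 + \<alpha>))) p * \<Omega>)"
      proof (rule J_taylor_convol[OF F JF n \<Omega> ker(6,7) ker(4,5) fc f0 \<delta>(3) ker(10) _ _ fA fvan \<epsilon> N' \<gamma>])
        show "cmod (dir_kernel k l h y) * (1 + norm y) ^ N \<le> A2 * norm h ^ l" if "l \<le> n" for l h y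
          by (rule order_trans[OF ker(12)[OF that]]) (intro mult_right_mono A2, simp)
        show "cmod (dir_kernel \<theta> n h y) * (1 + norm y) ^ N \<le> A2 * norm h ^ n" for h y
          by (rule order_trans[OF ker(13)]) (intro mult_right_mono A2, simp)
      qed
      then show ?thesis by (simp add: cb_def mult.assoc)
    qed
    have "AE x in lborel. F x - qop \<phi> \<psi> F x = R x + (convol (convol F ?K) (inv_fourier f) x + - qop \<phi> \<psi> R x)"
    proof -
      have "AE x in lborel. qop \<phi> \<psi> R x = qop \<phi> \<psi> F x - qop \<phi> \<psi> ?g x"
        unfolding R_def by (rule qop_diff[OF _ _ JF Jg Sfin fin]) measurable
      then show ?thesis using g_eq
      proof eventually_elim
        case (elim x)
        have "F x - qop \<phi> \<psi> F x = R x + ((?g x - qop \<phi> \<psi> ?g x) - (qop \<phi> \<psi> F x - qop \<phi> \<psi> ?g x))"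
          by (simp add: R_def)
        then show ?case unfolding elim by simp
      qed
    qed
    then have "J (\<lambda>x. F x - qop \<phi> \<psi> F x) = J (\<lambda>x. R x + (convol (convol F ?K) (inv_fourier f) x + - qop \<phi> \<psi> R x))"
      by (rule J_cong_AE)
    also have "\<dots> \<le> ennreal (2 powr p) * (J R + J (\<lambda>x. convol (convol F ?K) (inv_fourier f) x + - qop \<phi> \<psi> R x))"
      by (rule J_add) measurable
    also have "\<dots> \<le> ennreal (2 powr p) * (cR * \<Omega> + ennreal (2 powr p) * (cb * \<Omega> + S * cR * am * \<Omega>))"
    proof (intro mult_left_mono add_mono JR)
      have "J (\<lambda>x. convol (convol F ?K) (inv_fourier f) x + - qop \<phi> \<psi> R x)
        \<le> ennreal (2 powr p) * (J (convol (convol F ?K) (inv_fourier f)) + J (\<lambda>x. - qop \<phi> \<psi> R x))"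
        by (rule J_add) measurable
      also have "\<dots> \<le> ennreal (2 powr p) * (cb * \<Omega> + S * cR * am * \<Omega>)"
      proof (intro mult_left_mono add_mono Jg_err)
        have "J (\<lambda>x. - qop \<phi> \<psi> R x) = J (qop \<phi> \<psi> R)" by (rule J_minus)
        also have "\<dots> \<le> S * J R * amalgam" by (rule J_qop) measurable
        also have "\<dots> \<le> S * (cR * \<Omega>) * amalgam" by (intro mult_left_mono mult_right_mono JR) auto
        finally show "J (\<lambda>x. - qop \<phi> \<psi> R x) \<le> S * cR * am * \<Omega>" by (simp add: am_def mult_ac)
      qed simp
      finally show "J (\<lambda>x. convol (convol F ?K) (inv_fourier f) x + - qop \<phi> \<psi> R x) \<le> \<dots>" .
    qed simp
    also have "\<dots> = C * \<Omega>" unfolding C_def by (simp add: distrib_left distrib_right mult.assoc)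
    finally show ?thesis .
  qed
  show ?thesis by (rule exI[of _ C]) (use Cfin main in blast)
qed

section \<open>Invertible changes of variables\<close>

text \<open>The Jacobian formula for linear maps, by reduction to elementary matrices.\<close>

text \<open>The Jacobian formula for linear maps over an arbitrary finite index type, by reduction to elementary
  matrices. For a shear, boxes are first translated into the region of nonnegative coordinates, where
  \<open>measure_shear_interval\<close> applies.\<close>

lemma measure_invertible_linear_image:
  fixes A :: "real^'d^'d"
  assumes "det A \<noteq> 0" and "S \<in> lmeasurable"
  shows "(*v) A ` S \<in> lmeasurable \<and> measure lebesgue ((*v) A ` S) = \<bar>det A\<bar> * measure lebesgue S"
  using assms
proof (induction A arbitrary: S rule: induct_matrix_elementary_alt)
  case (1 A B)
  have nz: "det A \<noteq> 0" "det B \<noteq> 0" using 1(3) by (auto simp: det_mul)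
  have "(*v) (A ** B) ` S = (*v) A ` (*v) B ` S" by (simp add: image_image matrix_vector_mul_assoc)
  then show ?case using 1(1)[OF nz(1), of "(*v) B ` S"] 1(2)[OF nz(2) 1(4)] by (simp add: det_mul abs_mult)
next
  case (2 A i)
  then show ?case using det_zero_row(1)[of i A] by simp
next
  case (3 A)
  have "(*v) A = (\<lambda>x. \<chi> i. A $ i $ i * x $ i)"
  proof
    fix x
    have "(\<Sum>j\<in>UNIV. A $ i $ j * x $ j) = A $ i $ i * x $ i" for i
      using 3(1) by (subst sum.remove[of _ i]) (auto intro!: sum.neutral)
    then show "A *v x = (\<chi> i. A $ i $ i * x $ i)" by (simp add: matrix_vector_mult_def)
  qed
  then show ?case
    using measurable_stretch[OF 3(3), of "\<lambda>i. A $ i $ i"] measure_stretch[OF 3(3), of "\<lambda>i. A $ i $ i"] det_diagonal[of A] 3(1)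
    by (simp add: abs_prod)
next
  case (4 m n)
  define t where "t = Transposition.transpose m n"
  have tt [simp]: "t (t i) = i" for i by (simp add: t_def)
  let ?A = "(\<chi> i j. mat 1 $ i $ Transposition.transpose m n j) :: real^'d^'d"
  have eq: "(*v) ?A = (\<lambda>x. \<chi> i. x $ t i)"
  proof
    fix x :: "real^'d"
    have "(\<Sum>j\<in>UNIV. (if i = t j then 1 else 0) * x $ j) = x $ t i" for i
    proof -
      have "i = t j \<longleftrightarrow> j = t i" for j using tt by metis
      then have "(\<Sum>j\<in>UNIV. (if i = t j then 1 else 0) * x $ j) = (\<Sum>j\<in>UNIV. if j = t i then x $ j else 0)"
        by (intro sum.cong) auto
      then show ?thesis by simp
    qed
    then show "?A *v x = (\<chi> i. x $ t i)" by (simp add: matrix_vector_mult_def mat_def t_def)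
  qed
  have d: "\<bar>det ?A\<bar> = 1" by (simp add: det_permute_columns permutes_swap_id sign_swap_id abs_mult)
  have "(*v) ?A ` S \<in> lmeasurable \<and> 1 * measure lebesgue S = measure lebesgue ((*v) ?A ` S)"
  proof (rule measure_linear_sufficient[OF _ 4(3)])
    show "linear ((*v) ?A)" by simp
  next
    fix a b :: "real^'d"
    have img: "(*v) ?A ` cbox a b = cbox (?A *v a) (?A *v b)"
    proof safe
      fix y assume y: "y \<in> cbox (?A *v a) (?A *v b)"
      have "?A *v y \<in> cbox a b"
        unfolding mem_box_cart
      proof
        fix i
        show "a $ i \<le> (?A *v y) $ i \<and> (?A *v y) $ i \<le> b $ i"
          using y[unfolded mem_box_cart, THEN spec, of "t i"] by (simp add: eq)
      qed
      moreover have "y = ?A *v (?A *v y)" by (simp add: eq vec_eq_iff)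
      ultimately show "y \<in> (*v) ?A ` cbox a b" by blast
    qed (simp add: eq mem_box_cart)
    show "measure lebesgue ((*v) ?A ` cbox a b) = 1 * measure lebesgue (cbox a b)"
    proof (cases "cbox a b = {}")
      case False
      then have ne: "cbox (?A *v a) (?A *v b) \<noteq> {}" unfolding img[symmetric] by simp
      have "(\<Prod>i\<in>UNIV. b $ t i - a $ t i) = (\<Prod>i\<in>UNIV. b $ i - a $ i)"
        using prod.permute[OF permutes_swap_id, where S=UNIV and g="\<lambda>i. b $ i - a $ i", of m n] by (simp add: o_def t_def)
      then show ?thesis unfolding img using False ne
        by (simp add: content_cbox_cart) (simp add: eq)
    qed simp
  qed
  then show ?case using d by simp
next
  case (5 m n)
  let ?A = "(\<chi> i j. of_bool (i = m \<and> j = n \<or> i = j)) :: real^'d^'d"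
  have eq: "(*v) ?A = (\<lambda>x. \<chi> i. if i = m then x $ m + x $ n else x $ i)"
  proof
    fix x :: "real^'d"
    have "(\<Sum>j\<in>UNIV. of_bool (i = m \<and> j = n \<or> i = j) * x $ j) = (if i = m then x $ m + x $ n else x $ i)" for i
    proof -
      have "(\<Sum>j\<in>UNIV. of_bool (i = m \<and> j = n \<or> i = j) * x $ j)
        = (\<Sum>j\<in>UNIV. (if j = i then x $ j else 0) + (if j = n then (if i = m then x $ j else 0) else 0))"
        using 5(1) by (intro sum.cong) auto
      also have "\<dots> = x $ i + (if i = m then x $ n else 0)" by (subst sum.distrib) simp
      finally show ?thesis by simp
    qed
    then show "?A *v x = (\<chi> i. if i = m then x $ m + x $ n else x $ i)" by (simp add: matrix_vector_mult_def)
  qed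
  have "det (\<chi> k. if k = m then row m (mat 1 :: real^'d^'d) + 1 *s row n (mat 1) else row k (mat 1)) = det (mat 1 :: real^'d^'d)"
    by (rule det_row_operation[OF 5(1)])
  also have "(\<chi> k. if k = m then row m (mat 1 :: real^'d^'d) + 1 *s row n (mat 1) else row k (mat 1)) = ?A"
    using 5(1) by (auto simp: vec_eq_iff row_def mat_def)
  finally have d: "\<bar>det ?A\<bar> = 1" by simp
  have "(*v) ?A ` S \<in> lmeasurable \<and> 1 * measure lebesgue S = measure lebesgue ((*v) ?A ` S)"
  proof (rule measure_linear_sufficient[OF _ 5(3)])
    show "linear ((*v) ?A)" by simp
  next
    fix a b :: "real^'d"
    show "measure lebesgue ((*v) ?A ` cbox a b) = 1 * measure lebesgue (cbox a b)"
    proof (cases "cbox a b = {}")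
      case False
      (* After translation by s the box lies in the region of nonnegative coordinates. *)
      define s where "s = (\<chi> i. \<bar>a $ i\<bar>)"
      have tr: "cbox (s + a) (s + b) = (+) s ` cbox a b" by (simp add: cbox_translation)
      have "(+) (?A *v s) ` (*v) ?A ` cbox a b = (*v) ?A ` cbox (s + a) (s + b)"
        unfolding tr image_image by (simp add: matrix_vector_right_distrib)
      then have "measure lebesgue ((*v) ?A ` cbox a b) = measure lebesgue ((*v) ?A ` cbox (s + a) (s + b))"
        using measure_translation[of "?A *v s" "(*v) ?A ` cbox a b"] by simp
      also have "\<dots> = measure lebesgue (cbox (s + a) (s + b))"
      proof -
        have "cbox (s + a) (s + b) \<noteq> {}" unfolding tr using False by simp
        moreover have "0 \<le> (s + a) $ n" by (simp add: s_def)
        ultimately show ?thesis unfolding eq by (rule measure_shear_interval[OF 5(1)])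
      qed
      also have "\<dots> = measure lebesgue (cbox a b)" unfolding tr by (rule measure_translation)
      finally show ?thesis by simp
    qed simp
  qed
  then show ?case using d by simp
qed

lemma matrix_inv_mult:
  fixes B :: "real^'d^'d"
  assumes "invertible B" shows "B ** matrix_inv B = mat 1" "matrix_inv B ** B = mat 1"
proof -
  have "\<exists>A'. B ** A' = mat 1 \<and> A' ** B = mat 1" using assms by (simp add: invertible_def)
  from someI_ex[OF this] show "B ** matrix_inv B = mat 1" "matrix_inv B ** B = mat 1"
    by (simp_all add: matrix_inv_def)
qed

lemma matrix_inv_vector:
  fixes B :: "real^'d^'d"
  assumes "invertible B"
  shows "B *v (matrix_inv B *v x) = x" "matrix_inv B *v (B *v x) = x"
  using matrix_inv_mult[OF assms] by (simp_all add: matrix_vector_mul_assoc)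

lemma invertible_matrix_inv:
  fixes B :: "real^'d^'d"
  shows "invertible B \<Longrightarrow> invertible (matrix_inv B)"
  using matrix_inv_mult[of B] by (auto simp: invertible_def)

lemma matrix_inv_matrix_inv:
  fixes B :: "real^'d^'d"
  assumes "invertible B" shows "matrix_inv (matrix_inv B) *v x = B *v x"
  using matrix_inv_vector(2)[OF invertible_matrix_inv[OF assms], of "B *v x"] matrix_inv_vector(2)[OF assms]
  by simp

lemma matrix_vector_borel [measurable]: "(*v) (B :: real^'d^'d) \<in> borel \<rightarrow>\<^sub>M borel"
  by (intro borel_measurable_continuous_onI linear_continuous_on matrix_vector_mul_bounded_linear)

lemma lborel_eq_linear_distr:
  fixes B :: "real^'d^'d"
  assumes B: "invertible B"
  shows "lborel = density (distr lborel borel ((*v) B)) (\<lambda>_. ennreal \<bar>det B\<bar>)"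
proof (rule lborel_eqI)
  fix l r :: "real^'d" assume lr: "\<And>b. b \<in> Basis \<Longrightarrow> l \<bullet> b \<le> r \<bullet> b"
  let ?A = "matrix_inv B"
  have vim: "(*v) B -` box l r = (*v) ?A ` box l r"
  proof safe
    fix x assume "B *v x \<in> box l r" then show "x \<in> (*v) ?A ` box l r"
      using matrix_inv_vector(2)[OF B, of x] by (metis imageI)
  qed (simp add: matrix_inv_vector(1)[OF B])
  have [measurable]: "(*v) B -` box l r \<in> sets borel"
    using measurable_sets[OF matrix_vector_borel[of B], of "box l r"] by simp
  have dA: "det ?A \<noteq> 0" using invertible_matrix_inv[OF B] by (simp add: invertible_det_nz)
  have fm: "(*v) ?A ` box l r \<in> lmeasurable" "measure lebesgue ((*v) ?A ` box l r) = \<bar>det ?A\<bar> * measure lebesgue (box l r)"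
    using measure_invertible_linear_image[OF dA lmeasurable_box] by auto
  have "emeasure lborel ((*v) B -` box l r) = emeasure lebesgue ((*v) B -` box l r)"
    by simp
  also have "\<dots> = ennreal (measure lebesgue ((*v) ?A ` box l r))"
    unfolding vim using fm(1) by (rule emeasure_eq_measure2)
  also have "measure lebesgue ((*v) ?A ` box l r) = \<bar>det ?A\<bar> * measure lebesgue (box l r)"
    by (rule fm(2))
  finally have "emeasure (density (distr lborel borel ((*v) B)) (\<lambda>_. ennreal \<bar>det B\<bar>)) (box l r)
      = ennreal \<bar>det B\<bar> * ennreal (\<bar>det ?A\<bar> * measure lebesgue (box l r))"
    by (simp add: emeasure_density_const emeasure_distr)
  also have "\<dots> = ennreal ((\<bar>det B\<bar> * \<bar>det ?A\<bar>) * measure lebesgue (box l r))"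
    by (subst ennreal_mult[symmetric]) (auto simp: mult.assoc)
  also have "\<bar>det B\<bar> * \<bar>det ?A\<bar> = 1"
    using matrix_inv_mult(1)[OF B] det_mul[of B ?A] by (simp add: abs_mult[symmetric])
  also have "ennreal (1 * measure lebesgue (box l r)) = ennreal (prod ((\<bullet>) (r - l)) Basis)"
    using measure_lborel_box[OF lr] by (simp only: measure_completion sets_lborel borel_open open_box mult_1)
  finally show "emeasure (density (distr lborel borel ((*v) B)) (\<lambda>_. ennreal \<bar>det B\<bar>)) (box l r) = ennreal (prod ((\<bullet>) (r - l)) Basis)" .
qed simp

lemma nn_integral_linear:
  fixes B :: "real^'d^'d"
  assumes B: "invertible B" and [measurable]: "f \<in> borel_measurable borel"
  shows "(\<integral>\<^sup>+y. f y \<partial>lborel) = ennreal \<bar>det B\<bar> * (\<integral>\<^sup>+x. f (B *v x) \<partial>lborel)"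
  by (subst lborel_eq_linear_distr[OF B], subst nn_integral_density, simp, simp, subst nn_integral_cmult, simp, subst nn_integral_distr) simp_all

lemma integral_linear_map:
  fixes B :: "real^'d^'d" and f :: "real^'d \<Rightarrow> complex"
  assumes B: "invertible B" and [measurable]: "f \<in> borel_measurable borel"
  shows "(\<integral>y. f y \<partial>lborel) = of_real \<bar>det B\<bar> * (\<integral>x. f (B *v x) \<partial>lborel)"
  by (subst lborel_eq_linear_distr[OF B], subst integral_density, simp, simp, simp, subst integral_distr) (simp_all add: scaleR_conv_of_real)

lemma integrable_linear_map:
  fixes B :: "real^'d^'d" and f :: "real^'d \<Rightarrow> complex"
  assumes B: "invertible B" and f: "integrable lborel f"
  shows "integrable lborel (\<lambda>x. f (B *v x))"
proof (rule integrableI_bounded)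
  have [measurable]: "f \<in> borel_measurable borel" using f by auto
  show "(\<lambda>x. f (B *v x)) \<in> borel_measurable lborel" by measurable
  have "ennreal \<bar>det B\<bar> * (\<integral>\<^sup>+x. ennreal (norm (f (B *v x))) \<partial>lborel) = (\<integral>\<^sup>+y. ennreal (norm (f y)) \<partial>lborel)"
    by (rule nn_integral_linear[OF B, symmetric]) measurable
  also have "\<dots> < \<infinity>" using f by (simp add: integrable_iff_bounded)
  finally show "(\<integral>\<^sup>+x. ennreal (norm (f (B *v x))) \<partial>lborel) < \<infinity>"
    using B by (auto simp: ennreal_mult_less_top invertible_det_nz)
qed

lemma AE_linear:
  fixes B :: "real^'d^'d"
  assumes B: "invertible B" and P: "AE y in lborel. P y"
  shows "AE x in lborel. P (B *v x)"
proof -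
  have d: "0 < \<bar>det B\<bar>" using B by (simp add: invertible_det_nz)
  have "AE y in density (distr lborel borel ((*v) B)) (\<lambda>_. ennreal \<bar>det B\<bar>). P y"
    using P unfolding lborel_eq_linear_distr[OF B, symmetric] .
  then have "AE y in distr lborel borel ((*v) B). P y"
    using d by (subst (asm) AE_density) auto
  then show ?thesis by (rule AE_distrD[rotated]) simp
qed

section \<open>Borel representatives\<close>

lemma borel_representative:
  fixes f :: "real^'d \<Rightarrow> complex"
  assumes f: "f \<in> borel_measurable lebesgue"
  obtains g where "g \<in> borel_measurable borel" "AE x in lborel. f x = g x"
proof -
  have "(\<lambda>x. Re (f x)) \<in> borel_measurable lebesgue" "(\<lambda>x. Im (f x)) \<in> borel_measurable lebesgue"
    using f by measurable
  from this[THEN completion_ex_borel_measurable_real]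
  obtain r i where r: "r \<in> borel_measurable lborel" "AE x in lborel. Re (f x) = r x"
    and i: "i \<in> borel_measurable lborel" "AE x in lborel. Im (f x) = i x" by auto
  have "(\<lambda>x. Complex (r x) (i x)) \<in> borel_measurable borel"
    unfolding Complex_eq using r(1) i(1) by measurable
  moreover have "AE x in lborel. f x = Complex (r x) (i x)"
    using r(2) i(2) by eventually_elim (simp add: complex_eq_iff)
  ultimately show ?thesis by (rule that)
qed

lemma borel_imp_lebesgue: "f \<in> borel_measurable borel \<Longrightarrow> f \<in> borel_measurable (lebesgue :: (real^'d) measure)"
  by (rule measurable_completion) simp

lemma AE_eq_lebesgue_measurable:
  fixes f g :: "real^'d \<Rightarrow> complex"
  assumes "g \<in> borel_measurable borel" "AE x in lborel. f x = g x"
  shows "f \<in> borel_measurable lebesgue"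
proof (rule borel_measurable_AE[of g])
  show "g \<in> borel_measurable lebesgue" by (rule borel_imp_lebesgue) fact
  show "AE x in lebesgue. g x = f x" using AE_completion[OF assms(2)] by eventually_elim simp
qed

lemma integral_representative:
  fixes f g :: "real^'d \<Rightarrow> complex"
  assumes g: "g \<in> borel_measurable borel" and eq: "AE x in lborel. f x = g x"
  shows "(\<integral>x. f x \<partial>lebesgue) = (\<integral>x. g x \<partial>lborel)" "integrable lebesgue f \<longleftrightarrow> integrable lborel g"
proof -
  have fl: "f \<in> borel_measurable lebesgue" by (rule AE_eq_lebesgue_measurable[OF g eq])
  have gl: "g \<in> borel_measurable lebesgue" by (rule borel_imp_lebesgue[OF g])
  have "(\<integral>x. f x \<partial>lebesgue) = (\<integral>x. g x \<partial>lebesgue)"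
    by (rule integral_cong_AE[OF fl gl AE_completion[OF eq]])
  then show "(\<integral>x. f x \<partial>lebesgue) = (\<integral>x. g x \<partial>lborel)" using g by (simp add: integral_completion)
  have "integrable lebesgue f \<longleftrightarrow> integrable lebesgue g"
    by (rule integrable_cong_AE[OF fl gl AE_completion[OF eq]])
  then show "integrable lebesgue f \<longleftrightarrow> integrable lborel g" using g by (simp add: integrable_completion)
qed

lemma fourier_representative:
  fixes f g :: "real^'d \<Rightarrow> complex"
  assumes [measurable]: "g \<in> borel_measurable borel" and eq: "AE x in lborel. f x = g x"
  shows "fourier f = fourier_lborel g"
proof
  fix \<xi>
  have "fourier f \<xi> = (\<integral>x. g x * exp (- 2 * of_real pi * \<i> * of_real (x \<bullet> \<xi>)) \<partial>lborel)"
    unfolding fourier_def by (rule integral_representative(1)) (measurable, use eq in eventually_elim, simp)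
  moreover have "fourier g \<xi> = (\<integral>x. g x * exp (- 2 * of_real pi * \<i> * of_real (x \<bullet> \<xi>)) \<partial>lborel)"
    unfolding fourier_def by (rule integral_representative(1)) measurable
  ultimately show "fourier f \<xi> = fourier_lborel g \<xi>" using fourier_eq_fourier_lborel[OF assms(1), of \<xi>] by simp
qed

lemma Lpw_norm_representative:
  fixes f g :: "real^'d \<Rightarrow> complex"
  assumes p: "1 \<le> p" and eq: "AE x in lborel. f x = g x" and w: "\<And>x. 1 \<le> w x"
  shows "Lpw_norm (ennreal p) (\<lambda>x. 1 / w x) f = ennreal_powr (weighted_power p w g) (1 / p)"
proof -
  have "(\<integral>\<^sup>+x. ennreal_powr (ennreal (cmod (f x * complex_of_real (1 / w x)))) p \<partial>lborel) = weighted_power p w g"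
    unfolding weighted_power_def
  proof (rule nn_integral_cong_AE)
    show "AE x in lborel. ennreal_powr (ennreal (cmod (f x * complex_of_real (1 / w x)))) p = ennreal_powr (ennreal (cmod (g x) / w x)) p"
      using eq
    proof eventually_elim
      case (elim x)
      have "cmod (f x * complex_of_real (1 / w x)) = cmod (g x) / w x"
        using w[of x] unfolding norm_mult norm_of_real elim by simp
      then show ?case by (simp only:)
    qed
  qed
  then show ?thesis using p
    unfolding Lpw_norm_def Lp_norm_def eLp_def weighted_def by (simp add: nn_integral_completion)
qed

text \<open>Enumerate the countable index set; partial sums are finite subsums.\<close>

lemma nn_integral_counting_le_infsum:
  fixes f :: "int^'d \<Rightarrow> ennreal"
  shows "(\<integral>\<^sup>+k. f k \<partial>counting) \<le> (\<Sum>\<^sub>\<infinity>k\<in>UNIV. f k)"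
proof -
  have "infinite (UNIV :: (int^'d) set)"
  proof
    assume "finite (UNIV :: (int^'d) set)"
    then have "finite (range (\<lambda>i::int. (\<chi> j. i) :: int^'d))" by (rule rev_finite_subset) simp
    moreover have "inj (\<lambda>i::int. (\<chi> j. i) :: int^'d)" by (rule injI) (simp add: vec_eq_iff)
    ultimately have "finite (UNIV :: int set)" by (rule finite_imageD)
    then show False by (simp add: infinite_UNIV_int)
  qed
  then have b: "bij_betw (from_nat_into (UNIV :: (int^'d) set)) UNIV UNIV"
    by (intro bij_betw_from_nat_into) auto
  let ?e = "from_nat_into (UNIV :: (int^'d) set)"
  have "(\<integral>\<^sup>+k. f k \<partial>counting) = (\<integral>\<^sup>+i. f (?e i) \<partial>count_space UNIV)"
    by (rule nn_integral_bij_count_space[OF b, symmetric])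
  also have "\<dots> = (\<Sum>i. f (?e i))" by (rule nn_integral_count_space_nat)
  also have "\<dots> = (SUP n. \<Sum>i<n. f (?e i))" by (rule suminf_eq_SUP)
  also have "\<dots> \<le> Sup (sum f ` {F. finite F \<and> F \<subseteq> UNIV})"
  proof (rule SUP_least)
    fix n
    have "(\<Sum>i<n. f (?e i)) = sum f (?e ` {..<n})"
      using b by (subst sum.reindex) (auto simp: bij_betw_def intro: inj_on_subset)
    then show "(\<Sum>i<n. f (?e i)) \<le> Sup (sum f ` {F. finite F \<and> F \<subseteq> UNIV})"
      by (auto intro!: SUP_upper)
  qed
  also have "\<dots> = (\<Sum>\<^sub>\<infinity>k\<in>UNIV. f k)" by (rule nonneg_infsum_complete[symmetric]) simp
  finally show ?thesis .
qed

abbreviation "half_cube \<equiv> cbox (\<chi> i. - 1 / 2) (\<chi> i. 1 / 2) :: (real^'d) set"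

lemma unit_cube_subset_half_cube: "unit_cube \<subseteq> (half_cube :: (real^'d) set)"
  by (auto simp: unit_cube_def mem_box_cart less_imp_le)

text \<open>A Borel representative agrees with the function at all integer translates of almost every point.\<close>

lemma AE_lcube_periodization_le:
  fixes f g :: "real^'d \<Rightarrow> complex"
  assumes eq: "AE x in lborel. f x = g x"
  shows "AE x in lborel. periodization (\<lambda>x. ennreal (cmod (g x))) x \<le> (\<Sum>\<^sub>\<infinity>k\<in>(UNIV :: (int^'d) set). ennreal (cmod (f (x + int_vec k))))"
  using AE_translates[OF eq]
proof eventually_elim
  case (elim x)
  then have "periodization (\<lambda>x. ennreal (cmod (g x))) x = (\<integral>\<^sup>+k. ennreal (cmod (f (x + int_vec k))) \<partial>counting)" by simp
  then show ?case using nn_integral_counting_le_infsum by simp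
qed

lemma calL_norm_finite_exponent:
  fixes f g :: "real^'d \<Rightarrow> complex"
  assumes r: "1 \<le> r" and [measurable]: "g \<in> borel_measurable borel" and eq: "AE x in lborel. f x = g x"
    and fin: "calL_norm (ennreal r) f < \<infinity>"
  shows "(\<integral>\<^sup>+x. ennreal_powr (periodization (\<lambda>x. ennreal (cmod (g x))) x) r \<partial>lcube) < \<infinity>"
proof -
  let ?s = "\<lambda>x. \<Sum>\<^sub>\<infinity>k\<in>(UNIV :: (int^'d) set). ennreal (cmod (f (x + int_vec k)))"
  let ?P = "periodization (\<lambda>x. ennreal (cmod (g x)))"
  have "(\<integral>\<^sup>+x. ennreal_powr (?P x) r \<partial>lcube) = (\<integral>\<^sup>+x. indicator unit_cube x * ennreal_powr (?P x) r \<partial>lborel)"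
    by (rule nn_integral_density) measurable
  also have "\<dots> \<le> (\<integral>\<^sup>+x. ennreal_powr (?s x) r * indicator half_cube x \<partial>lborel)"
  proof (rule nn_integral_mono_AE)
    show "AE x in lborel. indicator unit_cube x * ennreal_powr (?P x) r \<le> ennreal_powr (?s x) r * indicator half_cube x"
      using AE_lcube_periodization_le[OF eq]
      by eventually_elim (use unit_cube_subset_half_cube r in \<open>auto simp: indicator_def intro!: ennreal_powr_mono\<close>)
  qed
  also have "\<dots> = (\<integral>\<^sup>+x. ennreal_powr (?s x) r \<partial>(lebesgue_on half_cube))"
    by (subst nn_integral_restrict_space) (auto simp: nn_integral_completion)
  also have "\<dots> < \<infinity>"
    using fin r unfolding calL_norm_def eLp_def by simp
  finally show ?thesis .
qed

lemma calL_norm_infinite_exponent: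
  fixes f g :: "real^'d \<Rightarrow> complex"
  assumes eq: "AE x in lborel. f x = g x" and fin: "calL_norm \<infinity> f < \<infinity>"
  shows "AE x in lcube. periodization (\<lambda>x. ennreal (cmod (g x))) x \<le> calL_norm \<infinity> f"
proof -
  let ?s = "\<lambda>x. \<Sum>\<^sub>\<infinity>k\<in>(UNIV :: (int^'d) set). ennreal (cmod (f (x + int_vec k)))"
  have "AE x in lebesgue_on half_cube. ?s x \<le> calL_norm \<infinity> f"
    unfolding calL_norm_def eLp_def by (simp only: refl if_True esssup_AE)
  then have "AE x in lebesgue. x \<in> half_cube \<longrightarrow> ?s x \<le> calL_norm \<infinity> f"
    by (subst (asm) AE_restrict_space_iff) auto
  then have "AE x in lborel. x \<in> half_cube \<longrightarrow> ?s x \<le> calL_norm \<infinity> f" by (simp add: AE_completion_iff)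
  then have "AE x in lborel. x \<in> unit_cube \<longrightarrow> periodization (\<lambda>x. ennreal (cmod (g x))) x \<le> calL_norm \<infinity> f"
    using AE_lcube_periodization_le[OF eq]
    by eventually_elim (use unit_cube_subset_half_cube in \<open>auto intro: order_trans\<close>)
  then show ?thesis by (simp add: AE_lcube)
qed

lemma integrable_counting_imp_infsum:
  fixes f :: "int^'d \<Rightarrow> complex"
  assumes "integrable counting f"
  shows "(\<lambda>k. norm (f k)) summable_on UNIV" "(\<Sum>\<^sub>\<infinity>k\<in>UNIV. f k) = (\<integral>k. f k \<partial>counting)"
proof -
  have *: "Infinite_Set_Sum.abs_summable_on f UNIV" using assms by (simp add: abs_summable_on_def)
  then show "(\<lambda>k. norm (f k)) summable_on UNIV" by (simp add: abs_summable_equivalent[symmetric])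
  show "(\<Sum>\<^sub>\<infinity>k\<in>UNIV. f k) = (\<integral>k. f k \<partial>counting)"
    using infsetsum_infsum[OF *] by (simp add: infsetsum_def)
qed

section \<open>Dilation matrices, weights and exponents\<close>

text \<open>A kernel vector would be an eigenvector with eigenvalue zero.\<close>

lemma dilation_matrix_det_nonzero:
  fixes M :: "real^'d^'d"
  assumes "dilation_matrix M" shows "det M \<noteq> 0"
proof
  assume "det M = 0"
  then have "\<not> invertible M" by (simp add: invertible_det_nz)
  then obtain x where x: "M *v x = 0" "x \<noteq> 0"
    unfolding invertible_left_inverse matrix_left_invertible_ker by blast
  define z where "z = (\<chi> i. complex_of_real (x $ i))"
  have "z \<noteq> 0" using x(2) by (auto simp: z_def vec_eq_iff)
  moreover have "map_matrix complex_of_real M *v z = 0 *s z"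
  proof -
    have "(\<Sum>j\<in>UNIV. complex_of_real (M $ i $ j) * complex_of_real (x $ j)) = 0" for i
    proof -
      have "(\<Sum>j\<in>UNIV. M $ i $ j * x $ j) = (M *v x) $ i" by (simp add: matrix_vector_mult_def)
      then have "(\<Sum>j\<in>UNIV. M $ i $ j * x $ j) = 0" using x(1) by simp
      then have "complex_of_real (\<Sum>j\<in>UNIV. M $ i $ j * x $ j) = 0" by (simp only: of_real_0)
      then show ?thesis by (simp only: of_real_sum of_real_mult)
    qed
    then show ?thesis by (simp add: vec_eq_iff z_def matrix_vector_mult_def map_matrix_def)
  qed
  ultimately have "1 < cmod 0"
    using assms[unfolded dilation_matrix_def, THEN spec[of _ 0], THEN spec[of _ z]] by (simp only: simp_thms)
  then show False by simp
qed

lemma det_mat_pow: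
  fixes M :: "real^'d^'d" shows "det (mat_pow M j) = det M ^ j"
proof (induction j)
  case (Suc j)
  have "mat_pow M (Suc j) = M ** mat_pow M j" by (simp add: mat_pow_def)
  then show ?case using Suc by (simp add: det_mul)
qed (simp add: mat_pow_def)

lemma invertible_mat_pow: "dilation_matrix M \<Longrightarrow> invertible (mat_pow M j)"
  using dilation_matrix_det_nonzero[of M] by (simp add: invertible_det_nz det_mat_pow)

lemma weighted_power_linear:
  fixes B :: "real^'d^'d"
  assumes B: "invertible B" and [measurable]: "g \<in> borel_measurable borel" "w \<in> borel_measurable borel"
  shows "weighted_power p (\<lambda>x. w (matrix_inv B *v x)) (\<lambda>x. g (matrix_inv B *v x)) = ennreal \<bar>det B\<bar> * weighted_power p w g"
proof -
  let ?f = "\<lambda>y. ennreal_powr (ennreal (cmod (g (matrix_inv B *v y)) / w (matrix_inv B *v y))) p"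
  have "(\<integral>\<^sup>+y. ?f y \<partial>lborel) = ennreal \<bar>det B\<bar> * (\<integral>\<^sup>+x. ?f (B *v x) \<partial>lborel)"
    by (rule nn_integral_linear[OF B]) measurable
  then show ?thesis unfolding weighted_power_def by (simp only: matrix_inv_vector(2)[OF B])
qed

lemma fin_diff_linear:
  fixes A :: "real^'d^'d"
  shows "fin_diff n h (\<lambda>x. g (A *v x)) = (\<lambda>x. fin_diff n (A *v h) g (A *v x))"
proof -
  have "A *v (x + real \<nu> *\<^sub>R h) = A *v x + real \<nu> *\<^sub>R (A *v h)" for x \<nu>
    using linear_scale[of "(*v) A" "real \<nu>" h] by (simp only: matrix_vector_right_distrib matrix_vector_mul_linear)
  then show ?thesis unfolding fin_diff_def by (simp only:)
qed

lemma AE_fin_diff: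
  fixes f g :: "real^'d \<Rightarrow> complex"
  assumes "AE x in lborel. f x = g x"
  shows "AE x in lborel. fin_diff n h f x = fin_diff n h g x"
proof -
  have "AE x in lborel. \<forall>\<nu>::nat. f (x + real \<nu> *\<^sub>R h) = g (x + real \<nu> *\<^sub>R h)"
    by (subst AE_all_countable) (intro allI AE_translate assms)
  then show ?thesis by eventually_elim (simp add: fin_diff_def)
qed

lemma conjugate_exponent_cases:
  assumes p: "1 \<le> p" and q: "1 / ennreal p + 1 / q = 1"
  shows "p = 1 \<and> q = \<infinity> \<or> 1 < p \<and> q = ennreal (p / (p - 1))"
proof (cases q)
  case (real r)
  have P: "1 / ennreal p = ennreal (1 / p)" using p by (simp add: divide_ennreal flip: ennreal_1)
  show ?thesis
  proof (cases "r = 0")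
    case True
    then show ?thesis using q real by (simp add: ennreal_divide_zero)
  next
    case False
    then have r: "0 < r" using real by simp
    then have "1 / q = ennreal (1 / r)" using real by (simp add: divide_ennreal flip: ennreal_1)
    then have "ennreal (1 / p + 1 / r) = ennreal 1" using q P p r by (simp add: ennreal_plus)
    then have e: "1 / p + 1 / r = 1" using p r by (subst (asm) ennreal_inj) auto
    then have "r + p = p * r" using p r by (simp add: field_simps)
    moreover have "p \<noteq> 1" using e r by auto
    ultimately have "1 < p" "r = p / (p - 1)" using p by (auto simp: field_simps)
    then show ?thesis using real by simp
  qed
next
  case top
  then have "ennreal (1 / p) = ennreal 1" using q p by (simp add: divide_ennreal flip: ennreal_1)
  then have "p = 1" using p by (subst (asm) ennreal_inj) auto
  then show ?thesis using top by simp
qed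

text \<open>The two cases \<open>q = \<infinity>\<close> and \<open>q = p / (p - 1)\<close> of the hypothesis on \<open>\<psi>\<close> enter the proof only through these
  two consequences.\<close>

lemma conjugate_amalgam_bounds:
  fixes f g :: "real^'d \<Rightarrow> complex"
  assumes p: "1 \<le> p" and q: "1 / ennreal p + 1 / q = 1" and [measurable]: "g \<in> borel_measurable borel"
    and eq: "AE x in lborel. f x = g x" and fin: "calL_norm q f < \<infinity>"
  shows "\<exists>S<\<infinity>. \<forall>h\<in>borel_measurable borel. (\<integral>\<^sup>+k. ennreal_powr (\<integral>\<^sup>+y. h y * ennreal (cmod (g (y + int_vec k))) \<partial>lborel) p \<partial>counting)
      \<le> S * (\<integral>\<^sup>+y. ennreal_powr (h y) p \<partial>lborel)" (is ?bound)
    and "(\<integral>\<^sup>+x. ennreal (cmod (g x)) \<partial>lborel) < \<infinity>" (is ?L1)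
proof -
  let ?b = "\<lambda>x. ennreal (cmod (g x))"
  have "?bound \<and> ?L1"
    using conjugate_exponent_cases[OF p q]
  proof
    assume 1: "p = 1 \<and> q = \<infinity>"
    let ?S = "calL_norm \<infinity> f"
    have S: "?S < \<infinity>" using fin 1 by simp
    have b: "AE x in lcube. periodization ?b x \<le> ?S" by (rule calL_norm_infinite_exponent[OF eq S])
    have "(\<integral>\<^sup>+k. (\<integral>\<^sup>+y. h y * ?b (y + int_vec k) \<partial>lborel) \<partial>counting) \<le> ?S * (\<integral>\<^sup>+y. h y \<partial>lborel)"
      if [measurable]: "h \<in> borel_measurable borel" for h
      by (rule analysis_bound_L1[OF _ _ b]) measurable
    then have ?bound using S 1 by (intro exI[of _ ?S]) simp
    moreover have "(\<integral>\<^sup>+x. ?b x \<partial>lborel) = (\<integral>\<^sup>+x. periodization ?b x \<partial>lcube)"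
      by (rule nn_integral_tiling) measurable
    then have "(\<integral>\<^sup>+x. ?b x \<partial>lborel) \<le> (\<integral>\<^sup>+x. ?S \<partial>(lcube :: (real^'d) measure))"
      using nn_integral_mono_AE[OF b] by simp
    then have ?L1 using S by (simp add: le_less_trans)
    ultimately show ?thesis by blast
  next
    assume 2: "1 < p \<and> q = ennreal (p / (p - 1))"
    let ?r = "p / (p - 1)"
    let ?W = "\<integral>\<^sup>+x. ennreal_powr (periodization ?b x) ?r \<partial>lcube"
    have r: "1 \<le> ?r" using 2 by (simp add: field_simps)
    have W: "?W < \<infinity>" by (rule calL_norm_finite_exponent[OF r _ eq]) (use fin 2 in auto)
    have "(\<integral>\<^sup>+k. ennreal_powr (\<integral>\<^sup>+y. h y * ?b (y + int_vec k) \<partial>lborel) p \<partial>counting)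
      \<le> ennreal_powr ?W (p - 1) * (\<integral>\<^sup>+y. ennreal_powr (h y) p \<partial>lborel)" if "h \<in> borel_measurable borel" for h
      by (rule analysis_bound_Lp[OF _ refl _ _ W]) (use that 2 in auto)
    moreover have "ennreal_powr ?W (p - 1) < \<infinity>" using W by simp
    ultimately have ?bound by (intro exI[of _ "ennreal_powr ?W (p - 1)"]) auto
    moreover have "ennreal_powr (\<integral>\<^sup>+x. ?b x \<partial>lborel) ?r \<le> ?W" by (rule nn_integral_le_periodization[OF r]) measurable
    then have "ennreal_powr (\<integral>\<^sup>+x. ?b x \<partial>lborel) ?r < \<infinity>" using W by (rule le_less_trans)
    then have ?L1 by simp
    ultimately show ?thesis by blast
  qed
  then show ?bound ?L1 by auto
qed

text \<open>Translate forth and back: \<open>w 0 \<le> ws x * ws (-x) * w 0\<close>.\<close>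

lemma weight_companion_ge_1:
  assumes "weight_companion \<alpha> w ws" "\<And>x. 1 \<le> w x" shows "1 \<le> ws x"
proof -
  have nn: "0 \<le> ws x" and ev: "ws (- x) = ws x" and sub: "\<And>x y. w (x + y) \<le> ws x * w y"
    using assms(1) unfolding weight_companion_def by auto
  have "w 0 \<le> ws x * w (- x)" using sub[of x "- x"] by simp
  also have "\<dots> \<le> ws x * (ws x * w 0)" using sub[of "- x" 0] nn by (intro mult_left_mono) (auto simp: ev)
  finally have "1 * w 0 \<le> (ws x)\<^sup>2 * w 0" by (simp add: power2_eq_square mult.assoc)
  then have "1\<^sup>2 \<le> (ws x)\<^sup>2" using assms(2)[of 0] by (subst (asm) mult_le_cancel_right) auto
  then show ?thesis using nn by (rule power2_le_imp_le)
qed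

text \<open>The closed support is compact and at positive distance from the complement of the open cube, which
  contains all nonzero integer points.\<close>

lemma separated_from_integer_translates:
  fixes g :: "real^'d \<Rightarrow> complex"
  assumes "closure {\<xi>. g \<xi> \<noteq> 0} \<subseteq> {\<xi>. \<forall>i. -1 < \<xi> $ i \<and> \<xi> $ i < 1}"
  shows "\<exists>\<delta>>0. \<forall>\<xi> l. norm \<xi> < \<delta> \<longrightarrow> l \<noteq> 0 \<longrightarrow> g (\<xi> + int_vec l) = 0"
proof -
  let ?S = "closure {\<xi>. g \<xi> \<noteq> 0}" and ?Q = "box (\<chi> i. -1) (\<chi> i. 1) :: (real^'d) set"
  have Q: "{\<xi>. \<forall>i. -1 < \<xi> $ i \<and> \<xi> $ i < 1} = ?Q" by (auto simp: mem_box_cart)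
  have SQ: "?S \<subseteq> ?Q" using assms unfolding Q .
  have "compact ?S" using bounded_subset[OF bounded_box SQ] by (simp add: compact_eq_bounded_closed)
  moreover have "closed (- ?Q)" by (simp add: closed_Compl open_box)
  ultimately obtain \<delta> where \<delta>: "0 < \<delta>" "\<And>x y. x \<in> ?S \<Longrightarrow> y \<in> - ?Q \<Longrightarrow> \<delta> \<le> dist x y"
    using separate_compact_closed[of ?S "- ?Q"] SQ by blast
  have "g (\<xi> + int_vec l) = 0" if "norm \<xi> < \<delta>" "l \<noteq> 0" for \<xi> l
  proof (rule ccontr)
    assume "g (\<xi> + int_vec l) \<noteq> 0"
    then have "\<xi> + int_vec l \<in> {\<xi>. g \<xi> \<noteq> 0}" by simp
    then have "\<xi> + int_vec l \<in> ?S" by (rule closure_subset[THEN subsetD])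
    moreover have "int_vec l \<in> - ?Q"
    proof -
      obtain i where i: "l $ i \<noteq> 0" using \<open>l \<noteq> 0\<close> by (auto simp: vec_eq_iff)
      have "\<not> (-1 < real_of_int (l $ i) \<and> real_of_int (l $ i) < 1)" using i by linarith
      then show ?thesis by (auto simp: mem_box_cart int_vec_def)
    qed
    ultimately have "\<delta> \<le> dist (\<xi> + int_vec l) (int_vec l)" by (rule \<delta>(2))
    then show False using that(1) by (simp add: dist_norm)
  qed
  then show ?thesis using \<delta>(1) by blast
qed

lemma aniso_modulus_le_modulus:
  fixes B :: "real^'d^'d"
  assumes B: "invertible B"
  shows "aniso_modulus n p u f (matrix_inv B) \<le> modulus n p u f (onorm ((*v) (matrix_inv B)))"
  unfolding aniso_modulus_def modulus_def
proof (rule SUP_subset_mono[OF _ order_refl], safe)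
  fix h assume "norm (matrix_inv (matrix_inv B) *v h) < 1"
  then have h: "norm (B *v h) < 1" by (simp add: matrix_inv_matrix_inv[OF B])
  let ?A = "matrix_inv B"
  have bl: "bounded_linear ((*v) ?A)" by simp
  obtain z :: "real^'d" where "norm z = 1" using vector_choose_size[of 1] by auto
  then have z: "z \<noteq> 0" by auto
  have "?A *v (B *v z) \<noteq> 0" using z by (simp add: matrix_inv_vector(2)[OF B])
  then have pos: "0 < onorm ((*v) ?A)" using onorm_pos_lt[OF bl] by blast
  have "norm h = norm (?A *v (B *v h))" by (simp add: matrix_inv_vector(2)[OF B])
  also have "\<dots> \<le> onorm ((*v) ?A) * norm (B *v h)" by (rule onorm[OF bl])
  also have "\<dots> < onorm ((*v) ?A)" using pos h by (simp add: mult_less_cancel_left1)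
  finally show "norm h < onorm ((*v) ?A)" .
qed

section \<open>The error estimate at an arbitrary scale\<close>

lemma smooth_bd_one_minus_product:
  assumes "open U" "smooth_bd k U C f" "smooth_bd k U D g" "0 \<le> C" "0 \<le> D"
  shows "\<exists>E\<ge>0. smooth_bd k U E (\<lambda>\<xi>. 1 - f \<xi> * cnj (g \<xi>))"
proof -
  let ?E = "1 + 2 ^ k * 1 * (2 ^ k * C * D)"
  have "smooth_bd k U ?E (\<lambda>\<xi>. 1 + (- 1) * (f \<xi> * cnj (g \<xi>)))"
    by (intro smooth_bd_add smooth_bd_mult smooth_bd_const smooth_bd_cnj assms) (use assms in auto)
  then show ?thesis using assms(4,5) by (intro exI[of _ ?E]) simp
qed

context quasi_projection_bounds
begin

context
  fixes M B :: "real^'d^'d" and j :: nat and f f0 F ft ft' :: "real^'d \<Rightarrow> complex"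
  assumes B_def: "B = mat_pow M j" and det: "det M \<noteq> 0"
    and f0 [measurable]: "f0 \<in> borel_measurable borel" and ff0: "AE x in lborel. f x = f0 x"
    and F_def: "F = (\<lambda>y. f0 (matrix_inv B *v y))"
    and JF: "J F < \<infinity>" and Sfin: "S < \<infinity>"
    and ft: "AE x in lborel. ft x = \<phi> x" and ft': "AE x in lborel. ft' x = \<psi> x"
begin

lemma inv_B: "invertible B"
  using det by (simp add: B_def invertible_det_nz det_mat_pow)

lemma F_measurable [measurable]: "F \<in> borel_measurable borel"
  unfolding F_def by measurable

lemma F_B: "F (B *v x) = f0 x"
  by (simp add: F_def matrix_inv_vector(2)[OF inv_B])

lemma dil_shift_scaled_coeff:
  shows "integrable lebesgue (\<lambda>x. f x * cnj (dil_shift M ft' j k x))"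
    and "pairing f (dil_shift M ft' j k)
      = complex_of_real (\<bar>det M\<bar> powr (real j / 2) / \<bar>det B\<bar>) * qcoeff \<psi> F k"
proof -
  let ?s = "\<bar>det M\<bar> powr (real j / 2)"
  define G where "G y = F y * cnj (\<psi> (y + int_vec k))" for y
  have G: "integrable lborel G" unfolding G_def by (rule qcoeff_integrable[OF F_measurable JF Sfin])
  then have [measurable]: "G \<in> borel_measurable borel" by auto
  have GB: "integrable lborel (\<lambda>x. complex_of_real ?s * G (B *v x))"
    using integrable_linear_map[OF inv_B G] by simp
  have eq: "AE x in lborel. f x * cnj (dil_shift M ft' j k x) = complex_of_real ?s * G (B *v x)"
    using ff0 AE_linear[OF inv_B AE_translate[OF ft', of "int_vec k"]]
  proof eventually_elim
    case (elim x)
    then show ?case by (simp add: dil_shift_def G_def F_B B_def[symmetric])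
  qed
  have m: "(\<lambda>x. complex_of_real ?s * G (B *v x)) \<in> borel_measurable borel" by measurable
  show "integrable lebesgue (\<lambda>x. f x * cnj (dil_shift M ft' j k x))"
    using GB by (simp only: integral_representative(2)[OF m eq])
  have "pairing f (dil_shift M ft' j k) = (\<integral>x. complex_of_real ?s * G (B *v x) \<partial>lborel)"
    unfolding pairing_def by (rule integral_representative(1)[OF m eq])
  also have "\<dots> = complex_of_real ?s * (\<integral>x. G (B *v x) \<partial>lborel)" by (rule integral_mult_right_zero)
  finally have P: "pairing f (dil_shift M ft' j k) = complex_of_real ?s * (\<integral>x. G (B *v x) \<partial>lborel)" .
  have "qcoeff \<psi> F k = complex_of_real \<bar>det B\<bar> * (\<integral>x. G (B *v x) \<partial>lborel)"
    unfolding qcoeff_def G_def[symmetric] by (rule integral_linear_map[OF inv_B]) measurable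
  moreover have "\<bar>det B\<bar> \<noteq> 0" using inv_B by (simp add: invertible_det_nz)
  ultimately show "pairing f (dil_shift M ft' j k) = complex_of_real (?s / \<bar>det B\<bar>) * qcoeff \<psi> F k"
    unfolding P by simp
qed

text \<open>The two normalizing factors \<open>\<bar>det M\<bar>\<^sup>j\<^sup>/\<^sup>2\<close> cancel the Jacobian of \<open>y = M\<^sup>j x\<close>.\<close>

lemma quasi_proj_term_scaled:
  "AE x in lborel. \<forall>k. quasi_proj_term M ft ft' j f x k = qcoeff \<psi> F k * \<phi> (B *v x + int_vec k)"
  using AE_linear[OF inv_B AE_translates[OF ft]]
proof eventually_elim
  case (elim x)
  let ?s = "\<bar>det M\<bar> powr (real j / 2)"
  have d: "0 < \<bar>det M\<bar>" using det by simp
  have "?s * ?s = \<bar>det M\<bar> powr real j" by (simp add: powr_add[symmetric])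
  also have "\<dots> = \<bar>det B\<bar>" using d by (simp add: B_def det_mat_pow power_abs powr_realpow)
  finally have s: "?s / \<bar>det B\<bar> * ?s = 1" using inv_B by (simp add: invertible_det_nz)
  show ?case
  proof
    fix k
    have "quasi_proj_term M ft ft' j f x k
      = complex_of_real (?s / \<bar>det B\<bar>) * qcoeff \<psi> F k * (complex_of_real ?s * \<phi> (B *v x + int_vec k))"
      unfolding quasi_proj_term_def dil_shift_scaled_coeff(2) using elim by (simp add: dil_shift_def B_def)
    also have "\<dots> = complex_of_real (?s / \<bar>det B\<bar> * ?s) * (qcoeff \<psi> F k * \<phi> (B *v x + int_vec k))"
      by (simp only: of_real_mult mult_ac)
    finally show "quasi_proj_term M ft ft' j f x k = qcoeff \<psi> F k * \<phi> (B *v x + int_vec k)"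
      unfolding s by simp
  qed
qed

lemma quasi_proj_scaled:
  assumes fin: "amalgam < \<infinity>"
  shows "AE x in lborel. (\<lambda>k. norm (quasi_proj_term M ft ft' j f x k)) summable_on UNIV"
    and "AE x in lborel. f x - quasi_proj M ft ft' j f x = F (B *v x) - qop \<phi> \<psi> F (B *v x)"
proof -
  have "AE x in lborel. (\<lambda>k. norm (quasi_proj_term M ft ft' j f x k)) summable_on UNIV \<and>
    f x - quasi_proj M ft ft' j f x = F (B *v x) - qop \<phi> \<psi> F (B *v x)"
    using quasi_proj_term_scaled AE_linear[OF inv_B AE_qop_summable[OF F_measurable JF Sfin fin]] ff0
  proof eventually_elim
    case (elim x)
    have t: "quasi_proj_term M ft ft' j f x = (\<lambda>k. qcoeff \<psi> F k * \<phi> (B *v x + int_vec k))"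
      using elim(1) by blast
    show ?case
      using integrable_counting_imp_infsum[OF elim(2)] elim(3)
      unfolding quasi_proj_def t qop_def F_B by simp
  qed
  then show "AE x in lborel. (\<lambda>k. norm (quasi_proj_term M ft ft' j f x k)) summable_on UNIV"
    "AE x in lborel. f x - quasi_proj M ft ft' j f x = F (B *v x) - qop \<phi> \<psi> F (B *v x)"
    by (auto elim: eventually_mono)
qed

end

end

theorem theorem9:
  fixes p \<alpha> \<epsilon> :: real and q :: ennreal and n \<gamma> :: nat
    and w ws :: "real^'d \<Rightarrow> real" and M :: "real^'d^'d"
    and \<phi> \<phi>t :: "real^'d \<Rightarrow> complex"
  assumes "1 \<le> p" and "1 / ennreal p + 1 / q = 1"
    and "0 < \<alpha>" and "w \<in> weight_class \<alpha>" and "weight_companion \<alpha> w ws"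
    and "1 \<le> n" and "dilation_matrix M"
    and "\<phi> \<in> calLw_space (ennreal p) ws \<inter> Lp_space 2" and "\<phi>t \<in> calLw_space q ws"
    and "real \<gamma> > real n + real CARD('d) + p * \<alpha>" and "0 < \<epsilon>"
    and "Ck_on \<gamma> (cball 0 \<epsilon>) (fourier \<phi>)" and "Ck_on \<gamma> (cball 0 \<epsilon>) (fourier \<phi>t)"
    and "weakly_compatible n \<phi>t \<phi>"
    and "closure {\<xi>. fourier \<phi> \<xi> \<noteq> 0} \<subseteq> {\<xi>. \<forall>i. -1 < \<xi> $ i \<and> \<xi> $ i < 1}"
  shows "\<exists>C::real. 0 < C \<and>
    (\<forall>f \<in> Lpw_space (ennreal p) (\<lambda>x. 1 / w x). \<forall>j::nat.
       (\<forall>k. integrable lebesgue (\<lambda>x. f x * cnj (dil_shift M \<phi>t j k x))) \<and>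
       (AE x in lebesgue. (\<lambda>k. norm (quasi_proj_term M \<phi> \<phi>t j f x k)) summable_on UNIV) \<and>
       Lpw_norm (ennreal p) (\<lambda>x. 1 / w x) (\<lambda>x. f x - quasi_proj M \<phi> \<phi>t j f x)
         \<le> ennreal C * aniso_modulus n (ennreal p) (\<lambda>x. 1 / w x) f (matrix_inv (mat_pow M j)) \<and>
       ennreal C * aniso_modulus n (ennreal p) (\<lambda>x. 1 / w x) f (matrix_inv (mat_pow M j))
         \<le> ennreal C * modulus n (ennreal p) (\<lambda>x. 1 / w x) f
             (onorm ((*v) (matrix_inv (mat_pow M j)))))"
proof -
  note p = assms(1)
  have w1: "1 \<le> w x" for x using assms(4) by (simp add: weight_class_def)
  have [measurable]: "w \<in> borel_measurable borel"
    using assms(4) by (auto simp: weight_class_def intro: borel_measurable_continuous_onI)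
  have ws_ev: "ws (- x) = ws x" and ws_sub: "w (x + y) \<le> ws x * w y" for x y
    using assms(5) unfolding weight_companion_def by auto
  have ws1: "1 \<le> ws x" for x by (rule weight_companion_ge_1[OF assms(5) w1])
  obtain c0 where c0: "0 < c0" "\<And>x. ws x \<le> c0 * (1 + (norm x)\<^sup>2) powr (\<alpha> / 2)"
    using assms(5) unfolding weight_companion_def by blast
  obtain C1 where C1: "\<And>x j. ws (matrix_inv (mat_pow M j) *v x) \<le> C1 * ws x"
    using assms(5,7) unfolding weight_companion_def by blast
  (* The maximum makes u at least one. *)
  define D where "D = max C1 1"
  define u where "u x = D * ws x" for x
  define c where "c = D * c0"
  have D: "1 \<le> D" by (simp add: D_def)
  have c: "0 < c" using D c0(1) by (simp add: c_def)
  have u1: "1 \<le> u x" for x using mult_mono[OF D ws1[of x]] D by (simp add: u_def)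
  have u_ev: "u (- x) = u x" for x by (simp add: u_def ws_ev)
  have uc: "u x \<le> c * (1 + norm x) powr \<alpha>" for x
  proof -
    have "1 + (norm x)\<^sup>2 \<le> (1 + norm x)\<^sup>2" by (simp add: power2_eq_square algebra_simps)
    then have "(1 + (norm x)\<^sup>2) powr (\<alpha> / 2) \<le> ((1 + norm x)\<^sup>2) powr (\<alpha> / 2)"
      using assms(3) by (intro powr_mono2) auto
    also have "((1 + norm x)\<^sup>2) powr (\<alpha> / 2) = (1 + norm x) powr \<alpha>"
      by (simp add: powr_powr flip: powr_numeral)
    finally have "ws x \<le> c0 * (1 + norm x) powr \<alpha>"
      using c0(1) by (intro order_trans[OF c0(2)] mult_left_mono) auto
    then show ?thesis using D unfolding u_def c_def mult.assoc by (intro mult_left_mono) auto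
  qed

  have \<phi>m: "\<phi> \<in> borel_measurable lebesgue" "weighted ws \<phi> \<in> borel_measurable lebesgue" "calL_norm (ennreal p) (weighted ws \<phi>) < \<infinity>"
    using assms(8) by (auto simp: calLw_space_def calL_space_def Lp_space_def)
  have \<psi>m: "\<phi>t \<in> borel_measurable lebesgue" "weighted ws \<phi>t \<in> borel_measurable lebesgue" "calL_norm q (weighted ws \<phi>t) < \<infinity>"
    using assms(9) by (auto simp: calLw_space_def calL_space_def Lp_space_def)
  obtain \<phi>0 where [measurable]: "\<phi>0 \<in> borel_measurable borel" and \<phi>0: "AE x in lborel. \<phi> x = \<phi>0 x"
    using borel_representative[OF \<phi>m(1)] .
  obtain \<psi>0 where [measurable]: "\<psi>0 \<in> borel_measurable borel" and \<psi>0: "AE x in lborel. \<phi>t x = \<psi>0 x"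
    using borel_representative[OF \<psi>m(1)] .
  obtain a0 where [measurable]: "a0 \<in> borel_measurable borel" and a0: "AE x in lborel. weighted ws \<phi> x = a0 x"
    using borel_representative[OF \<phi>m(2)] .
  obtain b0 where [measurable]: "b0 \<in> borel_measurable borel" and b0: "AE x in lborel. weighted ws \<phi>t x = b0 x"
    using borel_representative[OF \<psi>m(2)] .
  define a where "a x = ennreal D * ennreal (cmod (a0 x))" for x
  define b where "b x = ennreal D * ennreal (cmod (b0 x))" for x
  have [measurable]: "a \<in> borel_measurable borel" "b \<in> borel_measurable borel" unfolding a_def b_def by measurable
  have ab: "ennreal (cmod z * u x) = ennreal D * ennreal (cmod (weighted ws (\<lambda>_. z) x))" for z x
  proof -
    have "cmod z * u x = D * cmod (weighted ws (\<lambda>_. z) x)"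
      using ws1[of x] by (simp add: weighted_def norm_mult u_def)
    then show ?thesis using D by (simp add: ennreal_mult)
  qed
  have a: "AE x in lborel. ennreal (cmod (\<phi>0 x) * u x) \<le> a x"
    using \<phi>0 a0
  proof eventually_elim
    case (elim x)
    have "weighted ws (\<lambda>_. \<phi>0 x) x = a0 x" using elim by (simp add: weighted_def)
    then show ?case by (simp only: ab a_def order_refl)
  qed
  have b: "AE x in lborel. ennreal (cmod (\<psi>0 x) * u x) \<le> b x"
    using \<psi>0 b0
  proof eventually_elim
    case (elim x)
    have "weighted ws (\<lambda>_. \<psi>0 x) x = b0 x" using elim by (simp add: weighted_def)
    then show ?case by (simp only: ab b_def order_refl)
  qed

  have "(\<integral>\<^sup>+x. ennreal_powr (periodization (\<lambda>x. ennreal (cmod (a0 x))) x) p \<partial>lcube) < \<infinity>"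
    by (rule calL_norm_finite_exponent[OF p _ a0 \<phi>m(3)]) measurable
  note a0fin = this
  have afin: "(\<integral>\<^sup>+x. ennreal_powr (periodization a x) p \<partial>lcube) < \<infinity>"
  proof -
    have "periodization a x = ennreal D * periodization (\<lambda>x. ennreal (cmod (a0 x))) x" for x
      unfolding a_def by (rule nn_integral_cmult) measurable
    then have "(\<integral>\<^sup>+x. ennreal_powr (periodization a x) p \<partial>lcube)
      = (\<integral>\<^sup>+x. ennreal_powr (ennreal D) p * ennreal_powr (periodization (\<lambda>x. ennreal (cmod (a0 x))) x) p \<partial>lcube)"
      using p by (simp only: ennreal_powr_mult[of p])
    also have "\<dots> = ennreal_powr (ennreal D) p * (\<integral>\<^sup>+x. ennreal_powr (periodization (\<lambda>x. ennreal (cmod (a0 x))) x) p \<partial>lcube)"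
      by (rule nn_integral_cmult) measurable
    also have "\<dots> < \<infinity>" using a0fin by (simp add: ennreal_mult_less_top)
    finally show ?thesis .
  qed
  have "ennreal_powr (\<integral>\<^sup>+x. ennreal (cmod (a0 x)) \<partial>lborel) p \<le> (\<integral>\<^sup>+x. ennreal_powr (periodization (\<lambda>x. ennreal (cmod (a0 x))) x) p \<partial>lcube)"
    by (rule nn_integral_le_periodization[OF p]) measurable
  then have "ennreal_powr (\<integral>\<^sup>+x. ennreal (cmod (a0 x)) \<partial>lborel) p < \<infinity>" using a0fin by (rule le_less_trans)
  then have a0L1: "(\<integral>\<^sup>+x. ennreal (cmod (a0 x)) \<partial>lborel) < \<infinity>" by simp
  note b_bounds = conjugate_amalgam_bounds[OF p assms(2) \<open>b0 \<in> borel_measurable borel\<close> b0 \<psi>m(3)]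
  obtain S0 where S0: "S0 < \<infinity>" "\<And>h. h \<in> borel_measurable borel \<Longrightarrow>
    (\<integral>\<^sup>+k. ennreal_powr (\<integral>\<^sup>+y. h y * ennreal (cmod (b0 (y + int_vec k))) \<partial>lborel) p \<partial>counting) \<le> S0 * (\<integral>\<^sup>+y. ennreal_powr (h y) p \<partial>lborel)"
    using b_bounds(1) by blast
  (* The constant D is moved from b to the test function. *)
  define S where "S = S0 * ennreal_powr (ennreal D) p"
  have Sfin: "S < \<infinity>" using S0(1) by (simp add: S_def ennreal_mult_less_top)
  have S: "(\<integral>\<^sup>+k. ennreal_powr (\<integral>\<^sup>+y. h y * b (y + int_vec k) \<partial>lborel) p \<partial>counting) \<le> S * (\<integral>\<^sup>+y. ennreal_powr (h y) p \<partial>lborel)"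
    if [measurable]: "h \<in> borel_measurable borel" for h
  proof -
    have "(\<integral>\<^sup>+k. ennreal_powr (\<integral>\<^sup>+y. h y * b (y + int_vec k) \<partial>lborel) p \<partial>counting)
      = (\<integral>\<^sup>+k. ennreal_powr (\<integral>\<^sup>+y. (ennreal D * h y) * ennreal (cmod (b0 (y + int_vec k))) \<partial>lborel) p \<partial>counting)"
      unfolding b_def by (simp only: mult_ac)
    also have "\<dots> \<le> S0 * (\<integral>\<^sup>+y. ennreal_powr (ennreal D * h y) p \<partial>lborel)" by (rule S0(2)) measurable
    also have "(\<integral>\<^sup>+y. ennreal_powr (ennreal D * h y) p \<partial>lborel) = ennreal_powr (ennreal D) p * (\<integral>\<^sup>+y. ennreal_powr (h y) p \<partial>lborel)"
      using p by (subst nn_integral_cmult[symmetric]) (measurable, simp add: ennreal_powr_mult)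
    finally show ?thesis by (simp add: S_def mult.assoc)
  qed
  have L1: "integrable lborel g" if [measurable]: "g \<in> borel_measurable borel" and eq: "AE x in lborel. g' x = g x"
    and d: "AE x in lborel. weighted ws g' x = d0 x" "(\<integral>\<^sup>+x. ennreal (cmod (d0 x)) \<partial>lborel) < \<infinity>" for g g' d0
  proof (rule integrableI_bounded)
    have "(\<integral>\<^sup>+x. ennreal (cmod (g x)) \<partial>lborel) \<le> (\<integral>\<^sup>+x. ennreal (cmod (d0 x)) \<partial>lborel)"
    proof (rule nn_integral_mono_AE)
      show "AE x in lborel. ennreal (cmod (g x)) \<le> ennreal (cmod (d0 x))"
        using eq d(1)
      proof eventually_elim
        case (elim x)
        have "d0 x = g x * complex_of_real (ws x)" using elim by (simp add: weighted_def)
        then have "cmod (d0 x) = cmod (g x) * ws x" using ws1[of x] by (simp add: norm_mult)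
        then show ?case using mult_left_mono[OF ws1[of x], of "cmod (g x)"] by (intro ennreal_leI) simp
      qed
    qed
    then show "(\<integral>\<^sup>+x. ennreal (norm (g x)) \<partial>lborel) < \<infinity>" using d(2) by (rule le_less_trans)
  qed measurable
  have \<phi>L1: "integrable lborel \<phi>0" by (rule L1[OF _ \<phi>0 a0 a0L1]) measurable
  have \<psi>L1: "integrable lborel \<psi>0" by (rule L1[OF _ \<psi>0 b0 b_bounds(2)]) measurable

  have F\<phi>: "fourier \<phi> = fourier_lborel \<phi>0" by (rule fourier_representative[OF _ \<phi>0]) measurable
  have F\<psi>: "fourier \<phi>t = fourier_lborel \<psi>0" by (rule fourier_representative[OF _ \<psi>0]) measurable
  obtain C\<phi> where C\<phi>: "0 \<le> C\<phi>" "smooth_bd \<gamma> (ball 0 \<epsilon>) C\<phi> (fourier_lborel \<phi>0)"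
    using Ck_on_imp_smooth_bd[OF assms(12) assms(11)] unfolding F\<phi> by auto
  obtain C\<psi> where C\<psi>: "0 \<le> C\<psi>" "smooth_bd \<gamma> (ball 0 \<epsilon>) C\<psi> (fourier_lborel \<psi>0)"
    using Ck_on_imp_smooth_bd[OF assms(13) assms(11)] unfolding F\<psi> by auto
  have "1 * \<alpha> \<le> p * \<alpha>" using p assms(3) by (intro mult_right_mono) auto
  then have \<gamma>: "real n + \<alpha> + real CARD('d) < real \<gamma>" using assms(10) by linarith
  then have n\<gamma>: "n \<le> \<gamma>" using assms(3) by linarith
  obtain E where E: "0 \<le> E" "smooth_bd \<gamma> (ball 0 \<epsilon>) E (\<lambda>\<xi>. 1 - fourier_lborel \<phi>0 \<xi> * cnj (fourier_lborel \<psi>0 \<xi>))"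
    using smooth_bd_one_minus_product[OF open_ball C\<phi>(2) C\<psi>(2) C\<phi>(1) C\<psi>(1)] by blast
  have van0: "multi_deriv \<beta> (\<lambda>\<xi>. 1 - fourier_lborel \<phi>0 \<xi> * cnj (fourier_lborel \<psi>0 \<xi>)) 0 = 0" if "multi_order \<beta> < n" for \<beta>
    using assms(14) that unfolding weakly_compatible_def F\<phi> F\<psi> by simp
  obtain K where "\<forall>\<xi>\<in>ball 0 \<epsilon>. cmod (1 - fourier_lborel \<phi>0 \<xi> * cnj (fourier_lborel \<psi>0 \<xi>)) \<le> K * norm \<xi> ^ n"
    using vanishing_order[OF smooth_bd_mono_order[OF E(2) n\<gamma>] E(1) van0] by blast
  then have K: "cmod (1 - fourier_lborel \<phi>0 \<xi> * cnj (fourier_lborel \<psi>0 \<xi>)) \<le> K * norm \<xi> ^ n" if "norm \<xi> < \<epsilon>" for \<xi>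
    using that by simp
  obtain \<delta> where \<delta>: "0 < \<delta>" "\<And>\<xi> l. norm \<xi> < \<delta> \<Longrightarrow> l \<noteq> 0 \<Longrightarrow> fourier_lborel \<phi>0 (\<xi> + int_vec l) = 0"
    using separated_from_integer_translates[OF assms(15)] unfolding F\<phi> by blast

  have "\<exists>C<\<infinity>. \<forall>v F \<Omega>. v \<in> borel_measurable borel \<longrightarrow> (\<forall>x. 1 \<le> v x) \<longrightarrow> (\<forall>x y. v (x + y) \<le> u x * v y) \<longrightarrow>
    F \<in> borel_measurable borel \<longrightarrow> weighted_power p v F < \<infinity> \<longrightarrow>
    (\<forall>h. norm h < 1 \<longrightarrow> weighted_power p v (fin_diff n h F) \<le> \<Omega>) \<longrightarrow>
    weighted_power p v (\<lambda>x. F x - qop \<phi>0 \<psi>0 F x) \<le> C * \<Omega>"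
    by (rule quasi_projection_error_unit_scale[OF p less_imp_le[OF assms(3)] c assms(6) u1 u_ev uc \<phi>L1 \<psi>L1 _ _ a b S Sfin afin
      assms(11) C\<phi> C\<psi> \<gamma> K \<delta>]) measurable
  then obtain C0 where C0: "C0 < \<infinity>" and unit_scale: "\<forall>v F \<Omega>. v \<in> borel_measurable borel \<longrightarrow> (\<forall>x. 1 \<le> v x) \<longrightarrow> (\<forall>x y. v (x + y) \<le> u x * v y) \<longrightarrow>
    F \<in> borel_measurable borel \<longrightarrow> weighted_power p v F < \<infinity> \<longrightarrow>
    (\<forall>h. norm h < 1 \<longrightarrow> weighted_power p v (fin_diff n h F) \<le> \<Omega>) \<longrightarrow>
    weighted_power p v (\<lambda>x. F x - qop \<phi>0 \<psi>0 F x) \<le> C0 * \<Omega>"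
    by (elim exE conjE)
  define C where "C = max 1 (enn2real (ennreal_powr C0 (1 / p)))"
  have Cpos: "0 < C" by (simp add: C_def)
  have CC: "ennreal_powr C0 (1 / p) \<le> ennreal C"
  proof -
    have "ennreal_powr C0 (1 / p) < top" using C0 by simp
    then have "ennreal_powr C0 (1 / p) = ennreal (enn2real (ennreal_powr C0 (1 / p)))" by simp
    also have "\<dots> \<le> ennreal C" unfolding C_def by (rule ennreal_leI) simp
    finally show ?thesis .
  qed

  have main: "(\<forall>k. integrable lebesgue (\<lambda>x. f x * cnj (dil_shift M \<phi>t j k x))) \<and>
       (AE x in lebesgue. (\<lambda>k. norm (quasi_proj_term M \<phi> \<phi>t j f x k)) summable_on UNIV) \<and>
       Lpw_norm (ennreal p) (\<lambda>x. 1 / w x) (\<lambda>x. f x - quasi_proj M \<phi> \<phi>t j f x)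
         \<le> ennreal C * aniso_modulus n (ennreal p) (\<lambda>x. 1 / w x) f (matrix_inv (mat_pow M j)) \<and>
       ennreal C * aniso_modulus n (ennreal p) (\<lambda>x. 1 / w x) f (matrix_inv (mat_pow M j))
         \<le> ennreal C * modulus n (ennreal p) (\<lambda>x. 1 / w x) f
             (onorm ((*v) (matrix_inv (mat_pow M j))))"
    if f: "f \<in> Lpw_space (ennreal p) (\<lambda>x. 1 / w x)" for f j
  proof -
    define B where "B = mat_pow M j"
    let ?A = "matrix_inv B" and ?Am = "aniso_modulus n (ennreal p) (\<lambda>x. 1 / w x) f (matrix_inv B)"
    have dM: "det M \<noteq> 0" by (rule dilation_matrix_det_nonzero[OF assms(7)])
    have B: "invertible B" unfolding B_def by (rule invertible_mat_pow[OF assms(7)])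
    have dB: "ennreal \<bar>det B\<bar> \<noteq> 0" using B by (simp add: invertible_det_nz)
    have "f \<in> borel_measurable lebesgue" using f by (simp add: Lpw_space_def)
    then obtain f0 where [measurable]: "f0 \<in> borel_measurable borel" and f0: "AE x in lborel. f x = f0 x"
      by (rule borel_representative)
    define F where "F = (\<lambda>y. f0 (?A *v y))"
    define v where "v = (\<lambda>y. w (?A *v y))"
    have [measurable]: "v \<in> borel_measurable borel" "F \<in> borel_measurable borel" unfolding v_def F_def by measurable
    have v1: "1 \<le> v x" for x by (simp add: v_def w1)
    have vu: "v (x + y) \<le> u x * v y" for x y
    proof -
      have "v (x + y) \<le> ws (?A *v x) * v y" unfolding v_def matrix_vector_right_distrib by (rule ws_sub)
      also have "ws (?A *v x) \<le> C1 * ws x" unfolding B_def by (rule C1)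
      also have "C1 * ws x \<le> u x" unfolding u_def D_def using ws1[of x] by (intro mult_right_mono) auto
      finally show ?thesis using v1[of y] by (simp add: mult_right_mono)
    qed
    have Lw: "Lpw_norm (ennreal p) (\<lambda>x. 1 / w x) g = ennreal_powr (weighted_power p w g0) (1 / p)"
      if "AE x in lborel. g x = g0 x" for g g0
      by (rule Lpw_norm_representative[OF p that w1])
    have "ennreal_powr (weighted_power p w f0) (1 / p) < \<infinity>"
      using f unfolding Lw[OF f0, symmetric] by (simp add: Lpw_space_def Lpw_norm_def Lp_space_def)
    then have "weighted_power p w f0 < \<infinity>" by simp
    then have JF: "weighted_power p v F < \<infinity>"
      unfolding v_def F_def by (subst weighted_power_linear[OF B]) (measurable, simp add: ennreal_mult_less_top)
    interpret moderate_weight p \<alpha> c v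
    proof
      fix x y
      have "v (x + y) \<le> u x * v y" by (rule vu)
      also have "\<dots> \<le> c * (1 + norm x) powr \<alpha> * v y" using v1[of y] by (intro mult_right_mono uc) auto
      finally show "v (x + y) \<le> c * (1 + norm x) powr \<alpha> * v y" .
    qed (use p assms(3) c v1 in auto)
    interpret quasi_projection_bounds p \<alpha> c v u \<phi>0 \<psi>0 a b S
      by unfold_locales (use u1 u_ev vu a b S in auto)
    note scaled = B_def dM \<open>f0 \<in> borel_measurable borel\<close> f0 F_def JF Sfin \<phi>0 \<psi>0
    (* A step h at unit scale is the step A h of f, which is admissible in the anisotropic modulus. *)
    have small: "weighted_power p v (fin_diff n h F) \<le> ennreal \<bar>det B\<bar> * ennreal_powr ?Am p" if h: "norm h < 1" for h
    proof -
      have "ennreal_powr (weighted_power p w (fin_diff n (?A *v h) f0)) (1 / p)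
        = Lpw_norm (ennreal p) (\<lambda>x. 1 / w x) (fin_diff n (?A *v h) f)"
        by (rule Lw[symmetric]) (rule AE_fin_diff[OF f0])
      also have "\<dots> \<le> ?Am" unfolding aniso_modulus_def
        using h by (intro SUP_upper) (simp add: matrix_inv_matrix_inv[OF B] matrix_inv_vector(1)[OF B])
      finally have "ennreal_powr (ennreal_powr (weighted_power p w (fin_diff n (?A *v h) f0)) (1 / p)) p \<le> ennreal_powr ?Am p"
        using p by (intro ennreal_powr_mono) auto
      then have le: "weighted_power p w (fin_diff n (?A *v h) f0) \<le> ennreal_powr ?Am p"
        using p by (simp add: ennreal_powr_powr)
      have "weighted_power p v (fin_diff n h F) = ennreal \<bar>det B\<bar> * weighted_power p w (fin_diff n (?A *v h) f0)"
        unfolding v_def F_def fin_diff_linear by (rule weighted_power_linear[OF B]) measurable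
      also have "\<dots> \<le> ennreal \<bar>det B\<bar> * ennreal_powr ?Am p" by (intro mult_left_mono le) simp
      finally show ?thesis .
    qed
    let ?R = "\<lambda>y. F y - qop \<phi>0 \<psi>0 F y"
    have "weighted_power p v ?R \<le> C0 * (ennreal \<bar>det B\<bar> * ennreal_powr ?Am p)"
      by (rule unit_scale[rule_format]) (use v1 vu JF small in auto)
    moreover have "weighted_power p v ?R = ennreal \<bar>det B\<bar> * weighted_power p w (\<lambda>x. ?R (B *v x))"
    proof -
      have "(\<lambda>x. ?R (B *v x)) \<in> borel_measurable borel" by measurable
      from weighted_power_linear[OF B this, of w p] show ?thesis
        by (simp add: v_def matrix_inv_vector(1)[OF B])
    qed
    ultimately have "ennreal \<bar>det B\<bar> * weighted_power p w (\<lambda>x. ?R (B *v x)) \<le> ennreal \<bar>det B\<bar> * (C0 * ennreal_powr ?Am p)"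
      by (simp add: mult_ac)
    then have err: "weighted_power p w (\<lambda>x. ?R (B *v x)) \<le> C0 * ennreal_powr ?Am p"
      using dB by (subst (asm) ennreal_mult_le_mult_iff) auto
    have "Lpw_norm (ennreal p) (\<lambda>x. 1 / w x) (\<lambda>x. f x - quasi_proj M \<phi> \<phi>t j f x)
      = ennreal_powr (weighted_power p w (\<lambda>x. ?R (B *v x))) (1 / p)"
      by (rule Lw) (rule quasi_proj_scaled(2)[OF scaled afin])
    also have "\<dots> \<le> ennreal_powr (C0 * ennreal_powr ?Am p) (1 / p)"
      using p by (intro ennreal_powr_mono err) auto
    also have "\<dots> = ennreal_powr C0 (1 / p) * ?Am"
      using p by (simp add: ennreal_powr_mult ennreal_powr_powr)
    also have "\<dots> \<le> ennreal C * ?Am" by (intro mult_right_mono CC) simp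
    finally have bound: "Lpw_norm (ennreal p) (\<lambda>x. 1 / w x) (\<lambda>x. f x - quasi_proj M \<phi> \<phi>t j f x) \<le> ennreal C * ?Am" .
    have modulus: "ennreal C * ?Am \<le> ennreal C * modulus n (ennreal p) (\<lambda>x. 1 / w x) f (onorm ((*v) ?A))"
      by (intro mult_left_mono aniso_modulus_le_modulus[OF B]) simp
    show ?thesis
      unfolding B_def[symmetric]
      by (intro conjI allI dil_shift_scaled_coeff(1)[OF scaled] AE_completion[OF quasi_proj_scaled(1)[OF scaled afin]] bound modulus)
  qed
  show ?thesis by (rule exI[of _ C], rule conjI[OF Cpos], intro ballI allI, rule main)
qed

end
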